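(* For any $\lambda\in\mathbb{R}$ and $x\in\mathbb{R}$, let $$W_t(\lambda)=e^{-\gamma(\lambda)t}\sum_{u\in N_t}e^{-\lambda X_u(t)}\psi(X_u(t),\lambda),\qquad t\ge 0.$$ Then $\{(W_t(\lambda))_{t\ge 0},\mathbb{P}_x\}$ is a martingale, and the limit $W(\lambda,x):=\lim_{t\uparrow\infty}W_t(\lambda)$ exists $\mathbb{P}_x$-almost surely. Moreover: (i) If $|\lambda|>\lambda^*$, then $W(\lambda,x)=0$ $\mathbb{P}_x$-almost surely. (ii) If $|\lambda|=\lambda^*$, then $W(\lambda,x)=0$ $\mathbb{P}_x$-almost surely. (iii) If $|\lambda|<\lambda^*$, then $W(\lambda,x)=0$ $\mathbb{P}_x$-almost surely when $\mathbf{E}(L\log^+L)=\infty$, and $W(\lambda,x)$ is an $L^1(\mathbb{P}_x)$-limit (i.e. $W_t(\lambda)\to W(\lambda,x)$ in $L^1(\mathbb{P}_x)$) when $\mathbf{E}(L\log^+L)<\infty$.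
   Context: Let $\mathbf{g}\in C^1(\mathbb{R})$ be strictly positive and 1-periodic. Let $L$ be a random variable with values in $\{0,1,2,\dots\}$ and distribution $\{p_k:k\ge 0\}$, with $m:=\sum_{k\ge 0}kp_k\in(0,\infty)$; $\mathbf{E}$ denotes expectation with respect to $L$. Branching Brownian motion in a periodic environment (BBMPE): initially there is a single particle at $x\in\mathbb{R}$. Each particle moves as a standard Brownian motion. If $b_v,d_v$ are the birth and death times of a particle $v$ and $X_v(s)$ is its position at time $s$ (trajectory fictitiously extended beyond the death time), then $$\mathbb{P}_x\big(d_v-b_v>t\mid b_v,\{X_v(s):s\ge b_v\}\big)=\exp\Big\{-\int_{b_v}^{b_v+t}\mathbf{g}(X_v(s))\,ds\Big\}.$$ At its death a particle is replaced, at its position of death, by $1+A_v$ offspring, where $A_v$ is an independent copy of $L$; the offspring evolve independently in the same way. $\mathbb{P}_x$ is the law of the process started from one particle at $x$. $N_t$ is the set of particles alive at time $t$, and for $u\in N_t$, $s\le t$, $X_u(s)$ is the position at time $s$ of $u$ or of its ancestor alive at time $s$. Martingales are with respect to the natural filtration $(\mathcal{F}_t)$ of the branching process. For $\lambda\in\mathbb{R}$, $\gamma(\lambda)$ and $\psi(\cdot,\lambda)$ denote the principal eigenvalue and the corresponding positive eigenfunction of the periodic problem $$\tfrac12\psi_{xx}(x,\lambda)-\lambda\psi_x(x,\lambda)+\big(\tfrac12\lambda^2+m\mathbf{g}(x)\big)\psi(x,\lambda)=\gamma(\lambda)\psi(x,\lambda),\quad \psi(x+1,\lambda)=\psi(x,\lambda),\quad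 x\in\mathbb{R},$$ normalized by $\int_0^1\psi(x,\lambda)\,dx=1$. Set $\nu^*:=\min_{\lambda>0}\gamma(\lambda)/\lambda$ and let $\lambda^*>0$ be the (unique) minimizer. *)

theory Defs
  imports "HOL-Probability.Probability"
begin

subsection \<open>Standard Brownian motion and martingales\<close>

context prob_space
begin

definition standard_BM :: "(real \<Rightarrow> 'a \<Rightarrow> real) \<Rightarrow> bool" where
  "standard_BM B \<longleftrightarrow>
     (\<forall>t\<ge>0. B t \<in> borel_measurable M) \<and>
     (\<forall>\<omega>\<in>space M. B 0 \<omega> = 0 \<and> continuous_on {0..} (\<lambda>t. B t \<omega>)) \<and>
     (\<forall>s\<ge>0. \<forall>t>s. distributed M lborel (\<lambda>\<omega>. B t \<omega> - B s \<omega>) (normal_density 0 (sqrt (t - s)))) \<and>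
     (\<forall>r :: nat \<Rightarrow> real. \<forall>n. 0 \<le> r 0 \<and> mono r \<longrightarrow>
        indep_vars (\<lambda>_. borel) (\<lambda>i \<omega>. B (r (Suc i)) \<omega> - B (r i) \<omega>) {..<n})"

text \<open>Martingales indexed by \<open>[0, \<infinity>)\<close>; only the values at nonnegative times matter.\<close>

definition is_martingale :: "(real \<Rightarrow> 'a measure) \<Rightarrow> (real \<Rightarrow> 'a \<Rightarrow> real) \<Rightarrow> bool" where
  "is_martingale F Y \<longleftrightarrow>
     (\<forall>t\<ge>0. subalgebra M (F t)) \<and>
     (\<forall>s\<ge>0. \<forall>t\<ge>s. subalgebra (F t) (F s)) \<and>
     (\<forall>t\<ge>0. Y t \<in> borel_measurable (F t) \<and> integrable M (Y t)) \<and>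
     (\<forall>s\<ge>0. \<forall>t\<ge>s. AE \<omega> in M. real_cond_exp M (F s) (Y t) \<omega> = Y s \<omega>)"

end

subsection \<open>Genealogy and positions\<close>

text \<open>Particles carry Ulam--Harris labels, most recent entry first: \<open>[]\<close> is the initial particle
  and \<open>i # v\<close> is the \<open>i\<close>-th child of \<open>v\<close>. Every label, whether or not it is realized in the
  tree, has a displacement path \<open>B v\<close> (run from its birth, and continuing beyond its death),
  a lifetime \<open>T v\<close> and a number \<open>A v\<close>; a particle has \<open>1 + A v\<close> children.\<close>

type_synonym label = "nat list"

primrec birth :: "(label \<Rightarrow> 'w \<Rightarrow> real) \<Rightarrow> label \<Rightarrow> 'w \<Rightarrow> real" where
  "birth T [] \<omega> = 0"
| "birth T (i # v) \<omega> = birth T v \<omega> + T v \<omega>"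

definition death :: "(label \<Rightarrow> 'w \<Rightarrow> real) \<Rightarrow> label \<Rightarrow> 'w \<Rightarrow> real" where
  "death T v \<omega> = birth T v \<omega> + T v \<omega>"

primrec birth_place ::
  "real \<Rightarrow> (label \<Rightarrow> real \<Rightarrow> 'w \<Rightarrow> real) \<Rightarrow> (label \<Rightarrow> 'w \<Rightarrow> real) \<Rightarrow> label \<Rightarrow> 'w \<Rightarrow> real" where
  "birth_place x B T [] \<omega> = x"
| "birth_place x B T (i # v) \<omega> = birth_place x B T v \<omega> + B v (T v \<omega>) \<omega>"

text \<open>The position \<open>X\<^sub>v(s)\<close>, meaningful for \<open>s \<ge> birth T v \<omega>\<close>.\<close>

definition position ::
  "real \<Rightarrow> (label \<Rightarrow> real \<Rightarrow> 'w \<Rightarrow> real) \<Rightarrow> (label \<Rightarrow> 'w \<Rightarrow> real) \<Rightarrow> label \<Rightarrow> real \<Rightarrow> 'w \<Rightarrow> real" where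
  "position x B T v s \<omega> = birth_place x B T v \<omega> + B v (s - birth T v \<omega>) \<omega>"

primrec realized :: "(label \<Rightarrow> 'w \<Rightarrow> nat) \<Rightarrow> label \<Rightarrow> 'w \<Rightarrow> bool" where
  "realized A [] \<omega> \<longleftrightarrow> True"
| "realized A (i # v) \<omega> \<longleftrightarrow> realized A v \<omega> \<and> i < 1 + A v \<omega>"

definition alive :: "(label \<Rightarrow> 'w \<Rightarrow> real) \<Rightarrow> (label \<Rightarrow> 'w \<Rightarrow> nat) \<Rightarrow> real \<Rightarrow> 'w \<Rightarrow> label set" where
  "alive T A t \<omega> = {v. realized A v \<omega> \<and> birth T v \<omega> \<le> t \<and> t < death T v \<omega>}"

text \<open>If \<open>u\<close> is alive at time \<open>t\<close>, its ancestor at time \<open>s \<le> t\<close> is the tail of \<open>u\<close> alive at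
  time \<open>s\<close>; hence recording \<open>v \<in> N\<^sub>s\<close> and \<open>X\<^sub>v(s)\<close> for all \<open>v\<close> and \<open>s \<le> t\<close> records the ancestral
  trajectories.\<close>

definition natural_filtration ::
  "'w measure \<Rightarrow> real \<Rightarrow> (label \<Rightarrow> real \<Rightarrow> 'w \<Rightarrow> real) \<Rightarrow> (label \<Rightarrow> 'w \<Rightarrow> real) \<Rightarrow> (label \<Rightarrow> 'w \<Rightarrow> nat)
     \<Rightarrow> real \<Rightarrow> 'w measure" where
  "natural_filtration M x B T A t = sigma (space M)
     {{\<omega> \<in> space M. v \<in> alive T A s \<omega> \<and> position x B T v s \<omega> \<in> S} | v s S.
        0 \<le> s \<and> s \<le> t \<and> S \<in> sets borel}"

subsection \<open>Branching Brownian motion in a periodic environment\<close>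

definition path_events :: "'w measure \<Rightarrow> (real \<Rightarrow> 'w \<Rightarrow> real) \<Rightarrow> 'w set set" where
  "path_events M Y = sets (vimage_algebra (space M) (\<lambda>\<omega>. \<lambda>s\<in>{0..}. Y s \<omega>) (\<Pi>\<^sub>M s\<in>{0..}. borel))"

definition offspring_events :: "'w measure \<Rightarrow> ('w \<Rightarrow> nat) \<Rightarrow> 'w set set" where
  "offspring_events M K = sets (vimage_algebra (space M) K (count_space UNIV))"

definition lifetime_events :: "'w measure \<Rightarrow> ('w \<Rightarrow> real) \<Rightarrow> 'w set set" where
  "lifetime_events M Y = sets (vimage_algebra (space M) Y borel)"

text \<open>All displacement paths, all offspring numbers, and the lifetimes of all particles other
  than \<open>v\<close> up to the generation of \<open>v\<close>. In particular \<open>b\<^sub>v\<close> and \<open>X\<^sub>v(s)\<close>, \<open>s \<ge> b\<^sub>v\<close>, are determined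
  by this information.\<close>

definition sigma_before_clock ::
  "'w measure \<Rightarrow> (label \<Rightarrow> real \<Rightarrow> 'w \<Rightarrow> real) \<Rightarrow> (label \<Rightarrow> 'w \<Rightarrow> real) \<Rightarrow> (label \<Rightarrow> 'w \<Rightarrow> nat)
     \<Rightarrow> label \<Rightarrow> 'w measure" where
  "sigma_before_clock M B T A v = sigma (space M)
     ((\<Union>u. path_events M (B u)) \<union> (\<Union>u. offspring_events M (A u)) \<union>
      (\<Union>u\<in>{u. length u \<le> length v \<and> u \<noteq> v}. lifetime_events M (T u)))"

text \<open>The law of \<open>(B, T, A)\<close> is determined by these axioms: the displacements and offspring
  numbers are independent, and generation by generation each lifetime has the prescribed
  conditional survival function. Conditioning in \<open>survival\<close> on the \<open>\<sigma>\<close>-algebra above instead of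
  only on \<open>b\<^sub>v\<close> and \<open>{X\<^sub>v(s) : s \<ge> b\<^sub>v}\<close> also expresses that, given its own trajectory, the lifetime of
  a particle is independent of its ancestors and of the other particles of its generation, as
  well as of all offspring numbers and of the displacements of all other particles. By the tower
  property it implies the formula conditioned on \<open>b\<^sub>v\<close> and \<open>X\<^sub>v\<close> alone.\<close>

locale bbmpe = prob_space M
  for M :: "'w measure" +
  fixes g :: "real \<Rightarrow> real"
    and p :: "nat pmf"
    and x :: real
    and B :: "label \<Rightarrow> real \<Rightarrow> 'w \<Rightarrow> real"
    and T :: "label \<Rightarrow> 'w \<Rightarrow> real"
    and A :: "label \<Rightarrow> 'w \<Rightarrow> nat"
  assumes motion: "\<And>v. standard_BM (B v)"
    and offspring_measurable: "\<And>v. A v \<in> measurable M (count_space UNIV)"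
    and offspring_law: "\<And>v. distr M (count_space UNIV) (A v) = measure_pmf p"
    and independent: "indep_sets
          (\<lambda>k. case k of Inl u \<Rightarrow> path_events M (B u) | Inr u \<Rightarrow> offspring_events M (A u)) UNIV"
    and lifetime_measurable: "\<And>v. T v \<in> borel_measurable M"
    and lifetime_nonneg: "\<And>v \<omega>. \<omega> \<in> space M \<Longrightarrow> 0 \<le> T v \<omega>"
    and survival: "\<And>v t. 0 \<le> t \<Longrightarrow> AE \<omega> in M.
          real_cond_exp M (sigma_before_clock M B T A v) (indicator {\<omega> \<in> space M. death T v \<omega> - birth T v \<omega> > t}) \<omega>
            = exp (- integral {birth T v \<omega>..birth T v \<omega> + t} (\<lambda>s. g (position x B T v s \<omega>)))"

subsection \<open>Principal eigenvalue, additive martingale\<close>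

text \<open>The principal eigenvalue \<open>\<gamma>\<close> is the eigenvalue that has a positive eigenfunction; \<open>\<psi>\<close> is the
  normalized such eigenfunction.\<close>

definition principal_eigenpair ::
  "(real \<Rightarrow> real) \<Rightarrow> real \<Rightarrow> real \<Rightarrow> real \<Rightarrow> (real \<Rightarrow> real) \<Rightarrow> bool" where
  "principal_eigenpair g m l \<gamma> \<psi> \<longleftrightarrow>
     (\<forall>y. \<psi> differentiable (at y)) \<and> (\<forall>y. deriv \<psi> differentiable (at y)) \<and>
     (\<forall>y. 1/2 * deriv (deriv \<psi>) y - l * deriv \<psi> y + (1/2 * l\<^sup>2 + m * g y) * \<psi> y = \<gamma> * \<psi> y) \<and>
     (\<forall>y. \<psi> (y + 1) = \<psi> y) \<and>
     (\<forall>y. 0 < \<psi> y) \<and>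
     integral {0..1} \<psi> = 1"

text \<open>\<open>N\<^sub>t\<close> is almost surely finite for all \<open>t\<close>; on the exceptional null set where it is infinite
  the sum is \<open>0\<close>.\<close>

definition additive_W ::
  "real \<Rightarrow> (label \<Rightarrow> real \<Rightarrow> 'w \<Rightarrow> real) \<Rightarrow> (label \<Rightarrow> 'w \<Rightarrow> real) \<Rightarrow> (label \<Rightarrow> 'w \<Rightarrow> nat)
     \<Rightarrow> (real \<Rightarrow> real) \<Rightarrow> (real \<Rightarrow> real \<Rightarrow> real) \<Rightarrow> real \<Rightarrow> real \<Rightarrow> 'w \<Rightarrow> real" where
  "additive_W x B T A \<gamma> \<psi> l t \<omega> =
     exp (- \<gamma> l * t) *
     (\<Sum>u\<in>alive T A t \<omega>. exp (- l * position x B T u t \<omega>) * \<psi> (position x B T u t \<omega>) l)"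

definition log_plus :: "real \<Rightarrow> real" where
  "log_plus y = (if y \<le> 1 then 0 else ln y)"

definition E_LlogL :: "nat pmf \<Rightarrow> ennreal" where
  "E_LlogL p = (\<integral>\<^sup>+k. ennreal (real k * log_plus (real k)) \<partial>measure_pmf p)"

end

(*
  Write h(y) = exp(- l y) psi(y, l). A particle started at y that dies at time tau and leaves 1 + A
  children satisfies E[(1 + A) exp(- gamma tau) h(X_tau)] = h(y): with the lifetimes realized by
  exponential clocks this is the Feynman-Kac formula for the eigenvalue equation. Summing over the
  generations of the genealogical tree gives the mean of W_t, and testing the same balance against a
  pi-system of events observed at time s gives the martingale property.

  W_t converges almost surely because exp(- W) is a bounded submartingale, to which a maximal inequality
  and right continuity apply. The limit is compared with the sums V_n of exp(- gamma b) h(X_b) over the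
  births b in generation n, so that everything else concerns V_n:
  - above lstar, gamma (th l) < th gamma (l) for some th < 1, and E V_n^th decays geometrically;
  - below lstar, (1 + eta)-th powers decay. Deleting the families that are too large for their
    generation leaves sums whose means decrease by a loss that diverges or converges together with
    E (L log L); in the convergent case truncated second moments give E W = h(x);
  - at lstar the spine is driftless up to a periodic corrector D: D(X_t) - gamma t is a martingale along
    it. Killing the particles for which this quantity is large leaves sums whose means are compared
    with those of the tilts exp(th (D - gamma t)), of growth 1 + O(th^2), for two values of th;
    they tend to zero.
*)

theory Submission
  imports Defs
begin

section \<open>Floquet solutions and the principal eigenvalue\<close>

text \<open>The axioms describe lifetimes only by conditional survival functions, so a lifetime
  depends on its path and on a birth place inherited from the ancestors. The hazard
  \<open>EE v\<close> accumulated up to death removes this: paths, offspring numbers and clocks form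
  one independent family, the tree is a function of it, and conditioning becomes integration over
  two copies of the sample space. No change of measure is made; the spine survives only as a
  one-generation balance, tested against events that concern other particles or the own past.

  W_t and V_n are linked by the line stopped at time t or at generation n. Its truncated mean E
  min(., C) decreases in both parameters, so estimates for single V_n reach the limit without
  uniform integrability.

  At criticality the slightly tilted mass starts close to the untilted mass but grows in mean, so it
  has to leave through the barrier, and the untilted mass must leave with it. The overshoot over the
  barrier spoils this comparison; the larger tilt \<open>th1\<close>, normalized j units above the
  barrier, dominates the overshoot at small cost.\<close>

abbreviation bm :: "'a measure => ('a => 'b::topological_space) set" where "bm N \<equiv> borel_measurable N"

text \<open>This is the eigenvalue equation written for exp(- l y) psi(y), which turns the drift
  term into the multiplier exp(- l). The potential \<open>r\<close> stays free because geometric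
  means and exponential tilts of eigenfunctions are again of this form, with potentials other than
  gamma - m g.\<close>

definition floquet :: "real => (real => real) => (real => real) => (real => real) => bool" where
 "floquet l r H H' \<longleftrightarrow> (\<forall>y. 0 < H y) \<and> (\<forall>y. (H has_real_derivative H' y) (at y)) \<and>
   (\<forall>y. (H' has_real_derivative 2 * r y * H y) (at y)) \<and> (\<forall>y. H (y + 1) = exp (- l) * H y)"

lemma floquetD:
 assumes "floquet l r H H'"
 shows "0 < H y" "(H has_real_derivative H' y) (at y)"
  "(H' has_real_derivative 2 * r y * H y) (at y)" "H (y + 1) = exp (- l) * H y"
 using assms by (auto simp: floquet_def)

lemma floquet_deriv_shift:
 assumes "floquet l r H H'"
 shows "H' (y + 1) = exp (- l) * H' y"
proof -
 have 1: "((\<lambda>y. H (y + 1)) has_real_derivative H' (y + 1)) (at y)"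
  using DERIV_shift[of H "H' (y+1)" y 1] floquetD(2)[OF assms, of "y+1"] by simp
 have 2: "((\<lambda>y. H (y + 1)) has_real_derivative exp (- l) * H' y) (at y)"
  unfolding floquetD(4)[OF assms] by (intro DERIV_cmult floquetD(2)[OF assms])
 from DERIV_unique[OF 1 2] show ?thesis .
qed

lemma floquet_log_deriv:
 assumes "floquet l r H H'"
 shows "((\<lambda>y. H' y / H y) has_real_derivative 2 * r y - (H' y / H y)^2) (at y)"
proof -
 have nz: "H y ~= 0" using floquetD(1)[OF assms, of y] by simp
 show ?thesis
  by (rule DERIV_cong[OF DERIV_divide[OF floquetD(3,2)[OF assms] nz]]) (use nz in \<open>simp add: field_simps power2_eq_square\<close>)
qed

text \<open>The Riccati form suits solutions given as products or powers: their logarithmic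
  derivatives add up, whereas second derivatives do not.\<close>

lemma floquetI:
 assumes "!!y. 0 < H y" "!!y. (H has_real_derivative H y * v y) (at y)"
  "!!y. (v has_real_derivative 2 * r y - (v y)^2) (at y)" "!!y. H (y + 1) = exp (- l) * H y"
 shows "floquet l r H (\<lambda>y. H y * v y)"
 unfolding floquet_def
proof (intro conjI allI)
 show "((\<lambda>y. H y * v y) has_real_derivative 2 * r y * H y) (at y)" for y
  by (rule DERIV_cong[OF DERIV_mult[OF assms(2,3)]]) (simp add: algebra_simps power2_eq_square)
qed (rule assms)+

lemma wronskian_deriv:
 assumes "floquet l r H H'" "floquet k s K K'"
 shows "((\<lambda>y. H' y * K y - H y * K' y) has_real_derivative 2 * (r y - s y) * (H y * K y)) (at y)"
 by (rule derivative_eq_intros floquetD(2,3)[OF assms(1)] floquetD(2,3)[OF assms(2)] refl)+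
  (simp add: algebra_simps)

text \<open>The Wronskian of Floquet solutions with opposite exponents is periodic, so Rolle's theorem
 compares the two potentials.\<close>

lemma wronskian_periodic:
 assumes "floquet l r H H'" "floquet (- l) s K K'"
 shows "H' 1 * K 1 - H 1 * K' 1 = H' 0 * K 0 - H 0 * K' 0"
 using floquetD(4)[OF assms(1), of 0] floquetD(4)[OF assms(2), of 0]
  floquet_deriv_shift[OF assms(1), of 0] floquet_deriv_shift[OF assms(2), of 0]
 by (simp add: algebra_simps flip: exp_add)

lemma potentials_meet:
 assumes "floquet l r H H'" "floquet (- l) s K K'"
 shows "\<exists>y. r y = s y"
proof -
 let ?wt = "\<lambda>y. H' y * K y - H y * K' y"
 have d: "(?wt has_real_derivative 2 * (r y - s y) * (H y * K y)) (at y)" for y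
  using wronskian_deriv[OF assms] .
 have "\<exists>z>0. z < 1 \<and> ?wt 1 - ?wt 0 = (1 - 0) * (2 * (r z - s z) * (H z * K z))"
  by (rule MVT2) (use d in auto)
 then obtain z where "2 * (r z - s z) * (H z * K z) = 0"
  using wronskian_periodic[OF assms] by auto
 moreover have "H z > 0" "K z > 0" using floquetD(1) assms by blast+
 ultimately show ?thesis by (auto intro!: exI[of _ z])
qed

text \<open>The equality case of the comparison: \<open>r <= s\<close> makes the Wronskian monotone,
  and equal values at 0 and 1 then make it constant in between.\<close>

lemma potentials_equal:
 assumes "floquet l r H H'" "floquet (- l) s K K'" and le: "!!y. r y <= s y" and y: "0 < y" "y < 1"
 shows "r y = s y"
proof -
 let ?wt = "\<lambda>y. H' y * K y - H y * K' y"
 have pos: "H z * K z > 0" for z using floquetD(1) assms by (intro mult_pos_pos) blast+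
 have d: "(?wt has_real_derivative 2 * (r z - s z) * (H z * K z)) (at z)" for z
  using wronskian_deriv[OF assms(1,2)] .
 have mono: "?wt b <= ?wt a" if "a <= b" for a b
 proof (rule DERIV_nonpos_imp_nonincreasing[OF that])
  fix z
  have "2 * (r z - s z) * (H z * K z) <= 0"
   by (rule mult_nonpos_nonneg) (use le[of z] pos[of z] in simp_all)
  with d[of z] show "\<exists>D. (?wt has_real_derivative D) (at z) \<and> D <= 0" by blast
 qed
 have const: "?wt z = ?wt 0" if "0 <= z" "z <= 1" for z
  by (rule order.antisym[OF mono[OF that(1)] mono[OF that(2), unfolded wronskian_periodic[OF assms(1,2)]]])
 have "((\<lambda>z. ?wt 0) has_real_derivative 2 * (r y - s y) * (H y * K y)) (at y)"
 proof (rule has_field_derivative_transform_within_open[OF d[of y], where S="{0<..<1}"])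
  show "!!z. z \<in> {0<..<1} ==> ?wt z = ?wt 0" by (rule const) auto
 qed (use y in auto)
 from DERIV_unique[OF this DERIV_const] pos[of y] show ?thesis by auto
qed

section \<open>Bounds for periodic functions\<close>

lemma periodic_int_shift:
 fixes f :: "real => real"
 assumes "!!y. f (y + 1) = f y"
 shows "f (y + of_int n) = f y"
proof (induction n rule: int_induct[where k = 0])
 case (step1 i)
 thus ?case using assms[of "y + of_int i"] by (simp add: algebra_simps)
next
 case (step2 i)
 thus ?case using assms[of "y + of_int i - 1"] by (simp add: algebra_simps)
qed simp

lemma periodic_bounded:
 fixes f :: "real => real"
 assumes "continuous_on UNIV f" "!!y. f (y + 1) = f y"
 shows "\<exists>C>0. \<forall>y. \<bar>f y\<bar> <= C"
proof -
 have "bounded (f ` {0..1})"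
  by (intro compact_imp_bounded compact_continuous_image continuous_on_subset[OF assms(1)]) auto
 then obtain C where C: "C > 0" "!!z. z \<in> {0..1} ==> \<bar>f z\<bar> <= C"
  unfolding bounded_pos by auto
 have "\<bar>f y\<bar> <= C" for y
 proof -
  have "f y = f (frac y)"
   using periodic_int_shift[of f "frac y" "\<lfloor>y\<rfloor>"] assms(2) by (simp add: frac_def)
  thus ?thesis using C(2)[of "frac y"] frac_lt_1[of y] by (simp add: less_imp_le)
 qed
 with C(1) show ?thesis by blast
qed

lemma periodic_lower_bound:
 fixes f :: "real => real"
 assumes "continuous_on UNIV f" "!!y. f (y + 1) = f y" "!!y. 0 < f y"
 shows "\<exists>c>0. \<forall>y. c <= f y"
proof -
 have "continuous_on UNIV (\<lambda>y. inverse (f y))"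
  by (intro continuous_on_inverse assms(1)) (use assms(3) in \<open>auto simp: less_imp_neq[symmetric]\<close>)
 from periodic_bounded[OF this] assms(2) obtain C where C: "C > 0" "!!y. \<bar>inverse (f y)\<bar> <= C" by auto
 have "inverse C <= f y" for y
  using C(2)[of y] assms(3)[of y] C(1) by (simp add: field_simps)
 with C(1) show ?thesis by (intro exI[of _ "inverse C"]) auto
qed

lemma antiderivative_exists:
 fixes f :: "real => real"
 assumes "continuous_on UNIV f"
 shows "\<exists>F. \<forall>y. (F has_real_derivative f y) (at y)"
 using einterval_antiderivative[of "-\<infinity>" "\<infinity>" f] assms
 by (auto simp: continuous_on_eq_continuous_at has_real_derivative_iff_has_vector_derivative)

section \<open>Convexity of the principal eigenvalue and the critical parameter\<close>

locale eigen_setup =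
 fixes g :: "real => real" and m :: real and ga :: "real => real" and \<psi> :: "real => real => real"
  and lstar :: real
 assumes g_C1: "g C1_differentiable_on UNIV"
  and g_pos: "!!y. 0 < g y"
  and g_periodic: "!!y. g (y + 1) = g y"
  and m_pos: "0 < m"
  and eigen: "!!k. principal_eigenpair g m k (ga k) (\<lambda>y. \<psi> y k)"
  and lstar: "is_arg_min (\<lambda>k. ga k / k) (\<lambda>k. 0 < k) lstar"
begin

definition hh :: "real => real => real" where "hh l y = exp (- l * y) * \<psi> y l"
definition hh' :: "real => real => real" where
 "hh' l y = exp (- l * y) * (deriv (\<lambda>y. \<psi> y l) y - l * \<psi> y l)"

lemma floquet_hh: "floquet l (\<lambda>y. ga l - m * g y) (hh l) (hh' l)"
proof -
 let ?f = "\<lambda>y. \<psi> y l"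
 have e: "?f differentiable (at y)" "deriv ?f differentiable (at y)"
   "1/2 * deriv (deriv ?f) y - l * deriv ?f y + (1/2 * l^2 + m * g y) * ?f y = ga l * ?f y"
   "?f (y + 1) = ?f y" "0 < ?f y" for y
  using eigen[of l] unfolding principal_eigenpair_def by blast+
 have d1: "(?f has_real_derivative deriv ?f y) (at y)" for y
  using e(1) DERIV_deriv_iff_real_differentiable by blast
 have d2: "(deriv ?f has_real_derivative deriv (deriv ?f) y) (at y)" for y
  using e(2) DERIV_deriv_iff_real_differentiable by blast
 have "deriv (deriv ?f) y - 2 * l * deriv ?f y + l^2 * ?f y = 2 * (ga l - m * g y) * ?f y" for y
  using e(3)[of y] by (simp add: algebra_simps)
 note e3 = this
 show ?thesis unfolding floquet_def
 proof (intro conjI allI)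
  fix y
  show "0 < hh l y" using e(5) by (simp add: hh_def)
  show "(hh l has_real_derivative hh' l y) (at y)"
   unfolding hh_def[abs_def] hh'_def
   by (rule derivative_eq_intros d1 refl)+ (simp add: algebra_simps)
  show "(hh' l has_real_derivative 2 * (ga l - m * g y) * hh l y) (at y)"
   unfolding hh_def hh'_def[abs_def]
   apply (rule derivative_eq_intros d1 d2 refl)+
   using arg_cong[OF e3[of y], of "\<lambda>z. exp (-l*y) * z"]
   by (simp add: algebra_simps power2_eq_square)
  show "hh l (y + 1) = exp (- l) * hh l y"
   using e(4)[of y] by (simp add: hh_def algebra_simps flip: exp_add)
 qed
qed

lemma hh_pos: "0 < hh l y" using floquetD(1)[OF floquet_hh] .

text \<open>The eigenfunctions for l and - l have opposite exponents, so their potentials meet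
  somewhere; both are a constant minus \<open>m * g y\<close>, and the constants must agree.\<close>

lemma ga_even: "ga (- l) = ga l"
 using potentials_meet[OF floquet_hh[of l] floquet_hh[of "- l"]] by auto

lemma ga_meets:
 assumes "floquet l r H H'" shows "\<exists>y. r y = ga l - m * g y"
 using potentials_meet[OF assms floquet_hh[of "- l"]] ga_even by auto

lemma ga_0_pos: "0 < ga 0"
proof -
 have "floquet 0 (\<lambda>_. 0) (\<lambda>_. 1) (\<lambda>_. 0)"
  by (auto simp: floquet_def)
 from ga_meets[OF this] obtain y where "ga 0 = m * g y" by auto
 thus ?thesis using m_pos g_pos[of y] by simp
qed

text \<open>A Barta-type bound: a positive supersolution for c with the right multiplier bounds the
  eigenvalue by c. Convexity of gamma and the criticality estimate both come from well-chosen test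
  functions inserted here.\<close>

lemma ga_le:
 assumes "floquet l r H H'" "!!y. r y <= c - m * g y"
 shows "ga l <= c"
proof -
 obtain y where "r y = ga l - m * g y" using ga_meets[OF assms(1)] by blast
 with assms(2)[of y] show ?thesis by simp
qed

text \<open>Logarithmic derivatives average linearly, but the square in the Riccati equation does
  not; the defect \<open>ap * \<beta> / 2 * (v k y - v l y)^2\<close> is half the variance of the
  two derivatives under the weights \<open>ap\<close> and \<open>\<beta>\<close>. Its sign gives
  convexity, its vanishing the equality case.\<close>

lemma floquet_geometric_mean:
 fixes ap \<beta> :: real
 assumes ab: "ap + \<beta> = 1"
 defines "v \<equiv> \<lambda>l y. hh' l y / hh l y"
 shows "floquet (ap * k + \<beta> * l)
   (\<lambda>y. ap * ga k + \<beta> * ga l - m * g y - ap * \<beta> / 2 * (v k y - v l y)^2)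
   (\<lambda>y. hh k y powr ap * hh l y powr \<beta>)
   (\<lambda>y. hh k y powr ap * hh l y powr \<beta> * (ap * v k y + \<beta> * v l y))"
proof -
 let ?H = "\<lambda>y. hh k y powr ap * hh l y powr \<beta>"
 have b: "\<beta> = 1 - ap" using ab by simp
 have dv: "(v j has_real_derivative 2 * (ga j - m * g y) - (v j y)^2) (at y)" for j y
  unfolding v_def by (rule floquet_log_deriv[OF floquet_hh])
 have dH: "(?H has_real_derivative ?H y * (ap * v k y + \<beta> * v l y)) (at y)" for y
 proof -
  have p: "((\<lambda>y. hh j y powr a) has_real_derivative a * hh j y powr a * v j y) (at y)" for j a
  proof -
   have "((\<lambda>y. hh j y powr a) has_real_derivative a * hh j y powr (a - 1) * hh' j y) (at y)"
    by (rule DERIV_powr[THEN DERIV_cong, OF floquetD(2)[OF floquet_hh] hh_pos DERIV_const])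
      (use hh_pos[of j y] in \<open>simp add: powr_diff field_simps\<close>)
   thus ?thesis using hh_pos[of j y] unfolding v_def by (simp add: powr_diff field_simps)
  qed
  show ?thesis
   by (rule DERIV_cong[OF DERIV_mult[OF p p]]) (simp add: algebra_simps)
 qed
 show ?thesis
 proof (rule floquetI)
  fix y
  show "0 < ?H y" using hh_pos[of k y] hh_pos[of l y] by simp
  show "(?H has_real_derivative ?H y * (ap * v k y + \<beta> * v l y)) (at y)" by (rule dH)
  show "((\<lambda>y. ap * v k y + \<beta> * v l y) has_real_derivative
    2 * (ap * ga k + \<beta> * ga l - m * g y - ap * \<beta> / 2 * (v k y - v l y)^2) - (ap * v k y + \<beta> * v l y)^2) (at y)"
   by (rule DERIV_cong[OF DERIV_add[OF DERIV_cmult[OF dv] DERIV_cmult[OF dv]]]) (simp add: b field_simps power2_eq_square)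
  show "?H (y + 1) = exp (- (ap * k + \<beta> * l)) * ?H y"
   unfolding floquetD(4)[OF floquet_hh]
   using hh_pos[of k y] hh_pos[of l y]
   by (simp add: powr_mult powr_def ln_mult algebra_simps flip: exp_add)
 qed
qed

lemma ga_convex:
 fixes ap \<beta> :: real
 assumes "ap + \<beta> = 1" "0 <= ap" "0 <= \<beta>"
 shows "ga (ap * k + \<beta> * l) <= ap * ga k + \<beta> * ga l"
 by (rule ga_le[OF floquet_geometric_mean[OF assms(1)]]) (use assms in auto)

text \<open>Equality would make the variance term vanish, so both eigenfunctions would have the same
  logarithmic derivative on (0,1) and their quotient equal values at 0 and 1, against the different
  multipliers.\<close>

lemma ga_strictly_convex:
 fixes ap \<beta> :: real
 assumes ab: "ap + \<beta> = 1" "0 < ap" "0 < \<beta>" and "k ~= l"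
 shows "ga (ap * k + \<beta> * l) < ap * ga k + \<beta> * ga l"
proof (rule ccontr)
 assume "\<not> ?thesis"
 with ga_convex[of ap \<beta> k l] ab have eq: "ga (ap * k + \<beta> * l) = ap * ga k + \<beta> * ga l" by simp
 let ?v = "\<lambda>l y. hh' l y / hh l y"
 let ?q = "\<lambda>y. hh k y / hh l y"
 have v: "?v k y = ?v l y" if "0 < y" "y < 1" for y
 proof -
  have "ap * ga k + \<beta> * ga l - m * g y - ap * \<beta> / 2 * (?v k y - ?v l y)^2
    = ga (- (ap * k + \<beta> * l)) - m * g y"
   by (rule potentials_equal[OF floquet_geometric_mean[OF ab(1), of k l] floquet_hh _ that])
     (use ab in \<open>simp only: ga_even eq\<close>, simp)
  hence "ap * \<beta> * (?v k y - ?v l y)^2 = 0" by (simp only: ga_even eq) simp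
  with ab show ?thesis by simp
 qed
 have d: "(?q has_real_derivative ?q y * (?v k y - ?v l y)) (at y)" for y
  using hh_pos[of k y] hh_pos[of l y]
  by (intro DERIV_cong[OF DERIV_divide[OF floquetD(2)[OF floquet_hh] floquetD(2)[OF floquet_hh]]])
    (auto simp: field_simps)
 have "\<exists>z>0. z < 1 \<and> ?q 1 - ?q 0 = (1 - 0) * (?q z * (?v k z - ?v l z))"
  by (rule MVT2) (use d in auto)
 hence "?q 1 = ?q 0" using v by auto
 hence "exp (- k) / exp (- l) = 1"
  using floquetD(4)[OF floquet_hh, of k 0] floquetD(4)[OF floquet_hh, of l 0]
   hh_pos[of k 0] hh_pos[of l 0] by (simp add: field_simps)
 with \<open>k ~= l\<close> show False by simp
qed

lemma lstar_pos: "0 < lstar" and lstar_min: "0 < k ==> ga lstar / lstar <= ga k / k"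
proof -
 show "0 < lstar" using lstar unfolding is_arg_min_def by blast
 assume "0 < k"
 hence "\<not> ga k / k < ga lstar / lstar" using lstar unfolding is_arg_min_def by blast
 thus "ga lstar / lstar <= ga k / k" by (simp only: not_less)
qed

text \<open>At the midpoint of two minimizers, strict convexity would put gamma strictly below the
  ray through the origin with the minimal slope.\<close>

lemma lstar_unique:
 assumes "0 < k" "k ~= lstar" shows "ga lstar / lstar < ga k / k"
proof (rule ccontr)
 assume "\<not> ?thesis"
 hence eq: "ga k / k = ga lstar / lstar" (is "_ = ?n") using lstar_min[OF assms(1)] by simp
 let ?c = "1/2 * k + 1/2 * lstar"
 have c: "0 < ?c" using lstar_pos assms(1) by simp
 have "ga ?c < 1/2 * ga k + 1/2 * ga lstar" using ga_strictly_convex[of "1/2" "1/2" k lstar] assms by simp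
 also have "... = ?n * ?c" using eq assms lstar_pos by (simp add: field_simps)
 finally have "ga ?c / ?c < ?n" using c by (subst pos_divide_less_eq) auto
 with lstar_min[OF c] show False by simp
qed

lemma ga_abs: "ga \<bar>l\<bar> = ga l"
 by (cases "0 <= l") (auto simp: ga_even)

text \<open>Moving along the ray to modulus \<open>lstar\<close> strictly lowers gamma(k) / |k|. The
  factor \<open>lstar / \<bar>l\<bar>\<close> is greater than 1 below criticality and less than 1
  above it; it becomes the exponent 1 + eta, respectively th, of the moment estimates.\<close>

lemma ga_ray:
 assumes "l ~= 0" "\<bar>l\<bar> ~= lstar" shows "ga (lstar / \<bar>l\<bar> * l) < lstar / \<bar>l\<bar> * ga l"
proof -
 have "ga (lstar / \<bar>l\<bar> * l) = ga lstar"
  using ga_abs[of "lstar / \<bar>l\<bar> * l"] assms lstar_pos by (simp add: abs_mult)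
 also have "... < lstar / \<bar>l\<bar> * ga l"
  using lstar_unique[of "\<bar>l\<bar>"] assms pos_divide_less_eq[OF lstar_pos, of "ga lstar" "ga l / \<bar>l\<bar>"] by (simp add: ga_abs mult.commute)
 finally show ?thesis .
qed

lemma subcritical:
 assumes "\<bar>l\<bar> < lstar"
 shows "\<exists>et>0. ga ((1 + et) * l) < (1 + et) * ga l"
proof (cases "l = 0")
 case True
 \<comment> \<open>At l = 0 the ray degenerates, and any positive exponent works because gamma(0) is
   positive.\<close>
 thus ?thesis using ga_0_pos by (intro exI[of _ 1]) auto
next
 case False
 thus ?thesis using assms ga_ray[of l] by (intro exI[of _ "lstar / \<bar>l\<bar> - 1"]) auto
qed

lemma supercritical:
 assumes "\<bar>l\<bar> > lstar"
 shows "\<exists>th>0. th < 1 \<and> ga (th * l) < th * ga l"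
 using assms lstar_pos ga_ray[of l] by (intro exI[of _ "lstar / \<bar>l\<bar>"]) auto

lemma g_continuous: "continuous_on UNIV g"
 using g_C1 C1_differentiable_imp_continuous_on by blast

text \<open>The line through the origin with the minimal slope supports gamma from below on the ray
  through l and touches it at l.\<close>

lemma ga_critical_lower:
 assumes "\<bar>l\<bar> = lstar" "0 < k"
 shows "k * ga l <= ga (k * l)"
proof -
 have "ga lstar = ga l" using ga_abs[of l] assms by simp
 moreover have "ga (k * lstar) = ga (k * l)"
  using ga_abs[of "k * l"] assms by (simp add: abs_mult)
 moreover have "ga lstar / lstar <= ga (k * lstar) / (k * lstar)"
  using lstar_pos assms by (intro lstar_min) simp
 ultimately show ?thesis using lstar_pos assms(2) by (simp add: field_simps)
qed

text \<open>At criticality the function \<open>D (X\<^sub>t) - ga t\<close> is a martingale along the spine; \<open>wt = D'\<close> solves the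
 linear equation \<open>wt' + 2 (h' / h) wt = const\<close>, and minimality of \<open>ga k / k\<close> forces the constant.\<close>

lemma critical_corrector:
 assumes crit: "\<bar>l\<bar> = lstar"
 obtains D wt wt' where
  "!!y. (D has_real_derivative wt y) (at y)" "!!y. (wt has_real_derivative wt' y) (at y)"
  "continuous_on UNIV wt'" "!!y. wt (y + 1) = wt y" "!!y. wt y ~= 0" "!!y. D (y + 1) = D y - l"
  "!!th. floquet ((1 + th) * l) (\<lambda>y. ga l - m * g y + th * ga l + th^2 * (wt y)^2 / 2)
    (\<lambda>y. hh l y * exp (th * D y)) (\<lambda>y. hh l y * exp (th * D y) * (hh' l y / hh l y + th * wt y))"
proof -
 have l0: "l ~= 0" using crit lstar_pos by auto
 define h where "h = hh l"
 define v where "v = (\<lambda>y. hh' l y / hh l y)"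
 have hpos: "h y > 0" for y unfolding h_def by (rule hh_pos)
 have dh: "(h has_real_derivative h y * v y) (at y)" for y
  using floquetD(2)[OF floquet_hh, of l y] hh_pos[of l y] unfolding h_def v_def by simp
 have dv: "(v has_real_derivative 2 * (ga l - m * g y) - (v y)^2) (at y)" for y
  unfolding v_def by (rule floquet_log_deriv[OF floquet_hh])
 have hshift: "h (y + 1) = exp (- l) * h y" for y unfolding h_def by (rule floquetD(4)[OF floquet_hh])
 have conth: "continuous_on UNIV h" by (rule DERIV_continuous_on[OF dh])
 have contv: "continuous_on UNIV v" by (rule DERIV_continuous_on[OF dv])
 define e where "e = exp (- 2 * l)"
 have h2shift: "(h (y + 1))^2 = e * (h y)^2" for y
 proof -
  have "e = (exp (- l))^2" by (simp add: e_def power2_eq_square flip: exp_add)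
  thus ?thesis by (simp only: hshift power_mult_distrib)
 qed
 obtain Q where Q: "!!y. (Q has_real_derivative (h y)^2) (at y)"
  using antiderivative_exists[of "\<lambda>y. (h y)^2"] conth by (metis continuous_on_power)
 have Q1: "((\<lambda>y. Q (y + 1)) has_real_derivative e * (h y)^2) (at y)" for y
  using DERIV_shift[of Q "(h (y+1))^2" y 1] Q[of "y+1"] h2shift[of y] by (simp add: add.commute)
 have Qshift: "Q (y + 1) - e * Q y = Q 1 - e * Q 0" for y
 proof -
  have "((\<lambda>y. Q (y + 1) - e * Q y) has_real_derivative 0) (at y)" for y
   by (rule DERIV_cong[OF DERIV_diff[OF Q1 DERIV_cmult[OF Q]]]) simp
  thus ?thesis using DERIV_isconst_all[of "\<lambda>y. Q (y + 1) - e * Q y" y 0] by simp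
 qed
 \<comment> \<open>Integrated over one period, h^2 gives a function with the multiplier
   \<open>e\<close> of h^2 itself; dividing it by h^2 yields a positive periodic solution of
   \<open>w0' + 2 v w0 = e - 1\<close>.\<close>
 define I where "I = (\<lambda>y. Q (y + 1) - Q y)"
 have dI: "(I has_real_derivative (e - 1) * (h y)^2) (at y)" for y
  unfolding I_def by (rule DERIV_cong[OF DERIV_diff[OF Q1 Q]]) (simp add: algebra_simps)
 have Ishift: "I (y + 1) = e * I y" for y
  using Qshift[of y] Qshift[of "y + 1"] unfolding I_def by (simp add: algebra_simps)
 have Ipos: "I y > 0" for y
 proof -
  have "\<exists>z>y. z < y + 1 \<and> Q (y + 1) - Q y = (y + 1 - y) * (h z)^2"
   by (rule MVT2) (use Q in auto)
  then obtain z where "Q (y + 1) - Q y = (h z)^2" by auto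
  moreover have "(h z)^2 > 0" using hpos[of z] by simp
  ultimately show ?thesis unfolding I_def by simp
 qed
 define w0 where "w0 = (\<lambda>y. I y / (h y)^2)"
 have w0pos: "w0 y > 0" for y using Ipos hpos[of y] by (simp add: w0_def)
 have dw0: "(w0 has_real_derivative (e - 1) - 2 * v y * w0 y) (at y)" for y
 proof -
  have nz: "h y ~= 0" using hpos[of y] by simp
  show ?thesis unfolding w0_def
   apply (rule derivative_eq_intros dI dh refl)+
   using nz by (simp_all add: field_simps power2_eq_square)
 qed
 have w0per: "w0 (y + 1) = w0 y" for y
  unfolding w0_def Ishift h2shift by (simp add: e_def)
 have contw0: "continuous_on UNIV w0" by (rule DERIV_continuous_on[OF dw0])
 obtain D0 where D0: "!!y. (D0 has_real_derivative w0 y) (at y)"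
  using antiderivative_exists[OF contw0] by auto
 define c0 where "c0 = D0 1 - D0 0"
 have D0shift: "D0 (y + 1) = D0 y + c0" for y
 proof -
  have s: "((\<lambda>y. D0 (y + 1)) has_real_derivative w0 y) (at y)" for y
   using DERIV_shift[of D0 "w0 (y+1)" y 1] D0[of "y+1"] w0per by simp
  have "((\<lambda>y. D0 (y + 1) - D0 y) has_real_derivative 0) (at y)" for y
   by (rule DERIV_cong[OF DERIV_diff[OF s D0]]) simp
  thus ?thesis using DERIV_isconst_all[of "\<lambda>y. D0 (y + 1) - D0 y" y 0] by (simp add: c0_def)
 qed
 have c0: "c0 > 0"
 proof -
  have "\<exists>z>0. z < 1 \<and> D0 1 - D0 0 = (1 - 0) * w0 z"
   by (rule MVT2) (use D0 in auto)
  then obtain z where "D0 1 - D0 0 = w0 z" by auto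
  thus ?thesis using w0pos[of z] unfolding c0_def by simp
 qed
 \<comment> \<open>The scaling makes D drop by l over each period, so that
   \<open>h * exp (th * D)\<close> has the multiplier belonging to the parameter (1 + th) l.\<close>
 define \<beta> where "\<beta> = - l / c0"
 have b0: "\<beta> ~= 0" using l0 c0 by (simp add: \<beta>_def)
 define c where "c = \<beta> * (e - 1) / 2"
 define wt where "wt = (\<lambda>y. \<beta> * w0 y)"
 define D where "D = (\<lambda>y. \<beta> * D0 y)"
 have dw: "(wt has_real_derivative 2 * c - 2 * v y * wt y) (at y)" for y
  unfolding wt_def by (rule DERIV_cong[OF DERIV_cmult[OF dw0]]) (simp add: c_def field_simps)
 have dD: "(D has_real_derivative wt y) (at y)" for y
  unfolding wt_def D_def by (rule DERIV_cmult[OF D0])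
 have contw: "continuous_on UNIV wt" unfolding wt_def by (intro continuous_intros contw0)
 have Dshift: "D (y + 1) = D y - l" for y
  unfolding D_def D0shift \<beta>_def using c0 by (simp add: field_simps)
 have wper: "wt (y + 1) = wt y" for y by (simp add: wt_def w0per)
 have fl: "floquet ((1 + th) * l) (\<lambda>y. ga l - m * g y + th * c + th^2 * (wt y)^2 / 2)
    (\<lambda>y. h y * exp (th * D y)) (\<lambda>y. h y * exp (th * D y) * (v y + th * wt y))" for th
 proof (rule floquetI)
  fix y
  show "0 < h y * exp (th * D y)" using hpos by simp
  show "((\<lambda>y. h y * exp (th * D y)) has_real_derivative h y * exp (th * D y) * (v y + th * wt y)) (at y)"
   by (rule derivative_eq_intros dh dD refl)+ (simp add: algebra_simps)
  show "((\<lambda>y. v y + th * wt y) has_real_derivative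
    2 * (ga l - m * g y + th * c + th^2 * (wt y)^2 / 2) - (v y + th * wt y)^2) (at y)"
   by (rule DERIV_cong[OF DERIV_add[OF dv DERIV_cmult[OF dw]]]) (simp add: field_simps power2_eq_square)
  show "h (y + 1) * exp (th * D (y + 1)) = exp (- ((1 + th) * l)) * (h y * exp (th * D y))"
   unfolding hshift Dshift by (simp add: algebra_simps flip: exp_add)
 qed
 obtain K where K: "K > 0" "!!y. \<bar>wt y\<bar> <= K"
  using periodic_bounded[OF contw wper] by auto
 \<comment> \<open>The tilted function tests gamma at (1 + th) l from above, while the supporting
   ray bounds it from below. Both signs of th are allowed, so letting th tend to 0 from either side
   identifies c.\<close>
 have cmp: "th * ga l <= th * c + th^2 * K^2 / 2" if "-1 < th" for th
 proof -
  have "(1 + th) * ga l <= ga ((1 + th) * l)" using ga_critical_lower[OF crit] that by simp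
  also have "... <= ga l + th * c + th^2 * K^2 / 2"
  proof (rule ga_le[OF fl])
   fix y
   have "(wt y)^2 <= K^2" using K(2)[of y] K(1) by (simp add: abs_le_square_iff[symmetric])
   hence "th^2 * (wt y)^2 / 2 <= th^2 * K^2 / 2" by (simp add: mult_left_mono)
   thus "ga l - m * g y + th * c + th^2 * (wt y)^2 / 2 <= ga l + th * c + th^2 * K^2 / 2 - m * g y"
    by simp
  qed
  finally show ?thesis by (simp add: algebra_simps)
 qed
 have "ga l <= c + t * K^2 / 2" "c - t * K^2 / 2 <= ga l" if "0 < t" "t < 1" for t
 proof -
  have "t * ga l <= t * (c + t * K^2 / 2)" using cmp[of t] that by (simp add: algebra_simps power2_eq_square)
  with that show "ga l <= c + t * K^2 / 2" by simp
  have "t * (c - t * K^2 / 2) <= t * ga l" using cmp[of "-t"] that by (simp add: algebra_simps power2_eq_square)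
  with that show "c - t * K^2 / 2 <= ga l" by simp
 qed
 note ineq = this
 have "c = ga l"
 proof (rule ccontr)
  assume "c ~= ga l"
  define d where "d = \<bar>c - ga l\<bar>"
  have d: "d > 0" using \<open>c ~= ga l\<close> by (simp add: d_def)
  define t where "t = min (1/2) (d / K^2)"
  have t: "0 < t" "t < 1" using d K(1) by (auto simp: t_def)
  have "t * K^2 <= d" using K(1) by (simp add: t_def min_def field_simps)
  hence "t * K^2 / 2 < d" using d by linarith
  with ineq[OF t] show False unfolding d_def by linarith
 qed
 show ?thesis
 proof (rule that[OF dD dw _ wper _ Dshift])
  show "continuous_on UNIV (\<lambda>y. 2 * c - 2 * v y * wt y)" by (intro continuous_intros contv contw)
  show "wt y ~= 0" for y using b0 w0pos[of y] by (simp add: wt_def)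
  show "floquet ((1 + th) * l) (\<lambda>y. ga l - m * g y + th * ga l + th^2 * (wt y)^2 / 2)
    (\<lambda>y. hh l y * exp (th * D y)) (\<lambda>y. hh l y * exp (th * D y) * (hh' l y / hh l y + th * wt y))" for th
   using fl[of th] \<open>c = ga l\<close> unfolding h_def v_def by simp
 qed
qed

end

section \<open>Integration and periodic functions\<close>

text \<open>Rounding the time up to dyadic points leaves countably many deterministic times, and
  continuity removes the rounding. The path is read at \<open>f z\<close>, so that path and time may
  come from different factors of a product space.\<close>

lemma continuous_process_at_random_time:
 fixes Y :: "real => 'a => real"
 assumes Y: "!!r. 0 <= r ==> Y r \<in> bm N"
  and cont: "!!w. w \<in> space N ==> continuous_on {0..} (\<lambda>r. Y r w)"
  and f: "f \<in> measurable K N" and ta: "ta \<in> bm K"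
  and nonneg: "!!z. z \<in> space K ==> 0 <= ta z"
 shows "(\<lambda>z. Y (ta z) (f z)) \<in> bm K"
proof -
 define k where "k = (\<lambda>(n::nat) z. nat \<lceil>2 ^ n * ta z\<rceil>)"
 have k[measurable]: "k n \<in> measurable K (count_space UNIV)" for n
  unfolding k_def using ta by measurable
 have meas: "(\<lambda>z. Y (real (k n z) / 2 ^ n) (f z)) \<in> bm K" for n
 proof (rule measurable_compose_countable[OF _ k])
  show "(\<lambda>z. Y (real i / 2 ^ n) (f z)) \<in> bm K" for i
   by (rule measurable_compose[OF f Y]) simp
 qed
 show ?thesis
 proof (rule borel_measurable_LIMSEQ_real[OF _ meas])
  fix z assume z: "z \<in> space K"
  have fz: "f z \<in> space N" using measurable_space[OF f z] .
  have bnd: "ta z <= real (k n z) / 2 ^ n \<and> real (k n z) / 2 ^ n <= ta z + (1/2) ^ n" for n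
  proof -
   have k_real: "real (k n z) = of_int \<lceil>2 ^ n * ta z\<rceil>"
    using nonneg[OF z] by (simp add: k_def)
   have "2 ^ n * ta z <= real (k n z)" "real (k n z) <= 2 ^ n * ta z + 1"
    unfolding k_real by linarith+
   thus ?thesis by (simp add: field_simps power_one_over)
  qed
  have lim: "(\<lambda>n. real (k n z) / 2 ^ n) \<longlonglongrightarrow> ta z"
  proof (rule tendsto_sandwich)
   show "(\<lambda>n. ta z) \<longlonglongrightarrow> ta z" by simp
   show "(\<lambda>n. ta z + (1/2::real) ^ n) \<longlonglongrightarrow> ta z"
    using tendsto_add[OF tendsto_const[of "ta z"] LIMSEQ_power_zero[of "1/2::real"]] by simp
  qed (use bnd in auto)
  show "(\<lambda>n. Y (real (k n z) / 2 ^ n) (f z)) \<longlonglongrightarrow> Y (ta z) (f z)"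
   by (rule continuous_on_tendsto_compose[OF cont[OF fz] lim]) (use nonneg[OF z] in auto)
 qed
qed

lemma integral_eq_lborel:
 fixes f :: "real => real"
 assumes "continuous_on {a..b} f"
 shows "integral {a..b} f = (LINT s|lborel. indicator {a..b} s * f s)"
 using set_borel_integral_eq_integral(2)[OF borel_integrable_atLeastAtMost'[OF assms]]
 by (simp add: set_lebesgue_integral_def)

lemma measurable_time_integral:
 fixes Y :: "real => 'a => real"
 assumes Y: "!!r. 0 <= r ==> Y r \<in> bm N"
  and cont: "!!w. w \<in> space N ==> continuous_on {0..} (\<lambda>r. Y r w)"
  and f: "f \<in> measurable K N" and ta: "ta \<in> bm K" and v: "v \<in> bm K"
  and q: "continuous_on UNIV (q :: real => real)"
 shows "(\<lambda>z. integral {0..ta z} (\<lambda>s. q (v z + Y s (f z)))) \<in> bm K"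
proof -
 note [measurable] = ta v f
 have [measurable]: "q \<in> bm borel" using q by (rule borel_measurable_continuous_onI)
 have J: "(\<lambda>p. Y (max 0 (snd p)) (f (fst p))) \<in> bm (K \<Otimes>\<^sub>M lborel)"
  by (rule continuous_process_at_random_time[OF Y cont]) auto
 have "(\<lambda>z. LINT s|lborel. indicator {0..ta z} s * q (v z + Y (max 0 s) (f z))) \<in> bm K"
 proof (rule sigma_finite_measure.borel_measurable_lebesgue_integral[OF sigma_finite_lborel])
  have I: "(\<lambda>p. indicator {0..ta (fst p)} (snd p) :: real) \<in> bm (K \<Otimes>\<^sub>M lborel)"
   unfolding indicator_def atLeastAtMost_iff by measurable
  show "(\<lambda>(z, s). indicator {0..ta z} s * q (v z + Y (max 0 s) (f z))) \<in> bm (K \<Otimes>\<^sub>M lborel)"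
   using I J unfolding split_beta by measurable
 qed
 also have "?this \<longleftrightarrow> ?thesis"
 proof (rule measurable_cong)
  fix z assume "z \<in> space K"
  hence "continuous_on {0..ta z} (\<lambda>s. q (v z + Y s (f z)))"
   by (intro continuous_on_compose2[OF q] continuous_intros continuous_on_subset[OF cont])
     (use measurable_space[OF f] in auto)
  from integral_eq_lborel[OF this]
  show "(LINT s|lborel. indicator {0..ta z} s * q (v z + Y (max 0 s) (f z)))
    = integral {0..ta z} (\<lambda>s. q (v z + Y s (f z)))"
   by (auto intro!: Bochner_Integration.integral_cong simp: indicator_def)
 qed
 finally show ?thesis .
qed

context prob_space begin

abbreviation nn_expectation :: "('a => ennreal) => ennreal" (binder "\<E>" 10) where
 "nn_expectation f \<equiv> nn_integral M f"

lemma subalgebra_measurable_id: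
 "subalgebra M N ==> (\<lambda>w. w) \<in> measurable M N"
 by (rule measurableI) (auto simp: subalgebra_def dest: sets.sets_into_space)

text \<open>Viewing the identity as a map into each of the two sub-sigma-algebras turns independence
  of events into the statement that the diagonal map has a product law.\<close>

lemma indep_set_diagonal:
 assumes N: "subalgebra M N1" "subalgebra M N2" and ind: "indep_set (sets N1) (sets N2)"
 shows "indep_var N1 (\<lambda>w. w) N2 (\<lambda>w. w)"
proof -
 have s: "{(\<lambda>w. w) -` A \<inter> space M |A. A \<in> sets N} = sets N" if "subalgebra M N" for N
 proof -
  have "A \<inter> space M = A" if "A \<in> sets N" for A
   using sets.sets_into_space[OF that] \<open>subalgebra M N\<close> by (auto simp: subalgebra_def)
  hence "(\<lambda>A. A \<inter> space M) ` sets N = sets N" by (auto simp: image_iff)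
  moreover have "{(\<lambda>w. w) -` A \<inter> space M |A. A \<in> sets N} = (\<lambda>A. A \<inter> space M) ` sets N" by auto
  ultimately show ?thesis by (rule trans[rotated])
 qed
 have ss: "sigma_sets (space M) (sets N) = sets N" if "subalgebra M N" for N
  using sets.sigma_sets_eq[of N] that by (simp add: subalgebra_def)
 show ?thesis unfolding indep_var_eq s[OF N(1)] s[OF N(2)] ss[OF N(1)] ss[OF N(2)]
  using ind subalgebra_measurable_id N by blast
qed

text \<open>Integrating over two independent copies of the sample space replaces conditioning on \<open>N1\<close>.\<close>

lemma nn_integral_freeze:
 assumes N: "subalgebra M N1" "subalgebra M N2" and ind: "indep_set (sets N1) (sets N2)"
  and F: "(\<lambda>(w, w'). F w w') \<in> bm (N1 \<Otimes>\<^sub>M N2)"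
 shows "(\<E> w. F w w) = (\<E> w. (\<E> w'. F w w'))"
proof -
 note iv = indep_set_diagonal[OF N ind]
 note id1 = subalgebra_measurable_id[OF N(1)]
 note id2 = subalgebra_measurable_id[OF N(2)]
 interpret M1: prob_space "distr M N1 (\<lambda>w. w)" by (rule prob_space_distr[OF id1])
 interpret M2: prob_space "distr M N2 (\<lambda>w. w)" by (rule prob_space_distr[OF id2])
 have eq: "distr M N1 (\<lambda>w. w) \<Otimes>\<^sub>M distr M N2 (\<lambda>w. w) = distr M (N1 \<Otimes>\<^sub>M N2) (\<lambda>w. (w, w))"
  using iv unfolding indep_var_distribution_eq by blast
 have F': "(\<lambda>(w, w'). F w w') \<in> bm (distr M N1 (\<lambda>w. w) \<Otimes>\<^sub>M distr M N2 (\<lambda>w. w))"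
  using F by (simp cong: measurable_cong_sets sets_pair_measure_cong)
 have "(\<E> w. F w w) = (\<integral>\<^sup>+z. (case z of (w, w') => F w w') \<partial>distr M (N1 \<Otimes>\<^sub>M N2) (\<lambda>w. (w, w)))"
  by (subst nn_integral_distr) (use id1 id2 F in \<open>auto intro: measurable_Pair\<close>)
 also have "... = (\<integral>\<^sup>+w. (\<integral>\<^sup>+w'. F w w' \<partial>distr M N2 (\<lambda>w. w)) \<partial>distr M N1 (\<lambda>w. w))"
  unfolding eq[symmetric] using M2.nn_integral_fst[OF F'] by simp
 also have "... = (\<E> w. (\<integral>\<^sup>+w'. F w w' \<partial>distr M N2 (\<lambda>w. w)))"
  by (rule nn_integral_distr[OF id1]) (use M2.borel_measurable_nn_integral_fst[OF F'] in simp)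
 also have "... = (\<E> w. (\<E> w'. F w w'))"
 proof (rule nn_integral_cong)
  fix w assume "w \<in> space M"
  hence wt: "w \<in> space N1" using N by (simp add: subalgebra_def)
  show "(\<integral>\<^sup>+w'. F w w' \<partial>distr M N2 (\<lambda>w. w)) = (\<E> w'. F w w')"
   by (rule nn_integral_distr[OF id2]) (use measurable_Pair2[OF F wt] in simp)
 qed
 finally show ?thesis .
qed

lemma indep_set_integral_mult:
 fixes f h :: "'a => real"
 assumes N: "subalgebra M N1" "subalgebra M N2" and ind: "indep_set (sets N1) (sets N2)"
  and f: "f \<in> bm N1" "integrable M f"
  and h: "h \<in> bm N2" "integrable M h"
 shows "integrable M (\<lambda>w. f w * h w)" "expectation (\<lambda>w. f w * h w) = expectation f * expectation h"
proof -
 have iv: "indep_var borel f borel h"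
  using indep_var_compose[OF indep_set_diagonal[OF N ind] f(1) h(1)] by (simp add: comp_def)
 show "integrable M (\<lambda>w. f w * h w)" "expectation (\<lambda>w. f w * h w) = expectation f * expectation h"
  using indep_var_integrable[OF iv f(2) h(2)] indep_var_lebesgue_integral[OF iv f(2) h(2)] by auto
qed

end

section \<open>Lipschitz periodic potentials and growth of Floquet solutions\<close>

definition per_lip :: "(real => real) => bool" where
 "per_lip f \<longleftrightarrow> (\<forall>y. f (y + 1) = f y) \<and> (\<exists>L\<ge>0. \<forall>y z. \<bar>f y - f z\<bar> <= L * \<bar>y - z\<bar>)"

lemma per_lip_continuous:
 assumes "per_lip f" shows "continuous_on UNIV f"
proof -
 from assms obtain L where L: "L \<ge> 0" "!!y z. \<bar>f y - f z\<bar> <= L * \<bar>y - z\<bar>" by (auto simp: per_lip_def)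
 have "L-lipschitz_on UNIV f" by (rule lipschitz_onI) (use L in \<open>auto simp: dist_real_def\<close>)
 thus ?thesis by (rule lipschitz_on_continuous_on)
qed

lemma per_lip_bounded:
 assumes "per_lip f" obtains C where "C > 0" "!!y. \<bar>f y\<bar> <= C"
 using periodic_bounded[OF per_lip_continuous[OF assms]] assms by (auto simp: per_lip_def)

lemma per_lip_const: "per_lip (\<lambda>_. c)"
 by (auto simp: per_lip_def intro!: exI[of _ 0])

lemma per_lip_add:
 assumes "per_lip f" "per_lip h" shows "per_lip (\<lambda>y. f y + h y)"
proof -
 from assms obtain L K where L: "L \<ge> 0" "!!y z. \<bar>f y - f z\<bar> <= L * \<bar>y - z\<bar>"
  and K: "K \<ge> 0" "!!y z. \<bar>h y - h z\<bar> <= K * \<bar>y - z\<bar>" by (auto simp: per_lip_def)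
 have "\<bar>f y + h y - (f z + h z)\<bar> <= (L + K) * \<bar>y - z\<bar>" for y z
  using L(2)[of y z] K(2)[of y z] unfolding distrib_right by linarith
 with L K assms show ?thesis unfolding per_lip_def by (auto intro!: exI[of _ "L + K"])
qed

lemma per_lip_mult:
 assumes "per_lip f" "per_lip h" shows "per_lip (\<lambda>y. f y * h y)"
proof -
 from assms obtain L K where L: "L \<ge> 0" "!!y z. \<bar>f y - f z\<bar> <= L * \<bar>y - z\<bar>"
  and K: "K \<ge> 0" "!!y z. \<bar>h y - h z\<bar> <= K * \<bar>y - z\<bar>" by (auto simp: per_lip_def)
 obtain C where C: "C > 0" "!!y. \<bar>f y\<bar> <= C" using per_lip_bounded[OF assms(1)] by blast
 obtain E where E: "E > 0" "!!y. \<bar>h y\<bar> <= E" using per_lip_bounded[OF assms(2)] by blast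
 have "\<bar>f y * h y - f z * h z\<bar> <= (C * K + L * E) * \<bar>y - z\<bar>" for y z
 proof -
  have "f y * h y - f z * h z = f y * (h y - h z) + (f y - f z) * h z" by (simp add: algebra_simps)
  also have "\<bar>...\<bar> <= \<bar>f y\<bar> * \<bar>h y - h z\<bar> + \<bar>f y - f z\<bar> * \<bar>h z\<bar>"
   by (rule order_trans[OF abs_triangle_ineq]) (simp add: abs_mult)
  also have "... <= C * (K * \<bar>y - z\<bar>) + (L * \<bar>y - z\<bar>) * E"
   by (intro add_mono mult_mono C K L E) (use C E L K in auto)
  finally show ?thesis by (simp add: algebra_simps)
 qed
 with L K C E assms show ?thesis unfolding per_lip_def
  by (auto intro!: exI[of _ "C * K + L * E"])
qed

lemma per_lip_C1:
 fixes f f' :: "real => real"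
 assumes "!!y. (f has_real_derivative f' y) (at y)" "continuous_on UNIV f'" "!!y. f (y + 1) = f y"
 shows "per_lip f"
proof -
 have per: "f' (y + 1) = f' y" for y
 proof -
  have "((\<lambda>y. f (y + 1)) has_real_derivative f' (y + 1)) (at y)"
   using DERIV_shift[of f "f' (y+1)" y 1] assms(1)[of "y+1"] by simp
  thus ?thesis using DERIV_unique assms(1) unfolding assms(3) by blast
 qed
 obtain C where C: "C > 0" "!!y. \<bar>f' y\<bar> <= C" using periodic_bounded[OF assms(2) per] by blast
 have "\<bar>f y - f z\<bar> <= C * \<bar>y - z\<bar>" for y z
  using field_differentiable_bound[of UNIV f f' C y z] assms(1) C by auto
 with C assms(3) show ?thesis unfolding per_lip_def by (auto intro!: exI[of _ C])
qed

text \<open>All errors are relative to \<open>H y\<close>, because H itself may grow exponentially.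
  This works since H'/H is periodic and hence bounded; the second-order term uses H'' = 2 r H, and
  the Lipschitz bound on r supplies the third power of z.\<close>

lemma floquet_bounds:
 assumes fl: "floquet l r H H'" and r: "per_lip r" and q: "per_lip q"
 obtains c where "c > 0"
  "!!y z. H (y + z) <= H y * exp (c * \<bar>z\<bar>)"
  "!!y z. \<bar>H (y + z) - H y\<bar> <= c * H y * (\<bar>z\<bar> * exp (c * \<bar>z\<bar>))"
  "!!y z. \<bar>q (y + z) * H (y + z) - q y * H y\<bar> <= c * H y * (\<bar>z\<bar> * exp (c * \<bar>z\<bar>))"
  "!!y z. \<bar>H (y + z) - H y - H' y * z - r y * H y * z^2\<bar> <= c * H y * (\<bar>z\<bar> ^ 3 * exp (c * \<bar>z\<bar>))"
  "!!y. \<bar>H' y\<bar> <= c * H y"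
proof -
 note pos = floquetD(1)[OF fl]
 note dH = floquetD(2)[OF fl]
 note dH' = floquetD(3)[OF fl]
 have contH: "continuous_on UNIV H" by (rule DERIV_continuous_on[OF dH])
 have contH': "continuous_on UNIV H'" by (rule DERIV_continuous_on[OF dH'])
 have "continuous_on UNIV (\<lambda>y. H' y / H y)"
  by (intro continuous_on_divide contH contH') (use pos in \<open>auto simp: less_imp_neq[symmetric]\<close>)
 moreover have "H' (y + 1) / H (y + 1) = H' y / H y" for y
  unfolding floquetD(4)[OF fl] floquet_deriv_shift[OF fl] by simp
 ultimately obtain c0 where c0: "c0 > 0" "!!y. \<bar>H' y / H y\<bar> <= c0"
  using periodic_bounded by blast
 have H'le: "\<bar>H' y\<bar> <= c0 * H y" for y
  using c0(2)[of y] pos[of y] by (simp add: field_simps)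
 have growth: "H (y + z) <= H y * exp (c0 * \<bar>z\<bar>)" for y z
 proof -
  have dl: "((\<lambda>y. ln (H y)) has_real_derivative H' y / H y) (at y)" for y
   using dH[of y] pos[of y] by (auto intro!: derivative_eq_intros)
  have "\<bar>ln (H (y + z)) - ln (H y)\<bar> <= c0 * \<bar>y + z - y\<bar>"
   using field_differentiable_bound[of UNIV "\<lambda>y. ln (H y)" "\<lambda>y. H' y / H y" c0 "y+z" y] dl c0 by auto
  hence "ln (H (y + z)) <= ln (H y) + c0 * \<bar>z\<bar>" by simp
  hence "exp (ln (H (y + z))) <= exp (ln (H y) + c0 * \<bar>z\<bar>)" by simp
  thus ?thesis using pos by (simp add: exp_add)
 qed
 have incr: "\<bar>f (y + z) - f y\<bar> <= K * \<bar>z\<bar>"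
  if "!!u. (f has_real_derivative f' u) (at u)" "!!u. \<bar>u - y\<bar> <= \<bar>z\<bar> ==> \<bar>f' u\<bar> <= K" for f f' :: "real => real" and y z K
 proof -
  have "\<bar>f (y + z) - f y\<bar> <= K * \<bar>(y + z) - y\<bar>"
   using field_differentiable_bound[of "cball y \<bar>z\<bar>" f f' K "y+z" y] that
   by (auto simp: dist_real_def has_field_derivative_at_within)
  thus ?thesis by simp
 qed
 have near: "H u <= H y * exp (c0 * \<bar>z\<bar>)" if "\<bar>u - y\<bar> <= \<bar>z\<bar>" for u y z
 proof -
  have "H u <= H y * exp (c0 * \<bar>u - y\<bar>)" using growth[of y "u - y"] by simp
  also have "... <= H y * exp (c0 * \<bar>z\<bar>)" using that c0 pos[of y] by (simp add: mult_left_mono)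
  finally show ?thesis .
 qed
 have b2: "\<bar>H (y + z) - H y\<bar> <= c0 * H y * (\<bar>z\<bar> * exp (c0 * \<bar>z\<bar>))" for y z
 proof -
  have "\<bar>H (y + z) - H y\<bar> <= (c0 * (H y * exp (c0 * \<bar>z\<bar>))) * \<bar>z\<bar>"
  proof (rule incr[OF dH])
   fix u assume "\<bar>u - y\<bar> <= \<bar>z\<bar>"
   thus "\<bar>H' u\<bar> <= c0 * (H y * exp (c0 * \<bar>z\<bar>))"
    using H'le[of u] near[of u y z] c0 by (meson less_imp_le mult_left_mono order_trans)
  qed
  thus ?thesis by (simp add: mult_ac)
 qed
 have b3: "\<exists>K>0. \<forall>y z. \<bar>p (y + z) * H (y + z) - p y * H y\<bar> <= K * H y * (\<bar>z\<bar> * exp (c0 * \<bar>z\<bar>))"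
  if p: "per_lip p" for p
 proof -
  from p obtain L where L: "L \<ge> 0" "!!y z. \<bar>p y - p z\<bar> <= L * \<bar>y - z\<bar>" by (auto simp: per_lip_def)
  obtain C where C: "C > 0" "!!y. \<bar>p y\<bar> <= C" using per_lip_bounded[OF p] by blast
  have "\<bar>p (y + z) * H (y + z) - p y * H y\<bar> <= (C * c0 + L) * H y * (\<bar>z\<bar> * exp (c0 * \<bar>z\<bar>))" for y z
  proof -
   have "p (y + z) * H (y + z) - p y * H y = p (y + z) * (H (y + z) - H y) + (p (y + z) - p y) * H y"
    by (simp add: algebra_simps)
   also have "\<bar>...\<bar> <= \<bar>p (y + z)\<bar> * \<bar>H (y + z) - H y\<bar> + \<bar>p (y + z) - p y\<bar> * \<bar>H y\<bar>"
    by (rule order_trans[OF abs_triangle_ineq]) (simp add: abs_mult)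
   also have "... <= C * (c0 * H y * (\<bar>z\<bar> * exp (c0 * \<bar>z\<bar>))) + (L * \<bar>z\<bar>) * H y"
    using b2[of y z] C L(2)[of "y + z" y] pos[of y] by (intro add_mono mult_mono) auto
   also have "(L * \<bar>z\<bar>) * H y <= (L * H y) * (\<bar>z\<bar> * exp (c0 * \<bar>z\<bar>))"
   proof -
    have "\<bar>z\<bar> * 1 <= \<bar>z\<bar> * exp (c0 * \<bar>z\<bar>)" using c0 by (intro mult_left_mono) auto
    hence "(L * H y) * \<bar>z\<bar> <= (L * H y) * (\<bar>z\<bar> * exp (c0 * \<bar>z\<bar>))"
     using L pos[of y] by (intro mult_left_mono) auto
    thus ?thesis by (simp add: mult_ac)
   qed
   finally show ?thesis by (simp add: algebra_simps)
  qed
  thus ?thesis using C c0 L by (intro exI[of _ "C * c0 + L"]) (auto intro: add_pos_nonneg)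
 qed
 obtain K1 where K1: "K1 > 0" "!!y z. \<bar>q (y + z) * H (y + z) - q y * H y\<bar> <= K1 * H y * (\<bar>z\<bar> * exp (c0 * \<bar>z\<bar>))"
  using b3[OF q] by blast
 obtain K2 where K2: "K2 > 0" "!!y z. \<bar>r (y + z) * H (y + z) - r y * H y\<bar> <= K2 * H y * (\<bar>z\<bar> * exp (c0 * \<bar>z\<bar>))"
  using b3[OF r] by blast
 have b4: "\<bar>H (y + z) - H y - H' y * z - r y * H y * z^2\<bar> <= 2 * K2 * H y * (\<bar>z\<bar> ^ 3 * exp (c0 * \<bar>z\<bar>))" for y z
 proof -
  define ph' where "ph' = (\<lambda>u. H' u - H' y - 2 * (r y * H y) * (u - y))"
  define ph where "ph = (\<lambda>u. H u - H y - H' y * (u - y) - r y * H y * (u - y)^2)"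
  have d1: "(ph has_real_derivative ph' u) (at u)" for u
   unfolding ph_def ph'_def by (rule derivative_eq_intros dH refl)+ (simp add: algebra_simps)
  have d2: "(ph' has_real_derivative 2 * (r u * H u - r y * H y)) (at u)" for u
   unfolding ph'_def by (rule derivative_eq_intros dH' refl)+ (simp add: algebra_simps)
  define E where "E = 2 * K2 * H y * exp (c0 * \<bar>z\<bar>)"
  have E: "E \<ge> 0" using K2 pos[of y] by (simp add: E_def)
  have e1: "\<bar>ph' (y + z')\<bar> <= E * \<bar>z\<bar> * \<bar>z'\<bar>" if z': "\<bar>z'\<bar> <= \<bar>z\<bar>" for z'
  proof -
   have "\<bar>ph' (y + z') - ph' y\<bar> <= (E * \<bar>z\<bar>) * \<bar>z'\<bar>"
   proof (rule incr[OF d2])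
    fix u assume u: "\<bar>u - y\<bar> <= \<bar>z'\<bar>"
    have "\<bar>2 * (r u * H u - r y * H y)\<bar> <= 2 * (K2 * H y * (\<bar>u - y\<bar> * exp (c0 * \<bar>u - y\<bar>)))"
     using K2(2)[of y "u - y"] by simp
    also have "... <= 2 * (K2 * H y * (\<bar>z\<bar> * exp (c0 * \<bar>z\<bar>)))"
     using K2 pos[of y] u z' c0 by (intro mult_left_mono mult_mono) (auto intro!: mult_left_mono)
    finally show "\<bar>2 * (r u * H u - r y * H y)\<bar> <= E * \<bar>z\<bar>" by (simp add: E_def mult_ac)
   qed
   thus ?thesis by (simp add: ph'_def)
  qed
  have "\<bar>ph (y + z) - ph y\<bar> <= (E * \<bar>z\<bar> * \<bar>z\<bar>) * \<bar>z\<bar>"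
  proof (rule incr[OF d1])
   fix u assume u: "\<bar>u - y\<bar> <= \<bar>z\<bar>"
   have "\<bar>ph' u\<bar> <= E * \<bar>z\<bar> * \<bar>u - y\<bar>" using e1[OF u] by simp
   also have "... <= E * \<bar>z\<bar> * \<bar>z\<bar>" using u E by (intro mult_left_mono) auto
   finally show "\<bar>ph' u\<bar> <= E * \<bar>z\<bar> * \<bar>z\<bar>" .
  qed
  thus ?thesis by (simp add: ph_def E_def power3_eq_cube mult_ac)
 qed
 define c where "c = c0 + K1 + 2 * K2"
 have c: "c0 <= c" "K1 <= c" "2 * K2 <= c" "c > 0" using c0 K1 K2 by (auto simp: c_def)
 have e: "exp (c0 * \<bar>z\<bar>) <= exp (c * \<bar>z\<bar>)" for z using c by (simp add: mult_right_mono)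
 show ?thesis
 proof (rule that[of c])
  show "H (y + z) <= H y * exp (c * \<bar>z\<bar>)" for y z
   using growth[of y z] e[of z] pos[of y] by (meson less_imp_le mult_left_mono order_trans)
  have up: "K * H y * (\<bar>z\<bar> ^ n * exp (c0 * \<bar>z\<bar>)) <= c * H y * (\<bar>z\<bar> ^ n * exp (c * \<bar>z\<bar>))" if "K <= c" for K y z and n :: nat
   using that c pos[of y] e[of z] by (intro mult_mono mult_right_mono mult_left_mono) auto
  show "\<bar>H (y + z) - H y\<bar> <= c * H y * (\<bar>z\<bar> * exp (c * \<bar>z\<bar>))" for y z
   using order_trans[OF b2 up[OF c(1), of y z 1, simplified]] .
  show "\<bar>q (y + z) * H (y + z) - q y * H y\<bar> <= c * H y * (\<bar>z\<bar> * exp (c * \<bar>z\<bar>))" for y z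
   using order_trans[OF K1(2) up[OF c(2), of y z 1, simplified]] .
  show "\<bar>H (y + z) - H y - H' y * z - r y * H y * z^2\<bar> <= c * H y * (\<bar>z\<bar> ^ 3 * exp (c * \<bar>z\<bar>))" for y z
   using order_trans[OF b4 up[OF c(3), of y z 3]] .
  show "\<bar>H' y\<bar> <= c * H y" for y
   using H'le[of y] c(1) pos[of y] by (meson less_imp_le mult_right_mono order_trans)
 qed (rule c(4))
qed

section \<open>Gaussian exponential moments\<close>

lemma std_normal_exp_moments:
 "integrable lborel (\<lambda>z. std_normal_density z * (\<bar>z\<bar> ^ k * exp (c * \<bar>z\<bar>)))"
proof -
 have e: "integrable lborel (\<lambda>z. std_normal_density z * exp (a * z))" for a
 proof -
  have "std_normal_density z * exp (a * z) = exp (a^2 / 2) * normal_density a 1 z" for z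
   by (simp add: normal_density_def field_simps power2_eq_square flip: exp_add)
  thus ?thesis by simp
 qed
 let ?a = "\<bar>c\<bar> + 1"
 have "integrable lborel (\<lambda>z. fact k * (std_normal_density z * exp (?a * z) + std_normal_density z * exp (- ?a * z)))"
  by (intro integrable_mult_right Bochner_Integration.integrable_add e)
 thus ?thesis
 proof (rule Bochner_Integration.integrable_bound)
  show "(\<lambda>z. std_normal_density z * (\<bar>z\<bar> ^ k * exp (c * \<bar>z\<bar>))) \<in> bm lborel" by measurable
  have "\<bar>z\<bar> ^ k * exp (c * \<bar>z\<bar>) <= fact k * (exp (?a * z) + exp (- ?a * z))" for z
  proof -
   have "\<bar>z\<bar> ^ k / fact k <= exp \<bar>z\<bar>"
   proof -
    have "(\<lambda>n. inverse (fact n) * \<bar>z\<bar> ^ n) sums exp \<bar>z\<bar>"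
     using exp_converges[of "\<bar>z\<bar>"] by (simp add: scaleR_conv_of_real)
    from sum_le_suminf[OF sums_summable[OF this], of "{k}"] sums_unique[OF this]
    show ?thesis by (simp add: field_simps)
   qed
   hence "\<bar>z\<bar> ^ k <= fact k * exp \<bar>z\<bar>" by (simp add: field_simps)
   hence "\<bar>z\<bar> ^ k * exp (c * \<bar>z\<bar>) <= (fact k * exp \<bar>z\<bar>) * exp (\<bar>c\<bar> * \<bar>z\<bar>)"
    by (intro mult_mono) (auto intro: mult_right_mono)
   also have "... = fact k * exp (?a * \<bar>z\<bar>)" by (simp add: algebra_simps flip: exp_add)
   also have "exp (?a * \<bar>z\<bar>) <= exp (?a * z) + exp (- ?a * z)"
   proof -
    have "exp (?a * \<bar>z\<bar>) = exp (?a * z) \<or> exp (?a * \<bar>z\<bar>) = exp (- ?a * z)"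
     by (cases "0 <= z") (auto simp: algebra_simps)
    moreover have "exp (?a * z) > 0" "exp (- ?a * z) > 0" by (rule exp_gt_zero)+
    ultimately show ?thesis by linarith
   qed
   finally show ?thesis by simp
  qed
  from mult_left_mono[OF this normal_density_nonneg]
  show "AE z in lborel. norm (std_normal_density z * (\<bar>z\<bar> ^ k * exp (c * \<bar>z\<bar>)))
    <= norm (fact k * (std_normal_density z * exp (?a * z) + std_normal_density z * exp (- ?a * z)))"
   by (auto simp: abs_mult algebra_simps intro!: AE_I2)
 qed
qed

text \<open>After rescaling by s, the exponential factor is dominated by its value at s = S, so one
  constant serves all times up to a fixed horizon.\<close>

lemma normal_exp_moment_bound:
 assumes "0 <= c"
 obtains C where "C > 0"
  "!!s. 0 < s ==> s <= S ==> integrable lborel (\<lambda>z. normal_density 0 s z * (\<bar>z\<bar> ^ k * exp (c * \<bar>z\<bar>)))"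
  "!!s. 0 < s ==> s <= S ==> (LINT z|lborel. normal_density 0 s z * (\<bar>z\<bar> ^ k * exp (c * \<bar>z\<bar>))) <= C * s ^ k"
proof -
 define I where "I = (LINT z|lborel. std_normal_density z * (\<bar>z\<bar> ^ k * exp (c * S * \<bar>z\<bar>)))"
 have I: "I \<ge> 0" unfolding I_def by (intro integral_nonneg_AE) auto
 have sub: "normal_density 0 s (0 + s * z) = std_normal_density z / s" if "0 < s" for s z
  using that by (simp add: normal_density_def power_mult_distrib real_sqrt_mult)
 have key: "integrable lborel (\<lambda>z. normal_density 0 s z * (\<bar>z\<bar> ^ k * exp (c * \<bar>z\<bar>)))
   \<and> (LINT z|lborel. normal_density 0 s z * (\<bar>z\<bar> ^ k * exp (c * \<bar>z\<bar>))) <= (I + 1) * s ^ k"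
  if s: "0 < s" "s <= S" for s
 proof -
  let ?f = "\<lambda>z. normal_density 0 s z * (\<bar>z\<bar> ^ k * exp (c * \<bar>z\<bar>))"
  have f: "?f (0 + s * z) = s ^ k / s * (std_normal_density z * (\<bar>z\<bar> ^ k * exp (c * s * \<bar>z\<bar>)))" for z
   unfolding sub[OF s(1)] using s by (simp add: abs_mult power_mult_distrib mult_ac)
  have i: "integrable lborel (\<lambda>z. ?f (0 + s * z))"
   unfolding f by (intro integrable_mult_right std_normal_exp_moments)
  have int: "integrable lborel ?f"
   using lborel_integrable_real_affine_iff[of s ?f 0] i s by auto
  have "(LINT z|lborel. ?f z) = s * (LINT z|lborel. ?f (0 + s * z))"
   using lborel_integral_real_affine[of s ?f 0] s by simp
  also have "... = s ^ k * (LINT z|lborel. std_normal_density z * (\<bar>z\<bar> ^ k * exp (c * s * \<bar>z\<bar>)))"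
   unfolding f using s by simp
  also have "... <= s ^ k * I"
   unfolding I_def
   by (intro mult_left_mono integral_mono std_normal_exp_moments)
     (use s assms in \<open>auto intro!: mult_left_mono mult_right_mono\<close>)
  also have "... <= (I + 1) * s ^ k" using s by (simp add: algebra_simps)
  finally show ?thesis using int by blast
 qed
 show ?thesis by (rule that[of "I + 1"]) (use I key in auto)
qed

text \<open>Only right derivatives are available, because an expectation is differentiated by adding
  a future increment. The function stays below each line of small positive slope through its
  starting point: at the last time where this holds, the right derivative lets it hold a little
  longer.\<close>

lemma right_derivative_zero_imp_le:
 fixes f :: "real => real"
 assumes ab: "a <= b" and cont: "continuous_on {a..b} f"
  and der: "!!t. a <= t ==> t < b ==> ((\<lambda>e. (f (t + e) - f t) / e) \<longlongrightarrow> 0) (at_right 0)"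
 shows "f b <= f a"
proof (rule field_le_epsilon)
 fix d :: real assume d: "0 < d"
 define ep where "ep = d / (b - a + 1)"
 have ep: "0 < ep" "ep * (b - a) <= d" using d ab by (auto simp: ep_def field_simps)
 let ?S = "{t \<in> {a..b}. f t <= f a + ep * (t - a)}"
 have "closed ?S" by (intro continuous_on_closed_Collect_le continuous_intros cont)
 hence "compact ({a..b} \<inter> ?S)" by (rule compact_Int_closed[OF compact_Icc])
 moreover have "a \<in> {a..b} \<inter> ?S" using ab by simp
 ultimately obtain s where s: "s \<in> ?S" "!!t. t \<in> ?S ==> t <= s" using compact_attains_sup[of "{a..b} \<inter> ?S"] by blast
 have "s = b"
 proof (rule ccontr)
  assume "s ~= b"
  hence sb: "a <= s" "s < b" using s(1) by auto
  have "\<forall>\<^sub>F e in at_right 0. (f (s + e) - f s) / e < ep" by (rule order_tendstoD(2)[OF der[OF sb] ep(1)])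
  then obtain c where c: "0 < c" "!!e. 0 < e ==> e < c ==> (f (s + e) - f s) / e < ep"
   unfolding eventually_at_right_field by auto
  define e where "e = min (c / 2) (b - s)"
  have e: "0 < e" "e < c" "s + e <= b" using c sb by (auto simp: e_def)
  have "f (s + e) <= f s + ep * e" using c(2)[OF e(1,2)] e(1) by (simp add: field_simps)
  hence "s + e \<in> ?S" using s(1) e by (simp add: algebra_simps)
  thus False using s(2) e(1) by force
 qed
 thus "f b <= f a + d" using s(1) ep(2) by simp
qed

lemma right_derivative_zero_imp_const:
 fixes f :: "real => real"
 assumes ab: "a <= b" and cont: "continuous_on {a..b} f"
  and der: "!!t. a <= t ==> t < b ==> ((\<lambda>e. (f (t + e) - f t) / e) \<longlongrightarrow> 0) (at_right 0)"
 shows "f b = f a"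
proof (rule antisym)
 have "((\<lambda>e. (- f (t + e) - - f t) / e) \<longlongrightarrow> 0) (at_right 0)" if "a <= t" "t < b" for t
  using tendsto_minus[OF der[OF that]] by (simp add: minus_divide_left)
 from right_derivative_zero_imp_le[of _ _ "\<lambda>t. - f t", OF ab continuous_on_minus[OF cont] this] show "f a <= f b" by simp
qed (rule right_derivative_zero_imp_le[OF assms])

section \<open>Brownian paths and independent increments\<close>

context prob_space begin

lemma BM_measurable: "standard_BM B ==> 0 <= t ==> B t \<in> bm M"
 and BM_zero: "standard_BM B ==> w \<in> space M ==> B 0 w = 0"
 and BM_continuous: "standard_BM B ==> w \<in> space M ==> continuous_on {0..} (\<lambda>t. B t w)"
 and BM_increment: "standard_BM B ==> 0 <= s ==> s < t ==>
   distributed M lborel (\<lambda>w. B t w - B s w) (normal_density 0 (sqrt (t - s)))"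
 and BM_indep: "standard_BM B ==> 0 <= rh 0 ==> mono rh ==>
   indep_vars (\<lambda>_. borel) (\<lambda>i w. B (rh (Suc i)) w - B (rh i) w) {..<(n::nat)}"
 unfolding standard_BM_def by blast+

definition past :: "(real => 'a => real) => real => 'a measure" where
 "past B t = sigma (space M) {B s -` S \<inter> space M | s S. 0 <= s \<and> s <= t \<and> S \<in> sets borel}"

lemma space_past [simp]: "space (past B t) = space M"
 unfolding past_def by (rule space_measure_of) auto

lemma sets_past: "sets (past B t) = sigma_sets (space M) {B s -` S \<inter> space M | s S. 0 <= s \<and> s <= t \<and> S \<in> sets borel}"
 unfolding past_def by (rule sets_measure_of) auto

lemma measurable_past: "0 <= s ==> s <= t ==> B s \<in> bm (past B t)"
 by (rule measurableI) (auto simp: sets_past intro!: sigma_sets.Basic)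

lemma subalgebra_past: "standard_BM B ==> subalgebra M (past B t)"
 unfolding subalgebra_def sets_past
 by (auto intro!: sets.sigma_sets_subset measurable_sets[OF BM_measurable])

lemma sets_past_mono: "s <= t ==> sets (past B s) \<subseteq> sets (past B t)"
 unfolding sets_past by (rule sigma_sets_mono') force

lemma past_mono:
 assumes "s <= t" "f \<in> bm (past B s)" shows "f \<in> bm (past B t)"
 using assms(2) sets_past_mono[OF assms(1), of B] by (auto simp: measurable_def)

lemma sorted_index_mono:
 assumes "sorted xs" "last xs <= u" "xs ~= []"
 shows "mono (\<lambda>i. if i < length xs then xs ! i else (u::real))"
proof (rule monoI)
 fix i j :: nat assume "i <= j"
 have "xs ! i <= u" if "i < length xs" for i
 proof -
  have "xs ! i <= xs ! (length xs - 1)" using that assms(1) by (intro sorted_nth_mono) auto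
  with assms show ?thesis by (simp add: last_conv_nth)
 qed
 with \<open>i <= j\<close> show "(if i < length xs then xs ! i else u) <= (if j < length xs then xs ! j else u)"
  using assms(1) by (auto intro: sorted_nth_mono)
qed

text \<open>The axioms give independence of finitely many successive increments. Cylinder events of
  the past are events of the increments along a finite grid, and they form an intersection-stable
  generator, so independence extends to the whole past.\<close>

lemma indep_past_increment:
 assumes BM: "standard_BM B" and t: "0 <= t" "0 < e"
 shows "indep_set (sets (past B t)) (sets (vimage_algebra (space M) (\<lambda>w. B (t + e) w - B t w) borel))"
proof -
 let ?D = "\<lambda>w. B (t + e) w - B t w"
 define \<A> where "\<A> = {{w \<in> space M. \<forall>s\<in>R. B s w \<in> S s} | R S. finite R \<and> R \<subseteq> {0..t} \<and> (\<forall>s\<in>R. S s \<in> sets borel)}"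
 define \<D> where "\<D> = {?D -` S \<inter> space M | S. S \<in> sets borel}"
 have Dm: "?D \<in> bm M" using BM_measurable[OF BM] t by (intro borel_measurable_diff) auto
 have AM: "\<A> \<subseteq> sets M" unfolding \<A>_def
 proof safe
  fix R :: "real set" and S :: "real => real set"
  assume R: "finite R" "R \<subseteq> {0..t}" "\<forall>s\<in>R. S s \<in> sets borel"
  show "{w \<in> space M. \<forall>s\<in>R. B s w \<in> S s} \<in> sets M"
  proof (rule sets.sets_Collect_finite_All[OF _ R(1)])
   fix s assume "s \<in> R"
   hence "B s -` S s \<inter> space M \<in> sets M"
    using R by (intro measurable_sets[OF BM_measurable[OF BM]]) auto
   thus "{w \<in> space M. B s w \<in> S s} \<in> sets M" by (simp add: vimage_def Int_def conj_commute)
  qed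
 qed
 have Aint: "Int_stable \<A>"
 proof (rule Int_stableI)
  fix a a' assume "a \<in> \<A>" "a' \<in> \<A>"
  then obtain R S R' S' where a: "a = {w \<in> space M. \<forall>s\<in>R. B s w \<in> S s}" "finite R" "R \<subseteq> {0..t}" "\<forall>s\<in>R. S s \<in> sets borel"
   and a': "a' = {w \<in> space M. \<forall>s\<in>R'. B s w \<in> S' s}" "finite R'" "R' \<subseteq> {0..t}" "\<forall>s\<in>R'. S' s \<in> sets borel"
   unfolding \<A>_def by blast
  let ?S = "\<lambda>s. (if s \<in> R then S s else UNIV) \<inter> (if s \<in> R' then S' s else UNIV)"
  have "a \<inter> a' = {w \<in> space M. \<forall>s\<in>R \<union> R'. B s w \<in> ?S s}" unfolding a(1) a'(1) by auto
  moreover have "finite (R \<union> R')" "R \<union> R' \<subseteq> {0..t}" using a(2,3) a'(2,3) by simp_all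
  moreover have "\<forall>s\<in>R \<union> R'. ?S s \<in> sets borel" using a(4) a'(4) by simp
  ultimately show "a \<inter> a' \<in> \<A>" unfolding \<A>_def
   by (intro CollectI exI[of _ "R \<union> R'"] exI[of _ ?S] conjI)
 qed
 have Dint: "Int_stable \<D>"
 proof (rule Int_stableI)
  fix a a' assume "a \<in> \<D>" "a' \<in> \<D>"
  then obtain S S' where "a = ?D -` S \<inter> space M" "a' = ?D -` S' \<inter> space M" "S \<in> sets borel" "S' \<in> sets borel"
   unfolding \<D>_def by blast
  hence "a \<inter> a' = ?D -` (S \<inter> S') \<inter> space M" "S \<inter> S' \<in> sets borel" by auto
  thus "a \<inter> a' \<in> \<D>" unfolding \<D>_def by blast
 qed
 have ind: "indep_set \<A> \<D>"
 proof (rule indep_setI)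
  show "\<A> \<subseteq> events" by (rule AM)
  show "\<D> \<subseteq> events" unfolding \<D>_def using measurable_sets[OF Dm] by auto
  fix a d assume "a \<in> \<A>" "d \<in> \<D>"
  then obtain R S where a: "a = {w \<in> space M. \<forall>s\<in>R. B s w \<in> S s}" and R: "finite R" "R \<subseteq> {0..t}" "\<forall>s\<in>R. S s \<in> sets borel"
   unfolding \<A>_def by blast
  obtain S' where d: "d = ?D -` S' \<inter> space M" "S' \<in> sets borel" using \<open>d \<in> \<D>\<close> unfolding \<D>_def by blast
  \<comment> \<open>With 0 in the grid, increments sum to path values because
    \<open>B 0 = 0\<close>; with t in the grid, the one further increment is exactly the one from t
    to t + e.\<close>
  define xs where "xs = sorted_list_of_set (insert 0 (insert t R))"
  have xs: "set xs = insert 0 (insert t R)" "sorted xs"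
   unfolding xs_def using R(1) by (simp_all only: set_sorted_list_of_set finite_insert sorted_sorted_list_of_set)
  hence xs: "set xs = insert 0 (insert t R)" "sorted xs" "xs ~= []" by auto
  have lst: "last xs = t"
  proof (rule antisym)
   show "last xs <= t" using last_in_set[OF xs(3)] xs(1) R(2) t by auto
   have "t \<in> set xs" using xs(1) by simp
   then obtain i where i: "i < length xs" "xs ! i = t" by (auto simp: in_set_conv_nth)
   have "xs ! i <= xs ! (length xs - 1)" using i xs(2) by (intro sorted_nth_mono) auto
   thus "t <= last xs" using i xs(3) by (simp add: last_conv_nth)
  qed
  have hd0: "xs ! 0 = 0"
  proof (rule antisym)
   have "0 \<in> set xs" using xs(1) by simp
   then obtain i where i: "i < length xs" "xs ! i = 0" by (auto simp: in_set_conv_nth)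
   thus "xs ! 0 <= 0" using sorted_nth_mono[OF xs(2), of 0 i] by auto
   have "xs ! 0 \<in> set xs" using xs(3) by simp
   thus "0 <= xs ! 0" unfolding xs(1) using R(2) t by auto
  qed
  define n where "n = length xs - 1"
  have ln: "length xs = Suc n" using xs(3) by (simp add: n_def)
  define rh where "rh = (\<lambda>i. if i < length xs then xs ! i else t + e)"
  have rhmono: "mono rh" unfolding rh_def by (rule sorted_index_mono) (use xs lst t in auto)
  have rh0: "rh 0 = 0" using ln hd0 by (simp add: rh_def)
  have rhn: "rh n = t" "rh (Suc n) = t + e" using ln lst xs(3) by (auto simp: rh_def last_conv_nth)
  let ?Y = "\<lambda>i w. B (rh (Suc i)) w - B (rh i) w"
  have iv: "indep_vars (\<lambda>_. borel) ?Y {..<Suc n}" using BM_indep[OF BM _ rhmono] rh0 by simp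
  have iv2: "indep_var (PiM {..<n} (\<lambda>_. borel)) (\<lambda>w. restrict (\<lambda>i. ?Y i w) {..<n})
    (PiM {n} (\<lambda>_. borel)) (\<lambda>w. restrict (\<lambda>i. ?Y i w) {n})"
   by (rule indep_var_restrict[OF iv]) auto
  define E where "E = {f \<in> space (PiM {..<n} (\<lambda>_. borel :: real measure)). \<forall>s\<in>R. \<forall>k\<le>n. rh k = s --> (\<Sum>i<k. f i) \<in> S s}"
  define E' where "E' = {f \<in> space (PiM {n} (\<lambda>_. borel :: real measure)). f n \<in> S'}"
  have Em: "E \<in> sets (PiM {..<n} (\<lambda>_. borel))" unfolding E_def
  proof (intro sets.sets_Collect_finite_All[OF _ R(1)])
   fix s assume s: "s \<in> R"
   have "{f \<in> space (PiM {..<n} (\<lambda>_. borel :: real measure)). rh k = s --> (\<Sum>i<k. f i) \<in> S s} \<in> sets (PiM {..<n} (\<lambda>_. borel))"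
    if k: "k \<in> {..n}" for k
   proof (cases "rh k = s")
    case True
    have "(\<lambda>f. \<Sum>i<k. f i) \<in> bm (PiM {..<n} (\<lambda>_. borel :: real measure))"
     by (intro borel_measurable_sum measurable_component_singleton) (use k in auto)
    moreover have "S s \<in> sets borel" using R s by blast
    ultimately have "(\<lambda>f. \<Sum>i<k. f i) -` S s \<inter> space (PiM {..<n} (\<lambda>_. borel :: real measure)) \<in> sets (PiM {..<n} (\<lambda>_. borel))"
     by (rule measurable_sets)
    moreover have "{f \<in> space (PiM {..<n} (\<lambda>_. borel :: real measure)). rh k = s --> (\<Sum>i<k. f i) \<in> S s}
      = (\<lambda>f. \<Sum>i<k. f i) -` S s \<inter> space (PiM {..<n} (\<lambda>_. borel :: real measure))" using True by blast
    ultimately show ?thesis by (simp only:)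
   qed simp
   hence "{f \<in> space (PiM {..<n} (\<lambda>_. borel :: real measure)). \<forall>k\<in>{..n}. rh k = s --> (\<Sum>i<k. f i) \<in> S s} \<in> sets (PiM {..<n} (\<lambda>_. borel))"
    by (rule sets.sets_Collect_finite_All) simp_all
   thus "{f \<in> space (PiM {..<n} (\<lambda>_. borel :: real measure)). \<forall>k\<le>n. rh k = s --> (\<Sum>i<k. f i) \<in> S s} \<in> sets (PiM {..<n} (\<lambda>_. borel))"
    by (simp only: Ball_def atMost_iff)
  qed
  have E'm: "E' \<in> sets (PiM {n} (\<lambda>_. borel))"
  proof -
   have "(\<lambda>f. f n) \<in> bm (PiM {n} (\<lambda>_. borel :: real measure))" by simp
   moreover have "E' = (\<lambda>f. f n) -` S' \<inter> space (PiM {n} (\<lambda>_. borel :: real measure))" unfolding E'_def by blast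
   ultimately show ?thesis using d(2) measurable_sets by metis
  qed
  have tel: "(\<Sum>i<k. ?Y i w) = B (rh k) w" if "w \<in> space M" for k w
   using sum_lessThan_telescope[of "\<lambda>i. B (rh i) w" k] BM_zero[OF BM that] rh0 by simp
  have memE: "restrict (\<lambda>i. ?Y i w) {..<n} \<in> E \<longleftrightarrow> (\<forall>s\<in>R. B s w \<in> S s)" if wt: "w \<in> space M" for w
  proof -
   have sm: "(\<Sum>i<k. restrict (\<lambda>i. ?Y i w) {..<n} i) = B (rh k) w" if "k <= n" for k
    using that by (subst tel[OF wt, symmetric]) (intro sum.cong, auto)
   have ex: "\<exists>k\<le>n. rh k = s" if "s \<in> R" for s
   proof -
    have "s \<in> set xs" using xs(1) that by simp
    then obtain i where "i < length xs" "xs ! i = s" by (auto simp: in_set_conv_nth)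
    thus ?thesis using ln by (intro exI[of _ i]) (auto simp: rh_def)
   qed
   have "restrict (\<lambda>i. ?Y i w) {..<n} \<in> E \<longleftrightarrow> (\<forall>s\<in>R. \<forall>k\<le>n. rh k = s --> B (rh k) w \<in> S s)"
    unfolding E_def using sm by (auto simp: space_PiM)
   thus ?thesis using ex by auto
  qed
  have eqE: "(\<lambda>w. restrict (\<lambda>i. ?Y i w) {..<n}) -` E \<inter> space M = a"
   unfolding a using memE by auto
  have eqE': "(\<lambda>w. restrict (\<lambda>i. ?Y i w) {n}) -` E' \<inter> space M = d"
   unfolding d E'_def by (auto simp: space_PiM rhn)
  have "(\<lambda>w. (restrict (\<lambda>i. ?Y i w) {..<n}, restrict (\<lambda>i. ?Y i w) {n})) -` (E \<times> E') \<inter> space M = a \<inter> d"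
   unfolding eqE[symmetric] eqE'[symmetric] by auto
  with indep_varD[OF iv2 Em E'm] show "prob (a \<inter> d) = prob a * prob d"
   unfolding eqE eqE' by simp
 qed
 have "indep_set (sigma_sets (space M) \<A>) (sigma_sets (space M) \<D>)"
  by (rule indep_set_sigma_sets[OF ind Aint Dint])
 moreover have "sigma_sets (space M) \<D> = sets (vimage_algebra (space M) ?D borel)"
  unfolding \<D>_def sets_vimage_algebra ..
 moreover have "sets (past B t) \<subseteq> sigma_sets (space M) \<A>"
  unfolding sets_past
 proof (rule sigma_sets_mono', safe)
  fix s S assume "0 <= s" "s <= t" "S \<in> sets (borel :: real measure)"
  thus "B s -` S \<inter> space M \<in> \<A>" unfolding \<A>_def
   by (intro CollectI exI[of _ "{s}"] exI[of _ "\<lambda>_. S"]) auto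
 qed
 ultimately show ?thesis unfolding indep_set_def
  by (elim indep_sets_mono_sets) (auto split: bool.split)
qed

lemma increment_integral:
 assumes BM: "standard_BM B" and t: "0 <= t" "0 < e"
  and f: "f \<in> bm (past B t)" "integrable M f"
  and ph: "ph \<in> bm borel" "integrable lborel (\<lambda>z. normal_density 0 (sqrt e) z * ph z)"
 shows "integrable M (\<lambda>w. f w * ph (B (t + e) w - B t w))"
  "expectation (\<lambda>w. f w * ph (B (t + e) w - B t w)) = expectation f * (LINT z|lborel. normal_density 0 (sqrt e) z * ph z)"
proof -
 let ?D = "\<lambda>w. B (t + e) w - B t w"
 let ?V = "vimage_algebra (space M) ?D borel"
 have Dm: "?D \<in> bm M" using BM_measurable[OF BM] t by (intro borel_measurable_diff) auto
 have V: "subalgebra M ?V" unfolding subalgebra_def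
  using sets_image_in_sets[OF _ Dm] by simp
 have dist: "distributed M lborel ?D (normal_density 0 (sqrt e))"
  using BM_increment[OF BM t(1), of "t + e"] t by simp
 have "?D \<in> measurable ?V borel" by (rule measurable_vimage_algebra1) auto
 hence m: "(\<lambda>w. ph (?D w)) \<in> bm ?V" using ph(1) by (rule measurable_compose)
 have i: "integrable M (\<lambda>w. ph (?D w))"
  using distributed_integrable[OF dist, of ph] ph by simp
 have I: "expectation (\<lambda>w. ph (?D w)) = (LINT z|lborel. normal_density 0 (sqrt e) z * ph z)"
  using distributed_integral[OF dist, of ph] ph by simp
 note R = indep_set_integral_mult[OF subalgebra_past[OF BM] V indep_past_increment[OF BM t] f m i]
 from R show "integrable M (\<lambda>w. f w * ph (?D w))"
  "expectation (\<lambda>w. f w * ph (?D w)) = expectation f * (LINT z|lborel. normal_density 0 (sqrt e) z * ph z)"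
  unfolding I by blast+
qed

end

section \<open>The Feynman-Kac formula\<close>

lemma floquet_continuous: "floquet l r H H' ==> continuous_on UNIV H" "floquet l r H H' ==> continuous_on UNIV H'"
 by (rule DERIV_continuous_on, erule floquetD)+

lemma abs_le_imp_norm_le: "\<bar>a\<bar> <= (b::real) ==> norm a <= norm b"
 by simp

lemma exp_diff_le:
 fixes u v c :: real
 assumes "u <= c" "v <= c" shows "\<bar>exp u - exp v\<bar> <= exp c * \<bar>u - v\<bar>"
proof -
 have "norm (exp u - exp v) <= exp c * norm (u - v)"
  by (rule field_differentiable_bound[of "{..c}" exp exp])
    (use assms in \<open>auto intro: has_field_derivative_at_within\<close>)
 thus ?thesis by simp
qed

context prob_space begin

lemma BM_path_borel:
 assumes BM: "standard_BM B" and f: "continuous_on UNIV (f :: real => real)" and t: "0 <= t"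
 shows "(\<lambda>w. f (x + B t w)) \<in> bm (past B t)" "(\<lambda>w. f (x + B t w)) \<in> bm M"
proof -
 have [measurable]: "f \<in> bm borel" "B t \<in> bm (past B t)" "B t \<in> bm M"
  using borel_measurable_continuous_onI[OF f] measurable_past t BM_measurable[OF BM t] by auto
 show "(\<lambda>w. f (x + B t w)) \<in> bm (past B t)" "(\<lambda>w. f (x + B t w)) \<in> bm M"
  by measurable
qed

lemma floquet_moment:
 assumes BM: "standard_BM B" and fl: "floquet l r H H'" and r: "per_lip r"
 obtains C where "C > 0" "!!t. 0 <= t ==> t <= b ==> integrable M (\<lambda>w. H (x + B t w))"
  "!!t. 0 <= t ==> t <= b ==> expectation (\<lambda>w. H (x + B t w)) <= C"
proof -
 obtain c where c: "c > 0" "!!y z. H (y + z) <= H y * exp (c * \<bar>z\<bar>)"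
  by (rule floquet_bounds[OF fl r r]) (rule that; assumption)
 show thesis
 proof (cases rule: normal_exp_moment_bound[OF less_imp_le[OF c(1)], where S = "sqrt b" and k = 0])
 case C: (1 C)
 note pos = floquetD(1)[OF fl]
 have [measurable]: "H \<in> bm borel"
  using floquet_continuous(1)[OF fl] by (rule borel_measurable_continuous_onI)
 define C' where "C' = H x * C + H x"
 have key: "integrable M (\<lambda>w. H (x + B t w)) \<and> expectation (\<lambda>w. H (x + B t w)) <= C'"
  if t: "0 <= t" "t <= b" for t
 proof (cases "t = 0")
  case True
  have e: "H (x + B t w) = H x" if "w \<in> space M" for w using True BM_zero[OF BM that] by simp
  have "integrable M (\<lambda>w. H (x + B t w)) \<longleftrightarrow> integrable M (\<lambda>w. H x)"
   by (rule Bochner_Integration.integrable_cong) (auto simp: e)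
  moreover have "expectation (\<lambda>w. H (x + B t w)) = expectation (\<lambda>w. H x)"
   by (rule Bochner_Integration.integral_cong) (auto simp: e)
  ultimately show ?thesis using pos[of x] C(1) by (simp add: C'_def prob_space)
 next
  case False
  hence t0: "0 < t" using t by simp
  let ?n = "normal_density 0 (sqrt t)"
  have i: "integrable lborel (\<lambda>z. ?n z * (exp (c * \<bar>z\<bar>)))" "(LINT z|lborel. ?n z * exp (c * \<bar>z\<bar>)) <= C"
   using C(2,3)[of "sqrt t"] t t0 by auto
  have i2: "integrable lborel (\<lambda>z. H x * (?n z * (exp (c * \<bar>z\<bar>))))" using i(1) by simp
  have le: "?n z * H (x + z) <= H x * (?n z * exp (c * \<bar>z\<bar>))" for z
   using mult_left_mono[OF c(2)[of x z], of "?n z"] by (simp add: mult_ac)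
  have i3: "integrable lborel (\<lambda>z. ?n z * H (x + z))"
  proof (rule Bochner_Integration.integrable_bound[OF i2])
   show "AE z in lborel. norm (?n z * H (x + z)) <= norm (H x * (?n z * exp (c * \<bar>z\<bar>)))"
    using le pos by (intro AE_I2) (simp add: abs_mult less_imp_le abs_of_pos)
  qed measurable
  have e: "H (x + (B (0 + t) w - B 0 w)) = H (x + B t w)" if "w \<in> space M" for w
   using BM_zero[OF BM that] by simp
  have R: "integrable M (\<lambda>w. 1 * H (x + (B (0 + t) w - B 0 w)))"
    "expectation (\<lambda>w. 1 * H (x + (B (0 + t) w - B 0 w))) = expectation (\<lambda>_. 1) * (LINT z|lborel. ?n z * H (x + z))"
   by (rule increment_integral[OF BM _ t0, where f="\<lambda>_. 1" and ph="\<lambda>z. H (x + z)"]; use i3 in simp)+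
  have "integrable M (\<lambda>w. H (x + B t w))"
   using R(1) Bochner_Integration.integrable_cong[OF refl, of M "\<lambda>w. 1 * H (x + (B (0 + t) w - B 0 w))" "\<lambda>w. H (x + B t w)"] e
   by simp
  moreover have "expectation (\<lambda>w. H (x + B t w)) = (LINT z|lborel. ?n z * H (x + z))"
   using R(2) Bochner_Integration.integral_cong[OF refl, of M "\<lambda>w. 1 * H (x + (B (0 + t) w - B 0 w))" "\<lambda>w. H (x + B t w)"] e
   by (simp add: prob_space)
  moreover have "(LINT z|lborel. ?n z * H (x + z)) <= (LINT z|lborel. H x * (?n z * exp (c * \<bar>z\<bar>)))"
   by (rule integral_mono[OF i3 i2 le])
  moreover have "... <= C'" using mult_left_mono[OF i(2) less_imp_le[OF pos[of x]]] pos[of x]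
   unfolding C'_def integral_mult_right_zero by linarith
  ultimately show ?thesis by simp
 qed
 show thesis by (rule that[of C']) (use key pos[of x] C(1) in \<open>auto simp: C'_def add_pos_pos\<close>)
qed
 qed

lemma floquet_increment:
 assumes BM: "standard_BM B" and fl: "floquet l r H H'" and r: "per_lip r" and p: "per_lip p"
 obtains C where "C > 0"
  "!!t e. 0 <= t ==> 0 < e ==> t + e <= b ==>
   integrable M (\<lambda>w. \<bar>p (x + B (t + e) w) * H (x + B (t + e) w) - p (x + B t w) * H (x + B t w)\<bar>)"
  "!!t e. 0 <= t ==> 0 < e ==> t + e <= b ==>
   expectation (\<lambda>w. \<bar>p (x + B (t + e) w) * H (x + B (t + e) w) - p (x + B t w) * H (x + B t w)\<bar>) <= C * sqrt e"
proof -
 note pos = floquetD(1)[OF fl]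
 obtain c where c: "c > 0" "!!y z. \<bar>p (y + z) * H (y + z) - p y * H y\<bar> <= c * H y * (\<bar>z\<bar> * exp (c * \<bar>z\<bar>))"
  by (rule floquet_bounds[OF fl r p]) (rule that; assumption)
 show thesis
 proof (cases rule: normal_exp_moment_bound[OF less_imp_le[OF c(1)], where S = "sqrt b" and k = 1])
 case C1: (1 C1)
 show thesis
 proof (cases rule: floquet_moment[OF BM fl r, where b = b and x = x])
 case C2: (1 C2)
 note mH = floquet_continuous(1)[OF fl]
 have mpH: "continuous_on UNIV (\<lambda>y. p y * H y)" by (intro continuous_intros mH per_lip_continuous[OF p])
 have key: "integrable M (\<lambda>w. \<bar>p (x + B (t + e) w) * H (x + B (t + e) w) - p (x + B t w) * H (x + B t w)\<bar>)
   \<and> expectation (\<lambda>w. \<bar>p (x + B (t + e) w) * H (x + B (t + e) w) - p (x + B t w) * H (x + B t w)\<bar>) <= (c * C2 * C1) * sqrt e"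
  if t: "0 <= t" "0 < e" "t + e <= b" for t e
 proof -
  let ?ph = "\<lambda>z. \<bar>z\<bar> * exp (c * \<bar>z\<bar>)"
  let ?F = "\<lambda>w. \<bar>p (x + B (t + e) w) * H (x + B (t + e) w) - p (x + B t w) * H (x + B t w)\<bar>"
  let ?G = "\<lambda>w. c * (H (x + B t w) * ?ph (B (t + e) w - B t w))"
  have i: "integrable lborel (\<lambda>z. normal_density 0 (sqrt e) z * ?ph z)"
   "(LINT z|lborel. normal_density 0 (sqrt e) z * ?ph z) <= C1 * sqrt e"
   using C1(2,3)[of "sqrt e"] t by auto
  have h: "integrable M (\<lambda>w. H (x + B t w))" "expectation (\<lambda>w. H (x + B t w)) <= C2" using C2(2,3)[of t] t by auto
  note R = increment_integral[OF BM t(1,2) BM_path_borel(1)[OF BM mH t(1), of x] h(1) _ i(1)]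
  have iG: "integrable M ?G" using R(1) by simp
  have le: "?F w <= ?G w" for w
   using c(2)[of "x + B t w" "B (t + e) w - B t w"] by (simp add: mult_ac)
  have Fm: "?F \<in> bm M"
   using BM_path_borel(2)[OF BM mpH, of "t + e" x] BM_path_borel(2)[OF BM mpH, of t x] t by simp
  have iF: "integrable M ?F"
  proof (rule Bochner_Integration.integrable_bound[OF iG Fm])
   show "AE w in M. norm (?F w) <= norm (?G w)"
    by (rule AE_I2, rule abs_le_imp_norm_le) (use le in simp)
  qed
  have "expectation ?F <= expectation ?G" by (rule integral_mono[OF iF iG le])
  also have "... = c * (expectation (\<lambda>w. H (x + B t w)) * (LINT z|lborel. normal_density 0 (sqrt e) z * ?ph z))"
   using R(2) by simp
  also have "... <= c * (C2 * (C1 * sqrt e))"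
   by (intro mult_left_mono mult_mono h i) (use c C1 C2 t pos in \<open>auto intro!: integral_nonneg_AE simp: less_imp_le\<close>)
  finally show ?thesis using iF by (simp add: mult_ac)
 qed
 show thesis by (rule that[of "c * C2 * C1"]) (use key c C1 C2 in auto)
qed
 qed
 qed

text \<open>Given the past, the increment has mean 0 and variance e: the first-order term disappears
  and \<open>r H z^2\<close> turns into e r H, the generator. The remainder is of order e^(3/2),
  uniformly over past-measurable weights bounded by K.\<close>

lemma floquet_taylor:
 assumes BM: "standard_BM B" and fl: "floquet l r H H'" and r: "per_lip r"
 obtains C where "C > 0"
  "!!t e f K. 0 <= t ==> 0 < e ==> t + e <= b ==> f \<in> bm (past B t) ==> \<forall>w\<in>space M. \<bar>f w\<bar> <= K ==>
   \<bar>expectation (\<lambda>w. f w * (H (x + B (t + e) w) - H (x + B t w) - e * (r (x + B t w) * H (x + B t w))))\<bar> <= K * C * (e * sqrt e)"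
proof -
 note pos = floquetD(1)[OF fl]
 obtain c where c: "c > 0"
  "!!y z. \<bar>H (y + z) - H y - H' y * z - r y * H y * z^2\<bar> <= c * H y * (\<bar>z\<bar> ^ 3 * exp (c * \<bar>z\<bar>))"
  "!!y. \<bar>H' y\<bar> <= c * H y"
  by (rule floquet_bounds[OF fl r r]) (rule that; assumption)
 show thesis
 proof (cases rule: normal_exp_moment_bound[OF less_imp_le[OF c(1)], where S = "sqrt b" and k = 3])
 case C1: (1 C1)
 show thesis
 proof (cases rule: floquet_moment[OF BM fl r, where b = b and x = x])
 case C2: (1 C2)
 obtain P where P: "P > 0" "!!y. \<bar>r y\<bar> <= P" using per_lip_bounded[OF r] by blast
 note cH = floquet_continuous(1)[OF fl] and cH' = floquet_continuous(2)[OF fl]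
 have crH: "continuous_on UNIV (\<lambda>y. r y * H y)" by (intro continuous_intros cH per_lip_continuous[OF r])
 have key: "\<bar>expectation (\<lambda>w. f w * (H (x + B (t + e) w) - H (x + B t w) - e * (r (x + B t w) * H (x + B t w))))\<bar> <= K * (c * C2 * C1) * (e * sqrt e)"
  if t: "0 <= t" "0 < e" "t + e <= b" and f: "f \<in> bm (past B t)" "!!w. w \<in> space M ==> \<bar>f w\<bar> <= K" for t e f K
 proof -
  let ?D = "\<lambda>w. B (t + e) w - B t w"
  let ?X = "\<lambda>w. x + B t w"
  let ?n = "normal_density 0 (sqrt e)"
  obtain w0 where "w0 \<in> space M" using not_empty by blast
  hence K0: "0 <= K" using f(2) by (meson abs_ge_zero order_trans)
  have h: "integrable M (\<lambda>w. H (?X w))" "expectation (\<lambda>w. H (?X w)) <= C2" using C2(2,3)[of t] t by auto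
  have fM: "f \<in> bm M" using f(1) subalgebra_past[OF BM, of t]
   by (meson measurable_from_subalg)
  note mH = BM_path_borel[OF BM cH t(1), of x] and mH' = BM_path_borel[OF BM cH' t(1), of x]
   and mrH = BM_path_borel[OF BM crH t(1), of x]
  have ib: "integrable M (\<lambda>w. f w * F (?X w))" if F: "!!y. \<bar>F y\<bar> <= Q * H y" "(\<lambda>w. F (?X w)) \<in> bm M" for F Q
  proof (rule Bochner_Integration.integrable_bound[OF integrable_mult_right[OF h(1), of "K * Q"]])
   show "(\<lambda>w. f w * F (?X w)) \<in> bm M" using fM F(2) by simp
   have "\<bar>f w\<bar> * \<bar>F (?X w)\<bar> <= K * (Q * H (?X w))" if "w \<in> space M" for w
    by (intro mult_mono f(2) F(1) that K0) auto
   thus "AE w in M. norm (f w * F (?X w)) <= norm (K * Q * H (?X w))"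
    by (intro AE_I2 abs_le_imp_norm_le) (simp add: abs_mult mult.assoc)
  qed
  have n1: "integrable lborel (\<lambda>z. ?n z * z)" "(LINT z|lborel. ?n z * z) = 0"
   using integrable_normal_moment_nz_1[of "sqrt e" 0] integral_normal_moment_nz_1[of "sqrt e" 0] t by auto
  have n2: "integrable lborel (\<lambda>z. ?n z * z^2)" "(LINT z|lborel. ?n z * z^2) = e"
   using integrable_normal_moment[of "sqrt e" 0 2] integral_normal_moment_even[of "sqrt e" 0 1] t by auto
  have n3: "integrable lborel (\<lambda>z. ?n z * (\<bar>z\<bar> ^ 3 * exp (c * \<bar>z\<bar>)))"
   "(LINT z|lborel. ?n z * (\<bar>z\<bar> ^ 3 * exp (c * \<bar>z\<bar>))) <= C1 * (e * sqrt e)"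
  proof -
   have "sqrt e ^ 3 = e * sqrt e" using t by (simp add: power3_eq_cube)
   thus "integrable lborel (\<lambda>z. ?n z * (\<bar>z\<bar> ^ 3 * exp (c * \<bar>z\<bar>)))"
    "(LINT z|lborel. ?n z * (\<bar>z\<bar> ^ 3 * exp (c * \<bar>z\<bar>))) <= C1 * (e * sqrt e)"
    using C1(2,3)[of "sqrt e"] t by auto
  qed
  have i1: "integrable M (\<lambda>w. f w * H' (?X w))" by (rule ib[OF c(3)]) (rule mH')
  have i2: "integrable M (\<lambda>w. f w * (r (?X w) * H (?X w)))"
  proof (rule ib[of "\<lambda>y. r y * H y" P])
   show "\<bar>r y * H y\<bar> <= P * H y" for y using P(2)[of y] pos[of y] by (simp add: abs_mult mult_right_mono)
  qed (rule mrH)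
  have R1: "integrable M (\<lambda>w. f w * H' (?X w) * ?D w)" "expectation (\<lambda>w. f w * H' (?X w) * ?D w) = 0"
   using increment_integral[OF BM t(1,2) borel_measurable_times[OF f(1) mH'(1)] i1 _ n1(1)] n1(2) by auto
  have R2: "integrable M (\<lambda>w. f w * (r (?X w) * H (?X w)) * (?D w)^2)"
   "expectation (\<lambda>w. f w * (r (?X w) * H (?X w)) * (?D w)^2) = e * expectation (\<lambda>w. f w * (r (?X w) * H (?X w)))"
   using increment_integral[OF BM t(1,2) borel_measurable_times[OF f(1) mrH(1)] i2 _ n2(1)] n2(2) by auto
  note R3 = increment_integral[OF BM t(1,2) mH(1) h(1) _ n3(1)]
  let ?R = "\<lambda>w. H (x + B (t + e) w) - H (?X w) - H' (?X w) * ?D w - r (?X w) * H (?X w) * (?D w)^2"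
  let ?G = "\<lambda>w. K * c * (H (?X w) * (\<bar>?D w\<bar> ^ 3 * exp (c * \<bar>?D w\<bar>)))"
  have iG: "integrable M ?G" using R3(1) by simp
  have Rm: "?R \<in> bm M"
   using mH(2) mH'(2) mrH(2) BM_path_borel(2)[OF BM cH, of "t + e" x] BM_measurable[OF BM, of t] BM_measurable[OF BM, of "t + e"] t
   by simp
  have le: "\<bar>f w * ?R w\<bar> <= ?G w" if wt: "w \<in> space M" for w
  proof -
   have "\<bar>?R w\<bar> <= c * H (?X w) * (\<bar>?D w\<bar> ^ 3 * exp (c * \<bar>?D w\<bar>))"
    using c(2)[of "?X w" "?D w"] by simp
   from mult_mono[OF f(2)[OF wt] this] show ?thesis using K0 by (simp add: abs_mult mult_ac)
  qed
  have iR: "integrable M (\<lambda>w. f w * ?R w)"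
  proof (rule Bochner_Integration.integrable_bound[OF iG])
   show "(\<lambda>w. f w * ?R w) \<in> bm M" using fM Rm by (rule borel_measurable_times)
   show "AE w in M. norm (f w * ?R w) <= norm (?G w)"
    by (rule AE_I2, rule abs_le_imp_norm_le) (rule le)
  qed
  have bR: "\<bar>expectation (\<lambda>w. f w * ?R w)\<bar> <= K * c * (C2 * (C1 * (e * sqrt e)))"
  proof -
   have "\<bar>expectation (\<lambda>w. f w * ?R w)\<bar> <= expectation (\<lambda>w. \<bar>f w * ?R w\<bar>)"
    by (rule integral_abs_bound)
   also have "... <= expectation ?G"
    by (rule integral_mono[OF integrable_abs[OF iR] iG le])
   also have "... = K * c * (expectation (\<lambda>w. H (?X w)) * (LINT z|lborel. ?n z * (\<bar>z\<bar> ^ 3 * exp (c * \<bar>z\<bar>))))"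
    using R3(2) by simp
   also have "... <= K * c * (C2 * (C1 * (e * sqrt e)))"
    by (intro mult_left_mono mult_mono h n3)
      (use c C1 C2 t pos K0 in \<open>auto intro!: integral_nonneg_AE simp: less_imp_le\<close>)
   finally show ?thesis .
  qed
  have "expectation (\<lambda>w. f w * (H (x + B (t + e) w) - H (?X w) - e * (r (?X w) * H (?X w))))
   = expectation (\<lambda>w. f w * ?R w + f w * H' (?X w) * ?D w +
     (f w * (r (?X w) * H (?X w)) * (?D w)^2 - e * (f w * (r (?X w) * H (?X w)))))"
   by (rule Bochner_Integration.integral_cong) (auto simp: algebra_simps)
  also have "... = expectation (\<lambda>w. f w * ?R w)"
   using iR R1 R2 i2 by simp
  finally show ?thesis using bR by (simp add: mult_ac)
 qed
 show thesis by (rule that[of "c * C2 * C1"]) (use key c C1 C2 in auto)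
qed
 qed
 qed

section \<open>Feynman-Kac weights along a Brownian path\<close>

definition expw :: "(real => real) => real => (real => 'a => real) => real => 'a => real" where
 "expw q x B t w = exp (integral {0..t} (\<lambda>s. q (x + B s w)))"

lemma expw_pos: "0 < expw q x B t w" by (simp add: expw_def)

lemma BM_path_continuous:
 assumes BM: "standard_BM B" and q: "continuous_on UNIV (q :: real => real)" and wt: "w \<in> space M" and "S \<subseteq> {0..}"
 shows "continuous_on S (\<lambda>s. q (x + B s w))"
 by (intro continuous_on_compose2[OF q] continuous_intros continuous_on_subset[OF BM_continuous[OF BM wt]]) (use assms in auto)

lemma expw_split:
 assumes BM: "standard_BM B" and q: "continuous_on UNIV q" and wt: "w \<in> space M" and t: "0 <= s" "s <= t"
 shows "expw q x B t w = expw q x B s w * exp (integral {s..t} (\<lambda>s. q (x + B s w)))"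
proof -
 have "integral {0..s} (\<lambda>s. q (x + B s w)) + integral {s..t} (\<lambda>s. q (x + B s w)) = integral {0..t} (\<lambda>s. q (x + B s w))"
  by (intro Henstock_Kurzweil_Integration.integral_combine t integrable_continuous_interval BM_path_continuous[OF BM q wt]) auto
 thus ?thesis unfolding expw_def by (simp flip: exp_add)
qed

lemma BM_integral_bound:
 assumes BM: "standard_BM B" and q: "continuous_on UNIV q" and wt: "w \<in> space M" and t: "0 <= s" "s <= t"
  and Q: "!!y. \<bar>q y\<bar> <= Q"
 shows "\<bar>integral {s..t} (\<lambda>s. q (x + B s w))\<bar> <= Q * (t - s)"
proof -
 have "norm (integral {s..t} (\<lambda>s. q (x + B s w))) <= Q * (t - s)"
  by (rule integral_bound[OF t(2) BM_path_continuous[OF BM q wt]]) (use t Q in auto)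
 thus ?thesis by simp
qed

lemma expw_le:
 assumes BM: "standard_BM B" and q: "continuous_on UNIV q" and wt: "w \<in> space M" and t: "0 <= t"
  and Q: "!!y. \<bar>q y\<bar> <= Q"
 shows "expw q x B t w <= exp (Q * t)"
 using BM_integral_bound[OF BM q wt order_refl t Q, of x] by (simp add: expw_def)

lemma expw_diff:
 assumes BM: "standard_BM B" and q: "continuous_on UNIV q" and wt: "w \<in> space M" and t: "0 <= s" "s <= t" "t <= b"
  and Q: "!!y. \<bar>q y\<bar> <= Q"
 shows "\<bar>expw q x B t w - expw q x B s w\<bar> <= exp (Q * b) * (Q * (t - s))"
proof -
 have Q0: "0 <= Q" using Q[of 0] by (meson abs_ge_zero order_trans)
 let ?I = "\<lambda>t. integral {0..t} (\<lambda>s. q (x + B s w))"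
 have b: "?I u <= Q * b" if "0 <= u" "u <= b" for u
 proof -
  have "?I u <= Q * u" using BM_integral_bound[OF BM q wt order_refl that(1) Q, of x] by simp
  also have "... <= Q * b" using that Q0 by (simp add: mult_left_mono)
  finally show ?thesis .
 qed
 have "?I s + integral {s..t} (\<lambda>s. q (x + B s w)) = ?I t"
  by (intro Henstock_Kurzweil_Integration.integral_combine t integrable_continuous_interval BM_path_continuous[OF BM q wt]) auto
 hence d: "\<bar>?I t - ?I s\<bar> <= Q * (t - s)" using BM_integral_bound[OF BM q wt t(1,2) Q, of x] by linarith
 have "\<bar>exp (?I t) - exp (?I s)\<bar> <= exp (Q * b) * \<bar>?I t - ?I s\<bar>"
  by (rule exp_diff_le) (use b t in auto)
 also have "... <= exp (Q * b) * (Q * (t - s))" using d by simp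
 finally show ?thesis unfolding expw_def .
qed

lemma expw_past:
 assumes BM: "standard_BM B" and q: "continuous_on UNIV q" and t: "0 <= t"
 shows "expw q x B t \<in> bm (past B t)"
proof -
 have "(\<lambda>z. integral {0..t} (\<lambda>s. q (x + B (min s t) z))) \<in> bm (past B t)"
 proof (rule measurable_time_integral[where Y = "\<lambda>s. B (min s t)" and f = "\<lambda>z. z" and ta = "\<lambda>_. t" and v = "\<lambda>_. x", OF _ _ _ _ _ q])
  show "0 <= r ==> B (min r t) \<in> bm (past B t)" for r by (rule measurable_past) (use t in auto)
  show "continuous_on {0..} (\<lambda>r. B (min r t) w)" if "w \<in> space (past B t)" for w
   by (rule continuous_on_compose2[OF BM_continuous[OF BM, of w]]) (use that t in \<open>auto intro!: continuous_intros\<close>)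
 qed auto
 moreover have "integral {0..t} (\<lambda>s. q (x + B (min s t) z)) = integral {0..t} (\<lambda>s. q (x + B s z))" for z
  by (rule Henstock_Kurzweil_Integration.integral_cong) (auto simp: min_def)
 ultimately show ?thesis unfolding expw_def[abs_def] by simp
qed

lemma expw_right_deriv:
 assumes BM: "standard_BM B" and q: "continuous_on UNIV q" and wt: "w \<in> space M" and t: "0 <= t"
 shows "((\<lambda>e. (expw q x B (t + e) w - expw q x B t w) / e) \<longlongrightarrow> expw q x B t w * q (x + B t w)) (at_right 0)"
proof -
 let ?f = "\<lambda>s. q (x + B s w)"
 let ?J = "\<lambda>u. expw q x B t w * exp (integral {t..u} ?f)"
 have "((\<lambda>u. integral {t..u} ?f) has_real_derivative ?f t) (at t within {t..t+1})"
  by (rule integral_has_real_derivative[OF BM_path_continuous[OF BM q wt]]) (use t in auto)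
 hence "(?J has_real_derivative expw q x B t w * ?f t) (at t within {t..t+1})"
  by (auto intro!: derivative_eq_intros)
 hence "((\<lambda>u. (?J u - ?J t) / (u - t)) \<longlongrightarrow> expw q x B t w * ?f t) (at_right t)"
  by (simp add: has_field_derivative_iff at_within_Icc_at_right)
 hence "((\<lambda>e. (?J (e + t) - ?J t) / (e + t - t)) \<longlongrightarrow> expw q x B t w * ?f t) (at_right 0)"
  by (subst (asm) filterlim_at_right_to_0)
 thus ?thesis
 proof (rule Lim_transform_eventually)
  show "\<forall>\<^sub>F e in at_right 0. (?J (e + t) - ?J t) / (e + t - t) = (expw q x B (t + e) w - expw q x B t w) / e"
  proof (rule eventually_at_rightI[of 0 1])
   fix e :: real assume "e \<in> {0<..<1}"
   hence "expw q x B (t + e) w = ?J (e + t)" using expw_split[OF BM q wt t, of "t + e" x] by (simp add: add.commute)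
   thus "(?J (e + t) - ?J t) / (e + t - t) = (expw q x B (t + e) w - expw q x B t w) / e" by simp
  qed simp
 qed
qed

lemma integral_right_deriv:
 fixes f :: "real => real"
 assumes "continuous_on {a..b} f" "a <= t" "t < b"
 shows "((\<lambda>e. (integral {a..t + e} f - integral {a..t} f) / e) \<longlongrightarrow> f t) (at_right 0)"
proof -
 have "((\<lambda>u. integral {a..u} f) has_real_derivative f t) (at t within {a..b})"
  by (rule integral_has_real_derivative[OF assms(1)]) (use assms in auto)
 hence "((\<lambda>u. integral {a..u} f) has_real_derivative f t) (at t within {t..b})"
  by (rule DERIV_subset) (use assms in auto)
 hence "((\<lambda>u. (integral {a..u} f - integral {a..t} f) / (u - t)) \<longlongrightarrow> f t) (at_right t)"
  using assms by (simp add: has_field_derivative_iff at_within_Icc_at_right)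
 thus ?thesis by (subst (asm) filterlim_at_right_to_0) (simp add: add.commute)
qed

text \<open>Feynman--Kac: the expectation of \<open>et exp(\<integral> q) H\<close> has right derivative given by the generator; the second
 order Taylor expansion of \<open>H\<close> with relative error bounds replaces Ito's formula.\<close>

lemma feynman_kac:
 fixes x :: real
 assumes BM: "standard_BM B" and fl: "floquet l r H H'" and r: "per_lip r" and q: "per_lip q"
  and ab: "0 <= a" "a <= b" and et: "et \<in> bm (past B a)" "!!w. w \<in> space M ==> \<bar>et w\<bar> <= 1"
 defines "\<psi> \<equiv> \<lambda>t. expectation (\<lambda>w. et w * expw q x B t w * ((r (x + B t w) + q (x + B t w)) * H (x + B t w)))"
 shows "continuous_on {a..b} \<psi>"
  "expectation (\<lambda>w. et w * expw q x B b w * H (x + B b w)) - expectation (\<lambda>w. et w * expw q x B a w * H (x + B a w))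
    = integral {a..b} \<psi>"
proof -
 note pos = floquetD(1)[OF fl] and cq = per_lip_continuous[OF q]
 note cH = floquet_continuous(1)[OF fl]
 obtain Q where Q: "Q > 0" "!!y. \<bar>q y\<bar> <= Q" using per_lip_bounded[OF q] by blast
 have rq: "per_lip (\<lambda>y. r y + q y)" by (rule per_lip_add[OF r q])
 define E where "E = exp (Q * b)"
 have E1: "E \<ge> 1" using Q(1) ab by (simp add: E_def)
 obtain C0 where C0: "C0 > 0" "!!t. 0 <= t ==> t <= b ==> integrable M (\<lambda>w. H (x + B t w))"
  "!!t. 0 <= t ==> t <= b ==> expectation (\<lambda>w. H (x + B t w)) <= C0"
  by (rule floquet_moment[OF BM fl r, where b = b and x = x]) (rule that; assumption)
 have etaM: "et \<in> bm M" using et(1) subalgebra_past[OF BM, of a] by (meson measurable_from_subalg)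
 have A_M: "expw q x B t \<in> bm M" if "0 <= t" for t
  using expw_past[OF BM cq that] subalgebra_past[OF BM, of t] by (meson measurable_from_subalg)
 have A_le: "\<bar>expw q x B t w\<bar> <= E" if "0 <= t" "t <= b" "w \<in> space M" for t w
 proof -
  have "expw q x B t w <= exp (Q * t)" using expw_le[OF BM cq that(3,1) Q(2)] .
  also have "... <= E" using that Q(1) by (simp add: E_def)
  finally show ?thesis using expw_pos[of q x B t w] by simp
 qed
 have eA_le: "\<bar>et w * expw q x B t w\<bar> <= E" if "0 <= t" "t <= b" "w \<in> space M" for t w
  using mult_mono[OF et(2)[OF that(3)] A_le[OF that]] E1 by (simp add: abs_mult)
 have ib: "integrable M (\<lambda>w. f w * (p (x + B t w) * H (x + B t w)))"
  if f: "f \<in> bm M" "!!w. w \<in> space M ==> \<bar>f w\<bar> <= K" and p: "per_lip p" and t: "0 <= t" "t <= b" for f p K t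
 proof -
  obtain P where P: "P > 0" "!!y. \<bar>p y\<bar> <= P" using per_lip_bounded[OF p] by blast
  have cp: "continuous_on UNIV (\<lambda>y. p y * H y)" by (intro continuous_intros cH per_lip_continuous[OF p])
  show ?thesis
  proof (rule Bochner_Integration.integrable_bound[OF integrable_mult_right[OF C0(2)[OF t], of "K * P"]])
   show "(\<lambda>w. f w * (p (x + B t w) * H (x + B t w))) \<in> bm M"
    using f(1) BM_path_borel(2)[OF BM cp t(1), of x] by simp
   have "\<bar>f w\<bar> * (\<bar>p (x + B t w)\<bar> * \<bar>H (x + B t w)\<bar>) <= K * (P * H (x + B t w))" if wt: "w \<in> space M" for w
   proof (intro mult_mono f(2)[OF wt] P(2))
    show "0 <= K" using f(2)[OF wt] by linarith
    show "0 <= P" using P(1) by simp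
   qed (use pos in \<open>auto simp: less_imp_le abs_of_pos\<close>)
   thus "AE w in M. norm (f w * (p (x + B t w) * H (x + B t w))) <= norm (K * P * H (x + B t w))"
    by (intro AE_I2 abs_le_imp_norm_le) (simp add: abs_mult mult.assoc)
  qed
 qed
 have int: "integrable M (\<lambda>w. et w * expw q x B s w * (p (x + B t w) * H (x + B t w)))"
  if "per_lip p" "0 <= s" "s <= b" "0 <= t" "t <= b" for p s t
  by (rule ib[of _ E]) (use etaM A_M eA_le that in auto)
 note int1 = int[OF per_lip_const[of 1], unfolded mult_1]
 have dA: "\<bar>expw q x B (t + e) w - expw q x B t w\<bar> <= E * Q * e" if "0 <= t" "0 < e" "t + e <= b" "w \<in> space M" for t e w
  using expw_diff[OF BM cq that(4) that(1) _ that(3) Q(2), of x] that by (simp add: E_def mult_ac)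
 have deA: "\<bar>et w * (expw q x B (t + e) w - expw q x B t w)\<bar> <= E * Q * e" if "0 <= t" "0 < e" "t + e <= b" "w \<in> space M" for t e w
  using mult_mono[OF et(2)[OF that(4)] dA[OF that]] by (simp add: abs_mult)
 \<comment> \<open>The weight changes by order e and H in mean by order sqrt e, so the expectations
   are Hoelder continuous in time. This provides the continuity needed to integrate the right
   derivative.\<close>
 have holder: "\<exists>C>0. \<forall>t e. a <= t --> 0 < e --> t + e <= b -->
   \<bar>expectation (\<lambda>w. et w * expw q x B (t + e) w * (p (x + B (t + e) w) * H (x + B (t + e) w)))
    - expectation (\<lambda>w. et w * expw q x B t w * (p (x + B t w) * H (x + B t w)))\<bar> <= C * sqrt e"
  if p: "per_lip p" for p
 proof -
  obtain P where P: "P > 0" "!!y. \<bar>p y\<bar> <= P" using per_lip_bounded[OF p] by blast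
  obtain C1 where C1: "C1 > 0"
  "!!t e. 0 <= t ==> 0 < e ==> t + e <= b ==>
   integrable M (\<lambda>w. \<bar>p (x + B (t + e) w) * H (x + B (t + e) w) - p (x + B t w) * H (x + B t w)\<bar>)"
  "!!t e. 0 <= t ==> 0 < e ==> t + e <= b ==>
   expectation (\<lambda>w. \<bar>p (x + B (t + e) w) * H (x + B (t + e) w) - p (x + B t w) * H (x + B t w)\<bar>) <= C1 * sqrt e"
   by (rule floquet_increment[OF BM fl r p, where b = b and x = x]) (rule that; assumption)
  have "\<bar>expectation (\<lambda>w. et w * expw q x B (t + e) w * (p (x + B (t + e) w) * H (x + B (t + e) w)))
    - expectation (\<lambda>w. et w * expw q x B t w * (p (x + B t w) * H (x + B t w)))\<bar> <= (E * Q * P * C0 * sqrt b + E * C1) * sqrt e"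
   if t: "a <= t" "0 < e" "t + e <= b" for t e
  proof -
   have t0: "0 <= t" using t ab by simp
   let ?G = "\<lambda>t w. p (x + B t w) * H (x + B t w)"
   let ?A = "\<lambda>t w. et w * expw q x B t w"
   let ?F = "\<lambda>w. ?A (t + e) w * ?G (t + e) w - ?A t w * ?G t w"
   let ?R = "\<lambda>w. E * Q * e * P * H (x + B (t + e) w) + E * \<bar>?G (t + e) w - ?G t w\<bar>"
   have i1: "integrable M (\<lambda>w. ?A (t + e) w * ?G (t + e) w)"
    by (rule int[OF p]) (use t t0 in auto)
   have i2: "integrable M (\<lambda>w. ?A t w * ?G t w)"
    by (rule int[OF p]) (use t t0 in auto)
   have iR: "integrable M ?R"
    using C0(2)[of "t + e"] C1(2)[OF t0 t(2,3)] t t0 by (intro Bochner_Integration.integrable_add integrable_mult_right) auto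
   have le: "\<bar>?F w\<bar> <= ?R w" if wt: "w \<in> space M" for w
   proof -
    have "?F w = et w * (expw q x B (t + e) w - expw q x B t w) * ?G (t + e) w + ?A t w * (?G (t + e) w - ?G t w)"
     by (simp add: algebra_simps)
    also have "\<bar>...\<bar> <= \<bar>et w * (expw q x B (t + e) w - expw q x B t w)\<bar> * \<bar>?G (t + e) w\<bar> + \<bar>?A t w\<bar> * \<bar>?G (t + e) w - ?G t w\<bar>"
     by (rule order_trans[OF abs_triangle_ineq]) (simp only: abs_mult)
    also have "... <= (E * Q * e) * (P * H (x + B (t + e) w)) + E * \<bar>?G (t + e) w - ?G t w\<bar>"
    proof (intro add_mono mult_mono order_refl)
     show "\<bar>et w * (expw q x B (t + e) w - expw q x B t w)\<bar> <= E * Q * e" by (rule deA[OF t0 t(2,3) wt])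
     show "\<bar>?A t w\<bar> <= E" using eA_le[OF t0 _ wt] t by simp
     show "\<bar>?G (t + e) w\<bar> <= P * H (x + B (t + e) w)"
      using P(2)[of "x + B (t + e) w"] pos[of "x + B (t + e) w"] by (simp add: abs_mult mult_right_mono)
    qed (use E1 Q t in auto)
    finally show ?thesis by (simp only: mult.assoc)
   qed
   have "\<bar>expectation (\<lambda>w. ?A (t + e) w * ?G (t + e) w) - expectation (\<lambda>w. ?A t w * ?G t w)\<bar> = \<bar>expectation ?F\<bar>"
    using i1 i2 by simp
   also have "... <= expectation (\<lambda>w. \<bar>?F w\<bar>)" by (rule integral_abs_bound)
   also have "... <= expectation ?R"
    by (rule integral_mono[OF integrable_abs[OF Bochner_Integration.integrable_diff[OF i1 i2]] iR le])
   also have "... = E * Q * e * P * expectation (\<lambda>w. H (x + B (t + e) w)) + E * expectation (\<lambda>w. \<bar>?G (t + e) w - ?G t w\<bar>)"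
    using C0(2)[of "t + e"] C1(2)[OF t0 t(2,3)] t t0 by simp
   also have "... <= E * Q * e * P * C0 + E * (C1 * sqrt e)"
    by (intro add_mono mult_left_mono C0(3) C1(3)) (use t t0 E1 Q P in auto)
   also have "E * Q * e * P * C0 <= E * Q * P * C0 * sqrt b * sqrt e"
   proof -
    have "e = sqrt e * sqrt e" using t by simp
    also have "... <= sqrt b * sqrt e" using t t0 by (intro mult_right_mono) auto
    finally have "(E * Q * P * C0) * e <= (E * Q * P * C0) * (sqrt b * sqrt e)"
     using E1 Q P C0 by (intro mult_left_mono) auto
    thus ?thesis by (simp add: mult_ac)
   qed
   finally show ?thesis by (simp add: algebra_simps)
  qed
  thus ?thesis using E1 Q P C0 C1 ab
   by (intro exI[of _ "E * Q * P * C0 * sqrt b + E * C1"]) (auto intro: add_nonneg_pos)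
 qed
 have holder_cont: "continuous_on {a..b} F"
  if F: "\<exists>C>0. \<forall>t e. a <= t --> 0 < e --> t + e <= b --> \<bar>F (t + e) - F t\<bar> <= C * sqrt e" for F :: "real => real"
 proof -
  obtain C where C: "C > 0" "!!t e. a <= t ==> 0 < e ==> t + e <= b ==> \<bar>F (t + e) - F t\<bar> <= C * sqrt e" using F by blast
  have bd: "\<bar>F u - F t\<bar> <= C * sqrt \<bar>u - t\<bar>" if "t \<in> {a..b}" "u \<in> {a..b}" for t u
   using C(2)[of t "u - t"] C(2)[of u "t - u"] that by (cases "t < u"; cases "u < t") (auto simp: abs_minus_commute)
  show ?thesis unfolding continuous_on_def
  proof
   fix t assume t: "t \<in> {a..b}"
   have "((\<lambda>u. F u - F t) \<longlongrightarrow> 0) (at t within {a..b})"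
   proof (rule Lim_null_comparison)
    show "\<forall>\<^sub>F u in at t within {a..b}. norm (F u - F t) <= C * sqrt \<bar>u - t\<bar>"
     using bd[OF t] by (auto simp: eventually_at_filter)
    have "((\<lambda>u. C * sqrt \<bar>u - t\<bar>) \<longlongrightarrow> C * sqrt \<bar>t - t\<bar>) (at t within {a..b})"
     by (intro tendsto_intros)
    thus "((\<lambda>u. C * sqrt \<bar>u - t\<bar>) \<longlongrightarrow> 0) (at t within {a..b})" by simp
   qed
   thus "(F \<longlongrightarrow> F t) (at t within {a..b})" by (rule LIM_zero_cancel)
  qed
 qed
 show cont\<psi>: "continuous_on {a..b} \<psi>"
  unfolding \<psi>_def by (rule holder_cont[OF holder[OF rq]])
 define ph where "ph = (\<lambda>t. expectation (\<lambda>w. et w * expw q x B t w * H (x + B t w)))"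
 have contph: "continuous_on {a..b} ph"
  unfolding ph_def using holder_cont[OF holder[OF per_lip_const[of 1]]] by simp
 obtain C1 where C1: "C1 > 0"
  "!!t e f K. 0 <= t ==> 0 < e ==> t + e <= b ==> f \<in> bm (past B t) ==> \<forall>w\<in>space M. \<bar>f w\<bar> <= K ==>
   \<bar>expectation (\<lambda>w. f w * (H (x + B (t + e) w) - H (x + B t w) - e * (r (x + B t w) * H (x + B t w))))\<bar> <= K * C1 * (e * sqrt e)"
  by (rule floquet_taylor[OF BM fl r, where b = b and x = x]) (rule that; assumption)
 obtain C2 where C2: "C2 > 0"
  "!!t e. 0 <= t ==> 0 < e ==> t + e <= b ==>
   integrable M (\<lambda>w. \<bar>1 * H (x + B (t + e) w) - 1 * H (x + B t w)\<bar>)"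
  "!!t e. 0 <= t ==> 0 < e ==> t + e <= b ==>
   expectation (\<lambda>w. \<bar>1 * H (x + B (t + e) w) - 1 * H (x + B t w)\<bar>) <= C2 * sqrt e"
  by (rule floquet_increment[OF BM fl r per_lip_const[of 1], where b = b and x = x]) (rule that; assumption)
 have rd: "((\<lambda>e. (ph (t + e) - ph t) / e) \<longlongrightarrow> \<psi> t) (at_right 0)" if t: "a <= t" "t < b" for t
 proof -
  have t0: "0 <= t" using t ab by simp
  let ?H = "\<lambda>t w. H (x + B t w)"
  let ?A = "\<lambda>t. expw q x B t"
  let ?q = "\<lambda>w. q (x + B t w)"
  let ?T2 = "\<lambda>e w. et w * ((?A (t + e) w - ?A t w) / e - ?A t w * ?q w) * ?H t w"
  \<comment> \<open>Paths are merely continuous, so the difference quotient of the weight converges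
    without a rate. Dominated convergence handles this term, whereas the other two are of order sqrt
    e after division by e.\<close>
  have T2: "((\<lambda>e. expectation (?T2 e)) \<longlongrightarrow> 0) (at_right 0)"
   unfolding tendsto_at_iff_sequentially
  proof (intro allI impI)
   fix X :: "nat => real" assume X: "\<forall>i. X i \<in> {0<..} - {0}" "X \<longlonglongrightarrow> 0"
   have ev: "\<forall>\<^sub>F i in sequentially. X i < b - t" using order_tendstoD(2)[OF X(2), of "b - t"] t by simp
   obtain n0 where n0: "!!i. n0 <= i ==> X i < b - t" using ev unfolding eventually_sequentially by blast
   have "(\<lambda>i. expectation (?T2 (X (i + n0)))) \<longlonglongrightarrow> expectation (\<lambda>w. 0)"
   proof (rule integral_dominated_convergence[where w = "\<lambda>w. 2 * (E * Q) * ?H t w"])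
    show "(\<lambda>w. 0::real) \<in> bm M" by simp
    show "?T2 (X (i + n0)) \<in> bm M" for i
     using X(1) t0 etaM A_M[of t] A_M[of "t + X (i + n0)"] BM_path_borel(2)[OF BM cH t0, of x] BM_path_borel(2)[OF BM cq t0, of x]
     by (auto simp: less_imp_le add_nonneg_nonneg)
    show "integrable M (\<lambda>w. 2 * (E * Q) * ?H t w)" using C0(2)[OF t0] t by simp
    show "AE w in M. (\<lambda>i. ?T2 (X (i + n0)) w) \<longlonglongrightarrow> 0"
    proof (rule AE_I2)
     fix w assume wt: "w \<in> space M"
     have "((\<lambda>e. ?T2 e w) \<longlongrightarrow> et w * (?A t w * ?q w - ?A t w * ?q w) * ?H t w) (at_right 0)"
      by (intro tendsto_intros expw_right_deriv[OF BM cq wt t0])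
     hence "((\<lambda>e. ?T2 e w) \<longlongrightarrow> 0) (at_right 0)" by simp
     hence "((\<lambda>e. ?T2 e w) \<circ> X) \<longlonglongrightarrow> 0" using X unfolding tendsto_at_iff_sequentially by blast
     thus "(\<lambda>i. ?T2 (X (i + n0)) w) \<longlonglongrightarrow> 0" using LIMSEQ_ignore_initial_segment[of "(\<lambda>e. ?T2 e w) \<circ> X" 0 n0] by (simp add: comp_def)
    qed
    show "AE w in M. norm (?T2 (X (i + n0)) w) <= 2 * (E * Q) * ?H t w" for i
    proof (rule AE_I2)
     fix w assume wt: "w \<in> space M"
     define e where "e = X (i + n0)"
     have e: "0 < e" "t + e <= b" using X(1) n0[of "i + n0"] by (auto simp: e_def less_imp_le)
     have "\<bar>(?A (t + e) w - ?A t w) / e\<bar> <= E * Q" using dA[OF t0 e wt] e by (simp add: field_simps)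
     moreover have "\<bar>?A t w * ?q w\<bar> <= E * Q" unfolding abs_mult
      by (intro mult_mono A_le Q(2)) (use t t0 wt E1 in auto)
     ultimately have "\<bar>(?A (t + e) w - ?A t w) / e - ?A t w * ?q w\<bar> <= 2 * (E * Q)" by linarith
     hence "\<bar>et w\<bar> * \<bar>(?A (t + e) w - ?A t w) / e - ?A t w * ?q w\<bar> <= 1 * (2 * (E * Q))"
      by (intro mult_mono et(2)[OF wt]) auto
     hence "\<bar>et w\<bar> * \<bar>(?A (t + e) w - ?A t w) / e - ?A t w * ?q w\<bar> * ?H t w <= (1 * (2 * (E * Q))) * ?H t w"
      by (rule mult_right_mono) (use pos in \<open>simp add: less_imp_le\<close>)
     thus "norm (?T2 (X (i + n0)) w) <= 2 * (E * Q) * ?H t w"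
      unfolding e_def[symmetric] real_norm_def abs_mult using pos by (simp add: abs_of_pos)
    qed
   qed
   hence "(\<lambda>i. ((\<lambda>e. expectation (?T2 e)) \<circ> X) (i + n0)) \<longlonglongrightarrow> 0" by (simp add: comp_def)
   thus "((\<lambda>e. expectation (?T2 e)) \<circ> X) \<longlonglongrightarrow> 0" by (rule LIMSEQ_offset)
  qed
  \<comment> \<open>The increment of the product splits into the weight times the increment of H
    (\<open>?T1\<close> once the generator is removed), the increment of the weight times H
    (\<open>e * ?T2\<close> once its derivative is removed), and the product of both increments
    (\<open>?T3\<close>).\<close>
  have bnd: "\<bar>(ph (t + e) - ph t) / e - \<psi> t - expectation (?T2 e)\<bar> <= (E * C1 + E * Q * C2) * sqrt e" if e: "0 < e" "t + e <= b" for e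
  proof -
   have tb: "t <= b" "0 <= t + e" using t t0 e by auto
   let ?T1 = "\<lambda>w. et w * ?A t w * (?H (t + e) w - ?H t w - e * (r (x + B t w) * ?H t w))"
   let ?T3 = "\<lambda>w. et w * (?A (t + e) w - ?A t w) * (?H (t + e) w - ?H t w)"
   let ?P = "\<lambda>w. et w * ?A t w * ((r (x + B t w) + ?q w) * ?H t w)"
   have j: "integrable M (\<lambda>w. et w * ?A s w * ?H u w)" if "s \<in> {t, t + e}" "u \<in> {t, t + e}" for s u
    by (rule int1) (use that t0 tb e in auto)
   have j5: "integrable M (\<lambda>w. et w * ?A t w * (r (x + B t w) * ?H t w))" by (rule int[OF r t0 tb(1) t0 tb(1)])
   have j6: "integrable M (\<lambda>w. et w * ?A t w * (?q w * ?H t w))" by (rule int[OF q t0 tb(1) t0 tb(1)])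
   have i1: "integrable M ?T1"
   proof -
    have "integrable M (\<lambda>w. et w * ?A t w * ?H (t + e) w - et w * ?A t w * ?H t w - e * (et w * ?A t w * (r (x + B t w) * ?H t w)))"
     by (intro Bochner_Integration.integrable_diff j integrable_mult_right j5) auto
    thus ?thesis by (simp add: algebra_simps)
   qed
   have i3: "integrable M ?T3"
   proof -
    have "integrable M (\<lambda>w. (et w * ?A (t + e) w * ?H (t + e) w - et w * ?A (t + e) w * ?H t w) - (et w * ?A t w * ?H (t + e) w - et w * ?A t w * ?H t w))"
     by (intro Bochner_Integration.integrable_diff j) auto
    thus ?thesis by (simp add: algebra_simps)
   qed
   have i2: "integrable M (\<lambda>w. e * ?T2 e w)"
   proof -
    have "integrable M (\<lambda>w. et w * ?A (t + e) w * ?H t w - et w * ?A t w * ?H t w - e * (et w * ?A t w * (?q w * ?H t w)))"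
     by (intro Bochner_Integration.integrable_diff j integrable_mult_right j6) auto
    moreover have "e * ?T2 e w = et w * ?A (t + e) w * ?H t w - et w * ?A t w * ?H t w - e * (et w * ?A t w * (?q w * ?H t w))" for w
     using e by (simp add: field_simps)
    ultimately show ?thesis by (simp only:)
   qed
   have iP: "integrable M (\<lambda>w. e * ?P w)"
   proof -
    have "integrable M (\<lambda>w. e * (et w * ?A t w * (r (x + B t w) * ?H t w) + et w * ?A t w * (?q w * ?H t w)))"
     by (intro integrable_mult_right Bochner_Integration.integrable_add j5 j6)
    thus ?thesis by (simp add: algebra_simps)
   qed
   have "ph (t + e) - ph t = expectation (\<lambda>w. et w * ?A (t + e) w * ?H (t + e) w - et w * ?A t w * ?H t w)"
    unfolding ph_def using j[of t t] j[of "t + e" "t + e"] by simp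
   also have "... = expectation (\<lambda>w. ?T1 w + ?T3 w + (e * ?T2 e w + e * ?P w))"
    by (rule Bochner_Integration.integral_cong) (use e in \<open>auto simp: field_simps\<close>)
   also have "... = expectation ?T1 + expectation ?T3 + (e * expectation (?T2 e) + e * \<psi> t)"
    unfolding \<psi>_def using i1 i2 i3 iP
    by (simp only: Bochner_Integration.integral_add Bochner_Integration.integrable_add integral_mult_right_zero)
   finally have eq: "ph (t + e) - ph t - e * \<psi> t - e * expectation (?T2 e) = expectation ?T1 + expectation ?T3" by simp
   have b1: "\<bar>expectation ?T1\<bar> <= E * C1 * (e * sqrt e)"
   proof (rule C1(2)[OF t0 e])
    show "(\<lambda>w. et w * ?A t w) \<in> bm (past B t)"
     using past_mono[OF t(1) et(1)] expw_past[OF BM cq t0, of x] by simp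
    show "\<forall>w\<in>space M. \<bar>et w * ?A t w\<bar> <= E" using eA_le[OF t0 tb(1)] by blast
   qed
   have b3: "\<bar>expectation ?T3\<bar> <= (E * Q * e) * (C2 * sqrt e)"
   proof -
    have c2: "integrable M (\<lambda>w. \<bar>?H (t + e) w - ?H t w\<bar>)" "expectation (\<lambda>w. \<bar>?H (t + e) w - ?H t w\<bar>) <= C2 * sqrt e"
     using C2(2,3)[OF t0 e] by auto
    have "\<bar>expectation ?T3\<bar> <= expectation (\<lambda>w. \<bar>?T3 w\<bar>)" by (rule integral_abs_bound)
    also have "... <= expectation (\<lambda>w. (E * Q * e) * \<bar>?H (t + e) w - ?H t w\<bar>)"
    proof (rule integral_mono[OF integrable_abs[OF i3] integrable_mult_right[OF c2(1)]])
     fix w assume "w \<in> space M"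
     from mult_right_mono[OF deA[OF t0 e this], of "\<bar>?H (t + e) w - ?H t w\<bar>"]
     show "\<bar>?T3 w\<bar> <= E * Q * e * \<bar>?H (t + e) w - ?H t w\<bar>" by (simp add: abs_mult)
    qed
    also have "... <= (E * Q * e) * (C2 * sqrt e)"
     unfolding integral_mult_right_zero using c2(2) E1 Q e by (intro mult_left_mono) auto
    finally show ?thesis .
   qed
   have "(ph (t + e) - ph t) / e - \<psi> t - expectation (?T2 e) = (ph (t + e) - ph t - e * \<psi> t - e * expectation (?T2 e)) / e"
    using e by (simp add: field_simps)
   hence "\<bar>(ph (t + e) - ph t) / e - \<psi> t - expectation (?T2 e)\<bar> = \<bar>expectation ?T1 + expectation ?T3\<bar> / e"
    using e eq by (simp only: abs_divide abs_of_pos)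
   also have "... <= (E * C1 * (e * sqrt e) + (E * Q * e) * (C2 * sqrt e)) / e"
    using b1 b3 e by (intro divide_right_mono) auto
   also have "... = (E * C1 + E * Q * C2) * sqrt e" using e by (simp add: field_simps)
   finally show ?thesis .
  qed
  have "((\<lambda>e. (ph (t + e) - ph t) / e - \<psi> t - expectation (?T2 e)) \<longlongrightarrow> 0) (at_right 0)"
  proof (rule Lim_null_comparison)
   show "\<forall>\<^sub>F e in at_right 0. norm ((ph (t + e) - ph t) / e - \<psi> t - expectation (?T2 e)) <= (E * C1 + E * Q * C2) * sqrt e"
    by (rule eventually_at_rightI[of 0 "b - t"]) (use bnd t in auto)
   have "((\<lambda>e. (E * C1 + E * Q * C2) * sqrt e) \<longlongrightarrow> (E * C1 + E * Q * C2) * sqrt 0) (at_right 0)"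
    by (intro tendsto_intros)
   thus "((\<lambda>e. (E * C1 + E * Q * C2) * sqrt e) \<longlongrightarrow> 0) (at_right 0)" by simp
  qed
  from tendsto_add[OF tendsto_add[OF this T2] tendsto_const[of "\<psi> t"]] show ?thesis by simp
 qed
 have "ph b - integral {a..b} \<psi> = ph a - integral {a..a} \<psi>"
 proof (rule right_derivative_zero_imp_const[OF ab(2), where f = "\<lambda>t. ph t - integral {a..t} \<psi>"])
  show "continuous_on {a..b} (\<lambda>t. ph t - integral {a..t} \<psi>)"
   by (intro continuous_on_diff contph indefinite_integral_continuous_1 integrable_continuous_interval cont\<psi>)
  fix t assume t: "a <= t" "t < b"
  have "((\<lambda>e. (ph (t + e) - ph t) / e - (integral {a..t + e} \<psi> - integral {a..t} \<psi>) / e) \<longlongrightarrow> \<psi> t - \<psi> t) (at_right 0)"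
   by (intro tendsto_diff rd[OF t] integral_right_deriv[OF cont\<psi> t])
  thus "((\<lambda>e. ((ph (t + e) - integral {a..t + e} \<psi>) - (ph t - integral {a..t} \<psi>)) / e) \<longlongrightarrow> 0) (at_right 0)"
   by (simp add: diff_divide_distrib add_divide_distrib algebra_simps)
 qed
 hence "ph b - ph a = integral {a..b} \<psi>" by simp
 thus "expectation (\<lambda>w. et w * expw q x B b w * H (x + B b w)) - expectation (\<lambda>w. et w * expw q x B a w * H (x + B a w))
    = integral {a..b} \<psi>"
  unfolding ph_def .
qed

end

section \<open>Killing by an exponential clock\<close>

definition clock_inv :: "(real => real) => real => real" where
 "clock_inv K e = Inf {t. 0 <= t \<and> e <= K t}"

lemma nn_integral_Ioc_continuous:
 fixes f :: "real => real"
 assumes f: "continuous_on {a..b} f" "!!t. t \<in> {a..b} ==> 0 <= f t"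
 shows "(\<integral>\<^sup>+t. ennreal (f t) * indicator {a<..b} t \<partial>lborel) = ennreal (integral {a..b} f)"
proof -
 have i: "integrable lborel (\<lambda>t. indicator {a..b} t * f t)"
  using borel_integrable_atLeastAtMost'[OF f(1)] by (simp add: set_integrable_def)
 have "(\<integral>\<^sup>+t. ennreal (f t) * indicator {a<..b} t \<partial>lborel) = (\<integral>\<^sup>+t. ennreal (indicator {a..b} t * f t) \<partial>lborel)"
 proof (rule nn_integral_cong_AE)
  show "AE t in lborel. ennreal (f t) * indicator {a<..b} t = ennreal (indicator {a..b} t * f t)"
   using AE_lborel_singleton[of a] by eventually_elim (auto simp: indicator_def)
 qed
 also have "... = ennreal (LINT t|lborel. indicator {a..b} t * f t)"
  by (rule nn_integral_eq_integral[OF i]) (use f(2) in \<open>auto simp: indicator_def\<close>)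
 finally show ?thesis using integral_eq_lborel[OF f(1)] by simp
qed

lemma nn_integral_exhaust:
 fixes h :: "real => ennreal" and a :: "nat => real"
 assumes [measurable]: "h \<in> bm borel" and a: "incseq a" "filterlim a at_top sequentially"
 shows "(\<lambda>n. \<integral>\<^sup>+x. h x * indicator {0..a n} x \<partial>lborel) \<longlonglongrightarrow> (\<integral>\<^sup>+x. h x * indicator {0..} x \<partial>lborel)"
proof (rule nn_integral_LIMSEQ)
 show "incseq (\<lambda>n x. h x * indicator {0..a n} x)"
  using a(1) by (intro monoI le_funI mult_left_mono) (auto simp: indicator_def dest: incseqD)
 fix x :: real
 have ev: "\<forall>\<^sub>F n in sequentially. x <= a n" using a(2) by (simp add: filterlim_at_top)
 show "(\<lambda>n. h x * indicator {0..a n} x) \<longlonglongrightarrow> h x * indicator {0..} x"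
  by (intro tendsto_eventually eventually_mono[OF ev]) (auto simp: indicator_def)
qed measurable

lemma measurable_from_nonneg_levels:
 fixes ta :: "'a => real"
 assumes "!!z. z \<in> space N ==> 0 <= ta z" "!!y. 0 <= y ==> {z \<in> space N. ta z <= y} \<in> sets N"
 shows "ta \<in> bm N"
proof (rule borel_measurableI_le)
 fix y :: real
 have "0 <= y \<or> {z \<in> space N. ta z <= y} = {}" using assms(1) by force
 thus "{z \<in> space N. ta z <= y} \<in> sets N" using assms(2) by (elim disjE) (simp_all only: sets.empty_sets)
qed

text \<open>The lower bound c makes K strictly increasing and unbounded, so every nonnegative level
  is reached exactly once and \<open>clock_inv K\<close> is a true inverse there.\<close>

locale clock =
 fixes k :: "real => real" and c :: real and K :: "real => real"
 assumes k: "continuous_on {0..} k" and c: "0 < c" and kc: "!!t. 0 <= t ==> c <= k t"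
  and K: "!!t. K t = integral {0..t} k"
begin

lemma antiderivative:
 obtains G where "!!t. (G has_real_derivative k (max 0 t)) (at t)" "!!t. 0 <= t ==> K t = G t" "G 0 = 0"
proof -
 have ck: "continuous_on UNIV (\<lambda>t. k (max 0 t))"
  by (rule continuous_on_compose2[OF k]) (auto intro!: continuous_intros)
 obtain G where G: "!!t. (G has_real_derivative k (max 0 t)) (at t)" using antiderivative_exists[OF ck] by blast
 have "K t = G t - G 0" if t: "0 <= t" for t
 proof -
  have "((\<lambda>t. k (max 0 t)) has_integral (G t - G 0)) {0..t}"
   by (rule fundamental_theorem_of_calculus[OF t], fold has_real_derivative_iff_has_vector_derivative,
     rule has_field_derivative_at_within, rule G)
  hence "(k has_integral (G t - G 0)) {0..t}"
   by (rule has_integral_eq[rotated]) auto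
  thus ?thesis unfolding K by (rule integral_unique)
 qed
 thus ?thesis
  by (intro that[of "\<lambda>t. G t - G 0"]) (auto intro!: derivative_eq_intros G)
qed

lemma K_0: "K 0 = 0" by (simp add: K)

lemma K_growth: "0 <= s ==> s <= t ==> c * (t - s) <= K t - K s"
proof -
 assume st: "0 <= s" "s <= t"
 obtain G where G: "!!t. (G has_real_derivative k (max 0 t)) (at t)" "!!t. 0 <= t ==> K t = G t" "G 0 = 0"
  by (rule antiderivative; rule that; assumption)
 show ?thesis
 proof (cases "s = t")
  case False
  hence "s < t" using st by simp
  from MVT2[OF this G(1)] obtain z where z: "s < z" "G t - G s = (t - s) * k (max 0 z)" by blast
  have "(t - s) * c <= (t - s) * k (max 0 z)" by (rule mult_left_mono[OF kc]) (use st in simp_all)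
  hence "c * (t - s) <= (t - s) * k (max 0 z)" by (simp only: mult.commute)
  thus ?thesis using G(2) st z by simp
 qed simp
qed

lemma K_less: "0 <= s ==> s < t ==> K s < K t"
proof -
 assume st: "0 <= s" "s < t"
 hence "c * (t - s) > 0" using c by simp
 thus ?thesis using K_growth[of s t] st by linarith
qed

lemma K_mono: "0 <= s ==> s <= t ==> K s <= K t"
 using K_less[of s t] by (cases "s = t") auto

lemma K_ge: "0 <= t ==> c * t <= K t" using K_growth[of 0 t] K_0 by simp

lemma K_le_iff: "0 <= s ==> 0 <= t ==> K s <= K t \<longleftrightarrow> s <= t"
 using K_less[of t s] K_mono[of s t] by (cases "s <= t") auto

lemma K_continuous: "continuous_on {0..} K"
proof -
 obtain G where G: "!!t. (G has_real_derivative k (max 0 t)) (at t)" "!!t. 0 <= t ==> K t = G t" "G 0 = 0"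
  by (rule antiderivative; rule that; assumption)
 have "continuous_on {0..} G" by (rule continuous_on_subset[OF DERIV_continuous_on[of UNIV]]) (use G(1) in auto)
 thus ?thesis by (rule continuous_on_eq) (use G(2) in auto)
qed

lemma level_exists: "0 <= e ==> \<exists>t\<ge>0. K t = e"
proof -
 assume e: "0 <= e"
 have "K 0 <= e" "e <= K (e / c)" using e K_0 K_ge[of "e / c"] c by auto
 moreover have "continuous_on {0..e / c} K" by (rule continuous_on_subset[OF K_continuous]) auto
 ultimately have "\<exists>t\<ge>0. t <= e / c \<and> K t = e" using e c by (intro IVT') auto
 thus ?thesis by blast
qed

lemma clock_inv_K: "0 <= t ==> clock_inv K (K t) = t"
proof -
 assume t: "0 <= t"
 hence "{s. 0 <= s \<and> K t <= K s} = {t..}" using K_le_iff by auto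
 thus ?thesis by (simp add: clock_inv_def)
qed

lemma clock_inv_neg: "e < 0 ==> clock_inv K e = 0"
proof -
 assume e: "e < 0"
 have "{s. 0 <= s \<and> e <= K s} = {0..}"
 proof -
  have "e <= K s" if "0 <= s" for s using K_mono[of 0 s] K_0 that e by simp
  thus ?thesis by auto
 qed
 thus ?thesis by (simp add: clock_inv_def)
qed

lemma clock_inv_nonneg: "0 <= clock_inv K e"
proof (cases "e < 0")
 case False
 then obtain t where t: "0 <= t" "K t = e" using level_exists[of e] by auto
 thus ?thesis using clock_inv_K[OF t(1)] by simp
qed (simp add: clock_inv_neg)

lemma clock_inv_le_iff: "0 <= t ==> clock_inv K e <= t \<longleftrightarrow> e <= K t"
proof (cases "e < 0")
 case True
 assume "0 <= t" thus ?thesis using True K_mono[of 0 t] K_0 by (simp add: clock_inv_neg)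
next
 case False
 assume t: "0 <= t"
 obtain s where "0 <= s" "K s = e" using False level_exists[of e] by auto
 thus ?thesis using clock_inv_K K_le_iff t by auto
qed

lemma clock_inv_mono: "mono (clock_inv K)"
proof (rule monoI)
 fix d e :: real assume de: "d <= e"
 show "clock_inv K d <= clock_inv K e"
  using clock_inv_le_iff[OF clock_inv_nonneg[of e], of e] clock_inv_le_iff[OF clock_inv_nonneg[of e], of d] de by simp
qed

text \<open>For a standard exponential e, the time at which K reaches e has hazard rate k, hence
  density k exp(- K). The change of variables is made on bounded intervals, which then exhaust the
  half-line.\<close>

lemma substitution:
 fixes f :: "real => ennreal"
 assumes [measurable]: "f \<in> bm borel"
 shows "(\<integral>\<^sup>+e. ennreal (exponential_density 1 e) * f (clock_inv K e) \<partial>lborel)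
  = (\<integral>\<^sup>+t. f t * ennreal (k t * exp (- K t)) * indicator {0..} t \<partial>lborel)"
proof -
 obtain G where G: "!!t. (G has_real_derivative k (max 0 t)) (at t)" "!!t. 0 <= t ==> K t = G t" "G 0 = 0"
  by (rule antiderivative; rule that; assumption)
 have ck: "continuous_on UNIV (\<lambda>t. k (max 0 t))"
  by (rule continuous_on_compose2[OF k]) (auto intro!: continuous_intros)
 have [measurable]: "clock_inv K \<in> bm borel" by (rule borel_measurable_mono[OF clock_inv_mono])
 have [measurable]: "(\<lambda>t. k (max 0 t)) \<in> bm borel" using ck by (rule borel_measurable_continuous_onI)
 have [measurable]: "G \<in> bm borel"
  by (rule borel_measurable_continuous_onI, rule DERIV_continuous_on[OF G(1)])
 have [measurable]: "exponential_density 1 \<in> bm borel" by measurable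
 define h where "h = (\<lambda>e. ennreal (exponential_density 1 e) * f (clock_inv K e))"
 have hm[measurable]: "h \<in> bm borel" unfolding h_def by measurable
 define F where "F = (\<lambda>t. f t * ennreal (k (max 0 t) * exp (- G t)) * indicator {0..} t)"
 have Fm[measurable]: "F \<in> bm borel" unfolding F_def by measurable
 have step: "(\<integral>\<^sup>+e. h e * indicator {0..G (real n + 1)} e \<partial>lborel) = (\<integral>\<^sup>+t. F t * indicator {0..real n + 1} t \<partial>lborel)" for n
 proof -
  have "(\<integral>\<^sup>+e. h e * indicator {G 0..G (real n + 1)} e \<partial>lborel) = (\<integral>\<^sup>+t. h (G t) * ennreal (k (max 0 t)) * indicator {0..real n + 1} t \<partial>lborel)"
   by (rule nn_integral_substitution_aux[OF _ _ G(1)])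
     (use c in \<open>auto intro: continuous_on_subset[OF ck] order_trans[OF less_imp_le[OF c] kc]\<close>)
  also have "... = (\<integral>\<^sup>+t. F t * indicator {0..real n + 1} t \<partial>lborel)"
  proof (rule nn_integral_cong)
   fix t :: real
   show "h (G t) * ennreal (k (max 0 t)) * indicator {0..real n + 1} t = F t * indicator {0..real n + 1} t"
   proof (cases "0 <= t")
    case True
    have kt: "0 <= k t" using kc[OF True] c by linarith
    have Gt: "\<not> G t < 0" "clock_inv K (G t) = t" using G(2)[OF True] K_mono[of 0 t] K_0 True clock_inv_K[OF True] by auto
    have "h (G t) = ennreal (exp (- G t)) * f t"
     unfolding h_def exponential_density_def using Gt by simp
    moreover have "ennreal (k t * exp (- G t)) = ennreal (k t) * ennreal (exp (- G t))" using kt by (simp add: ennreal_mult)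
    ultimately show ?thesis using True unfolding F_def by (simp add: mult_ac max_def)
   qed auto
  qed
  finally show ?thesis using G(3) by simp
 qed
 have "c * real n <= G (real n + 1)" for n
  using K_ge[of "real n + 1"] G(2)[of "real n + 1"] c by (simp add: algebra_simps)
 moreover have "filterlim (\<lambda>n. c * real n) at_top sequentially"
  by (rule filterlim_tendsto_pos_mult_at_top[OF tendsto_const c filterlim_real_sequentially])
 ultimately have Glim: "filterlim (\<lambda>n. G (real n + 1)) at_top sequentially"
  by (auto intro: filterlim_at_top_mono)
 have Gmono: "incseq (\<lambda>n. G (real n + 1))"
  unfolding incseq_def using K_mono G(2) by simp
 have h0: "h e * indicator {0..} e = h e" for e by (simp add: h_def exponential_density_def indicator_def)
 have F0: "F t * indicator {0..} t = F t" for t by (simp add: F_def indicator_def)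
 have nlim: "filterlim (\<lambda>n. real n + 1) at_top sequentially"
  by (rule filterlim_at_top_mono[OF filterlim_real_sequentially]) simp
 have ninc: "incseq (\<lambda>n. real n + 1)" by (simp add: incseq_def)
 have "(\<integral>\<^sup>+e. h e \<partial>lborel) = (\<integral>\<^sup>+t. F t \<partial>lborel)"
  by (rule LIMSEQ_unique[OF nn_integral_exhaust[OF hm Gmono Glim, unfolded h0 step] nn_integral_exhaust[OF Fm ninc nlim, unfolded F0]])
 also have "... = (\<integral>\<^sup>+t. f t * ennreal (k t * exp (- K t)) * indicator {0..} t \<partial>lborel)"
  by (rule nn_integral_cong) (auto simp: F_def indicator_def G(2))
 finally show ?thesis unfolding h_def .
qed

end

context prob_space begin

definition allpast :: "(real => 'a => real) => 'a measure" where
 "allpast B = sigma (space M) {B s -` S \<inter> space M | s S. 0 <= s \<and> S \<in> sets borel}"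

lemma space_allpast [simp]: "space (allpast B) = space M"
 unfolding allpast_def by (rule space_measure_of) auto

lemma sets_allpast: "sets (allpast B) = sigma_sets (space M) {B s -` S \<inter> space M | s S. 0 <= s \<and> S \<in> sets borel}"
 unfolding allpast_def by (rule sets_measure_of) auto

lemma measurable_allpast: "0 <= s ==> B s \<in> bm (allpast B)"
 by (rule measurableI) (auto simp: sets_allpast intro!: sigma_sets.Basic)

lemma subalgebra_allpast: "standard_BM B ==> subalgebra M (allpast B)"
 unfolding subalgebra_def sets_allpast
 by (auto intro!: sets.sigma_sets_subset measurable_sets[OF BM_measurable])

lemma past_allpast:
 assumes "f \<in> bm (past B s)" shows "f \<in> bm (allpast B)"
proof -
 have "sets (past B s) \<subseteq> sets (allpast B)"
  unfolding sets_past sets_allpast by (rule sigma_sets_mono') force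
 with assms show ?thesis by (auto simp: measurable_def)
qed

end

text \<open>Killing at rate g is realized by an independent exponential clock instead of a
  conditional survival law; the clocks extracted from the lifetimes of the branching system
  instantiate this.\<close>

locale killed_bm = prob_space M for M :: "'a measure" +
 fixes g :: "real => real" and B :: "real => 'a => real" and E :: "'a => real"
 assumes BM: "standard_BM B" and g: "per_lip g" and gpos: "!!y. 0 < g y"
  and E_exp: "distributed M lborel E (exponential_density 1)"
  and E_indep: "indep_set (sets (allpast B)) (sets (vimage_algebra (space M) E borel))"
begin

definition K :: "real => real => 'a => real" where "K x t w = integral {0..t} (\<lambda>s. g (x + B s w))"
definition tau :: "real => 'a => real" where "tau x w = clock_inv (\<lambda>t. K x t w) (E w)"

lemma g_continuous: "continuous_on UNIV g" by (rule per_lip_continuous[OF g])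

lemma clock_K:
 assumes "w \<in> space M"
 obtains c where "clock (\<lambda>s. g (x + B s w)) c (\<lambda>t. K x t w)"
proof -
 obtain c where c: "c > 0" "!!y. c <= g y"
  using periodic_lower_bound[OF g_continuous _ gpos] g by (auto simp: per_lip_def)
 show ?thesis
  by (rule that[of c], unfold_locales) (use c BM_path_continuous[OF BM g_continuous assms] in \<open>auto simp: K_def\<close>)
qed

lemma tau_nonneg: "w \<in> space M ==> 0 <= tau x w"
 unfolding tau_def by (metis clock_K clock.clock_inv_nonneg)

lemma tau_le_iff: "w \<in> space M ==> 0 <= t ==> tau x w <= t \<longleftrightarrow> E w <= K x t w"
 unfolding tau_def by (metis clock_K clock.clock_inv_le_iff)

lemma E_measurable: "E \<in> bm M"
 using distributed_measurable[OF E_exp] by simp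

abbreviation "SE \<equiv> vimage_algebra (space M) E borel"

lemma subalgebra_SE: "subalgebra M SE"
 unfolding subalgebra_def using sets_image_in_sets[OF _ E_measurable] by simp

lemma E_SE: "E \<in> bm SE"
 by (rule measurable_vimage_algebra1) auto

lemma measurable_K:
 assumes f: "f \<in> measurable N (allpast B)" and ta: "ta \<in> bm N" and v: "v \<in> bm N"
 shows "(\<lambda>z. K (v z) (ta z) (f z)) \<in> bm N"
 unfolding K_def
 by (rule measurable_time_integral[OF measurable_allpast _ f ta v g_continuous])
   (use BM_continuous[OF BM] in auto)

lemma measurable_B:
 assumes f: "f \<in> measurable N (allpast B)" and ta: "ta \<in> bm N" and h: "h \<in> bm borel"
  and v: "v \<in> bm N"
 shows "(\<lambda>z. h (v z + B (max 0 (ta z)) (f z))) \<in> bm N"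
proof -
 have "(\<lambda>z. B (max 0 (ta z)) (f z)) \<in> bm N"
  by (rule continuous_process_at_random_time[OF measurable_allpast _ f])
    (use BM_continuous[OF BM] ta in auto)
 hence "(\<lambda>z. v z + B (max 0 (ta z)) (f z)) \<in> bm N" using v by simp
 thus ?thesis using h by (rule measurable_compose)
qed

text \<open>Freezing the path leaves a single exponential variable, to which the substitution along
  that path applies.\<close>

lemma nn_integral_clock:
 assumes F: "(\<lambda>(t, w). F t w) \<in> bm (borel \<Otimes>\<^sub>M allpast B)"
 shows "(\<E> w. F (tau x w) w) =
  (\<E> w. (\<integral>\<^sup>+t. F t w * ennreal (g (x + B t w) * exp (- K x t w)) * indicator {0..} t \<partial>lborel))"
proof -
 let ?t = "\<lambda>w e. clock_inv (\<lambda>t. K x t w) e"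
 have tm: "(\<lambda>z. ?t (fst z) (E (snd z))) \<in> bm (allpast B \<Otimes>\<^sub>M SE)"
 proof (rule measurable_from_nonneg_levels)
  have c: "0 <= ?t (fst z) e" "0 <= y ==> ?t (fst z) e <= y \<longleftrightarrow> e <= K x y (fst z)"
   if "z \<in> space (allpast B \<Otimes>\<^sub>M SE)" for z y e
   using that clock.clock_inv_nonneg clock.clock_inv_le_iff by (auto simp: space_pair_measure) (metis clock_K)+
  show "0 <= ?t (fst z) (E (snd z))" if "z \<in> space (allpast B \<Otimes>\<^sub>M SE)" for z by (rule c(1)[OF that])
  fix y :: real assume y: "0 <= y"
  have [measurable]: "(\<lambda>z. E (snd z)) \<in> bm (allpast B \<Otimes>\<^sub>M SE)"
   by (rule measurable_compose[OF measurable_snd E_SE])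
  have [measurable]: "(\<lambda>z. K x y (fst z)) \<in> bm (allpast B \<Otimes>\<^sub>M SE)"
   by (rule measurable_K) auto
  have "{z \<in> space (allpast B \<Otimes>\<^sub>M SE). E (snd z) <= K x y (fst z)} \<in> sets (allpast B \<Otimes>\<^sub>M SE)" by measurable
  thus "{z \<in> space (allpast B \<Otimes>\<^sub>M SE). ?t (fst z) (E (snd z)) <= y} \<in> sets (allpast B \<Otimes>\<^sub>M SE)"
   by (simp add: c(2)[OF _ y] cong: conj_cong)
 qed
 have FF: "(\<lambda>(w, w'). F (?t w (E w')) w) \<in> bm (allpast B \<Otimes>\<^sub>M SE)"
 proof -
  have "(\<lambda>z. (?t (fst z) (E (snd z)), fst z)) \<in> measurable (allpast B \<Otimes>\<^sub>M SE) (borel \<Otimes>\<^sub>M allpast B)"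
   using tm by (intro measurable_Pair) auto
  from measurable_compose[OF this F] show ?thesis by (simp add: split_beta)
 qed
 have "(\<E> w. F (tau x w) w) = (\<E> w. (\<E> w'. F (?t w (E w')) w))"
  unfolding tau_def by (rule nn_integral_freeze[OF subalgebra_allpast[OF BM] subalgebra_SE E_indep FF])
 also have "... = (\<E> w. (\<integral>\<^sup>+t. F t w * ennreal (g (x + B t w) * exp (- K x t w)) * indicator {0..} t \<partial>lborel))"
 proof (rule nn_integral_cong)
  fix w assume wt: "w \<in> space M"
  then obtain c where c: "clock (\<lambda>s. g (x + B s w)) c (\<lambda>t. K x t w)" using clock_K by blast
  have Fm: "(\<lambda>t. F t w) \<in> bm borel" using measurable_Pair1[OF F, of w] wt by simp
  have cm: "?t w \<in> bm borel" by (rule borel_measurable_mono[OF clock.clock_inv_mono[OF c]])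
  have "(\<E> w'. F (?t w (E w')) w) = (\<integral>\<^sup>+e. ennreal (exponential_density 1 e) * F (?t w e) w \<partial>lborel)"
   by (rule distributed_nn_integral[OF E_exp, symmetric]) (use measurable_compose[OF cm Fm] in simp)
  also have "... = (\<integral>\<^sup>+t. F t w * ennreal (g (x + B t w) * exp (- K x t w)) * indicator {0..} t \<partial>lborel)"
   by (rule clock.substitution[OF c Fm])
  finally show "(\<E> w'. F (?t w (E w')) w) = (\<integral>\<^sup>+t. F t w * ennreal (g (x + B t w) * exp (- K x t w)) * indicator {0..} t \<partial>lborel)" .
 qed
 finally show ?thesis .
qed

lemma nn_integral_survival:
 assumes G: "G \<in> bm (allpast B)" and b: "0 <= b"
 shows "(\<E> w. G w * indicator {w. b < tau x w} w) = (\<E> w. G w * ennreal (exp (- K x b w)))"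
proof -
 have [measurable]: "(\<lambda>z. E (snd z)) \<in> bm (allpast B \<Otimes>\<^sub>M SE)"
  by (rule measurable_compose[OF measurable_snd E_SE])
 have [measurable]: "(\<lambda>z. K x b (fst z)) \<in> bm (allpast B \<Otimes>\<^sub>M SE)"
  by (rule measurable_K) auto
 have [measurable]: "(\<lambda>z. G (fst z)) \<in> bm (allpast B \<Otimes>\<^sub>M SE)"
  by (rule measurable_compose[OF measurable_fst G])
 have F: "(\<lambda>(w, w'). G w * (if K x b w < E w' then 1 else 0)) \<in> bm (allpast B \<Otimes>\<^sub>M SE)"
  unfolding split_beta by measurable
 have "(\<E> w. G w * indicator {w. b < tau x w} w) = (\<E> w. G w * (if K x b w < E w then 1 else 0))"
  by (rule nn_integral_cong) (use tau_le_iff[OF _ b, of _ x] in \<open>auto simp: indicator_def not_le[symmetric]\<close>)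
 also have "... = (\<E> w. (\<E> w'. G w * (if K x b w < E w' then 1 else 0)))"
  by (rule nn_integral_freeze[OF subalgebra_allpast[OF BM] subalgebra_SE E_indep F])
 also have "... = (\<E> w. G w * ennreal (exp (- K x b w)))"
 proof (rule nn_integral_cong)
  fix w assume wt: "w \<in> space M"
  then obtain c where c: "clock (\<lambda>s. g (x + B s w)) c (\<lambda>t. K x t w)" using clock_K by blast
  have K0: "0 <= K x b w" using clock.K_mono[OF c order_refl b] clock.K_0[OF c] by simp
  have [measurable]: "E \<in> bm M" by (rule E_measurable)
  have "(\<E> w'. G w * (if K x b w < E w' then 1 else 0)) = (\<E> w'. G w * indicator {w' \<in> space M. K x b w < E w'} w')"
   by (rule nn_integral_cong) (auto simp: indicator_def)
  also have "... = G w * emeasure M {w' \<in> space M. K x b w < E w'}"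
   by (rule nn_integral_cmult_indicator) measurable
  also have "... = G w * ennreal (exp (- K x b w))"
   using exponential_distributedD_gt[OF E_exp K0] by (simp add: emeasure_eq_measure)
  finally show "(\<E> w'. G w * (if K x b w < E w' then 1 else 0)) = G w * ennreal (exp (- K x b w))" .
 qed
 finally show ?thesis .
qed

lemma expw_K: "0 <= t ==> w \<in> space M ==> expw (\<lambda>y. - g y - dl) x B t w = exp (- dl * t) * exp (- K x t w)"
proof -
 assume t: "0 <= t" and wt: "w \<in> space M"
 have "integral {0..t} (\<lambda>s. - g (x + B s w) - dl) = integral {0..t} (\<lambda>s. - g (x + B s w)) - integral {0..t} (\<lambda>s. dl)"
  by (intro Henstock_Kurzweil_Integration.integral_diff integrable_continuous_interval continuous_intros
     BM_path_continuous[OF BM g_continuous wt]) auto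
 also have "... = - K x t w - dl * t" using t by (simp add: K_def)
 finally have I: "integral {0..t} (\<lambda>s. - g (x + B s w) - dl) = - K x t w - dl * t" .
 show ?thesis unfolding expw_def I by (simp add: mult.commute flip: exp_add)
qed

text \<open>The discounted mean of \<open>\<xi> * p * H\<close> at time t over surviving paths, with
  the survival indicator replaced by its conditional probability given the path. The
  \<open>max 0\<close> keeps the integrand measurable in t on the whole line.\<close>

definition mass :: "('a => real) => (real => real) => real => real => (real => real) => real => ennreal" where
 "mass \<xi> H x dl p t = (\<E> w. ennreal (\<xi> w * (exp (- dl * t) * exp (- K x t w)) * (p (x + B (max 0 t) w) * H (x + B (max 0 t) w))))"

context
 fixes l :: real and r H H' :: "real => real" and x a dl :: real and \<xi> :: "'a => real"
 assumes fl: "floquet l r H H'" and r: "per_lip r" and a: "0 <= a"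
  and \<xi>: "\<xi> \<in> bm (past B a)" "!!w. w \<in> space M ==> 0 <= \<xi> w \<and> \<xi> w <= 1"
begin

abbreviation "A t w \<equiv> expw (\<lambda>y. - g y - dl) x B t w"
abbreviation "N \<equiv> mass \<xi> H x dl"

lemma q_per_lip: "per_lip (\<lambda>y. - g y - dl)"
 using per_lip_add[OF per_lip_mult[OF per_lip_const[of "-1"] g] per_lip_const[of "-dl"]] by simp

lemma floquet_measurable [measurable]: "H \<in> bm borel"
 by (rule borel_measurable_continuous_onI[OF floquet_continuous(1)[OF fl]])

lemma mass_integrand_measurable:
 assumes p: "per_lip p"
 shows "(\<lambda>z. ennreal (\<xi> (snd z) * (exp (- dl * fst z) * exp (- K x (fst z) (snd z)))
   * (p (x + B (max 0 (fst z)) (snd z)) * H (x + B (max 0 (fst z)) (snd z))))) \<in> bm (lborel \<Otimes>\<^sub>M M)"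
proof -
 have s: "snd \<in> measurable (lborel \<Otimes>\<^sub>M M) (allpast B)"
  by (rule measurable_compose[OF measurable_snd subalgebra_measurable_id[OF subalgebra_allpast[OF BM]]])
 have h: "(\<lambda>z. h (x + B (max 0 (fst z)) (snd z))) \<in> bm (lborel \<Otimes>\<^sub>M M)" if "h \<in> bm borel" for h
  by (rule measurable_B[OF s _ that]) auto
 have [measurable]: "(\<lambda>z. K x (fst z) (snd z)) \<in> bm (lborel \<Otimes>\<^sub>M M)" by (rule measurable_K[OF s]) auto
 note [measurable] = h[OF borel_measurable_continuous_onI[OF per_lip_continuous[OF p]]] h[OF floquet_measurable]
  measurable_compose[OF measurable_snd measurable_from_subalg[OF subalgebra_past[OF BM] \<xi>(1)]]
 show ?thesis by measurable
qed

lemma mass_measurable: "per_lip p ==> N p \<in> bm lborel"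
 using borel_measurable_nn_integral_fst[OF mass_integrand_measurable, of p] by (simp add: mass_def[abs_def])

lemma mass_eq:
 assumes p: "per_lip p" "!!y. 0 <= p y" and t: "0 <= t"
 shows "N p t = ennreal (expectation (\<lambda>w. \<xi> w * A t w * (p (x + B t w) * H (x + B t w))))"
proof -
 note cq = per_lip_continuous[OF q_per_lip]
 obtain Q where Q: "Q > 0" "!!y. \<bar>- g y - dl\<bar> <= Q" using per_lip_bounded[OF q_per_lip] by blast
 obtain P where P: "P > 0" "!!y. \<bar>p y\<bar> <= P" using per_lip_bounded[OF p(1)] by blast
 obtain C where C: "integrable M (\<lambda>w. H (x + B t w))"
  using floquet_moment[OF BM fl r, where b = t and x = x] t by (metis order_refl)
 have pos: "0 < H y" for y using floquetD(1)[OF fl] .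
 have cp: "continuous_on UNIV (\<lambda>y. p y * H y)"
  by (intro continuous_intros floquet_continuous(1)[OF fl] per_lip_continuous[OF p(1)])
 have m: "(\<lambda>w. \<xi> w * A t w * (p (x + B t w) * H (x + B t w))) \<in> bm M"
  using measurable_from_subalg[OF subalgebra_past[OF BM] \<xi>(1)] measurable_from_subalg[OF subalgebra_past[OF BM] expw_past[OF BM cq t, of x]]
   BM_path_borel(2)[OF BM cp t, of x] by simp
 have i: "integrable M (\<lambda>w. \<xi> w * A t w * (p (x + B t w) * H (x + B t w)))"
 proof (rule Bochner_Integration.integrable_bound[OF integrable_mult_right[OF C, of "exp (Q * t) * P"] m], rule AE_I2, rule abs_le_imp_norm_le)
  fix w assume wt: "w \<in> space M"
  have "\<bar>\<xi> w\<bar> * \<bar>A t w\<bar> * (\<bar>p (x + B t w)\<bar> * \<bar>H (x + B t w)\<bar>) <= 1 * exp (Q * t) * (P * H (x + B t w))"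
   using \<xi>(2)[OF wt] expw_le[OF BM cq wt t Q(2), of x] expw_pos[of "\<lambda>y. - g y - dl" x B t w] P pos[of "x + B t w"]
   by (intro mult_mono) auto
  thus "\<bar>\<xi> w * A t w * (p (x + B t w) * H (x + B t w))\<bar> <= exp (Q * t) * P * H (x + B t w)"
   by (simp only: abs_mult mult_1 mult.assoc)
 qed
 have "N p t = (\<E> w. ennreal (\<xi> w * A t w * (p (x + B t w) * H (x + B t w))))"
  unfolding mass_def by (rule nn_integral_cong) (use t in \<open>simp add: expw_K max_def\<close>)
 also have "... = ennreal (expectation (\<lambda>w. \<xi> w * A t w * (p (x + B t w) * H (x + B t w))))"
  by (rule nn_integral_eq_integral[OF i], rule AE_I2)
    (use \<xi>(2) expw_pos pos p(2) in \<open>auto intro!: mult_nonneg_nonneg simp: less_imp_le\<close>)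
 finally show ?thesis .
qed

lemma mass_mono: "(!!y. p y <= q y) ==> N p t <= N q t"
 unfolding mass_def using \<xi>(2) less_imp_le[OF floquetD(1)[OF fl]]
 by (intro nn_integral_mono ennreal_leI mult_left_mono mult_right_mono) auto

lemma mass_cmult: "per_lip p ==> 0 <= ap ==> N (\<lambda>y. ap * p y) t = ennreal ap * N p t"
 using measurable_Pair2[OF mass_integrand_measurable, of p t]
 by (simp add: mass_def nn_integral_cmult[symmetric] ennreal_mult'[symmetric] mult_ac)

text \<open>With killing rate g and discount dl, the generator multiplies H by r - g - dl = - p, so
  p is the rate at which mass disappears. Since p is nonnegative, the balance can be written without
  subtraction.\<close>

lemma mass_fk:
 assumes b: "a <= b" and p: "p = (\<lambda>y. g y + dl - r y)" "!!y. 0 <= p y"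
 shows "N (\<lambda>_. 1) a = N (\<lambda>_. 1) b + (\<integral>\<^sup>+t. N p t * indicator {a<..b} t \<partial>lborel)"
proof -
 let ?\<psi> = "\<lambda>t. expectation (\<lambda>w. \<xi> w * A t w * (p (x + B t w) * H (x + B t w)))"
 let ?ph = "\<lambda>t. expectation (\<lambda>w. \<xi> w * A t w * H (x + B t w))"
 have \<xi>1: "\<bar>\<xi> w\<bar> <= 1" if "w \<in> space M" for w using \<xi>(2)[OF that] by simp
 have pos: "0 < H y" for y using floquetD(1)[OF fl] .
 have pl: "per_lip p" unfolding p(1)
  using per_lip_add[OF per_lip_add[OF g per_lip_const[of dl]] per_lip_mult[OF per_lip_const[of "-1"] r]] by simp
 note fk = feynman_kac[OF BM fl r q_per_lip a b \<xi>(1) \<xi>1, of x]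
 have \<psi>: "?\<psi> = (\<lambda>t. - expectation (\<lambda>w. \<xi> w * A t w * ((r (x + B t w) + (- g (x + B t w) - dl)) * H (x + B t w))))"
  by (rule ext, subst Bochner_Integration.integral_minus[symmetric], rule Bochner_Integration.integral_cong)
    (auto simp: p(1) algebra_simps)
 have c: "continuous_on {a..b} ?\<psi>" unfolding \<psi> by (intro continuous_intros fk(1))
 have eq: "?ph a = ?ph b + integral {a..b} ?\<psi>" unfolding \<psi> using fk(2) by simp
 have nn: "0 <= ?\<psi> t" "0 <= ?ph t" for t
  by (rule integral_nonneg_AE, rule AE_I2, use \<xi>(2) expw_pos pos p(2) in \<open>auto intro!: mult_nonneg_nonneg simp: less_imp_le\<close>)+
 have one: "N (\<lambda>_. 1) t = ennreal (?ph t)" if "0 <= t" for t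
  using mass_eq[OF per_lip_const _ that, of 1] by simp
 have "(\<integral>\<^sup>+t. N p t * indicator {a<..b} t \<partial>lborel) = (\<integral>\<^sup>+t. ennreal (?\<psi> t) * indicator {a<..b} t \<partial>lborel)"
  by (rule nn_integral_cong) (use a mass_eq[OF pl p(2)] in \<open>auto simp: indicator_def\<close>)
 also have "... = ennreal (integral {a..b} ?\<psi>)" by (rule nn_integral_Ioc_continuous[OF c nn(1)])
 finally show ?thesis
  using a b integral_nonneg[OF integrable_continuous_interval[OF c] nn(1)] nn(2) by (simp add: one eq del: ennreal_plus add: ennreal_plus[symmetric])
qed

text \<open>Given the path, death has density g exp(- K), so the weight collected at death is the
  time integral of the mass tested against g.\<close>

lemma mass_at_death:
 assumes S: "S \<subseteq> {a..}" "S \<in> sets borel"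
 shows "(\<E> w. ennreal (\<xi> w * exp (- dl * tau x w) * H (x + B (tau x w) w)) * indicator S (tau x w))
  = (\<integral>\<^sup>+t. N g t * indicator S t \<partial>lborel)"
proof -
 let ?F = "\<lambda>t w. ennreal (\<xi> w * exp (- dl * t) * H (x + B (max 0 t) w)) * indicator S t"
 let ?G = "\<lambda>t w. ennreal (\<xi> w * (exp (- dl * t) * exp (- K x t w)) * (g (x + B (max 0 t) w) * H (x + B (max 0 t) w)))"
 have [measurable]: "(\<lambda>z. H (x + B (max 0 (fst z)) (snd z))) \<in> bm (borel \<Otimes>\<^sub>M allpast B)"
  by (rule measurable_B) auto
 note [measurable] = S(2)
  measurable_compose[OF measurable_snd past_allpast[OF \<xi>(1)]]
 have F: "(\<lambda>(t, w). ?F t w) \<in> bm (borel \<Otimes>\<^sub>M allpast B)" unfolding split_beta by measurable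
 note [measurable] = mass_integrand_measurable[OF g]
 have G: "(\<lambda>(t, w). ?G t w * indicator S t) \<in> bm (lborel \<Otimes>\<^sub>M M)" unfolding split_beta by measurable
 interpret P: pair_sigma_finite lborel M
  by (intro pair_sigma_finite.intro sigma_finite_lborel sigma_finite_measure_axioms)
 have "(\<E> w. ennreal (\<xi> w * exp (- dl * tau x w) * H (x + B (tau x w) w)) * indicator S (tau x w)) = (\<E> w. ?F (tau x w) w)"
  by (rule nn_integral_cong) (simp add: tau_nonneg max_def)
 also have "... = (\<E> w. (\<integral>\<^sup>+t. ?F t w * ennreal (g (x + B t w) * exp (- K x t w)) * indicator {0..} t \<partial>lborel))"
  by (rule nn_integral_clock[OF F])
 also have "... = (\<E> w. (\<integral>\<^sup>+t. ?G t w * indicator S t \<partial>lborel))"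
 proof (intro nn_integral_cong)
  fix w t assume wt: "w \<in> space M"
  show "?F t w * ennreal (g (x + B t w) * exp (- K x t w)) * indicator {0..} t = ?G t w * indicator S t"
  proof (cases "t \<in> S")
   case True
   hence "0 <= t" using a S(1) by auto
   thus ?thesis using True \<xi>(2)[OF wt] gpos[of "x + B t w"] floquetD(1)[OF fl, of "x + B t w"]
    by (simp add: max_def ennreal_mult[symmetric] mult_ac)
  qed simp
 qed
 also have "... = (\<integral>\<^sup>+t. (\<E> w. ?G t w * indicator S t) \<partial>lborel)" using P.Fubini'[OF G] by simp
 also have "... = (\<integral>\<^sup>+t. N g t * indicator S t \<partial>lborel)"
  unfolding mass_def by (intro nn_integral_cong) (simp split: split_indicator)
 finally show ?thesis .
qed

lemma mass_alive:
 assumes b: "a <= b"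
 shows "(\<E> w. ennreal (\<xi> w * exp (- dl * b) * H (x + B b w)) * indicator {w. b < tau x w} w) = N (\<lambda>_. 1) b"
proof -
 have b0: "0 <= b" using a b by simp
 have G: "(\<lambda>w. ennreal (\<xi> w * exp (- dl * b) * H (x + B b w))) \<in> bm (allpast B)"
  using past_allpast[OF \<xi>(1)] measurable_allpast[OF b0, of B] by simp
 show ?thesis
  unfolding nn_integral_survival[OF G b0] mass_def
  by (rule nn_integral_cong) (use b0 \<xi>(2) less_imp_le[OF floquetD(1)[OF fl]] in \<open>simp add: max_def ennreal_mult''[symmetric] mult_ac\<close>)
qed

text \<open>For dl = gamma and r = gamma - m g the mass disappears at rate (1 + m) g, a multiple of
  the death rate: what is lost equals the mean family size times the weight at death. The start time
  a and the factor \<open>\<xi>\<close> allow conditioning on what was observed of the path before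
  a.\<close>

lemma killed_balance:
 assumes b: "a <= b" and ap: "0 < ap" "!!y. g y + dl - r y = ap * g y"
 shows "(\<E> w. ennreal (\<xi> w * exp (- dl * a) * H (x + B a w)) * indicator {w. a < tau x w} w)
  = (\<E> w. ennreal (\<xi> w * exp (- dl * b) * H (x + B b w)) * indicator {w. b < tau x w} w)
   + ennreal ap * (\<E> w. ennreal (\<xi> w * exp (- dl * tau x w) * H (x + B (tau x w) w)) * indicator {a<..b} (tau x w))"
proof -
 have S: "{a<..b} \<subseteq> {a..}" "{a<..b} \<in> sets borel" by auto
 note [measurable] = mass_measurable[OF g]
 have "N (\<lambda>_. 1) a = N (\<lambda>_. 1) b + (\<integral>\<^sup>+t. N (\<lambda>y. ap * g y) t * indicator {a<..b} t \<partial>lborel)"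
  by (rule mass_fk[OF b]) (use ap gpos in \<open>auto simp: less_imp_le\<close>)
 thus ?thesis
  unfolding mass_at_death[OF S] mass_alive[OF b] mass_alive[OF order_refl] mass_cmult[OF g less_imp_le[OF ap(1)]]
  by (simp add: nn_integral_cmult mult.assoc)
qed

end

text \<open>The horizon is sent to infinity. For the upper bound the surviving mass is simply
  dropped; for the lower bound it has to vanish, which the margin \<open>ep\<close> ensures.\<close>

lemma killed_total:
 fixes x dl :: real
 assumes fl: "floquet l r H H'" and r: "per_lip r"
 defines "D \<equiv> \<integral>\<^sup>+w. ennreal (exp (- dl * tau x w) * H (x + B (tau x w) w)) \<partial>M"
 shows killed_total_le: "0 < ap ==> (!!y. ap * g y <= g y + dl - r y) ==> ennreal ap * D <= ennreal (H x)"
  and killed_total_ge: "0 < ap ==> 0 < ep ==> (!!y. g y + dl - r y <= ap * g y) ==> (!!y. ep <= g y + dl - r y) ==> ennreal (H x) <= ennreal ap * D"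
proof -
 let ?N = "mass (\<lambda>_. 1) H x" and ?p = "\<lambda>dl y. g y + dl - r y"
 have x1: "(\<lambda>_. 1::real) \<in> bm (past B 0)" by simp
 have x2: "0 <= (1::real) \<and> (1::real) <= 1" by simp
 note ctx = fl r order_refl x1 x2
 have N0: "?N dl (\<lambda>_. 1) 0 = ennreal (H x)" for dl
 proof -
  have "?N dl (\<lambda>_. 1) 0 = (\<E> w. ennreal (H x))"
   unfolding mass_def by (rule nn_integral_cong) (simp add: BM_zero[OF BM] K_def)
  thus ?thesis by (simp add: emeasure_space_1)
 qed
 note [measurable] = mass_measurable[OF ctx g, where x = x and dl = dl]
 have "D = (\<integral>\<^sup>+t. ?N dl g t * indicator {0..} t \<partial>lborel)"
 proof -
  have "D = (\<E> w. ennreal (1 * exp (- dl * tau x w) * H (x + B (tau x w) w)) * indicator {0..} (tau x w))"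
   unfolding D_def by (rule nn_integral_cong) (simp add: tau_nonneg)
  also have "... = (\<integral>\<^sup>+t. ?N dl g t * indicator {0..} t \<partial>lborel)" by (rule mass_at_death[OF ctx]) auto
  finally show ?thesis .
 qed
 hence "ennreal ap * D = (\<integral>\<^sup>+t. ennreal ap * ?N dl g t * indicator {0..} t \<partial>lborel)" for ap
  by (simp add: nn_integral_cmult mult.assoc)
 hence D: "ennreal ap * D = (\<integral>\<^sup>+t. ?N dl (\<lambda>y. ap * g y) t * indicator {0..} t \<partial>lborel)" if "0 < ap" for ap
  using mass_cmult[OF ctx g, where ap = ap and x = x and dl = dl] that by (simp add: less_imp_le)
 have fk: "ennreal (H x) = ?N dl (\<lambda>_. 1) (real n) + (\<integral>\<^sup>+t. ?N dl (?p dl) t * indicator {0..real n} t \<partial>lborel)"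
  if "!!y. 0 <= ?p dl y" for n dl
 proof -
  have "(\<integral>\<^sup>+t. ?N dl (?p dl) t * indicator {0<..real n} t \<partial>lborel) = (\<integral>\<^sup>+t. ?N dl (?p dl) t * indicator {0..real n} t \<partial>lborel)"
   by (rule nn_integral_cong_AE) (use AE_lborel_singleton[of 0] in \<open>eventually_elim, auto simp: indicator_def\<close>)
  thus ?thesis using mass_fk[OF ctx _ refl that, where b = "real n" and x = x] by (simp add: N0)
 qed
 {
  assume ap: "0 < ap" and le: "!!y. ap * g y <= ?p dl y"
  have nn: "0 <= ?p dl y" for y using le[of y] mult_pos_pos[OF ap gpos[of y]] by linarith
  have [measurable]: "?N dl (\<lambda>y. ap * g y) \<in> bm lborel"
   by (rule mass_measurable[OF ctx per_lip_mult[OF per_lip_const g]])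
  have "(\<lambda>n. \<integral>\<^sup>+t. ?N dl (\<lambda>y. ap * g y) t * indicator {0..real n} t \<partial>lborel) \<longlonglongrightarrow> ennreal ap * D"
   unfolding D[OF ap] by (rule nn_integral_exhaust[OF _ _ filterlim_real_sequentially]) (auto simp: incseq_def)
  moreover have "(\<integral>\<^sup>+t. ?N dl (\<lambda>y. ap * g y) t * indicator {0..real n} t \<partial>lborel) <= ennreal (H x)" for n
   unfolding fk[OF nn, of n]
   by (rule order_trans[OF nn_integral_mono[OF mult_right_mono[OF mass_mono[OF ctx le]]]]) simp_all
  ultimately show "ennreal ap * D <= ennreal (H x)" by (intro LIMSEQ_le_const2) auto
 next
  assume ap: "0 < ap" and ep: "0 < ep" and le: "!!y. ?p dl y <= ap * g y" and ge: "!!y. ep <= ?p dl y"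
  have bound: "ennreal (H x) <= ennreal (exp (- ep * real n)) * ennreal (H x) + ennreal ap * D" for n
  proof -
   \<comment> \<open>Thanks to the margin, the balance still holds with discount dl - ep and bounds
     that mass by H x; restoring the full discount gives the factor exp(- ep n).\<close>
   have e: "exp (- dl * real n) = exp (- (dl - ep) * real n) * exp (- ep * real n)"
    by (simp add: algebra_simps flip: exp_add)
   have "?N dl (\<lambda>_. 1) (real n) = ?N (dl - ep) (\<lambda>_. exp (- ep * real n)) (real n)"
    unfolding mass_def e by (simp only: mult_ac mult_1_left mult_1_right)
   also have "... = ennreal (exp (- ep * real n)) * ?N (dl - ep) (\<lambda>_. 1) (real n)"
    using mass_cmult[OF ctx per_lip_const[of 1], where ap = "exp (- ep * real n)" and x = x and dl = "dl - ep"] by simp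
   also have "... <= ennreal (exp (- ep * real n)) * ennreal (H x)"
    using fk[of "dl - ep" n] ge by (intro mult_left_mono) (simp_all add: algebra_simps)
   finally have n: "?N dl (\<lambda>_. 1) (real n) <= ennreal (exp (- ep * real n)) * ennreal (H x)" .
   have "(\<integral>\<^sup>+t. ?N dl (?p dl) t * indicator {0..real n} t \<partial>lborel) <= ennreal ap * D"
    unfolding D[OF ap] by (intro nn_integral_mono mult_mono mass_mono[OF ctx le]) (auto simp: indicator_def)
   from add_mono[OF n this] show ?thesis unfolding fk[OF order_trans[OF less_imp_le[OF ep] ge], of n, symmetric] .
  qed
  have "(\<lambda>n. exp (- ep * real n)) \<longlonglongrightarrow> 0" using ep
   by (intro filterlim_compose[OF exp_at_bot] filterlim_tendsto_neg_mult_at_bot[OF tendsto_const _ filterlim_real_sequentially]) simp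
  hence "(\<lambda>n. ennreal (exp (- ep * real n)) * ennreal (H x) + ennreal ap * D) \<longlonglongrightarrow> ennreal 0 * ennreal (H x) + ennreal ap * D"
   by (intro tendsto_add tendsto_const tendsto_mult_ennreal tendsto_ennrealI) auto
  from LIMSEQ_le_const[OF this, of "ennreal (H x)"] bound show "ennreal (H x) <= ennreal ap * D" by auto
 }
qed

end

section \<open>Independence in the branching system\<close>

primrec ancs :: "label => label set" where
 "ancs [] = {}"
| "ancs (i # v) = insert v (ancs v)"

lemma ancs_length: "wt \<in> ancs v ==> length wt < length v"
 by (induction v) auto

lemma not_ancs_self: "v \<notin> ancs v" using ancs_length[of v v] by auto

lemma integral_translate:
 fixes f :: "real => real"
 assumes "f integrable_on {b..b + t}"
 shows "integral {b..b + t} f = integral {0..t} (\<lambda>s. f (s + b))"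
proof -
 have "(f has_integral integral {b..b+t} f) (cbox b (b + t))" using assms by (simp add: has_integral_integral)
 from has_integral_affinity'[OF this, of 1 b] show ?thesis by (simp add: integral_unique)
qed

context prob_space begin

lemma subalgebra_sigma:
 assumes "\<G> \<subseteq> sets M" shows "subalgebra M (sigma (space M) \<G>)"
proof -
 have "\<G> \<subseteq> Pow (space M)" using assms sets.sets_into_space by blast
 thus ?thesis unfolding subalgebra_def using sets.sigma_sets_subset[OF assms] by simp
qed

lemma path_events_subset:
 assumes "standard_BM Y" shows "path_events M Y \<subseteq> sets M"
proof -
 have "(\<lambda>w. \<lambda>s\<in>{0..}. Y s w) \<in> measurable M (\<Pi>\<^sub>M s\<in>{0..}. borel)"
  by (rule measurable_restrict) (use BM_measurable[OF assms] in auto)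
 thus ?thesis unfolding path_events_def by (intro sets_image_in_sets) auto
qed

lemma path_events_measurable:
 assumes N: "space N = space M" "path_events M Y \<subseteq> sets N" and s: "0 <= s"
 shows "Y s \<in> bm N"
proof -
 have 1: "(\<lambda>w. \<lambda>s\<in>{0..}. Y s w) \<in> measurable (vimage_algebra (space M) (\<lambda>w. \<lambda>s\<in>{0..}. Y s w) (\<Pi>\<^sub>M s\<in>{0..}. borel)) (\<Pi>\<^sub>M s\<in>{0..}. borel)"
  by (rule measurable_vimage_algebra1) (auto simp: space_PiM)
 have 2: "(\<lambda>f. f s) \<in> bm (\<Pi>\<^sub>M s\<in>{0..}. (borel :: real measure))" using s by simp
 have "(\<lambda>w. (\<lambda>s\<in>{0..}. Y s w) s) \<in> bm (vimage_algebra (space M) (\<lambda>w. \<lambda>s\<in>{0..}. Y s w) (\<Pi>\<^sub>M s\<in>{0..}. borel))"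
  by (rule measurable_compose[OF 1 2])
 hence "Y s \<in> bm (vimage_algebra (space M) (\<lambda>w. \<lambda>s\<in>{0..}. Y s w) (\<Pi>\<^sub>M s\<in>{0..}. borel))"
  using s by simp
 thus ?thesis using N by (auto simp: measurable_def path_events_def)
qed

end

lemma (in prob_space) offspring_events_subset:
 assumes "Y \<in> measurable M (count_space UNIV)" shows "offspring_events M Y \<subseteq> sets M"
 unfolding offspring_events_def using assms by (intro sets_image_in_sets) auto

lemma (in prob_space) offspring_events_measurable:
 assumes "space N = space M" "offspring_events M Y \<subseteq> sets N"
 shows "Y \<in> measurable N (count_space UNIV)"
proof -
 have "Y \<in> measurable (vimage_algebra (space M) Y (count_space UNIV)) (count_space UNIV)"
  by (rule measurable_vimage_algebra1) auto
 thus ?thesis using assms by (auto simp: measurable_def offspring_events_def)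
qed

lemma (in prob_space) lifetime_events_measurable:
 assumes "space N = space M" "lifetime_events M Y \<subseteq> sets N"
 shows "Y \<in> bm N"
proof -
 have "Y \<in> bm (vimage_algebra (space M) Y borel)"
  by (rule measurable_vimage_algebra1) auto
 thus ?thesis using assms by (auto simp: measurable_def lifetime_events_def)
qed

section \<open>Recovering exponential clocks from the lifetimes\<close>

locale bbm_env = bbmpe M g p x B T A
 for M :: "'w measure" and g p x B T A +
 assumes g: "per_lip g" and gpos: "!!y. 0 < g y"
begin

abbreviation "bt v w \<equiv> birth T v w"
abbreviation "kids v w \<equiv> ennreal (1 + real (A v w))"
abbreviation "bp v w \<equiv> birth_place x B T v w"
definition dp :: "label => 'w => real" where "dp v w = bp v w + B v (T v w) w"
definition clk :: "label => real => real => 'w => real" where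
 "clk v y t w = integral {0..t} (\<lambda>s. g (y + B v s w))"
text \<open>The hazard accumulated up to the death of v. The survival axiom makes it a standard
  exponential variable, whatever the path and the birth place, and \<open>T v\<close> is recovered
  from it by inverting the accumulated hazard.\<close>

definition EE :: "label => 'w => real" where "EE v w = clk v (bp v w) (T v w) w"

lemma g_cont: "continuous_on UNIV g" by (rule per_lip_continuous[OF g])

lemma clock_clk:
 assumes "w \<in> space M"
 obtains c where "clock (\<lambda>s. g (y + B v s w)) c (\<lambda>t. clk v y t w)"
proof -
 obtain c where c: "c > 0" "!!y. c <= g y"
  using periodic_lower_bound[OF g_cont _ gpos] g by (auto simp: per_lip_def)
 show ?thesis
  by (rule that[of c], unfold_locales) (use c BM_path_continuous[OF motion g_cont assms] in \<open>auto simp: clk_def\<close>)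
qed

lemma T_nonneg: "w \<in> space M ==> 0 <= T v w" by (rule lifetime_nonneg)

lemma birth_nonneg: "w \<in> space M ==> 0 <= bt v w"
 by (induction v) (auto intro!: add_nonneg_nonneg T_nonneg)

lemma measurable_clk:
 assumes "!!s. 0 <= s ==> B v s \<in> bm N" "space N = space M"
  "f \<in> measurable K N" "y \<in> bm K" "ta \<in> bm K"
 shows "(\<lambda>z. clk v (y z) (ta z) (f z)) \<in> bm K"
 unfolding clk_def
 by (rule measurable_time_integral[OF assms(1) _ assms(3,5,4) g_cont])
   (use BM_continuous[OF motion] assms(2) in auto)

lemma measurable_dp:
 assumes N: "!!s. 0 <= s ==> B v s \<in> bm N" "space N = space M"
  and "T v \<in> bm N" "bp v \<in> bm N"
 shows "dp v \<in> bm N"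
proof -
 have "(\<lambda>w. B v (T v w) w) \<in> bm N"
  by (rule continuous_process_at_random_time[where N = N and f = "\<lambda>w. w"])
    (use assms T_nonneg BM_continuous[OF motion] in auto)
 thus ?thesis unfolding dp_def[abs_def] using assms(4) by simp
qed

lemma clk_T: "w \<in> space M ==> clock_inv (\<lambda>t. clk v (bp v w) t w) (EE v w) = T v w"
proof -
 assume wt: "w \<in> space M"
 then obtain c where c: "clock (\<lambda>s. g (bp v w + B v s w)) c (\<lambda>t. clk v (bp v w) t w)" using clock_clk by blast
 show ?thesis unfolding EE_def by (rule clock.clock_inv_K[OF c T_nonneg[OF wt]])
qed

lemma T_le_iff: "w \<in> space M ==> 0 <= t ==> T v w <= t \<longleftrightarrow> EE v w <= clk v (bp v w) t w"
 unfolding EE_def using clock.K_le_iff T_nonneg by (metis clock_clk)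

lemma clk_nonneg: "w \<in> space M ==> 0 <= t ==> 0 <= clk v y t w"
 unfolding clk_def by (intro integral_nonneg integrable_continuous_interval BM_path_continuous[OF motion g_cont]) (auto simp: less_imp_le[OF gpos])

lemma EE_nonneg: "w \<in> space M ==> 0 <= EE v w"
 unfolding EE_def by (rule clk_nonneg[OF _ T_nonneg])

lemma measurable_T:
 assumes N: "space N = space M" "!!s. 0 <= s ==> B v s \<in> bm N"
  "EE v \<in> bm N" "bp v \<in> bm N"
 shows "T v \<in> bm N"
proof (rule measurable_from_nonneg_levels)
 show "w \<in> space N ==> 0 <= T v w" for w using T_nonneg N(1) by simp
 fix y :: real assume y: "0 <= y"
 have "(\<lambda>w. clk v (bp v w) y w) \<in> bm N" by (rule measurable_clk[where N = N]) (use N in auto)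
 hence "{w \<in> space N. EE v w <= clk v (bp v w) y w} \<in> sets N" using N(3) by measurable
 thus "{w \<in> space N. T v w <= y} \<in> sets N" using T_le_iff[OF _ y] by (simp add: N(1) cong: conj_cong)
qed

text \<open>Along the ancestry either lifetimes or clocks may be the given data: a clock yields the
  lifetime as soon as the birth place is known, so the induction climbs one generation at a
  time.\<close>

lemma measurable_birth:
 assumes N: "space N = space M" "!!u. u \<in> ancs v ==> T u \<in> bm N \<or> EE u \<in> bm N"
   "!!u s. u \<in> ancs v ==> 0 <= s ==> B u s \<in> bm N"
 shows "birth T v \<in> bm N" "bp v \<in> bm N"
proof -
 have "birth T v \<in> bm N \<and> bp v \<in> bm N"
  using N(2,3)
 proof (induction v)
  case Nil
  have "birth T [] = (\<lambda>_. 0)" "birth_place x B T [] = (\<lambda>_. x)" by auto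
  thus ?case by simp
 next
  case (Cons i v)
  hence IH: "birth T v \<in> bm N" "bp v \<in> bm N" by auto
  have "T v \<in> bm N" using Cons.prems measurable_T[OF N(1) _ _ IH(2)] by auto
  moreover have "dp v \<in> bm N" by (rule measurable_dp) (use Cons IH N(1) \<open>T v \<in> bm N\<close> in auto)
  moreover have "birth T (i # v) = (\<lambda>w. bt v w + T v w)" "birth_place x B T (i # v) = dp v" by (auto simp: dp_def)
  ultimately show ?case using IH(1) by simp
 qed
 thus "birth T v \<in> bm N" "bp v \<in> bm N" by auto
qed

lemma measurable_EE:
 assumes N: "space N = space M" "!!s. 0 <= s ==> B v s \<in> bm N"
  "T v \<in> bm N" "bp v \<in> bm N"
 shows "EE v \<in> bm N"
 unfolding EE_def[abs_def] by (rule measurable_clk[where N = N]) (use N in auto)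

abbreviation "SBC v \<equiv> sigma_before_clock M B T A v"

lemma SBC_gen: "(\<Union>u. path_events M (B u)) \<union> (\<Union>u. offspring_events M (A u)) \<union>
   (\<Union>u\<in>{u. length u <= length v \<and> u ~= v}. lifetime_events M (T u)) \<subseteq> sets M"
proof -
 have "lifetime_events M (T u) \<subseteq> sets M" for u
  unfolding lifetime_events_def using lifetime_measurable by (intro sets_image_in_sets) auto
 thus ?thesis using path_events_subset[OF motion] offspring_events_subset[OF offspring_measurable] by blast
qed

lemma subalgebra_SBC: "subalgebra M (SBC v)"
 unfolding sigma_before_clock_def by (rule subalgebra_sigma[OF SBC_gen])

lemma space_SBC [simp]: "space (SBC v) = space M" using subalgebra_SBC by (simp add: subalgebra_def)

lemma SBC_sets: "sets (SBC v) = sigma_sets (space M) ((\<Union>u. path_events M (B u)) \<union> (\<Union>u. offspring_events M (A u)) \<union>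
   (\<Union>u\<in>{u. length u <= length v \<and> u ~= v}. lifetime_events M (T u)))"
 unfolding sigma_before_clock_def using SBC_gen sets.sets_into_space by (intro sets_measure_of) blast

lemma SBC_B: "0 <= s ==> B u s \<in> bm (SBC v)"
 by (rule path_events_measurable) (auto simp: SBC_sets)

lemma SBC_T: "length u <= length v ==> u ~= v ==> T u \<in> bm (SBC v)"
 by (rule lifetime_events_measurable) (auto simp: SBC_sets)

lemma SBC_birth:
 assumes "length u <= length v"
 shows "birth T u \<in> bm (SBC v)" "bp u \<in> bm (SBC v)"
proof -
 have "T wt \<in> bm (SBC v)" if "wt \<in> ancs u" for wt
  using ancs_length[OF that] assms by (intro SBC_T) auto
 thus "birth T u \<in> bm (SBC v)" "bp u \<in> bm (SBC v)" by (intro measurable_birth; simp add: SBC_B)+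
qed

lemma SBC_EE: "length u <= length v ==> u ~= v ==> EE u \<in> bm (SBC v)"
 by (intro measurable_EE SBC_B SBC_birth SBC_T space_SBC)

lemma survival_integral:
 assumes D: "D \<in> sets (SBC v)" and t: "0 <= t"
 shows "(\<E> w. indicator D w * indicator {w \<in> space M. t < T v w} w)
   = (\<E> w. indicator D w * ennreal (exp (- clk v (bp v w) t w)))"
proof -
 interpret S: finite_measure_subalgebra M "SBC v"
  by (intro finite_measure_subalgebra.intro finite_measure_axioms finite_measure_subalgebra_axioms.intro subalgebra_SBC)
 have DM: "D \<in> sets M" using D subalgebra_SBC[of v] by (auto simp: subalgebra_def)
 let ?S = "{w \<in> space M. death T v w - birth T v w > t}"
 have S: "?S = {w \<in> space M. t < T v w}" by (simp add: death_def)
 have SM: "{w \<in> space M. t < T v w} \<in> sets M" using lifetime_measurable[of v] by measurable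
 have cm: "(\<lambda>w. clk v (bp v w) t w) \<in> bm M"
  using measurable_from_subalg[OF subalgebra_SBC[of v]] SBC_birth(2)[of v v]
  by (intro measurable_clk[where N = M] BM_measurable[OF motion]) auto
 have eqx: "integral {birth T v w..birth T v w + t} (\<lambda>s. g (position x B T v s w)) = clk v (bp v w) t w" if wt: "w \<in> space M" for w
 proof -
  have "continuous_on {bt v w..bt v w + t} (\<lambda>s. g (position x B T v s w))"
   unfolding position_def
   by (intro continuous_on_compose2[OF g_cont] continuous_intros continuous_on_compose2[OF BM_continuous[OF motion wt]]) auto
  from integral_translate[OF integrable_continuous_interval[OF this]]
  show ?thesis by (simp add: position_def clk_def)
 qed
 have "(\<integral>w\<in>D. indicator ?S w \<partial>M) = (\<integral>w\<in>D. real_cond_exp M (SBC v) (indicator ?S) w \<partial>M)"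
  by (rule S.real_cond_exp_intA[OF _ D]) (use SM S in \<open>auto simp: emeasure_eq_measure\<close>)
 also have "... = (\<integral>w\<in>D. exp (- clk v (bp v w) t w) \<partial>M)"
 proof (rule set_lebesgue_integral_cong_AE)
  show "AE w\<in>D in M. real_cond_exp M (SBC v) (indicator ?S) w = exp (- clk v (bp v w) t w)"
   using survival[OF t, of v] AE_space by eventually_elim (simp add: eqx)
 qed (use DM cm in auto)
 finally have eq: "(\<integral>w\<in>D. indicator ?S w \<partial>M) = (\<integral>w\<in>D. exp (- clk v (bp v w) t w) \<partial>M)" .
 have i1: "integrable M (\<lambda>w. indicator D w * indicator {w \<in> space M. t < T v w} w :: real)"
  by (rule integrable_const_bound[of _ 1]) (use DM SM in \<open>auto simp: indicator_def\<close>)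
 have i2: "integrable M (\<lambda>w. indicator D w * exp (- clk v (bp v w) t w))"
  by (rule integrable_const_bound[of _ 1]) (use DM cm clk_nonneg[OF _ t] in \<open>auto simp: indicator_def\<close>)
 have "(\<E> w. indicator D w * indicator {w \<in> space M. t < T v w} w) = (\<E> w. ennreal (indicator D w * indicator {w \<in> space M. t < T v w} w))"
  by (intro nn_integral_cong) (auto simp: indicator_def)
 also have "... = ennreal (expectation (\<lambda>w. indicator D w * indicator {w \<in> space M. t < T v w} w))"
  by (rule nn_integral_eq_integral[OF i1]) auto
 also have "... = ennreal (expectation (\<lambda>w. indicator D w * exp (- clk v (bp v w) t w)))"
  using eq by (simp add: set_lebesgue_integral_def S)
 also have "... = (\<E> w. ennreal (indicator D w * exp (- clk v (bp v w) t w)))"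
  by (rule nn_integral_eq_integral[OF i2, symmetric]) auto
 also have "... = (\<E> w. indicator D w * ennreal (exp (- clk v (bp v w) t w)))"
  by (intro nn_integral_cong) (auto simp: indicator_def)
 finally show ?thesis .
qed

text \<open>Dyadic approximation from above extends \<open>survival\<close> to the random time at which the clock shows \<open>s\<close>.\<close>

lemma clock_tail:
 assumes G: "G \<in> sets (SBC v)" and s: "0 <= s"
 shows "prob (G \<inter> {w \<in> space M. s < EE v w}) = prob G * exp (- s)"
proof -
 have GM: "G \<in> sets M" using G subalgebra_SBC[of v] by (auto simp: subalgebra_def)
 define ta where "ta = (\<lambda>w. clock_inv (\<lambda>t. clk v (bp v w) t w) s)"
 have t0: "0 <= ta w" and tc: "clk v (bp v w) (ta w) w = s" and tl: "!!t. 0 <= t ==> ta w <= t \<longleftrightarrow> s <= clk v (bp v w) t w"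
  and tT: "s < EE v w \<longleftrightarrow> ta w < T v w"
  if wt: "w \<in> space M" for w
 proof -
  obtain c where c: "clock (\<lambda>s. g (bp v w + B v s w)) c (\<lambda>t. clk v (bp v w) t w)" using clock_clk[OF wt] by blast
  show 1: "0 <= ta w" unfolding ta_def by (rule clock.clock_inv_nonneg[OF c])
  obtain u where u: "0 <= u" "clk v (bp v w) u w = s" using clock.level_exists[OF c s] by blast
  hence "ta w = u" unfolding ta_def using clock.clock_inv_K[OF c u(1)] by simp
  with u show 2: "clk v (bp v w) (ta w) w = s" by simp
  show "!!t. 0 <= t ==> ta w <= t \<longleftrightarrow> s <= clk v (bp v w) t w" unfolding ta_def by (rule clock.clock_inv_le_iff[OF c])
  show "s < EE v w \<longleftrightarrow> ta w < T v w"
   using clock.K_le_iff[OF c T_nonneg[OF wt, of v] 1] unfolding EE_def 2 by auto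
 qed
 have tam: "ta \<in> bm (SBC v)"
 proof (rule measurable_from_nonneg_levels)
  fix y :: real assume y: "0 <= y"
  have "(\<lambda>w. clk v (bp v w) y w) \<in> bm (SBC v)"
   by (rule measurable_clk[where N = "SBC v"]) (use SBC_B SBC_birth in auto)
  hence "{w \<in> space (SBC v). s <= clk v (bp v w) y w} \<in> sets (SBC v)" by measurable
  thus "{w \<in> space (SBC v). ta w <= y} \<in> sets (SBC v)" using tl[OF _ y] by (simp cong: conj_cong)
 qed (use t0 in simp)
 define k where "k = (\<lambda>(n::nat) w. nat \<lceil>2 ^ n * ta w\<rceil>)"
 have km[measurable]: "k n \<in> measurable (SBC v) (count_space UNIV)" for n
  unfolding k_def using tam by measurable
 define rh where "rh = (\<lambda>n w. real (k n w) / 2 ^ n)"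
 have rhbnd: "ta w <= rh n w \<and> rh n w <= ta w + (1/2) ^ n" if wt: "w \<in> space M" for n w
 proof -
  have k_real: "real (k n w) = of_int \<lceil>2 ^ n * ta w\<rceil>" using t0[OF wt] by (simp add: k_def)
  have "2 ^ n * ta w <= real (k n w)" "real (k n w) <= 2 ^ n * ta w + 1"
   unfolding k_real by linarith+
  thus ?thesis by (simp add: rh_def field_simps power_one_over)
 qed
 have rhlim: "(\<lambda>n. rh n w) \<longlonglongrightarrow> ta w" if wt: "w \<in> space M" for w
 proof (rule tendsto_sandwich)
  show "(\<lambda>n. ta w) \<longlonglongrightarrow> ta w" by simp
  show "(\<lambda>n. ta w + (1/2::real) ^ n) \<longlonglongrightarrow> ta w"
   using tendsto_add[OF tendsto_const[of "ta w"] LIMSEQ_power_zero[of "1/2::real"]] by simp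
 qed (use rhbnd[OF wt] in auto)
 have cm: "(\<lambda>w. clk v (bp v w) (t w) w) \<in> bm M" if "t \<in> bm M" for t
  using measurable_from_subalg[OF subalgebra_SBC[of v]] SBC_birth(2)[of v v] that
  by (intro measurable_clk[where N = M] BM_measurable[OF motion]) auto
 have Tm[measurable]: "T v \<in> bm M" by (rule lifetime_measurable)
 have kM[measurable]: "k n \<in> measurable M (count_space UNIV)" for n
  using measurable_from_subalg[OF subalgebra_SBC km] .
 have rhM[measurable]: "rh n \<in> bm M" for n unfolding rh_def by measurable
 note GM[measurable]
 have step: "(\<E> w. indicator G w * indicator {w \<in> space M. rh n w < T v w} w)
   = (\<E> w. indicator G w * ennreal (exp (- clk v (bp v w) (rh n w) w)))" for n
 proof -
  \<comment> \<open>The rounded time is constant on each of these events of \<open>SBC v\<close>, so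
    the survival axiom can be applied at a deterministic time.\<close>
  define D where "D = (\<lambda>j. G \<inter> (k n -` {j} \<inter> space (SBC v)))"
  have DS: "D j \<in> sets (SBC v)" for j unfolding D_def by (intro sets.Int G measurable_sets[OF km]) simp
  have DM[measurable]: "D j \<in> sets M" for j using DS subalgebra_SBC[of v] by (auto simp: subalgebra_def)
  have sp: "(\<Sum>j. indicator (D j) w * f j) = indicator G w * (f (k n w) :: ennreal)" if wt: "w \<in> space M" for f w
  proof -
   have "(\<lambda>j. indicator (D j) w * f j) sums (indicator (D (k n w)) w * f (k n w))"
    using sums_single[of "k n w" "\<lambda>j. indicator (D j) w * f j"]
    by (rule sums_cong[THEN iffD1, rotated]) (auto simp: D_def indicator_def)
   thus ?thesis using wt by (simp add: sums_iff D_def indicator_def)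
  qed
  have "(\<E> w. indicator G w * indicator {w \<in> space M. rh n w < T v w} w)
   = (\<E> w. (\<Sum>j. indicator (D j) w * indicator {w \<in> space M. real j / 2 ^ n < T v w} w))"
   by (rule nn_integral_cong, subst sp) (auto simp: rh_def indicator_def)
  also have "... = (\<Sum>j. \<E> w. indicator (D j) w * indicator {w \<in> space M. real j / 2 ^ n < T v w} w)"
   by (rule nn_integral_suminf) measurable
  also have "... = (\<Sum>j. \<E> w. indicator (D j) w * ennreal (exp (- clk v (bp v w) (real j / 2 ^ n) w)))"
   by (intro suminf_cong survival_integral[OF DS]) simp
  also have "... = (\<E> w. (\<Sum>j. indicator (D j) w * ennreal (exp (- clk v (bp v w) (real j / 2 ^ n) w))))"
   by (rule nn_integral_suminf[symmetric]) (use cm in measurable)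
  also have "... = (\<E> w. indicator G w * ennreal (exp (- clk v (bp v w) (rh n w) w)))"
   by (rule nn_integral_cong, subst sp) (auto simp: rh_def)
  finally show ?thesis .
 qed
 have [measurable]: "ta \<in> bm M" using measurable_from_subalg[OF subalgebra_SBC tam] .
 have L1: "(\<lambda>n. \<E> w. indicator G w * indicator {w \<in> space M. rh n w < T v w} w) \<longlonglongrightarrow>
   (\<E> w. indicator G w * indicator {w \<in> space M. ta w < T v w} w)"
 proof (rule nn_integral_dominated_convergence[where w = "\<lambda>_. 1"])
  show "AE w in M. (\<lambda>n. indicator G w * indicator {w \<in> space M. rh n w < T v w} w :: ennreal) \<longlonglongrightarrow> indicator G w * indicator {w \<in> space M. ta w < T v w} w"
  proof (rule AE_I2)
   fix w assume wt: "w \<in> space M"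
   have "\<forall>\<^sub>F n in sequentially. (rh n w < T v w) = (ta w < T v w)"
   proof (cases "ta w < T v w")
    case True
    from order_tendstoD(2)[OF rhlim[OF wt] True] show ?thesis by eventually_elim (use True in simp)
   next
    case False
    have "rh n w < T v w \<longleftrightarrow> False" for n using rhbnd[OF wt, of n] False by auto
    thus ?thesis using False by simp
   qed
   thus "(\<lambda>n. indicator G w * indicator {w \<in> space M. rh n w < T v w} w :: ennreal) \<longlonglongrightarrow> indicator G w * indicator {w \<in> space M. ta w < T v w} w"
    by (intro tendsto_eventually, elim eventually_mono) (auto simp: indicator_def)
  qed
 qed (auto simp: indicator_def emeasure_space_1)
 have L2: "(\<lambda>n. \<E> w. indicator G w * ennreal (exp (- clk v (bp v w) (rh n w) w))) \<longlonglongrightarrow>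
   (\<E> w. indicator G w * ennreal (exp (- s)))"
 proof (rule nn_integral_dominated_convergence[where w = "\<lambda>_. 1"])
  show "AE w in M. (\<lambda>n. indicator G w * ennreal (exp (- clk v (bp v w) (rh n w) w))) \<longlonglongrightarrow> indicator G w * ennreal (exp (- s))"
  proof (rule AE_I2)
   fix w assume wt: "w \<in> space M"
   then obtain c where c: "clock (\<lambda>s. g (bp v w + B v s w)) c (\<lambda>t. clk v (bp v w) t w)" using clock_clk by blast
   have "(\<lambda>n. clk v (bp v w) (rh n w) w) \<longlonglongrightarrow> clk v (bp v w) (ta w) w"
    by (rule continuous_on_tendsto_compose[OF clock.K_continuous[OF c] rhlim[OF wt]]) (use t0[OF wt] in \<open>auto simp: rh_def\<close>)
   thus "(\<lambda>n. indicator G w * ennreal (exp (- clk v (bp v w) (rh n w) w))) \<longlonglongrightarrow> indicator G w * ennreal (exp (- s))"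
    unfolding tc[OF wt] by (intro ennreal_tendsto_cmult tendsto_ennrealI tendsto_intros) (simp split: split_indicator)
  qed
  show "AE w in M. indicator G w * ennreal (exp (- clk v (bp v w) (rh n w) w)) <= 1" for n
   by (rule AE_I2) (use clk_nonneg[of _ "rh n _"] in \<open>auto simp: indicator_def rh_def\<close>)
 qed (use cm emeasure_space_1 in auto)
 have [measurable]: "EE v \<in> bm M"
  by (rule measurable_EE) (use BM_measurable[OF motion] measurable_from_subalg[OF subalgebra_SBC SBC_birth(2)[of v v]] in auto)
 have "emeasure M (G \<inter> {w \<in> space M. s < EE v w}) = (\<E> w. indicator G w * indicator {w \<in> space M. ta w < T v w} w)"
  by (subst nn_integral_indicator[symmetric], measurable, rule nn_integral_cong) (auto simp: indicator_def tT)
 also have "... = (\<E> w. indicator G w * ennreal (exp (- s)))" using L1 L2 unfolding step by (rule LIMSEQ_unique)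
 also have "... = ennreal (prob G * exp (- s))" by (simp add: nn_integral_multc emeasure_eq_measure ennreal_mult)
 finally show ?thesis by (simp add: emeasure_eq_measure)
qed

lemma EE_measurable: "EE v \<in> bm M"
 by (rule measurable_EE) (use BM_measurable[OF motion] lifetime_measurable measurable_from_subalg[OF subalgebra_SBC SBC_birth(2)[of v v]] in auto)

lemma bp_measurable [measurable]: "bp v \<in> bm M"
 and bt_measurable [measurable]: "birth T v \<in> bm M"
 using measurable_from_subalg[OF subalgebra_SBC SBC_birth(1)[of v v]] measurable_from_subalg[OF subalgebra_SBC SBC_birth(2)[of v v]] by auto

lemma EE_exponential: "distributed M lborel (EE v) (exponential_density 1)"
 unfolding exponential_distributed_iff[OF zero_less_one]
proof (intro conjI allI impI)
 show [measurable]: "EE v \<in> bm M" by (rule EE_measurable)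
 fix a :: real assume a: "0 <= a"
 have "space M \<in> sets (SBC v)" using sets.top[of "SBC v"] by simp
 from clock_tail[OF this a] have "prob {w \<in> space M. a < EE v w} = exp (- a)"
  by (simp add: prob_space Int_def conj_commute cong: conj_cong)
 moreover have "prob {w \<in> space M. \<not> a < EE v w} = 1 - prob {w \<in> space M. a < EE v w}"
  by (rule prob_neg) measurable
 ultimately show "prob {w \<in> space M. EE v w <= a} = 1 - exp (- a * 1)"
  by (simp add: not_less)
qed

section \<open>The independent family of paths, offspring numbers and clocks\<close>

definition ev :: "label + label + label => 'w set set" where
 "ev k = (case k of Inl u => path_events M (B u) | Inr (Inl u) => offspring_events M (A u)
   | Inr (Inr u) => sets (vimage_algebra (space M) (EE u) borel))"

text \<open>A label v of maximal generation is removed first: the clocks of the remaining labels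
  involve only lifetimes of other particles up to the generation of v, so they are determined by
  \<open>SBC v\<close> and the tail of \<open>EE v\<close> splits off.\<close>

lemma clocks_tail:
 assumes G: "G \<in> sigma_sets (space M) ((\<Union>u. path_events M (B u)) \<union> (\<Union>u. offspring_events M (A u)))" and F: "finite F"
  and s: "!!u. 0 <= s u"
 shows "prob (G \<inter> {w \<in> space M. \<forall>u\<in>F. s u < EE u w}) = prob G * (\<Prod>u\<in>F. exp (- s u))"
 using F
proof (induction "card F" arbitrary: F)
 case 0
 have "G \<subseteq> space M" using sigma_sets_into_sp[OF _ G] path_events_subset[OF motion] offspring_events_subset[OF offspring_measurable]
   sets.sets_into_space by (metis Un_subset_iff SUP_least PowI subsetI subset_iff)
 hence "G \<inter> space M = G" by blast
 with 0 show ?case by simp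
next
 case (Suc n)
 hence ne: "F ~= {}" by auto
 obtain v where v: "v \<in> F" "!!u. u \<in> F ==> length u <= length v"
  using finite_imageI[OF Suc.prems, of length] ne Max_in[of "length ` F"] Max_ge[of "length ` F"] by (metis (no_types, lifting) imageE image_eqI image_is_empty)
 let ?F = "F - {v}"
 have F: "F = insert v ?F" using v(1) by blast
 let ?G = "G \<inter> {w \<in> space M. \<forall>u\<in>?F. s u < EE u w}"
 have "G \<in> sets (SBC v)" unfolding SBC_sets by (rule subsetD[OF sigma_sets_mono' G]) blast
 moreover have "{w \<in> space (SBC v). \<forall>u\<in>?F. s u < EE u w} \<in> sets (SBC v)"
 proof (rule sets.sets_Collect_finite_All)
  fix u assume "u \<in> ?F"
  hence "EE u \<in> bm (SBC v)" using v(2) by (intro SBC_EE) auto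
  thus "{w \<in> space (SBC v). s u < EE u w} \<in> sets (SBC v)" by measurable
 qed (use Suc.prems in simp)
 ultimately have GS: "?G \<in> sets (SBC v)" by auto
 have "G \<inter> {w \<in> space M. \<forall>u\<in>F. s u < EE u w} = ?G \<inter> {w \<in> space M. s v < EE v w}"
  using v(1) by blast
 hence "prob (G \<inter> {w \<in> space M. \<forall>u\<in>F. s u < EE u w}) = prob ?G * exp (- s v)"
  using clock_tail[OF GS s] by simp
 also have "prob ?G = prob G * (\<Prod>u\<in>?F. exp (- s u))"
  using Suc v(1) by (intro Suc.hyps(1)) auto
 also have "prob G * (\<Prod>u\<in>?F. exp (- s u)) * exp (- s v) = prob G * (\<Prod>u\<in>F. exp (- s u))"
  using prod.remove[OF Suc.prems v(1), of "\<lambda>u. exp (- s u)"] by (simp add: mult_ac)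
 finally show ?case .
qed

text \<open>Tail events at nonnegative levels are intersection-stable, and they generate the clock
  sigma-algebras because clocks are nonnegative. \<open>clocks_tail\<close> factors them out, and
  the independence axiom handles what is left.\<close>

lemma indep_ev: "indep_sets ev UNIV"
proof -
 define F where "F = (\<lambda>k. case k of Inr (Inr u) => {{w \<in> space M. s < EE u w} | s. 0 <= s} | _ => ev k)"
 have FM: "F k \<subseteq> events" for k
 proof -
  have [measurable]: "EE u \<in> bm M" for u by (rule EE_measurable)
  show ?thesis
   using path_events_subset[OF motion] offspring_events_subset[OF offspring_measurable]
   by (cases k; (cases "projr k")?) (auto simp: F_def ev_def split: sum.splits)
 qed
 have ind: "indep_sets F UNIV"
 proof (rule indep_setsI)
  fix a :: "label + label + label => 'w set" and J :: "(label + label + label) set"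
  assume J: "J ~= {}" "finite J" "\<forall>j\<in>J. a j \<in> F j"
  \<comment> \<open>The map embeds the two-part index type of the independence axiom into the
    three-part index type of \<open>ev\<close>.\<close>
  define c where "c = (\<lambda>k :: label + label. case k of Inl u => (Inl u :: label + label + label) | Inr u => Inr (Inl u))"
  define P where "P = {k. c k \<in> J}"
  define L where "L = {u. Inr (Inr u) \<in> J}"
  have cinj: "inj c" unfolding c_def inj_def by (auto split: sum.splits)
  have Jsplit: "J = c ` P \<union> (\<lambda>u. Inr (Inr u)) ` L"
  proof (intro set_eqI iffI)
   fix j assume j: "j \<in> J"
   consider (1) u where "j = c (Inl u)" | (2) u where "j = c (Inr u)" | (3) u where "j = Inr (Inr u)"
    by (cases j; (cases "projr j")?) (auto simp: c_def)
   thus "j \<in> c ` P \<union> (\<lambda>u. Inr (Inr u)) ` L"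
    using j by cases (auto simp: P_def L_def)
  qed (auto simp: P_def L_def)
  have fP: "finite P" using J(2) finite_imageD[of c P] cinj Jsplit by (metis finite_Un inj_on_subset subset_UNIV)
  have fL: "finite L" using J(2) finite_imageD[of "\<lambda>u. Inr (Inr u) :: label + label + label" L] Jsplit by (metis (no_types, lifting) finite_Un inj_onI sum.inject(2))
  have "\<exists>s\<ge>0. u \<in> L --> a (Inr (Inr u)) = {w \<in> space M. s < EE u w}" for u
   using bspec[OF J(3), of "Inr (Inr u)"] by (cases "u \<in> L") (auto simp: L_def F_def)
  then obtain s where s: "!!u. 0 <= s u" "!!u. u \<in> L ==> a (Inr (Inr u)) = {w \<in> space M. s u < EE u w}" by metis
  define G where "G = (\<Inter>k\<in>P. a (c k)) \<inter> space M"
  have aP: "a (c k) \<in> (case k of Inl u => path_events M (B u) | Inr u => offspring_events M (A u))" if "k \<in> P" for k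
  proof -
   have "c k \<in> J" using that Jsplit by blast
   with J(3) have "a (c k) \<in> F (c k)" by blast
   thus ?thesis by (auto simp: c_def F_def ev_def split: sum.splits)
  qed
  have GS: "G \<in> sigma_sets (space M) ((\<Union>u. path_events M (B u)) \<union> (\<Union>u. offspring_events M (A u)))"
  proof (cases "P = {}")
   case True thus ?thesis by (simp add: G_def sigma_sets_top)
  next
   case False
   have gen: "(\<Union>u. path_events M (B u)) \<union> (\<Union>u. offspring_events M (A u)) \<subseteq> sets M"
    using path_events_subset[OF motion] offspring_events_subset[OF offspring_measurable] by blast
   hence gP: "(\<Union>u. path_events M (B u)) \<union> (\<Union>u. offspring_events M (A u)) \<subseteq> Pow (space M)"
    using sets.sets_into_space by blast
   let ?N = "sigma (space M) ((\<Union>u. path_events M (B u)) \<union> (\<Union>u. offspring_events M (A u)))"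
   have "a (c k) \<in> sets ?N" if "k \<in> P" for k
    using aP[OF that] unfolding sets_measure_of[OF gP] by (intro sigma_sets.Basic) (auto split: sum.splits)
   hence "(\<Inter>k\<in>P. a (c k)) \<in> sets ?N" by (intro sets.finite_INT[OF fP False]) auto
   moreover have "space M \<in> sets ?N" unfolding sets_measure_of[OF gP] by (rule sigma_sets_top)
   ultimately have "G \<in> sets ?N" unfolding G_def by (rule sets.Int)
   thus ?thesis unfolding sets_measure_of[OF gP] .
  qed
  have pG: "prob G = (\<Prod>k\<in>P. prob (a (c k)))"
  proof (cases "P = {}")
   case True thus ?thesis by (simp add: G_def prob_space)
  next
   case False
   have "(\<Inter>k\<in>P. a (c k)) \<subseteq> space M"
   proof -
    obtain k where "k \<in> P" using False by blast
    hence "a (c k) \<in> F (c k)" using J(3) Jsplit by blast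
    hence "a (c k) \<in> events" using FM by blast
    thus ?thesis using sets.sets_into_space \<open>k \<in> P\<close> by blast
   qed
   hence "G = (\<Inter>k\<in>P. a (c k))" unfolding G_def by blast
   thus ?thesis using indep_setsD[OF independent _ False fP, of "\<lambda>k. a (c k)"] aP by simp
  qed
  have "prob (\<Inter>j\<in>J. a j) = prob (G \<inter> {w \<in> space M. \<forall>u\<in>L. s u < EE u w})"
  proof -
   obtain j where j: "j \<in> J" using J(1) by blast
   hence "a j \<in> events" using J(3) FM by blast
   hence "(\<Inter>j\<in>J. a j) = (\<Inter>j\<in>J. a j) \<inter> space M" using sets.sets_into_space j by blast
   also have "... = G \<inter> {w \<in> space M. \<forall>u\<in>L. s u < EE u w}"
   proof (rule set_eqI)
    fix w
    have "(\<forall>u\<in>L. w \<in> a (Inr (Inr u))) \<longleftrightarrow> (\<forall>u\<in>L. s u < EE u w)" if "w \<in> space M"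
     using s that by simp
    thus "w \<in> (\<Inter>j\<in>J. a j) \<inter> space M \<longleftrightarrow> w \<in> G \<inter> {w \<in> space M. \<forall>u\<in>L. s u < EE u w}"
     unfolding Jsplit G_def by auto
   qed
   finally show ?thesis by (rule arg_cong)
  qed
  also have "... = prob G * (\<Prod>u\<in>L. exp (- s u))"
   by (rule clocks_tail[OF GS fL s(1)])
  also have "... = (\<Prod>k\<in>P. prob (a (c k))) * (\<Prod>u\<in>L. prob (a (Inr (Inr u))))"
   unfolding pG using s exponential_distributedD_gt[OF EE_exponential s(1)] by simp
  also have "... = (\<Prod>j\<in>c ` P. prob (a j)) * (\<Prod>j\<in>(\<lambda>u. Inr (Inr u)) ` L. prob (a j))"
   using cinj by (simp add: prod.reindex inj_on_def)
  also have "... = (\<Prod>j\<in>J. prob (a j))"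
   unfolding Jsplit by (rule prod.union_disjoint[symmetric]) (use fP fL in \<open>auto simp: c_def split: sum.splits\<close>)
  finally show "prob (\<Inter>j\<in>J. a j) = (\<Prod>j\<in>J. prob (a j))" .
 qed (rule FM)
 have st: "Int_stable (F k)" for k
 proof -
  have ev_st: "Int_stable (ev k)"
  proof -
   have "Int_stable (sets N)" for N :: "'w measure" by (auto simp: Int_stable_def)
   thus ?thesis by (auto simp: ev_def path_events_def offspring_events_def split: sum.split)
  qed
  have "Int_stable {{w \<in> space M. s < EE u w} | s. 0 <= s}" for u
  proof (rule Int_stableI, clarify)
   fix s t :: real assume "0 <= s" "0 <= t"
   thus "\<exists>r. {w \<in> space M. s < EE u w} \<inter> {w \<in> space M. t < EE u w} = {w \<in> space M. r < EE u w} \<and> 0 <= r"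
    by (intro exI[of _ "max s t"]) auto
  qed
  with ev_st show ?thesis unfolding F_def by (auto split: sum.split)
 qed
 have "ev k \<subseteq> sigma_sets (space M) (F k)" for k
 proof -
  have "sets (vimage_algebra (space M) (EE u) borel) \<subseteq> sigma_sets (space M) {{w \<in> space M. s < EE u w} | s. 0 <= s}" for u
  proof -
   let ?N = "sigma (space M) {{w \<in> space M. s < EE u w} | s. 0 <= s}"
   have sN: "sets ?N = sigma_sets (space M) {{w \<in> space M. s < EE u w} | s. 0 <= s}" by (rule sets_measure_of) auto
   have spN: "space ?N = space M" by (rule space_measure_of) auto
   have "EE u \<in> bm ?N"
   proof (rule borel_measurableI_greater)
    fix y :: real
    have "{w \<in> space M. y < EE u w} = space M" if "\<not> 0 <= y" using that EE_nonneg[of _ u] by force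
    thus "{w \<in> space ?N. y < EE u w} \<in> sets ?N"
     unfolding spN sN by (cases "0 <= y") (auto intro: sigma_sets.Basic sigma_sets_top)
   qed
   thus ?thesis using sets_image_in_sets[OF spN] sN by simp
  qed
  thus ?thesis unfolding F_def by (auto simp: ev_def split: sum.split intro: sigma_sets.Basic)
 qed
 thus ?thesis by (intro indep_sets_mono_sets[OF indep_sets_sigma[OF ind st]])
qed

definition Sg :: "(label + label + label) set => 'w measure" where
 "Sg P = sigma (space M) (\<Union>k\<in>P. ev k)"

lemma ev_subset: "ev k \<subseteq> sets M"
proof -
 have "sets (vimage_algebra (space M) (EE u) borel) \<subseteq> sets M" for u
  using sets_image_in_sets[OF refl EE_measurable] .
 thus ?thesis
  using path_events_subset[OF motion] offspring_events_subset[OF offspring_measurable]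
  by (auto simp: ev_def split: sum.splits)
qed

lemma Sg_sets: "sets (Sg P) = sigma_sets (space M) (\<Union>k\<in>P. ev k)"
 unfolding Sg_def using ev_subset sets.sets_into_space by (intro sets_measure_of) blast

lemma subalgebra_Sg: "subalgebra M (Sg P)"
 unfolding Sg_def by (rule subalgebra_sigma) (use ev_subset in blast)

lemma space_Sg [simp]: "space (Sg P) = space M" using subalgebra_Sg by (simp add: subalgebra_def)

lemma indep_Sg:
 assumes "P \<inter> Q = {}" shows "indep_set (sets (Sg P)) (sets (Sg Q))"
proof -
 have st: "Int_stable (ev k)" for k
  using sets.Int by (auto simp: ev_def path_events_def offspring_events_def Int_stable_def split: sum.split)
 have "indep_sets (\<lambda>j. sigma_sets (space M) (\<Union>i\<in>(case j of True => P | False => Q). ev i)) (UNIV :: bool set)"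
 proof (rule indep_sets_collect_sigma)
  show "indep_sets ev (\<Union>j\<in>UNIV. case j of True => P | False => Q)"
   by (rule indep_sets_mono_index[OF _ indep_ev]) simp
  show "disjoint_family_on (case_bool P Q) UNIV"
   using assms by (auto simp: disjoint_family_on_def split: bool.split)
 qed (rule st)
 thus ?thesis unfolding indep_set_def
  by (elim indep_sets_mono_sets) (auto simp: Sg_sets split: bool.split)
qed

lemma Sg_B: "Inl v \<in> P ==> 0 <= s ==> B v s \<in> bm (Sg P)"
 by (rule path_events_measurable) (auto simp: Sg_sets ev_def intro!: sigma_sets.Basic)

lemma Sg_A: "Inr (Inl v) \<in> P ==> A v \<in> measurable (Sg P) (count_space UNIV)"
 by (rule offspring_events_measurable) (auto simp: Sg_sets ev_def intro!: sigma_sets.Basic)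

lemma Sg_EE: "Inr (Inr v) \<in> P ==> EE v \<in> bm (Sg P)"
 by (rule lifetime_events_measurable) (auto simp: Sg_sets ev_def lifetime_events_def intro!: sigma_sets.Basic)

end

section \<open>A single particle\<close>

context bbm_env begin

text \<open>The lifetime v would have if it were born at y. Separating y from the randomness of v
  lets the birth place be frozen while path and clock are integrated out.\<close>

definition tauv :: "label => real => 'w => real" where
 "tauv v y w = clock_inv (\<lambda>t. clk v y t w) (EE v w)"

lemma killed: "killed_bm M g (B v) (EE v)"
proof (unfold_locales)
 have "sets (allpast (B v)) \<subseteq> sets (Sg {Inl v})"
  unfolding sets_allpast
 proof (rule sets.sigma_sets_subset[of _ "Sg {Inl v}", simplified])
  show "{B v s -` S \<inter> space M |s S. 0 <= s \<and> S \<in> sets borel} \<subseteq> sets (Sg {Inl v})"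
   using measurable_sets[OF Sg_B[of v "{Inl v}"]] by auto
 qed
 moreover have "sets (vimage_algebra (space M) (EE v) borel) \<subseteq> sets (Sg {Inr (Inr v)})"
  using sets_image_in_sets[OF _ Sg_EE[of v "{Inr (Inr v)}"]] by simp
 moreover have "indep_set (sets (Sg {Inl v})) (sets (Sg {Inr (Inr v)}))" by (rule indep_Sg) auto
 ultimately show "indep_set (sets (allpast (B v))) (sets (vimage_algebra (space M) (EE v) borel))"
  unfolding indep_set_def by (elim indep_sets_mono_sets) (auto split: bool.split)
qed (rule motion g gpos EE_exponential)+

lemma killed_tau: "killed_bm.tau g (B v) (EE v) y w = tauv v y w"
 unfolding killed_bm.tau_def[OF killed] killed_bm.K_def[OF killed] tauv_def clk_def ..

lemma T_tauv: "w \<in> space M ==> tauv v (bp v w) w = T v w"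
 unfolding tauv_def by (rule clk_T)

lemma tauv_nonneg: "w \<in> space M ==> 0 <= tauv v y w"
 using killed_bm.tau_nonneg[OF killed] unfolding killed_tau .

lemma tauv_le_iff: "w \<in> space M ==> 0 <= t ==> tauv v y w <= t \<longleftrightarrow> EE v w <= clk v y t w"
 using killed_bm.tau_le_iff[OF killed] unfolding killed_tau killed_bm.K_def[OF killed] clk_def .

lemma measurable_tauv:
 assumes N: "!!s. 0 <= s ==> B v s \<in> bm N" "EE v \<in> bm N" "space N = space M"
  and f: "f \<in> measurable K N" and y: "y \<in> bm K"
 shows "(\<lambda>z. tauv v (y z) (f z)) \<in> bm K"
proof (rule measurable_from_nonneg_levels)
 have fM: "f z \<in> space M" if "z \<in> space K" for z using measurable_space[OF f that] N(3) by simp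
 show "z \<in> space K ==> 0 <= tauv v (y z) (f z)" for z by (rule tauv_nonneg[OF fM])
 fix u :: real assume u: "0 <= u"
 have "(\<lambda>z. clk v (y z) u (f z)) \<in> bm K" by (rule measurable_clk[where N = N]) (use N f y in auto)
 moreover have "(\<lambda>z. EE v (f z)) \<in> bm K" by (rule measurable_compose[OF f N(2)])
 ultimately have "{z \<in> space K. EE v (f z) <= clk v (y z) u (f z)} \<in> sets K" by measurable
 thus "{z \<in> space K. tauv v (y z) (f z) <= u} \<in> sets K" by (simp add: tauv_le_iff[OF fM u] cong: conj_cong)
qed

lemma measurable_Bv:
 assumes N: "!!s. 0 <= s ==> B v s \<in> bm N" "space N = space M"
  and f: "f \<in> measurable K N" and t: "t \<in> bm K" "!!z. z \<in> space K ==> 0 <= t z"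
 shows "(\<lambda>z. B v (t z) (f z)) \<in> bm K"
 by (rule continuous_process_at_random_time[OF N(1) _ f t]) (use BM_continuous[OF motion] N(2) in auto)

definition own :: "label => (label + label + label) set" where "own v = {Inl v, Inr (Inl v), Inr (Inr v)}"

lemma Sg_birth:
 assumes "!!u. u \<in> ancs wt ==> Inl u \<in> P \<and> Inr (Inr u) \<in> P"
 shows "birth T wt \<in> bm (Sg P)" "bp wt \<in> bm (Sg P)"
 by (rule measurable_birth; use assms Sg_B Sg_EE in auto)+

lemma Sg_T:
 assumes "!!u. u \<in> insert wt (ancs wt) ==> Inl u \<in> P \<and> Inr (Inr u) \<in> P"
 shows "T wt \<in> bm (Sg P)" "dp wt \<in> bm (Sg P)" "death T wt \<in> bm (Sg P)"
proof -
 have b: "birth T wt \<in> bm (Sg P)" "bp wt \<in> bm (Sg P)"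
  by (rule Sg_birth; use assms in blast)+
 show t: "T wt \<in> bm (Sg P)" by (rule measurable_T) (use assms b Sg_B Sg_EE in auto)
 show "dp wt \<in> bm (Sg P)" by (rule measurable_dp) (use assms b t Sg_B in auto)
 show "death T wt \<in> bm (Sg P)" unfolding death_def[abs_def] using b t by simp
qed

lemma Sg_realized:
 assumes "!!u. u \<in> ancs wt ==> Inr (Inl u) \<in> P"
 shows "realized A wt \<in> measurable (Sg P) (count_space UNIV)"
 using assms
proof (induction wt)
 case Nil
 have "realized A [] = (\<lambda>_. True)" by auto
 thus ?case by simp
next
 case (Cons i v)
 hence IH: "realized A v \<in> measurable (Sg P) (count_space UNIV)" by auto
 have a: "A v \<in> measurable (Sg P) (count_space UNIV)" by (rule Sg_A) (use Cons in auto)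
 have "realized A (i # v) = (\<lambda>w. realized A v w \<and> i < 1 + A v w)" by auto
 thus ?case using IH a by simp
qed

text \<open>Everything except the path, the clock and the family size of v. Birth time and birth
  place of v depend on its ancestors only and are therefore measurable here.\<close>

abbreviation "SO v \<equiv> Sg (- own v)"

lemma SO_birth: "v \<notin> ancs wt ==> birth T wt \<in> bm (SO v)" "v \<notin> ancs wt ==> bp wt \<in> bm (SO v)"
 by (rule Sg_birth; auto simp: own_def)+

lemma SO_T:
 assumes "v \<notin> ancs wt" "v ~= wt"
 shows "T wt \<in> bm (SO v)" "dp wt \<in> bm (SO v)" "death T wt \<in> bm (SO v)"
  "A wt \<in> measurable (SO v) (count_space UNIV)"
 by (rule Sg_T; use assms in \<open>auto simp: own_def\<close>)+ (rule Sg_A, use assms in \<open>auto simp: own_def\<close>)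

lemma SO_realized: "v \<notin> ancs wt ==> realized A wt \<in> measurable (SO v) (count_space UNIV)"
 by (rule Sg_realized) (auto simp: own_def)

lemma own_freeze:
 assumes "(\<lambda>(w, w'). F w w') \<in> bm (SO v \<Otimes>\<^sub>M Sg (own v))"
 shows "(\<E> w. F w w) = (\<E> w. (\<E> w'. F w w'))"
 by (rule nn_integral_freeze[OF subalgebra_Sg subalgebra_Sg indep_Sg assms]) auto

lemma own_measurable:
 shows "0 <= s ==> B v s \<in> bm (Sg (own v))" "EE v \<in> bm (Sg (own v))"
  "A v \<in> measurable (Sg (own v)) (count_space UNIV)"
 by (rule Sg_B Sg_EE Sg_A; simp add: own_def)+

lemma offspring_factor:
 assumes "G \<in> bm (Sg {Inl v, Inr (Inr v)})"
 shows "(\<E> w. f (A v w) * G w) = (\<integral>\<^sup>+k. f k \<partial>measure_pmf p) * (\<E> w. G w)"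
proof -
 let ?N1 = "Sg {Inr (Inl v)}" and ?N2 = "Sg {Inl v, Inr (Inr v)}"
 have A: "A v \<in> measurable ?N1 (count_space UNIV)" by (rule Sg_A) simp
 have Am: "A v \<in> measurable M (count_space UNIV)" by (rule offspring_measurable)
 have [measurable]: "(\<lambda>z. f (A v (fst z))) \<in> bm (?N1 \<Otimes>\<^sub>M ?N2)"
  by (rule measurable_compose[OF measurable_compose[OF measurable_fst A]]) simp
 have [measurable]: "(\<lambda>z. G (snd z)) \<in> bm (?N1 \<Otimes>\<^sub>M ?N2)"
  by (rule measurable_compose[OF measurable_snd assms])
 have F: "(\<lambda>(w, w'). f (A v w) * G w') \<in> bm (?N1 \<Otimes>\<^sub>M ?N2)" unfolding split_beta by measurable
 have GM: "G \<in> bm M" by (rule measurable_from_subalg[OF subalgebra_Sg assms])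
 have fM: "(\<lambda>w. f (A v w)) \<in> bm M" by (rule measurable_compose[OF Am]) simp
 have "(\<E> w. f (A v w) * G w) = (\<E> w. (\<E> w'. f (A v w) * G w'))"
  by (rule nn_integral_freeze[OF subalgebra_Sg subalgebra_Sg indep_Sg F]) auto
 also have "... = (\<E> w. f (A v w) * (\<E> w'. G w'))"
  by (intro nn_integral_cong nn_integral_cmult GM)
 also have "... = (\<E> w. f (A v w)) * (\<E> w'. G w')" by (rule nn_integral_multc[OF fM])
 also have "(\<E> w. f (A v w)) = (\<integral>\<^sup>+k. f k \<partial>measure_pmf p)"
  unfolding offspring_law[of v, symmetric] by (rule nn_integral_distr[symmetric, OF Am]) simp
 finally show ?thesis .
qed

definition Dk :: "label => real => (real => real) => real => ennreal" where
 "Dk v dl H y = (\<E> w. ennreal (exp (- dl * tauv v y w) * H (y + B v (tauv v y w) w)))"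

lemma Dk_measurable:
 assumes [measurable]: "H \<in> bm borel"
 shows "Dk v dl H \<in> bm borel"
proof -
 let ?N = "borel \<Otimes>\<^sub>M M"
 have Bm: "0 <= s ==> B v s \<in> bm M" for s by (rule BM_measurable[OF motion])
 have t1[measurable]: "(\<lambda>z. tauv v (fst z) (snd z)) \<in> bm ?N"
  by (rule measurable_tauv[OF Bm EE_measurable _ measurable_snd]) auto
 have [measurable]: "(\<lambda>z. B v (tauv v (fst z) (snd z)) (snd z)) \<in> bm ?N"
  by (rule measurable_Bv[OF Bm _ measurable_snd t1]) (auto simp: tauv_nonneg space_pair_measure)
 have "(\<lambda>z. ennreal (exp (- dl * tauv v (fst z) (snd z)) * H (fst z + B v (tauv v (fst z) (snd z)) (snd z)))) \<in> bm ?N"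
  by measurable
 from borel_measurable_nn_integral_fst[OF this] show ?thesis unfolding Dk_def[abs_def] by simp
qed

text \<open>Given the rest of the system, the birth data of v are constants, so its path, clock and
  family size can be averaged out; the family size factors off because it is independent of path and
  clock.\<close>

lemma one_step:
 assumes Z: "Z \<in> bm (SO v)" and H: "H \<in> bm borel" "!!y. 0 <= H y"
 shows "(\<E> w. Z w * f (A v w) * ennreal (exp (- dl * death T v w) * H (dp v w)))
  = (\<integral>\<^sup>+k. f k \<partial>measure_pmf p) * (\<E> w. Z w * ennreal (exp (- dl * bt v w)) * Dk v dl H (bp v w))"
proof -
 let ?N = "SO v \<Otimes>\<^sub>M Sg (own v)"
 let ?t = "\<lambda>z. tauv v (bp v (fst z)) (snd z)"
 note sb = SO_birth[OF not_ancs_self]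
 have [measurable]: "(\<lambda>z. bt v (fst z)) \<in> bm ?N" "(\<lambda>z. bp v (fst z)) \<in> bm ?N"
   "(\<lambda>z. Z (fst z)) \<in> bm ?N"
  by (rule measurable_compose[OF measurable_fst] sb Z)+
 have [measurable]: "(\<lambda>z. f (A v (snd z))) \<in> bm ?N"
  by (rule measurable_compose[OF measurable_compose[OF measurable_snd own_measurable(3)]]) simp
 have tm[measurable]: "?t \<in> bm ?N"
  by (rule measurable_tauv[OF own_measurable(1,2) _ measurable_snd]) auto
 have [measurable]: "(\<lambda>z. B v (?t z) (snd z)) \<in> bm ?N"
  by (rule measurable_Bv[OF own_measurable(1) _ measurable_snd tm]) (auto simp: space_pair_measure tauv_nonneg)
 note [measurable] = H(1)
 let ?F = "\<lambda>w w'. Z w * ennreal (exp (- dl * bt v w)) *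
   (f (A v w') * ennreal (exp (- dl * tauv v (bp v w) w') * H (bp v w + B v (tauv v (bp v w) w') w')))"
 have F: "(\<lambda>(w, w'). ?F w w') \<in> bm ?N" unfolding split_beta by measurable
 have "(\<E> w. Z w * f (A v w) * ennreal (exp (- dl * death T v w) * H (dp v w))) = (\<E> w. ?F w w)"
 proof (rule nn_integral_cong)
  fix w assume wt: "w \<in> space M"
  have "exp (- dl * death T v w) * H (dp v w) = exp (- dl * bt v w) * (exp (- dl * T v w) * H (dp v w))"
   by (simp add: death_def algebra_simps flip: exp_add)
  note e = this
  have "ennreal (exp (- dl * death T v w) * H (dp v w)) = ennreal (exp (- dl * bt v w)) * ennreal (exp (- dl * T v w) * H (dp v w))"
   unfolding e by (rule ennreal_mult) (use H(2) in simp_all)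
  thus "Z w * f (A v w) * ennreal (exp (- dl * death T v w) * H (dp v w)) = ?F w w"
   unfolding T_tauv[OF wt] dp_def by (simp only: mult_ac)
 qed
 also have "... = (\<E> w. (\<E> w'. ?F w w'))" by (rule own_freeze[OF F])
 also have "... = (\<E> w. (\<integral>\<^sup>+k. f k \<partial>measure_pmf p) * (Z w * ennreal (exp (- dl * bt v w)) * Dk v dl H (bp v w)))"
 proof (rule nn_integral_cong)
  fix w assume wt: "w \<in> space M"
  define y where "y = bp v w"
  let ?S = "Sg {Inl v, Inr (Inr v)}"
  have Bm: "0 <= s ==> B v s \<in> bm ?S" for s by (rule Sg_B) simp
  have Em: "EE v \<in> bm ?S" by (rule Sg_EE) simp
  have t1[measurable]: "(\<lambda>w'. tauv v y w') \<in> bm ?S"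
   by (rule measurable_tauv[OF Bm Em, where f = "\<lambda>z. z"]) auto
  have [measurable]: "(\<lambda>w'. B v (tauv v y w') w') \<in> bm ?S"
   by (rule measurable_Bv[OF Bm, where f = "\<lambda>z. z"]) (auto simp: tauv_nonneg)
  let ?G = "\<lambda>w'. ennreal (exp (- dl * tauv v y w') * H (y + B v (tauv v y w') w'))"
  have G: "?G \<in> bm ?S" by measurable
  have GM: "?G \<in> bm M" by (rule measurable_from_subalg[OF subalgebra_Sg G])
  have fM: "(\<lambda>w. f (A v w)) \<in> bm M" by (rule measurable_compose[OF offspring_measurable]) simp
  have "(\<E> w'. ?F w w') = Z w * ennreal (exp (- dl * bt v w)) * (\<E> w'. f (A v w') * ?G w')"
   unfolding y_def[symmetric] by (rule nn_integral_cmult) (use fM GM in simp)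
  also have "(\<E> w'. f (A v w') * ?G w') = (\<integral>\<^sup>+k. f k \<partial>measure_pmf p) * Dk v dl H y"
   unfolding Dk_def by (rule offspring_factor[OF G])
  finally show "(\<E> w'. ?F w w') = (\<integral>\<^sup>+k. f k \<partial>measure_pmf p) * (Z w * ennreal (exp (- dl * bt v w)) * Dk v dl H (bp v w))"
   by (simp only: y_def mult_ac)
 qed
 also have "... = (\<integral>\<^sup>+k. f k \<partial>measure_pmf p) * (\<E> w. Z w * ennreal (exp (- dl * bt v w)) * Dk v dl H (bp v w))"
 proof (rule nn_integral_cmult)
  have [measurable]: "Z \<in> bm M" by (rule measurable_from_subalg[OF subalgebra_Sg Z])
  have [measurable]: "(\<lambda>w. Dk v dl H (bp v w)) \<in> bm M" by (rule measurable_compose[OF bp_measurable Dk_measurable[OF H(1)]])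
  show "(\<lambda>w. Z w * ennreal (exp (- dl * bt v w)) * Dk v dl H (bp v w)) \<in> bm M" by measurable
 qed
 finally show ?thesis .
qed

lemma Dk_killed: "Dk v dl H y = (\<E> w. ennreal (exp (- dl * killed_bm.tau g (B v) (EE v) y w) * H (y + B v (killed_bm.tau g (B v) (EE v) y w) w)))"
 unfolding Dk_def killed_tau ..

lemma one_step_mult:
 assumes Z: "Z \<in> bm (SO v)" and H: "H \<in> bm borel" "!!y. 0 <= H y"
 shows "ennreal ap * (\<E> w. Z w * f (A v w) * ennreal (exp (- dl * death T v w) * H (dp v w)))
  = (\<integral>\<^sup>+k. f k \<partial>measure_pmf p) * (\<E> w. Z w * (ennreal (exp (- dl * bt v w)) * (ennreal ap * Dk v dl H (bp v w))))"
proof -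
 have [measurable]: "Z \<in> bm M" "(\<lambda>w. Dk v dl H (bp v w)) \<in> bm M"
  using measurable_from_subalg[OF subalgebra_Sg Z] measurable_compose[OF bp_measurable Dk_measurable[OF H(1)]] by auto
 have "ennreal ap * (\<E> w. Z w * ennreal (exp (- dl * bt v w)) * Dk v dl H (bp v w))
  = (\<E> w. Z w * (ennreal (exp (- dl * bt v w)) * (ennreal ap * Dk v dl H (bp v w))))"
  by (subst nn_integral_cmult[symmetric], measurable) (simp only: mult_ac)
 note e = this
 show ?thesis unfolding one_step[OF Z H] mult.left_commute[of "ennreal ap" "\<integral>\<^sup>+k. f k \<partial>measure_pmf p"] e ..
qed

lemma
 assumes Z: "Z \<in> bm (SO v)" and fl: "floquet l r H H'" and r: "per_lip r" and ap: "0 < ap"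
 shows one_step_le: "(!!y. ap * g y <= g y + dl - r y) ==>
   ennreal ap * (\<E> w. Z w * f (A v w) * ennreal (exp (- dl * death T v w) * H (dp v w)))
   <= (\<integral>\<^sup>+k. f k \<partial>measure_pmf p) * (\<E> w. Z w * ennreal (exp (- dl * bt v w) * H (bp v w)))"
  and one_step_ge: "0 < ep ==> (!!y. g y + dl - r y <= ap * g y) ==> (!!y. ep <= g y + dl - r y) ==>
   (\<integral>\<^sup>+k. f k \<partial>measure_pmf p) * (\<E> w. Z w * ennreal (exp (- dl * bt v w) * H (bp v w)))
   <= ennreal ap * (\<E> w. Z w * f (A v w) * ennreal (exp (- dl * death T v w) * H (dp v w)))"
proof -
 have H: "H \<in> bm borel" "!!y. 0 <= H y"
  using borel_measurable_continuous_onI[OF floquet_continuous(1)[OF fl]] floquetD(1)[OF fl] by (auto simp: less_imp_le)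
 show "ennreal ap * (\<E> w. Z w * f (A v w) * ennreal (exp (- dl * death T v w) * H (dp v w)))
   <= (\<integral>\<^sup>+k. f k \<partial>measure_pmf p) * (\<E> w. Z w * ennreal (exp (- dl * bt v w) * H (bp v w)))"
  if "!!y. ap * g y <= g y + dl - r y"
  using killed_bm.killed_total_le[OF killed fl r ap that, folded Dk_killed]
  unfolding one_step_mult[OF Z H] unfolding ennreal_mult[OF exp_ge_zero H(2)]
  by (intro mult_left_mono nn_integral_mono) auto
 show "(\<integral>\<^sup>+k. f k \<partial>measure_pmf p) * (\<E> w. Z w * ennreal (exp (- dl * bt v w) * H (bp v w)))
   <= ennreal ap * (\<E> w. Z w * f (A v w) * ennreal (exp (- dl * death T v w) * H (dp v w)))"
  if "0 < ep" "!!y. g y + dl - r y <= ap * g y" "!!y. ep <= g y + dl - r y"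
  using killed_bm.killed_total_ge[OF killed fl r ap that, folded Dk_killed]
  unfolding one_step_mult[OF Z H] unfolding ennreal_mult[OF exp_ge_zero H(2)]
  by (intro mult_left_mono nn_integral_mono) auto
qed

text \<open>Finitely many constraints on the own path of v. Birth time and birth place are
  parameters so that they can be frozen; a constraint at a time before birth counts as
  failed.\<close>

definition seen :: "label => (real \<times> real set) list => real => real => 'w => bool" where
 "seen v Q b y w \<longleftrightarrow> (\<forall>(u, S)\<in>set Q. b <= u \<and> y + B v (u - b) w \<in> S)"

lemma seen_past:
 assumes Q: "!!u S. (u, S) \<in> set Q ==> u <= s \<and> S \<in> sets borel"
 shows "(\<lambda>w. of_bool (seen v Q b y w) :: real) \<in> bm (past (B v) (s - b))"
 using Q
proof (induction Q)
 case Nil thus ?case by (simp add: seen_def)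
next
 case (Cons q Q)
 obtain u S where q: "q = (u, S)" by fastforce
 have IH: "(\<lambda>w. of_bool (seen v Q b y w) :: real) \<in> bm (past (B v) (s - b))"
  using Cons by auto
 have uS: "u <= s" "S \<in> sets borel" using Cons.prems[of u S] q by auto
 have "(\<lambda>w. of_bool (b <= u \<and> y + B v (u - b) w \<in> S) :: real) \<in> bm (past (B v) (s - b))"
 proof (cases "b <= u")
  case True
  have [measurable]: "B v (u - b) \<in> bm (past (B v) (s - b))" by (rule measurable_past) (use True uS in auto)
  note uS(2)[measurable]
  show ?thesis using True by simp
 qed simp
 moreover have "(\<lambda>w. of_bool (seen v (q # Q) b y w) :: real) = (\<lambda>w. of_bool (b <= u \<and> y + B v (u - b) w \<in> S) * of_bool (seen v Q b y w))"
  by (auto simp: seen_def q)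
 ultimately show ?case using IH by (simp only: borel_measurable_times)
qed

lemma seen_measurable:
 assumes Q: "!!u S. (u, S) \<in> set Q ==> S \<in> sets borel"
  and N: "!!s. 0 <= s ==> B v s \<in> bm N" "space N = space M"
  and f: "f \<in> measurable K N" and b: "b \<in> bm K" and y: "y \<in> bm K"
 shows "Measurable.pred K (\<lambda>z. seen v Q (b z) (y z) (f z))"
 using Q
proof (induction Q)
 case Nil thus ?case by (simp add: seen_def)
next
 case (Cons q Q)
 obtain u S where q: "q = (u, S)" by fastforce
 have IH: "Measurable.pred K (\<lambda>z. seen v Q (b z) (y z) (f z))" using Cons by auto
 have S[measurable]: "S \<in> sets borel" using Cons.prems[of u S] q by auto
 note b[measurable] y[measurable]
 have [measurable]: "(\<lambda>z. B v (max 0 (u - b z)) (f z)) \<in> bm K"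
  by (rule measurable_Bv[OF N f]) auto
 have "Measurable.pred K (\<lambda>z. b z <= u \<and> y z + B v (max 0 (u - b z)) (f z) \<in> S)" by measurable
 moreover have "seen v (q # Q) (b z) (y z) (f z) \<longleftrightarrow> (b z <= u \<and> y z + B v (max 0 (u - b z)) (f z) \<in> S) \<and> seen v Q (b z) (y z) (f z)" for z
  by (auto simp: seen_def q)
 ultimately show ?case using IH by simp
qed

end

section \<open>Sums over generations\<close>

locale bbm_full = bbm_env M g p x B T A + eigen_setup g m ga \<psi> lstar
 for M :: "'w measure" and g p x B T A m ga \<psi> lstar +
 assumes L_integrable: "integrable (measure_pmf p) real"
  and m_def: "m = measure_pmf.expectation p real"
begin

lemma pot_per_lip: "per_lip (\<lambda>y. c - m * g y)"
 using per_lip_add[OF per_lip_const[of c] per_lip_mult[OF per_lip_const[of "-m"] g]] by simp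

lemma hh_borel [measurable]: "hh l \<in> bm borel"
 by (rule borel_measurable_continuous_onI[OF floquet_continuous(1)[OF floquet_hh]])

lemma hh_nonneg: "0 <= hh l y" using hh_pos[of l y] by simp

lemma offspring_mean: "(\<integral>\<^sup>+k. ennreal (1 + real k) \<partial>measure_pmf p) = ennreal (1 + m)"
proof -
 have "(\<integral>\<^sup>+k. ennreal (1 + real k) \<partial>measure_pmf p) = ennreal (measure_pmf.expectation p (\<lambda>k. 1 + real k))"
  by (rule nn_integral_eq_integral) (use L_integrable in auto)
 thus ?thesis using L_integrable by (simp add: m_def)
qed

section \<open>Weights of a particle at birth, at death and at a fixed time\<close>

definition Yb :: "real => label => 'w => real" where "Yb l v w = exp (- ga l * bt v w) * hh l (bp v w)"
definition Yd :: "real => label => 'w => real" where "Yd l v w = exp (- ga l * death T v w) * hh l (dp v w)"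
text \<open>The \<open>max 0\<close> only supplies a measurable value before birth, where an
  indicator makes the term vanish in every sum.\<close>

definition Yt :: "real => real => label => 'w => real" where
 "Yt l t v w = exp (- ga l * t) * hh l (bp v w + B v (max 0 (t - bt v w)) w)"

lemma Yt_position: "bt v w <= t ==> Yt l t v w = exp (- ga l * t) * hh l (position x B T v t w)"
 by (simp add: Yt_def position_def)

lemma Yb_pos: "0 < Yb l v w" and Yd_pos: "0 < Yd l v w" and Yt_pos: "0 < Yt l t v w"
 using hh_pos by (simp_all add: Yb_def Yd_def Yt_def)

lemma Yb_Cons: "Yb l (i # v) w = Yd l v w"
 by (simp add: Yb_def Yd_def death_def dp_def)

lemma T_pos_AE: "AE w in M. 0 < T v w"
proof -
 have [measurable]: "EE v \<in> bm M" by (rule EE_measurable)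
 have "prob {w \<in> space M. 0 < EE v w} = 1"
  using exponential_distributedD_gt[OF EE_exponential order_refl, of v] by simp
 hence "AE w in M. 0 < EE v w" by (subst (asm) prob_Collect_eq_1) auto
 thus ?thesis using AE_space
 proof eventually_elim
  case (elim w)
  hence "\<not> T v w <= 0" using T_le_iff[OF elim(2) order_refl, of v] by (simp add: clk_def)
  thus ?case by simp
 qed
qed

text \<open>\<open>Z\<close> carries information on all other particles, \<open>seen\<close> on the particle's own path up to time \<open>s\<close>.\<close>

lemma particle_balance:
 assumes Z: "Z \<in> bm (SO v)" and Q: "!!u S. (u, S) \<in> set Q ==> u <= s \<and> S \<in> sets borel"
  and st: "0 <= s" "s <= t"
 defines "\<sigma> \<equiv> \<lambda>w. max s (bt v w)"
 shows "(\<E> w. Z w * of_bool (bt v w <= t \<and> seen v Q (bt v w) (bp v w) w \<and> \<sigma> w < death T v w) * ennreal (Yt l (\<sigma> w) v w))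
  = (\<E> w. Z w * of_bool (bt v w <= t \<and> seen v Q (bt v w) (bp v w) w \<and> t < death T v w) * ennreal (Yt l t v w))
  + (\<E> w. Z w * of_bool (bt v w <= t \<and> seen v Q (bt v w) (bp v w) w \<and> \<sigma> w < death T v w \<and> death T v w <= t)
     * kids v w * ennreal (Yd l v w))"
proof -
 let ?N = "SO v \<Otimes>\<^sub>M Sg (own v)"
 note sb = SO_birth[OF not_ancs_self]
 have bm[measurable]: "(\<lambda>z. bt v (fst z)) \<in> bm ?N" "(\<lambda>z. bp v (fst z)) \<in> bm ?N"
   "(\<lambda>z. Z (fst z)) \<in> bm ?N"
  by (rule measurable_compose[OF measurable_fst] sb Z)+
 have \<sigma>m[measurable]: "(\<lambda>z. \<sigma> (fst z)) \<in> bm ?N" unfolding \<sigma>_def by measurable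
 have Am[measurable]: "(\<lambda>z. A v (snd z)) \<in> measurable ?N (count_space UNIV)"
  by (rule measurable_compose[OF measurable_snd own_measurable(3)])
 have tm[measurable]: "(\<lambda>z. tauv v (bp v (fst z)) (snd z)) \<in> bm ?N"
  by (rule measurable_tauv[OF own_measurable(1,2) _ measurable_snd]) auto
 have Bm: "(\<lambda>z. B v (max 0 (u z)) (snd z)) \<in> bm ?N" if "u \<in> bm ?N" for u
  by (rule measurable_Bv[OF own_measurable(1) _ measurable_snd]) (use that in auto)
 have sm[measurable]: "Measurable.pred ?N (\<lambda>z. seen v Q (bt v (fst z)) (bp v (fst z)) (snd z))"
  by (rule seen_measurable[OF _ own_measurable(1) _ measurable_snd]) (use Q in auto)
 define D where "D = (\<lambda>b y ta w'. ennreal (exp (- ga l * ta) * hh l (y + B v (max 0 (ta - b)) w')))"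
 have Dm[measurable]: "(\<lambda>z. D (bt v (fst z)) (bp v (fst z)) (u z) (snd z)) \<in> bm ?N" if "u \<in> bm ?N" for u
  unfolding D_def using that Bm[of "\<lambda>z. u z - bt v (fst z)"] by measurable
 define F1 where "F1 = (\<lambda>w w'. Z w * of_bool (bt v w <= t \<and> seen v Q (bt v w) (bp v w) w' \<and> \<sigma> w < bt v w + tauv v (bp v w) w') * D (bt v w) (bp v w) (\<sigma> w) w')"
 define F2 where "F2 = (\<lambda>w w'. Z w * of_bool (bt v w <= t \<and> seen v Q (bt v w) (bp v w) w' \<and> t < bt v w + tauv v (bp v w) w') * D (bt v w) (bp v w) t w')"
 define F3 where "F3 = (\<lambda>w w'. Z w * of_bool (bt v w <= t \<and> seen v Q (bt v w) (bp v w) w' \<and> \<sigma> w < bt v w + tauv v (bp v w) w' \<and> bt v w + tauv v (bp v w) w' <= t)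
     * kids v w' * D (bt v w) (bp v w) (bt v w + tauv v (bp v w) w') w')"
 have F1m: "(\<lambda>(w, w'). F1 w w') \<in> bm ?N"
  unfolding split_beta F1_def using Dm[OF \<sigma>m] by measurable
 have F2m: "(\<lambda>(w, w'). F2 w w') \<in> bm ?N"
  unfolding split_beta F2_def using Dm[of "\<lambda>_. t"] by measurable
 have F3m: "(\<lambda>(w, w'). F3 w w') \<in> bm ?N"
  unfolding split_beta F3_def using Dm[of "\<lambda>z. bt v (fst z) + tauv v (bp v (fst z)) (snd z)"] by measurable
 have e1: "F1 w w = Z w * of_bool (bt v w <= t \<and> seen v Q (bt v w) (bp v w) w \<and> \<sigma> w < death T v w) * ennreal (Yt l (\<sigma> w) v w)"
  if wt: "w \<in> space M" for w
  unfolding F1_def D_def T_tauv[OF wt] by (simp add: death_def Yt_def)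
 have e2: "F2 w w = Z w * of_bool (bt v w <= t \<and> seen v Q (bt v w) (bp v w) w \<and> t < death T v w) * ennreal (Yt l t v w)"
  if wt: "w \<in> space M" for w
  unfolding F2_def D_def T_tauv[OF wt] by (simp add: death_def Yt_def)
 have e3: "F3 w w = Z w * of_bool (bt v w <= t \<and> seen v Q (bt v w) (bp v w) w \<and> \<sigma> w < death T v w \<and> death T v w <= t)
     * kids v w * ennreal (Yd l v w)"
  if wt: "w \<in> space M" for w
  unfolding F3_def D_def T_tauv[OF wt] using T_nonneg[OF wt, of v] by (simp add: death_def Yd_def dp_def)
 have inner: "(\<E> w'. F1 w w') = (\<E> w'. F2 w w') + (\<E> w'. F3 w w')" if wt: "w \<in> space M" for w
 proof (cases "bt v w <= t")
  case False
  thus ?thesis by (simp add: F1_def F2_def F3_def)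
 next
  case True
  define b where "b = bt v w"
  define y where "y = bp v w"
  \<comment> \<open>The balance runs from age a to age c of the particle: a is 0 for a birth after
    s, and the age at time s otherwise.\<close>
  define a where "a = \<sigma> w - b"
  define c where "c = t - b"
  have a0: "0 <= a" "a <= c" using True st by (auto simp: a_def c_def \<sigma>_def b_def)
  let ?\<xi> = "\<lambda>w'. of_bool (seen v Q b y w') :: real"
  have \<xi>m: "?\<xi> \<in> bm (past (B v) a)"
   by (rule past_mono[OF _ seen_past[of Q s]]) (use Q in \<open>auto simp: a_def b_def \<sigma>_def\<close>)
  have \<xi>M[measurable]: "?\<xi> \<in> bm M" by (rule measurable_from_subalg[OF subalgebra_past[OF motion] \<xi>m])
  let ?t = "tauv v y"
  let ?S = "Sg {Inl v, Inr (Inr v)}"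
  have BS: "0 <= s ==> B v s \<in> bm ?S" for s by (rule Sg_B) simp
  have ES: "EE v \<in> bm ?S" by (rule Sg_EE) simp
  have tS[measurable]: "?t \<in> bm ?S"
   by (rule measurable_tauv[OF BS ES, where f = "\<lambda>z. z"]) auto
  have [measurable]: "(\<lambda>w'. B v (?t w') w') \<in> bm ?S"
   by (rule measurable_Bv[OF BS, where f = "\<lambda>z. z"]) (auto simp: tauv_nonneg)
  have \<xi>S[measurable]: "Measurable.pred ?S (\<lambda>w'. seen v Q b y w')"
   by (rule seen_measurable[OF _ BS, where f = "\<lambda>z. z"]) (use Q in auto)
  note tM[measurable] = measurable_from_subalg[OF subalgebra_Sg tS]
  let ?G1 = "\<lambda>w'. ennreal (?\<xi> w' * exp (- ga l * a) * hh l (y + B v a w')) * indicator {w. a < ?t w} w'"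
  let ?G2 = "\<lambda>w'. ennreal (?\<xi> w' * exp (- ga l * c) * hh l (y + B v c w')) * indicator {w. c < ?t w} w'"
  let ?G3 = "\<lambda>w'. ennreal (?\<xi> w' * exp (- ga l * ?t w') * hh l (y + B v (?t w') w')) * indicator {a<..c} (?t w')"
  have bal: "(\<E> w'. ?G1 w') = (\<E> w'. ?G2 w') + ennreal (1 + m) * (\<E> w'. ?G3 w')"
  proof -
   have cond: "g u + ga l - (ga l - m * g u) = (1 + m) * g u" for u by (simp add: algebra_simps)
   have \<xi>01: "0 <= ?\<xi> w' \<and> ?\<xi> w' <= 1" for w' by simp
   have m1: "0 < 1 + m" using m_pos by simp
   show ?thesis
    using killed_bm.killed_balance[OF killed floquet_hh[of l] pot_per_lip a0(1) \<xi>m \<xi>01 a0(2) m1 cond, where x = y]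
    unfolding killed_tau .
  qed
  have G3S: "?G3 \<in> bm ?S" by measurable
  have G3M: "?G3 \<in> bm M" by (rule measurable_from_subalg[OF subalgebra_Sg G3S])
  have BM'[measurable]: "B v a \<in> bm M" "B v c \<in> bm M" using BM_measurable[OF motion] a0 by auto
  have G1M: "?G1 \<in> bm M" and G2M: "?G2 \<in> bm M" unfolding indicator_def mem_Collect_eq by measurable
  have AM[measurable]: "A v \<in> measurable M (count_space UNIV)" by (rule offspring_measurable)
  let ?z = "Z w * ennreal (exp (- ga l * b))"
  have E: "ennreal (exp (- ga l * (b + u)) * hh l z) = ennreal (exp (- ga l * b)) * ennreal (exp (- ga l * u) * hh l z)" for u z
   by (simp only: ennreal_mult[OF exp_ge_zero mult_nonneg_nonneg[OF exp_ge_zero hh_nonneg], symmetric]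
     mult.assoc[symmetric] exp_add[symmetric] distrib_left)
  have ac: "\<sigma> w = b + a" "t = b + c" by (simp_all add: a_def c_def)
  note F = F1_def F2_def F3_def D_def b_def[symmetric] y_def[symmetric] ac E
  have 1: "F1 w w' = ?z * ?G1 w'" and 2: "F2 w w' = ?z * ?G2 w'" for w'
   unfolding F using a0 by (simp_all add: indicator_def mult_ac)
  have 3: "F3 w w' = ?z * (kids v w' * ?G3 w')" if "w' \<in> space M" for w'
   unfolding F using a0 tauv_nonneg[OF that, of v y] by (simp add: indicator_def mult_ac)
  have "(\<E> w'. F1 w w') = ?z * (\<E> w'. ?G1 w')"
   unfolding 1 by (rule nn_integral_cmult[OF G1M])
  also have "... = ?z * (\<E> w'. ?G2 w') + ?z * (ennreal (1 + m) * (\<E> w'. ?G3 w'))"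
   unfolding bal by (simp only: distrib_left)
  also have "?z * (\<E> w'. ?G2 w') = (\<E> w'. F2 w w')"
   unfolding 2 by (rule nn_integral_cmult[OF G2M, symmetric])
  also have "ennreal (1 + m) * (\<E> w'. ?G3 w') = (\<E> w'. kids v w' * ?G3 w')"
   unfolding offspring_mean[symmetric] by (rule offspring_factor[OF G3S, symmetric])
  also have "?z * (\<E> w'. kids v w' * ?G3 w') = (\<E> w'. ?z * (kids v w' * ?G3 w'))"
  proof (rule nn_integral_cmult[symmetric])
   note G3M[measurable]
   show "(\<lambda>w'. kids v w' * ?G3 w') \<in> bm M" by measurable
  qed
  also have "... = (\<E> w'. F3 w w')" by (rule nn_integral_cong) (simp only: 3)
  finally show ?thesis .
 qed
 have m2: "(\<lambda>w. \<E> w'. F w w') \<in> bm M" if F: "(\<lambda>(w, w'). F w w') \<in> bm ?N" for F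
 proof -
  have id1: "(\<lambda>z. (fst z, snd z)) \<in> measurable (M \<Otimes>\<^sub>M M) ?N"
   by (intro measurable_Pair measurable_compose[OF measurable_fst subalgebra_measurable_id[OF subalgebra_Sg]]
      measurable_compose[OF measurable_snd subalgebra_measurable_id[OF subalgebra_Sg]])
  from borel_measurable_nn_integral_fst[OF measurable_compose[OF id1 F]] show ?thesis by simp
 qed
 have "(\<E> w. F1 w w) = (\<E> w. (\<E> w'. F1 w w'))" by (rule own_freeze[OF F1m])
 also have "... = (\<E> w. (\<E> w'. F2 w w') + (\<E> w'. F3 w w'))" by (rule nn_integral_cong) (rule inner)
 also have "... = (\<E> w. (\<E> w'. F2 w w')) + (\<E> w. (\<E> w'. F3 w w'))"
  by (rule nn_integral_add[OF m2[OF F2m] m2[OF F3m]])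
 also have "... = (\<E> w. F2 w w) + (\<E> w. F3 w w)"
  unfolding own_freeze[OF F2m] own_freeze[OF F3m] ..
 finally show ?thesis by (simp only: e1 e2 e3 cong: nn_integral_cong)
qed

text \<open>Integration over counting measure lets sums over infinitely many labels, realized or
  not, commute with expectations without any summability condition.\<close>

definition gsum :: "nat => (label => ennreal) => ennreal" where
 "gsum n F = (\<integral>\<^sup>+v. F v \<partial>count_space {v. length v = n})"

lemma gsum_mono: "(!!v. length v = n ==> F v <= G v) ==> gsum n F <= gsum n G"
 unfolding gsum_def by (rule nn_integral_mono) simp

lemma gsum_cong: "(!!v. length v = n ==> F v = G v) ==> gsum n F = gsum n G"
 unfolding gsum_def by (rule nn_integral_cong) simp

lemma gsum_add: "gsum n (\<lambda>v. F v + G v) = gsum n F + gsum n G"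
 unfolding gsum_def by (rule nn_integral_add) auto

lemma gsum_cmult: "gsum n (\<lambda>v. c * F v) = c * gsum n F"
 unfolding gsum_def by (rule nn_integral_cmult) auto

lemma gsum_0: "gsum 0 F = F []"
 unfolding gsum_def by (simp add: nn_integral_count_space_finite)

lemma gsum_measurable:
 assumes "!!v. length v = n ==> F v \<in> bm N"
 shows "(\<lambda>w. gsum n (\<lambda>v. F v w)) \<in> bm N"
proof -
 interpret sigma_finite_measure "count_space {v :: label. length v = n}"
  by (rule sigma_finite_measure_count_space_countable) auto
 have "(\<lambda>(w, v). F v w) \<in> bm (N \<Otimes>\<^sub>M count_space {v. length v = n})"
  unfolding split_beta
  by (rule measurable_compose_countable'[where I = "{v. length v = n}"])
    (use assms in \<open>auto intro: measurable_compose[OF measurable_fst]\<close>)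
 from borel_measurable_nn_integral[OF this] show ?thesis by (simp add: gsum_def)
qed

lemma nn_integral_gsum:
 assumes "!!v. length v = n ==> F v \<in> bm N"
 shows "(\<integral>\<^sup>+w. gsum n (\<lambda>v. F v w) \<partial>N) = gsum n (\<lambda>v. \<integral>\<^sup>+w. F v w \<partial>N)"
 unfolding gsum_def
 by (rule nn_integral_count_space_nn_integral) (use assms in auto)

lemma gsum_Suc: "gsum (Suc n) F = gsum n (\<lambda>v. \<integral>\<^sup>+i. F (i # v) \<partial>count_space UNIV)"
proof -
 have bij: "bij_betw (\<lambda>(v, i). i # v) ({v :: label. length v = n} \<times> UNIV) {v. length v = Suc n}"
  by (rule bij_betwI[where g = "\<lambda>u. (tl u, hd u)"]) (auto simp: length_Suc_conv)
 have "gsum (Suc n) F = (\<integral>\<^sup>+z. F (case z of (v, i) => i # v) \<partial>count_space ({v. length v = n} \<times> UNIV))"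
  unfolding gsum_def by (rule nn_integral_bij_count_space[OF bij, symmetric])
 also have "... = gsum n (\<lambda>v. \<integral>\<^sup>+i. F (i # v) \<partial>count_space UNIV)"
 proof -
  have "(\<integral>\<^sup>+z. F (case z of (v, i) => i # v) \<partial>count_space ({v. length v = n} \<times> UNIV))
    = (\<integral>\<^sup>+z. F (snd z # fst z) * indicator {v. length v = n} (fst z) \<partial>count_space UNIV)"
   by (subst nn_integral_count_space_indicator) (auto intro!: nn_integral_cong simp: indicator_def split: prod.split)
  also have "... = (\<integral>\<^sup>+v. (\<integral>\<^sup>+i. F (i # v) * indicator {v. length v = n} v \<partial>count_space UNIV) \<partial>count_space UNIV)"
   by (subst nn_integral_fst_count_space[symmetric]) simp
  also have "... = gsum n (\<lambda>v. \<integral>\<^sup>+i. F (i # v) \<partial>count_space UNIV)"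
   unfolding gsum_def by (subst (2) nn_integral_count_space_indicator) (simp_all add: nn_integral_multc)
  finally show ?thesis .
 qed
 finally show ?thesis .
qed

lemma sum_children: "(\<integral>\<^sup>+i. of_bool (i < 1 + k) \<partial>count_space (UNIV :: nat set)) = ennreal (1 + real k)"
proof -
 have "(\<integral>\<^sup>+i. of_bool (i < 1 + k) \<partial>count_space (UNIV :: nat set)) = (\<integral>\<^sup>+i. indicator {..<1 + k} i \<partial>count_space (UNIV :: nat set))"
  by (intro nn_integral_cong) (auto simp: indicator_def)
 also have "... = emeasure (count_space UNIV) {..<1 + k}" by (rule nn_integral_indicator) simp
 also have "... = ennreal (1 + real k)" by (simp add: ennreal_of_nat_eq_real_of_nat)
 finally show ?thesis .
qed

lemma gsum_children:
 assumes F: "!!i v. length v = n ==> F (i # v) = of_bool (realized A (i # v) w) * G v"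
 shows "gsum (Suc n) F = gsum n (\<lambda>v. of_bool (realized A v w) * kids v w * G v)"
 unfolding gsum_Suc
proof (rule gsum_cong)
 fix v :: label assume v: "length v = n"
 have "(\<integral>\<^sup>+i. F (i # v) \<partial>count_space UNIV) = (\<integral>\<^sup>+i. of_bool (i < 1 + A v w) * (of_bool (realized A v w) * G v) \<partial>count_space UNIV)"
  unfolding F[OF v] by (intro nn_integral_cong) auto
 also have "... = kids v w * (of_bool (realized A v w) * G v)"
  by (subst nn_integral_multc) (simp_all only: sum_children, simp_all)
 finally show "(\<integral>\<^sup>+i. F (i # v) \<partial>count_space UNIV) = of_bool (realized A v w) * kids v w * G v"
  by (simp only: mult_ac)
qed

end

section \<open>Stopped generation sums\<close>

text \<open>This is the supermartingale property of min(., C) in the only form needed: X is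
  exchanged for Y where X < C, and C is a trivial bound elsewhere. A single event is tested, so no
  conditional expectation has to be formed.\<close>

lemma (in prob_space) min_mean_antimono:
 fixes X Y :: "'a => ennreal" and C :: ennreal
 assumes [measurable]: "X \<in> bm M" "Y \<in> bm M"
  and eq: "(\<E> w. of_bool (X w < C) * X w) = (\<E> w. of_bool (X w < C) * Y w)"
 shows "(\<E> w. min (Y w) C) <= (\<E> w. min (X w) C)"
proof -
 have "(\<E> w. min (Y w) C) <= (\<E> w. of_bool (X w < C) * Y w + of_bool (\<not> X w < C) * C)"
  by (rule nn_integral_mono) (auto simp: min_def)
 also have "... = (\<E> w. of_bool (X w < C) * Y w) + (\<E> w. of_bool (\<not> X w < C) * C)"
  by (rule nn_integral_add) measurable
 also have "... = (\<E> w. of_bool (X w < C) * X w) + (\<E> w. of_bool (\<not> X w < C) * C)"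
  by (simp only: eq)
 also have "... = (\<E> w. of_bool (X w < C) * X w + of_bool (\<not> X w < C) * C)"
  by (rule nn_integral_add[symmetric]) measurable
 also have "... = (\<E> w. min (X w) C)"
  by (rule nn_integral_cong) (auto simp: min_def)
 finally show ?thesis .
qed

type_synonym obs = "label \<times> real \<times> real set + label \<times> (real \<times> real) set"

context bbm_full begin

lemma realized_measurable [measurable]: "realized A v \<in> measurable M (count_space UNIV)"
 using measurable_from_subalg[OF subalgebra_Sg Sg_realized[of v UNIV]] by simp

lemma death_measurable [measurable]: "death T v \<in> bm M"
 and dp_measurable [measurable]: "dp v \<in> bm M"
 using measurable_from_subalg[OF subalgebra_Sg Sg_T(3)[of v UNIV]] measurable_from_subalg[OF subalgebra_Sg Sg_T(2)[of v UNIV]]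
 by simp_all

lemma A_measurable [measurable]: "A v \<in> measurable M (count_space UNIV)" by (rule offspring_measurable)

lemma Yt_measurable_Sg:
 assumes "!!u. u \<in> insert v (ancs v) ==> Inl u \<in> P \<and> Inr (Inr u) \<in> P"
 shows "Yt l t v \<in> bm (Sg P)"
proof -
 have [measurable]: "birth T v \<in> bm (Sg P)" "bp v \<in> bm (Sg P)"
  by (rule Sg_birth; use assms in blast)+
 have [measurable]: "(\<lambda>w. B v (max 0 (t - bt v w)) w) \<in> bm (Sg P)"
  by (rule measurable_Bv[where f = "\<lambda>w. w" and N = "Sg P"]) (use assms Sg_B in auto)
 show ?thesis unfolding Yt_def[abs_def] by measurable
qed

lemma Yt_measurable [measurable]: "Yt l t v \<in> bm M"
 by (rule measurable_from_subalg[OF subalgebra_Sg Yt_measurable_Sg[of v UNIV]]) auto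

lemma Yb_measurable [measurable]: "Yb l v \<in> bm M" unfolding Yb_def[abs_def] by measurable
lemma Yd_measurable [measurable]: "Yd l v \<in> bm M" unfolding Yd_def[abs_def] by measurable

lemma death_le_birth: "wt \<in> ancs v ==> w \<in> space M ==> death T wt w <= bt v w"
proof (induction v)
 case (Cons i v)
 thus ?case using T_nonneg[of w v] by (auto simp: death_def)
qed simp

lemma birth_le_death: "w \<in> space M ==> bt v w <= death T v w"
 using T_nonneg[of w v] by (simp add: death_def)

lemma g_bounds: obtains g0 g1 where "0 < g0" "g0 <= g1" "!!y. g0 <= g y" "!!y. g y <= g1"
proof -
 obtain g0 where g0: "g0 > 0" "!!y. g0 <= g y"
  using periodic_lower_bound[OF g_cont g_periodic gpos] by auto
 obtain g1 where g1: "!!y. \<bar>g y\<bar> <= g1"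
  using periodic_bounded[OF g_cont g_periodic] by auto
 show ?thesis
 proof (rule that[of g0 g1])
  show "g y <= g1" for y using g1[of y] by simp
  thus "g0 <= g1" using g0(2)[of 0] by (meson order_trans)
 qed (use g0 in auto)
qed

definition gw :: "real => (real => real) => label => 'w => ennreal" where
 "gw dl H v w = ennreal (exp (- dl * bt v w) * H (bp v w))"

abbreviation "GG dl H n w \<equiv> gsum n (\<lambda>v. of_bool (realized A v w) * gw dl H v w)"

lemma gsum_realized_Suc:
 "GG dl H (Suc n) w
  = gsum n (\<lambda>v. of_bool (realized A v w) * kids v w * ennreal (exp (- dl * death T v w) * H (dp v w)))"
 by (rule gsum_children) (simp add: gw_def death_def dp_def)

lemma realized_SO: "(\<lambda>w. of_bool (realized A v w) :: ennreal) \<in> bm (SO v)"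
 using SO_realized[OF not_ancs_self, of v] by measurable

text \<open>Mass disappears at least \<open>ap\<close> times as fast as particles die, so the weight
  at death is at most 1 / ap of the weight at birth, and 1 + m is the mean number of
  children.\<close>

lemma generation_le:
 assumes fl: "floquet l r H H'" and r: "per_lip r" and ap: "0 < ap" "!!y. ap * g y <= g y + dl - r y"
 shows "(\<E> w. GG dl H n w) <= ennreal (((1 + m) / ap) ^ n * H x)"
proof (induction n)
 case 0
 show ?case by (simp add: gsum_0 gw_def emeasure_space_1)
next
 case (Suc n)
 have [measurable]: "H \<in> bm borel" using borel_measurable_continuous_onI[OF floquet_continuous(1)[OF fl]] .
 have q: "ennreal (1 / ap) * ennreal ap = 1" using ap(1) by (simp add: ennreal_mult[symmetric])
 have "(\<E> w. GG dl H (Suc n) w)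
  = gsum n (\<lambda>v. \<E> w. of_bool (realized A v w) * kids v w * ennreal (exp (- dl * death T v w) * H (dp v w)))"
  unfolding gsum_realized_Suc by (rule nn_integral_gsum) measurable
 also have "... <= gsum n (\<lambda>v. ennreal ((1 + m) / ap) * (\<E> w. of_bool (realized A v w) * gw dl H v w))"
 proof (rule gsum_mono)
  fix v :: label
  let ?I = "\<integral>\<^sup>+w. of_bool (realized A v w) * kids v w * ennreal (exp (- dl * death T v w) * H (dp v w)) \<partial>M"
  have "ennreal ap * ?I <= ennreal (1 + m) * (\<E> w. of_bool (realized A v w) * ennreal (exp (- dl * bt v w) * H (bp v w)))"
   using one_step_le[OF realized_SO[of v] fl r ap, where f = "\<lambda>k. ennreal (1 + real k)"] unfolding offspring_mean .
  from mult_left_mono[OF this, of "ennreal (1 / ap)"]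
  have "(ennreal (1 / ap) * ennreal ap) * ?I <= (ennreal (1 / ap) * ennreal (1 + m)) * (\<E> w. of_bool (realized A v w) * gw dl H v w)"
   unfolding gw_def by (simp only: mult.assoc) simp
  also have "ennreal (1 / ap) * ennreal (1 + m) = ennreal ((1 + m) / ap)"
   using ap(1) m_pos by (simp add: ennreal_mult[symmetric] del: ennreal_plus)
  finally show "?I <= ennreal ((1 + m) / ap) * (\<E> w. of_bool (realized A v w) * gw dl H v w)"
   unfolding q by simp
 qed
 also have "... = ennreal ((1 + m) / ap) * (\<E> w. GG dl H n w)"
  unfolding gsum_cmult by (subst nn_integral_gsum) (auto simp: gw_def)
 also have "... <= ennreal ((1 + m) / ap) * ennreal (((1 + m) / ap) ^ n * H x)"
  by (rule mult_left_mono[OF Suc.IH]) simp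
 also have "... = ennreal (((1 + m) / ap) ^ Suc n * H x)"
  using ap(1) m_pos floquetD(1)[OF fl, of x] by (simp add: ennreal_mult[symmetric] mult_ac)
 finally show ?case .
qed

text \<open>A discount above c raises the rate of disappearance above (1 + m) g; dividing the
  surplus by an upper bound of g turns it into a multiple of g.\<close>

lemma generation_decay:
 assumes fl: "floquet l (\<lambda>y. c - m * g y) H H'" and dl: "c < dl"
 obtains rh where "0 < rh" "rh < 1"
  "!!n. (\<E> w. GG dl H n w) <= ennreal (rh ^ n * H x)"
proof -
 obtain g0 g1 where gb: "0 < g0" "g0 <= g1" "!!y. g0 <= g y" "!!y. g y <= g1" by (rule g_bounds) (rule that; assumption)
 define ap where "ap = 1 + m + (dl - c) / g1"
 have a: "1 + m < ap" using dl gb by (simp add: ap_def)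
 have "ap * g y <= g y + dl - (c - m * g y)" for y
 proof -
  have "(dl - c) / g1 * g y <= (dl - c) / g1 * g1" using gb dl by (intro mult_left_mono) auto
  also have "... = dl - c" using gb by simp
  finally show ?thesis by (simp add: ap_def algebra_simps)
 qed
 note b = generation_le[OF fl pot_per_lip _ this]
 show ?thesis
 proof (rule that[of "(1 + m) / ap"])
  show "0 < (1 + m) / ap" "(1 + m) / ap < 1" using a m_pos by auto
  show "!!n. (\<E> w. GG dl H n w) <= ennreal (((1 + m) / ap) ^ n * H x)"
   by (rule b) (use a m_pos in auto)
 qed
qed

section \<open>Sums at a fixed time, in a generation, and along stopped lines\<close>

definition Al :: "real => nat => real => 'w => ennreal" where
 "Al l n t w = gsum n (\<lambda>v. of_bool (realized A v w \<and> bt v w <= t \<and> t < death T v w) * ennreal (Yt l t v w))"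
definition Bo :: "real => nat => real => 'w => ennreal" where
 "Bo l n t w = gsum n (\<lambda>v. of_bool (realized A v w \<and> bt v w <= t) * ennreal (Yb l v w))"
definition Bn :: "real => nat => real => real => 'w => ennreal" where
 "Bn l n s t w = gsum n (\<lambda>v. of_bool (realized A v w \<and> s < bt v w \<and> bt v w <= t) * ennreal (Yb l v w))"
text \<open>The sum over the line where every ancestral line is stopped at time t or on birth into
  generation n, whichever comes first. Almost surely it tends to \<open>WW l t\<close> as n grows,
  and it tends to \<open>VV l n\<close> as t grows.\<close>

definition UU :: "real => nat => real => 'w => ennreal" where
 "UU l n t w = (\<Sum>k<n. Al l k t w) + Bo l n t w"
definition VV :: "real => nat => 'w => ennreal" where
 "VV l n w = gsum n (\<lambda>v. of_bool (realized A v w) * ennreal (Yb l v w))"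
definition WW :: "real => real => 'w => ennreal" where
 "WW l t w = (\<Sum>n. Al l n t w)"

lemma Al_measurable [measurable]: "Al l n t \<in> bm M"
 and Bo_measurable [measurable]: "Bo l n t \<in> bm M"
 and Bn_measurable [measurable]: "Bn l n s t \<in> bm M"
 and VV_measurable [measurable]: "VV l n \<in> bm M"
 unfolding Al_def[abs_def] Bo_def[abs_def] Bn_def[abs_def] VV_def[abs_def]
 by (rule gsum_measurable; measurable)+

lemma UU_measurable [measurable]: "UU l n t \<in> bm M" unfolding UU_def[abs_def] by measurable
lemma WW_measurable [measurable]: "WW l t \<in> bm M" unfolding WW_def[abs_def] by measurable

lemma Bo_split: "s <= t ==> Bo l n t w = Bo l n s w + Bn l n s t w"
 unfolding Bo_def Bn_def gsum_add[symmetric] by (rule gsum_cong) (auto simp: of_bool_def)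

text \<open>One extra unit of discount costs at most exp t on births before t, and it makes the
  generation means decay geometrically.\<close>

lemma Bo_decay:
 obtains rh C where "0 < rh" "rh < 1" "0 < C" "!!n. (\<E> w. Bo l n t w) <= ennreal (C * rh ^ n)"
proof -
 obtain rh where rh: "0 < rh" "rh < 1"
  "!!n. (\<E> w. GG (ga l + 1) (hh l) n w) <= ennreal (rh ^ n * hh l x)"
  by (rule generation_decay[OF floquet_hh, of l "ga l + 1"]) auto
 show ?thesis
 proof (rule that[OF rh(1,2), of "exp t * hh l x"])
  show "0 < exp t * hh l x" using hh_pos by simp
  fix n
  have "(\<E> w. Bo l n t w) <= (\<E> w. ennreal (exp t) * GG (ga l + 1) (hh l) n w)"
   unfolding Bo_def gsum_cmult[symmetric]
  proof (intro nn_integral_mono gsum_mono)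
   fix w v
   have "ennreal (Yb l v w) <= ennreal (exp t) * gw (ga l + 1) (hh l) v w" if "bt v w <= t"
   proof -
    have "exp (- ga l * bt v w) * 1 <= exp (- ga l * bt v w) * exp (t - bt v w)" using that by (intro mult_left_mono) auto
    also have "... = exp t * exp (- (ga l + 1) * bt v w)" by (simp add: algebra_simps flip: exp_add)
    finally have "Yb l v w <= exp t * (exp (- (ga l + 1) * bt v w) * hh l (bp v w))"
     unfolding Yb_def mult.assoc[symmetric] using hh_nonneg by (intro mult_right_mono) auto
    thus ?thesis unfolding gw_def using hh_nonneg by (subst ennreal_mult[symmetric]) (auto intro: ennreal_leI)
   qed
   thus "of_bool (realized A v w \<and> bt v w <= t) * ennreal (Yb l v w) <= ennreal (exp t) * (of_bool (realized A v w) * gw (ga l + 1) (hh l) v w)"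
    by (auto simp: of_bool_def)
  qed
  also have "... = ennreal (exp t) * (\<E> w. GG (ga l + 1) (hh l) n w)"
   by (rule nn_integral_cmult, rule gsum_measurable) (auto simp: gw_def)
  also have "... <= ennreal (exp t) * ennreal (rh ^ n * hh l x)" by (rule mult_left_mono[OF rh(3)]) simp
  also have "... = ennreal (exp t * hh l x * rh ^ n)" using rh hh_nonneg by (simp add: ennreal_mult[symmetric] mult_ac)
  finally show "(\<E> w. Bo l n t w) <= ennreal (exp t * hh l x * rh ^ n)" .
 qed
qed

lemma geometric_suminf_finite:
 fixes f :: "nat => ennreal"
 assumes "0 < rh" "rh < 1" "0 < C" "!!n. f n <= ennreal (C * rh ^ n)"
 shows "(\<Sum>n. f n) < \<infinity>"
proof -
 have "(\<Sum>n. f n) <= (\<Sum>n. ennreal (C * rh ^ n))" by (rule suminf_le) (use assms in auto)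
 also have "... = ennreal (\<Sum>n. C * rh ^ n)"
  by (rule suminf_ennreal2) (use assms in \<open>auto intro: summable_mult summable_geometric\<close>)
 finally show ?thesis by (simp add: top.not_eq_extremum order_le_less_trans)
qed

text \<open>At l = 0 the eigenfunction is periodic, hence bounded away from 0, so births before a
  fixed time carry weights bounded below; their total expected weight is finite, which bounds their
  number.\<close>

lemma population_finite: "AE w in M. \<forall>t. finite {v. realized A v w \<and> bt v w <= t}"
proof -
 have "AE w in M. finite {v. realized A v w \<and> bt v w <= real N}" for N :: nat
 proof -
  obtain rh C where rh: "0 < rh" "rh < 1" "0 < C" "!!n. (\<E> w. Bo 0 n (real N) w) <= ennreal (C * rh ^ n)"
   by (rule Bo_decay[where l = 0 and t = "real N"]; rule that; assumption)
  have "(\<E> w. (\<Sum>n. Bo 0 n (real N) w)) = (\<Sum>n. \<E> w. Bo 0 n (real N) w)" by (rule nn_integral_suminf) measurable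
  also have "... < \<infinity>" by (rule geometric_suminf_finite[OF rh])
  finally have "AE w in M. (\<Sum>n. Bo 0 n (real N) w) ~= \<infinity>" by (intro nn_integral_noteq_infinite) auto
  thus ?thesis using AE_space
  proof eventually_elim
   case (elim w)
   obtain c where c: "0 < c" "!!y. c <= hh 0 y"
    using periodic_lower_bound[OF floquet_continuous(1)[OF floquet_hh[of 0]] _ hh_pos] floquetD(4)[OF floquet_hh[of 0]] by auto
   let ?S = "{v. realized A v w \<and> bt v w <= real N}"
   define e where "e = exp (- ga 0 * real N) * c"
   have e: "0 < e" using c by (simp add: e_def)
   have Ye: "e <= Yb 0 v w" if "v \<in> ?S" for v
    unfolding e_def Yb_def using that c ga_0_pos by (intro mult_mono) auto
   have sn: "ennreal e * emeasure (count_space UNIV) ({v. length v = n} \<inter> ?S) <= Bo 0 n (real N) w" for n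
   proof -
    have "ennreal e * emeasure (count_space {v. length v = n}) ({v. length v = n} \<inter> ?S)
      = (\<integral>\<^sup>+v. ennreal e * indicator ({v. length v = n} \<inter> ?S) v \<partial>count_space {v. length v = n})"
     by (rule nn_integral_cmult_indicator[symmetric]) simp
    also have "... <= Bo 0 n (real N) w" unfolding Bo_def gsum_def
     by (rule nn_integral_mono) (use Ye in \<open>auto simp: indicator_def intro!: ennreal_leI\<close>)
    finally show ?thesis by (simp add: emeasure_count_space)
   qed
   have "emeasure (count_space UNIV) ?S = (\<Sum>n. emeasure (count_space UNIV) ({v. length v = n} \<inter> ?S))"
   proof -
    have "?S = (\<Union>n. {v. length v = n} \<inter> ?S)" by auto
    thus ?thesis by (subst suminf_emeasure) (auto simp: disjoint_family_on_def)
   qed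
   hence "ennreal e * emeasure (count_space UNIV) ?S = (\<Sum>n. ennreal e * emeasure (count_space UNIV) ({v. length v = n} \<inter> ?S))" by simp
   also have "... <= (\<Sum>n. Bo 0 n (real N) w)" by (intro suminf_le sn) auto
   finally have "ennreal e * emeasure (count_space UNIV) ?S < \<infinity>" using elim(1) by (simp add: top.not_eq_extremum order_le_less_trans)
   hence "emeasure (count_space UNIV) ?S < \<infinity>" using e by (auto simp: ennreal_mult_less_top top.not_eq_extremum)
   thus ?case by (auto simp: emeasure_count_space split: if_splits)
  qed
 qed
 hence "AE w in M. \<forall>N. finite {v. realized A v w \<and> bt v w <= real N}" by (simp add: AE_all_countable)
 thus ?thesis
 proof (rule AE_mp, intro AE_I2 impI allI)
  fix w and t :: real
  assume fin: "\<forall>N. finite {v. realized A v w \<and> bt v w <= real N}"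
  obtain N where N: "t <= real N" using real_arch_simple by blast
  show "finite {v. realized A v w \<and> bt v w <= t}"
   by (rule finite_subset[OF _ fin[rule_format, of N]]) (use N in auto)
 qed
qed

text \<open>Events determined at time \<open>s\<close>: positions of living particles (\<open>Inl\<close>) and births (\<open>Inr\<close>).\<close>

definition obs_ok :: "real => obs => bool" where
 "obs_ok s c \<longleftrightarrow> (case c of Inl (v, u, S) => 0 <= u \<and> u <= s \<and> S \<in> sets borel | Inr (v, S) => S \<in> sets (borel \<Otimes>\<^sub>M borel))"

definition obs_holds :: "real => obs => 'w => bool" where
 "obs_holds s c w \<longleftrightarrow> (case c of
   Inl (v, u, S) => realized A v w \<and> bt v w <= u \<and> u < death T v w \<and> bp v w + B v (max 0 (u - bt v w)) w \<in> S
  | Inr (v, S) => realized A v w \<and> bt v w <= s \<and> (bt v w, bp v w) \<in> S)"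

definition all_hold :: "real => obs list => 'w => bool" where
 "all_hold s cs w \<longleftrightarrow> (\<forall>c\<in>set cs. obs_holds s c w)"

lemma obs_holds_Sg:
 assumes ok: "obs_ok s c" and P: "!!u. u \<in> insert (case c of Inl (v, _) => v | Inr (v, _) => v) (ancs (case c of Inl (v, _) => v | Inr (v, _) => v))
   ==> Inl u \<in> P \<and> Inr (Inl u) \<in> P \<and> Inr (Inr u) \<in> P"
 shows "Measurable.pred (Sg P) (obs_holds s c)"
proof (cases c)
 case (Inl z)
 obtain v u S where z: "z = (v, u, S)" by (cases z) auto
 have vP: "!!wt. wt \<in> insert v (ancs v) ==> Inl wt \<in> P \<and> Inr (Inl wt) \<in> P \<and> Inr (Inr wt) \<in> P" using P by (simp add: Inl z)
 have [measurable]: "birth T v \<in> bm (Sg P)" "bp v \<in> bm (Sg P)" by (rule Sg_birth; use vP in blast)+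
 have [measurable]: "death T v \<in> bm (Sg P)" by (rule Sg_T; use vP in blast)
 have [measurable]: "realized A v \<in> measurable (Sg P) (count_space UNIV)" by (rule Sg_realized; use vP in blast)
 have [measurable]: "(\<lambda>w. B v (max 0 (u - bt v w)) w) \<in> bm (Sg P)"
  by (rule measurable_Bv[where f = "\<lambda>w. w" and N = "Sg P"]) (use vP Sg_B in auto)
 have [measurable]: "S \<in> sets borel" using ok by (simp add: obs_ok_def Inl z)
 show ?thesis unfolding obs_holds_def[abs_def] Inl z by simp
next
 case (Inr z)
 obtain v S where z: "z = (v, S)" by (cases z) auto
 have vP: "!!wt. wt \<in> insert v (ancs v) ==> Inl wt \<in> P \<and> Inr (Inl wt) \<in> P \<and> Inr (Inr wt) \<in> P" using P by (simp add: Inr z)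
 have [measurable]: "birth T v \<in> bm (Sg P)" "bp v \<in> bm (Sg P)" by (rule Sg_birth; use vP in blast)+
 have [measurable]: "realized A v \<in> measurable (Sg P) (count_space UNIV)" by (rule Sg_realized; use vP in blast)
 have [measurable]: "S \<in> sets (borel \<Otimes>\<^sub>M borel)" using ok by (simp add: obs_ok_def Inr z)
 show ?thesis unfolding obs_holds_def[abs_def] Inr z by simp
qed

lemma all_hold_measurable:
 assumes "!!c. c \<in> set cs ==> obs_ok s c" shows "Measurable.pred M (all_hold s cs)"
proof -
 have "Measurable.pred (Sg UNIV) (obs_holds s c)" if "c \<in> set cs" for c
  by (rule obs_holds_Sg[OF assms[OF that]]) auto
 hence "Measurable.pred (Sg UNIV) (all_hold s cs)" unfolding all_hold_def[abs_def] by (intro pred_intros_finite) auto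
 thus ?thesis by (rule measurable_from_subalg[OF subalgebra_Sg])
qed

text \<open>Before its death, a particle is not the ancestor of anyone observed, so that an event determined at time
 \<open>s\<close> splits into information on other particles and on the path of the particle itself.\<close>

lemma all_hold_section:
 assumes "!!c. c \<in> set cs ==> obs_ok s c"
 shows "\<exists>Z Q. Measurable.pred (SO wt) Z \<and> (\<forall>(u, S)\<in>set Q. u <= s \<and> S \<in> sets borel) \<and>
   (\<forall>w\<in>space M. realized A wt w --> s < death T wt w --> all_hold s cs w \<longleftrightarrow> Z w \<and> seen wt Q (bt wt w) (bp wt w) w)"
 using assms
proof (induction cs)
 case Nil
 show ?case by (intro exI[of _ "\<lambda>_. True"] exI[of _ "[]"]) (auto simp: all_hold_def seen_def)
next
 case (Cons c cs)
 have "\<exists>Z Q. Measurable.pred (SO wt) Z \<and> (\<forall>(u, S)\<in>set Q. u <= s \<and> S \<in> sets borel) \<and>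
   (\<forall>w\<in>space M. realized A wt w --> s < death T wt w --> all_hold s cs w \<longleftrightarrow> Z w \<and> seen wt Q (bt wt w) (bp wt w) w)"
  by (rule Cons.IH) (use Cons.prems in simp)
 then obtain Z Q where Z: "Measurable.pred (SO wt) Z" and Q: "\<forall>(u, S)\<in>set Q. u <= s \<and> S \<in> sets borel"
  and eq: "!!w. w \<in> space M ==> realized A wt w ==> s < death T wt w ==> all_hold s cs w \<longleftrightarrow> Z w \<and> seen wt Q (bt wt w) (bp wt w) w"
  by blast
 have ok: "obs_ok s c" using Cons.prems by simp
 have all: "all_hold s (c # cs) w \<longleftrightarrow> obs_holds s c w \<and> all_hold s cs w" for w by (simp add: all_hold_def)
 let ?v = "case c of Inl (v, _) => v | Inr (v, _) => v"
 consider (anc) "wt \<in> ancs ?v" | (other) "wt \<notin> ancs ?v" "?v ~= wt" | (self) "?v = wt" using not_ancs_self by blast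
 thus ?case
 proof cases
  case anc
  \<comment> \<open>Observing a descendant of \<open>wt\<close> requires its birth by time s, hence
    the death of \<open>wt\<close> by time s.\<close>
  have "\<not> obs_holds s c w" if wt: "w \<in> space M" and d: "s < death T wt w" for w
   using death_le_birth[OF anc wt] d ok by (auto simp: obs_holds_def obs_ok_def split: sum.splits prod.splits)
  thus ?thesis using all by (intro exI[of _ "\<lambda>_. False"] exI[of _ "[]"]) auto
 next
  case other
  have c: "Measurable.pred (SO wt) (obs_holds s c)" by (rule obs_holds_Sg[OF ok]) (use other in \<open>auto simp: own_def\<close>)
  show ?thesis using c Z Q eq all by (intro exI[of _ "\<lambda>w. obs_holds s c w \<and> Z w"] exI[of _ Q]) auto
 next
  case self
  show ?thesis
  proof (cases c)
   case (Inl z)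
   then obtain u S where c: "c = Inl (wt, u, S)" using self by (cases z) auto
   have uS: "u <= s" "S \<in> sets borel" using ok c by (auto simp: obs_ok_def)
   have "obs_holds s c w \<longleftrightarrow> bt wt w <= u \<and> bp wt w + B wt (u - bt wt w) w \<in> S" if "realized A wt w" "s < death T wt w" for w
    using that uS by (auto simp: obs_holds_def c max_def)
   thus ?thesis using Z Q eq all uS
    by (intro exI[of _ Z] exI[of _ "(u, S) # Q"]) (auto simp: seen_def)
  next
   case (Inr z)
   then obtain S where c: "c = Inr (wt, S)" using self by (cases z) auto
   have [measurable]: "S \<in> sets (borel \<Otimes>\<^sub>M borel)" using ok c by (simp add: obs_ok_def)
   have [measurable]: "birth T wt \<in> bm (SO wt)" "bp wt \<in> bm (SO wt)" using SO_birth[OF not_ancs_self] by auto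
   have Zm: "Measurable.pred (SO wt) (\<lambda>w. (bt wt w <= s \<and> (bt wt w, bp wt w) \<in> S) \<and> Z w)" using Z by measurable
   show ?thesis using Zm Q eq all
    by (intro exI[of _ "\<lambda>w. (bt wt w <= s \<and> (bt wt w, bp wt w) \<in> S) \<and> Z w"] exI[of _ Q]) (auto simp: obs_holds_def c)
  qed
 qed
qed

lemma alive_after_birth_AE: "AE w in M. bt v w < death T v w"
 using T_pos_AE[of v] by eventually_elim (simp add: death_def)

lemma Yt_birth: "w \<in> space M ==> Yt l (bt v w) v w = Yb l v w"
 using BM_zero[OF motion] by (simp add: Yt_def Yb_def)

text \<open>A particle alive at time s and one born during (s, t] are both covered by the balance
  started at the later of s and the birth time; by time t each of them is still alive or has
  branched.\<close>

lemma particle_step: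
 assumes cs: "!!c. c \<in> set cs ==> obs_ok s c" and st: "0 <= s" "s <= t"
 shows "(\<E> w. of_bool (all_hold s cs w) * (of_bool (realized A v w \<and> bt v w <= s \<and> s < death T v w) * ennreal (Yt l s v w)))
  + (\<E> w. of_bool (all_hold s cs w) * (of_bool (realized A v w \<and> s < bt v w \<and> bt v w <= t) * ennreal (Yb l v w)))
  = (\<E> w. of_bool (all_hold s cs w) * (of_bool (realized A v w \<and> bt v w <= t \<and> t < death T v w) * ennreal (Yt l t v w)))
  + (\<E> w. of_bool (all_hold s cs w) * (of_bool (realized A v w) * kids v w * (of_bool (s < death T v w \<and> death T v w <= t) * ennreal (Yd l v w))))"
proof -
 obtain Z Q where Z: "Measurable.pred (SO v) Z" and Q: "!!u S. (u, S) \<in> set Q ==> u <= s \<and> S \<in> sets borel"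
  and eq: "!!w. w \<in> space M ==> realized A v w ==> s < death T v w ==> all_hold s cs w \<longleftrightarrow> Z w \<and> seen v Q (bt v w) (bp v w) w"
  using all_hold_section[of cs s v] cs by blast
 note hm[measurable] = all_hold_measurable[OF cs]
 let ?Z = "\<lambda>w. of_bool (realized A v w \<and> Z w) :: ennreal"
 have Zm: "?Z \<in> bm (SO v)" using Z SO_realized[OF not_ancs_self, of v] by measurable
 let ?\<sigma> = "\<lambda>w. max s (bt v w)"
 let ?L = "\<lambda>w. ?Z w * of_bool (bt v w <= t \<and> seen v Q (bt v w) (bp v w) w \<and> ?\<sigma> w < death T v w) * ennreal (Yt l (?\<sigma> w) v w)"
 let ?R1 = "\<lambda>w. ?Z w * of_bool (bt v w <= t \<and> seen v Q (bt v w) (bp v w) w \<and> t < death T v w) * ennreal (Yt l t v w)"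
 let ?R2 = "\<lambda>w. ?Z w * of_bool (bt v w <= t \<and> seen v Q (bt v w) (bp v w) w \<and> ?\<sigma> w < death T v w \<and> death T v w <= t)
     * kids v w * ennreal (Yd l v w)"
 have bal: "(\<E> w. ?L w) = (\<E> w. ?R1 w) + (\<E> w. ?R2 w)"
  by (rule particle_balance[OF Zm Q st])
 let ?a = "\<lambda>w. of_bool (all_hold s cs w) * (of_bool (realized A v w \<and> bt v w <= s \<and> s < death T v w) * ennreal (Yt l s v w))"
 let ?b = "\<lambda>w. of_bool (all_hold s cs w) * (of_bool (realized A v w \<and> s < bt v w \<and> bt v w <= t) * ennreal (Yb l v w))"
 have "(\<E> w. ?a w) + (\<E> w. ?b w) = (\<E> w. ?a w + ?b w)"
  by (rule nn_integral_add[symmetric]) measurable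
 also have "... = (\<E> w. ?L w)"
 proof (rule nn_integral_cong_AE)
  show "AE w in M. ?a w + ?b w = ?L w" using alive_after_birth_AE[of v] AE_space
  proof eventually_elim
   case (elim w)
   show ?case
   proof (cases "realized A v w \<and> ?\<sigma> w < death T v w")
    case True
    hence e: "all_hold s cs w \<longleftrightarrow> Z w \<and> seen v Q (bt v w) (bp v w) w" using eq[OF elim(2)] by auto
    show ?thesis unfolding e using True elim Yt_birth[OF elim(2), of l v] st
     by (cases "bt v w <= s") (auto simp: max_def of_bool_def)
   next
    case False
    hence "?a w = 0" "?b w = 0" "?L w = 0" using elim by (auto simp: of_bool_def max_def split: if_splits)
    thus ?thesis by simp
   qed
  qed
 qed
 also have "... = (\<E> w. ?R1 w) + (\<E> w. ?R2 w)" by (rule bal)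
 also have "(\<E> w. ?R1 w) = (\<E> w. of_bool (all_hold s cs w) * (of_bool (realized A v w \<and> bt v w <= t \<and> t < death T v w) * ennreal (Yt l t v w)))"
 proof (rule nn_integral_cong)
  fix w assume wt: "w \<in> space M"
  show "?R1 w = of_bool (all_hold s cs w) * (of_bool (realized A v w \<and> bt v w <= t \<and> t < death T v w) * ennreal (Yt l t v w))"
   using eq[OF wt] st by (cases "realized A v w \<and> t < death T v w") (auto simp: of_bool_def)
 qed
 also have "(\<E> w. ?R2 w) = (\<E> w. of_bool (all_hold s cs w) * (of_bool (realized A v w) * kids v w * (of_bool (s < death T v w \<and> death T v w <= t) * ennreal (Yd l v w))))"
 proof (rule nn_integral_cong_AE)
  show "AE w in M. ?R2 w = of_bool (all_hold s cs w) * (of_bool (realized A v w) * kids v w * (of_bool (s < death T v w \<and> death T v w <= t) * ennreal (Yd l v w)))"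
   using alive_after_birth_AE[of v] AE_space
  proof eventually_elim
   case (elim w)
   show ?case
   proof (cases "realized A v w \<and> s < death T v w")
    case True
    hence e: "all_hold s cs w \<longleftrightarrow> Z w \<and> seen v Q (bt v w) (bp v w) w" using eq[OF elim(2)] by auto
    show ?thesis unfolding e using True elim by (auto simp: of_bool_def)
   qed (auto simp: of_bool_def)
  qed
 qed
 finally show ?thesis .
qed

lemma generation_step:
 assumes cs: "!!c. c \<in> set cs ==> obs_ok s c" and st: "0 <= s" "s <= t"
 shows "(\<E> w. of_bool (all_hold s cs w) * Al l n s w) + (\<E> w. of_bool (all_hold s cs w) * Bn l n s t w)
  = (\<E> w. of_bool (all_hold s cs w) * Al l n t w) + (\<E> w. of_bool (all_hold s cs w) * Bn l (Suc n) s t w)"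
proof -
 note hm[measurable] = all_hold_measurable[OF cs]
 have B: "Bn l (Suc n) s t w = gsum n (\<lambda>v. of_bool (realized A v w) * kids v w * (of_bool (s < death T v w \<and> death T v w <= t) * ennreal (Yd l v w)))" for w
  unfolding Bn_def
  by (rule gsum_children) (simp only: Yb_Cons birth.simps death_def[symmetric] of_bool_conj mult.assoc)
 have I: "(\<E> w. of_bool (all_hold s cs w) * gsum n (\<lambda>v. F v w)) = gsum n (\<lambda>v. \<E> w. of_bool (all_hold s cs w) * F v w)"
  if [measurable]: "!!v. F v \<in> bm M" for F
  unfolding gsum_cmult[symmetric] by (rule nn_integral_gsum) measurable
 show ?thesis
  unfolding B unfolding Al_def Bn_def
  by (subst I, measurable)+ (simp only: gsum_add[symmetric] particle_step[OF cs st])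
qed

end

section \<open>Conditioning on the observations up to a fixed time\<close>

text \<open>The two densities define finite measures that agree on an intersection-stable
  generator.\<close>

lemma (in prob_space) nn_integral_eq_on_sigma:
 fixes F G :: "'a => ennreal"
 assumes m[measurable]: "F \<in> bm M" "G \<in> bm M"
  and E: "Int_stable E" "E \<subseteq> sets M" "space M \<in> E"
  and eq: "!!X. X \<in> E ==> (\<E> w. indicator X w * F w) = (\<E> w. indicator X w * G w)"
  and fin: "(\<E> w. F w) < \<infinity>" and X: "X \<in> sigma_sets (space M) E"
 shows "(\<E> w. indicator X w * F w) = (\<E> w. indicator X w * G w)"
proof -
 have EP: "E \<subseteq> Pow (space M)" using E(2) sets.sets_into_space by blast
 let ?S = "sigma (space M) E"
 have sub: "subalgebra (density M H) ?S" for H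
  using EP sets.sigma_sets_subset[OF E(2)] by (auto simp: subalgebra_def)
 have d: "emeasure (restr_to_subalg (density M H) ?S) Y = (\<E> w. indicator Y w * H w)"
  if "Y \<in> sigma_sets (space M) E" "H \<in> bm M" for H Y
 proof -
  have "Y \<in> sets M" using that(1) sets.sigma_sets_subset[OF E(2)] by blast
  thus ?thesis using that EP by (simp add: emeasure_restr_to_subalg[OF sub] emeasure_density mult.commute)
 qed
 have "restr_to_subalg (density M F) ?S = restr_to_subalg (density M G) ?S"
 proof (rule measure_eqI_generator_eq[OF E(1) EP, where A = "\<lambda>_. space M"])
  show "emeasure (restr_to_subalg (density M F) ?S) Y = emeasure (restr_to_subalg (density M G) ?S) Y" if "Y \<in> E" for Y
   using that by (simp add: d eq)
  have "(\<E> w. indicator (space M) w * F w) = (\<E> w. F w)" by (intro nn_integral_cong) simp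
  thus "emeasure (restr_to_subalg (density M F) ?S) (space M) ~= \<infinity>"
   using fin by (simp add: d sigma_sets.Basic E(3))
 qed (use E EP sets_restr_to_subalg[OF sub] in auto)
 thus ?thesis using d[OF X m(1)] d[OF X m(2)] by simp
qed

text \<open>The variable \<open>f\<close> need not be observable off the event \<open>P\<close>,
  where the product is 0 in any case, so only joint events are required. Positions and birth data of
  unrealized labels are of this kind.\<close>

lemma measurable_on_event:
 assumes ev: "!!S. S \<in> sets L ==> {w \<in> space N. P w \<and> f w \<in> S} \<in> sets N"
  and F: "F \<in> bm L" and f: "!!w. w \<in> space N ==> f w \<in> space L"
 shows "(\<lambda>w. of_bool (P w) * F (f w) :: ennreal) \<in> bm N"
proof -
 have P: "{w \<in> space N. P w} \<in> sets N"
 proof -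
  have "{w \<in> space N. P w} = {w \<in> space N. P w \<and> f w \<in> space L}" using f by auto
  thus ?thesis using ev[of "space L"] by simp
 qed
 show ?thesis
 proof (rule measurableI)
  fix S :: "ennreal set" assume S: "S \<in> sets borel"
  let ?D = "{w \<in> space N. P w \<and> f w \<in> F -` S \<inter> space L}"
  have "(\<lambda>w. of_bool (P w) * F (f w)) -` S \<inter> space N = ?D \<union> (if 0 \<in> S then space N - {w \<in> space N. P w} else {})"
   using f by (auto simp: of_bool_def split: if_splits)
  thus "(\<lambda>w. of_bool (P w) * F (f w)) -` S \<inter> space N \<in> sets N"
   using ev[OF measurable_sets[OF F S]] P by auto
 qed simp
qed

context bbm_full begin

text \<open>Besides the positions of living particles this records all births up to s, including
  those of particles already dead. The stopped sums \<open>UU\<close> need the latter, and the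
  natural filtration is contained in this one.\<close>

definition Obs :: "real => 'w measure" where
 "Obs s = sigma (space M) {{w \<in> space M. all_hold s cs w} | cs. \<forall>c\<in>set cs. obs_ok s c}"

lemma space_Obs [simp]: "space (Obs s) = space M" and sets_Obs: "sets (Obs s) = sigma_sets (space M) {{w \<in> space M. all_hold s cs w} | cs. \<forall>c\<in>set cs. obs_ok s c}"
 unfolding Obs_def by (auto intro!: space_measure_of sets_measure_of)

lemma all_hold_sets: "\<forall>c\<in>set cs. obs_ok s c ==> {w \<in> space M. all_hold s cs w} \<in> sets M"
 using all_hold_measurable[of cs s] by (simp add: pred_def)

lemma Obs_subalgebra: "subalgebra M (Obs s)"
 unfolding subalgebra_def sets_Obs by (auto intro!: sets.sigma_sets_subset all_hold_sets)

lemma Obs_eq: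
 assumes [measurable]: "F \<in> bm M" "G \<in> bm M"
  and eq: "!!cs. \<forall>c\<in>set cs. obs_ok s c ==> (\<E> w. of_bool (all_hold s cs w) * F w) = (\<E> w. of_bool (all_hold s cs w) * G w)"
  and fin: "(\<E> w. F w) < \<infinity>" and X: "X \<in> sets (Obs s)"
 shows "(\<E> w. indicator X w * F w) = (\<E> w. indicator X w * G w)"
proof (rule nn_integral_eq_on_sigma[OF assms(1,2) _ _ _ _ fin X[unfolded sets_Obs]])
 show "Int_stable {{w \<in> space M. all_hold s cs w} | cs. \<forall>c\<in>set cs. obs_ok s c}"
 proof (rule Int_stableI, clarsimp)
  fix cs ds assume "\<forall>c\<in>set cs. obs_ok s c" "\<forall>c\<in>set ds. obs_ok s c"
  thus "\<exists>es. {w \<in> space M. all_hold s cs w} \<inter> {w \<in> space M. all_hold s ds w} = {w \<in> space M. all_hold s es w} \<and> (\<forall>c\<in>set es. obs_ok s c)"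
   by (intro exI[of _ "cs @ ds"]) (auto simp: all_hold_def)
 qed
 show "space M \<in> {{w \<in> space M. all_hold s cs w} | cs. \<forall>c\<in>set cs. obs_ok s c}"
  by (intro CollectI exI[of _ "[]"]) (simp add: all_hold_def)
 fix X assume "X \<in> {{w \<in> space M. all_hold s cs w} | cs. \<forall>c\<in>set cs. obs_ok s c}"
 then obtain cs where cs: "X = {w \<in> space M. all_hold s cs w}" "\<forall>c\<in>set cs. obs_ok s c" by auto
 have "(\<E> w. indicator X w * H w) = (\<E> w. of_bool (all_hold s cs w) * H w)" for H
  by (intro nn_integral_cong) (simp add: cs(1) indicator_def of_bool_def)
 thus "(\<E> w. indicator X w * F w) = (\<E> w. indicator X w * G w)" using eq[OF cs(2)] by simp
qed (use all_hold_sets in auto)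

lemma Obs_alive:
 assumes "0 <= u" "u <= s" "S \<in> sets borel"
 shows "{w \<in> space M. (realized A v w \<and> bt v w <= u \<and> u < death T v w) \<and> bp v w + B v (max 0 (u - bt v w)) w \<in> S} \<in> sets (Obs s)"
 unfolding sets_Obs by (intro sigma_sets.Basic CollectI exI[of _ "[Inl (v, u, S)]"])
  (use assms in \<open>auto simp: all_hold_def obs_holds_def obs_ok_def\<close>)

lemma Obs_born:
 assumes "S \<in> sets (borel \<Otimes>\<^sub>M borel)"
 shows "{w \<in> space M. (realized A v w \<and> bt v w <= s) \<and> (bt v w, bp v w) \<in> S} \<in> sets (Obs s)"
 unfolding sets_Obs by (intro sigma_sets.Basic CollectI exI[of _ "[Inr (v, S)]"])
  (use assms in \<open>auto simp: all_hold_def obs_holds_def obs_ok_def\<close>)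

lemma UU_Obs:
 assumes s: "0 <= s" shows "UU l n s \<in> bm (Obs s)"
proof -
 have "(\<lambda>w. of_bool (realized A v w \<and> bt v w <= s \<and> s < death T v w) * ennreal (Yt l s v w)) \<in> bm (Obs s)" for v
  unfolding Yt_def by (rule measurable_on_event[where F = "\<lambda>y. ennreal (exp (- ga l * s) * hh l y)" and L = borel])
   (use Obs_alive[OF s order_refl, of _ v] in auto)
 moreover have "(\<lambda>w. of_bool (realized A v w \<and> bt v w <= s) * ennreal (Yb l v w)) \<in> bm (Obs s)" for v
  unfolding Yb_def using measurable_on_event[where F = "\<lambda>(b, y). ennreal (exp (- ga l * b) * hh l y)" and L = "borel \<Otimes>\<^sub>M borel"
    and N = "Obs s" and P = "\<lambda>w. realized A v w \<and> bt v w <= s" and f = "\<lambda>w. (bt v w, bp v w)"] Obs_born[of _ v s]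
  by (simp add: space_pair_measure)
 ultimately show ?thesis unfolding UU_def[abs_def] Al_def Bo_def
  by (intro borel_measurable_add borel_measurable_sum gsum_measurable) auto
qed

lemma AE_good: "AE w in M. w \<in> space M \<and> (\<forall>t. finite {v. realized A v w \<and> bt v w <= t}) \<and> (\<forall>v. 0 < T v w)"
 using AE_space population_finite AE_all_countable[THEN iffD2, OF allI[OF T_pos_AE]] by eventually_elim auto

lemma gsum_zero: "(!!v. length v = n ==> F v = 0) ==> gsum n F = 0"
 using gsum_cong[of n F "\<lambda>_. 0"] gsum_cmult[of n 0 "\<lambda>_. 0"] by simp

text \<open>Lifetimes are almost surely positive, so only the initial particle is present at time
  0.\<close>

lemma AE_time_zero: "AE w in M. Al l n 0 w = (if n = 0 then ennreal (hh l x) else 0) \<and> (n ~= 0 --> Bo l n 0 w = 0)"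
 using AE_good
proof eventually_elim
 case (elim w)
 hence b: "0 <= bt v w" for v by (simp add: birth_nonneg)
 have p: "\<not> bt v w <= 0" if "v ~= []" for v
 proof (cases v)
  case (Cons i u)
  have "0 < T u w" using elim by auto
  thus ?thesis using b[of u] Cons by simp
 qed (use that in simp)
 have "Al l n 0 w = 0" "Bo l n 0 w = 0" if n: "n ~= 0"
  unfolding Al_def Bo_def
  by (rule gsum_zero, use p n in \<open>metis (no_types, lifting) length_0_conv mult_zero_left of_bool_eq_0_iff\<close>)+
 moreover have "Al l 0 0 w = ennreal (hh l x)" using elim BM_zero[OF motion, of w "[]"] by (simp add: Al_def gsum_0 death_def Yt_def)
 ultimately show ?case by auto
qed

text \<open>Births into generation k + 1 during (s, t] are the output of generation k and cancel in
  the sum; those into generation n remain. The root contributes none because it is born at time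
  0.\<close>

lemma sum_step:
 assumes cs: "\<forall>c\<in>set cs. obs_ok s c" and st: "0 <= s" "s <= t"
 shows "(\<Sum>k<n. \<E> w. of_bool (all_hold s cs w) * Al l k s w)
  = (\<Sum>k<n. \<E> w. of_bool (all_hold s cs w) * Al l k t w) + (\<E> w. of_bool (all_hold s cs w) * Bn l n s t w)"
proof (induction n)
 case 0
 show ?case using st by (simp add: Bn_def gsum_0)
next
 case (Suc n)
 show ?case using generation_step[of cs s t l n] cs st by (simp add: Suc.IH ac_simps)
qed

lemma UU_event:
 assumes cs: "\<forall>c\<in>set cs. obs_ok s c" and st: "0 <= s" "s <= t"
 shows "(\<E> w. of_bool (all_hold s cs w) * UU l n s w) = (\<E> w. of_bool (all_hold s cs w) * UU l n t w)"
proof -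
 have [measurable]: "Measurable.pred M (all_hold s cs)" using all_hold_measurable cs by auto
 have U: "(\<E> w. of_bool (all_hold s cs w) * UU l n r w)
   = (\<Sum>k<n. \<E> w. of_bool (all_hold s cs w) * Al l k r w) + (\<E> w. of_bool (all_hold s cs w) * Bo l n r w)" for r
  unfolding UU_def distrib_left sum_distrib_left by (subst nn_integral_add, measurable, subst nn_integral_sum, measurable)
 have B: "(\<E> w. of_bool (all_hold s cs w) * Bo l n t w)
  = (\<E> w. of_bool (all_hold s cs w) * Bo l n s w) + (\<E> w. of_bool (all_hold s cs w) * Bn l n s t w)"
  unfolding Bo_split[OF st(2)] distrib_left by (simp add: nn_integral_add)
 show ?thesis unfolding U B sum_step[OF assms] by (simp add: ac_simps)
qed

text \<open>The births into generation n left over by the telescoping vanish in mean as n grows, by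
  the geometric decay.\<close>

lemma WW_event:
 assumes cs: "\<forall>c\<in>set cs. obs_ok s c" and st: "0 <= s" "s <= t"
 shows "(\<E> w. of_bool (all_hold s cs w) * WW l s w) = (\<E> w. of_bool (all_hold s cs w) * WW l t w)"
proof -
 have [measurable]: "Measurable.pred M (all_hold s cs)" using all_hold_measurable cs by auto
 have W: "(\<lambda>n. \<Sum>k<n. \<E> w. of_bool (all_hold s cs w) * Al l k r w) \<longlonglongrightarrow> (\<E> w. of_bool (all_hold s cs w) * WW l r w)" for r
  unfolding WW_def ennreal_suminf_cmult[symmetric] by (subst nn_integral_suminf) (auto intro: summable_LIMSEQ)
 obtain rh C where rh: "0 < rh" "rh < 1" and "0 < C" and b: "!!n. (\<E> w. Bo l n t w) <= ennreal (C * rh ^ n)"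
  by (rule Bo_decay) (rule that; assumption)
 have "(\<lambda>n. \<E> w. of_bool (all_hold s cs w) * Bn l n s t w) \<longlonglongrightarrow> 0"
 proof (rule tendsto_sandwich[OF _ _ tendsto_const])
  show "\<forall>\<^sub>F n in sequentially. (\<E> w. of_bool (all_hold s cs w) * Bn l n s t w) <= ennreal (C * rh ^ n)"
   by (intro always_eventually allI order_trans[OF nn_integral_mono b]) (auto simp: Bo_split[OF st(2)] of_bool_def)
  have "(\<lambda>n. C * rh ^ n) \<longlonglongrightarrow> C * 0" using rh by (intro tendsto_intros LIMSEQ_realpow_zero) auto
  thus "(\<lambda>n. ennreal (C * rh ^ n)) \<longlonglongrightarrow> 0" using tendsto_ennrealI by fastforce
 qed simp
 from tendsto_add[OF W[of t] this] show ?thesis using W[of s] unfolding sum_step[OF assms, symmetric]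
  by (simp add: LIMSEQ_unique)
qed

lemma WW_mean: assumes t: "0 <= t" shows "(\<E> w. WW l t w) = ennreal (hh l x)"
proof -
 have "(\<E> w. WW l t w) = (\<E> w. WW l 0 w)" using WW_event[of "[]" 0 t l] t by (simp add: all_hold_def)
 also have "... = (\<Sum>n. \<E> w. Al l n 0 w)" unfolding WW_def by (rule nn_integral_suminf) measurable
 also have "... = (\<Sum>n. if n = 0 then ennreal (hh l x) else 0)"
 proof (rule suminf_cong)
  fix n
  have "(\<E> w. Al l n 0 w) = (\<E> w. (if n = 0 then ennreal (hh l x) else 0))"
   by (rule nn_integral_cong_AE) (use AE_time_zero[of l n] in \<open>eventually_elim, simp\<close>)
  thus "(\<E> w. Al l n 0 w) = (if n = 0 then ennreal (hh l x) else 0)" by (simp add: emeasure_space_1)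
 qed
 also have "... = ennreal (hh l x)" by (subst suminf_finite[of "{0}"]) auto
 finally show ?thesis .
qed

lemma UU_mean: assumes t: "0 <= t" shows "(\<E> w. UU l n t w) <= ennreal (hh l x)"
proof -
 have "(\<E> w. UU l n t w) = (\<E> w. UU l n 0 w)" using UU_event[of "[]" 0 t l n] t by (simp add: all_hold_def)
 also have "... <= (\<E> w. ennreal (hh l x))"
 proof (rule nn_integral_mono_AE)
  have "AE w in M. \<forall>k. Al l k 0 w = (if k = 0 then ennreal (hh l x) else 0) \<and> (k ~= 0 --> Bo l k 0 w = 0)"
   using AE_time_zero by (simp add: AE_all_countable)
  thus "AE w in M. UU l n 0 w <= ennreal (hh l x)"
  proof eventually_elim
   case (elim w)
   show ?case
   proof (cases "n = 0")
    case False
    hence "(\<Sum>k<n. Al l k 0 w) = ennreal (hh l x)" using elim by simp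
    thus ?thesis using False elim by (simp add: UU_def)
   qed (simp add: UU_def Bo_def gsum_0 Yb_def)
  qed
 qed
 finally show ?thesis by (simp add: emeasure_space_1)
qed

section \<open>Moving the stopped line in generation and in time\<close>

lemma Sg_mono: "P \<subseteq> Q ==> subalgebra (Sg Q) (Sg P)"
 unfolding subalgebra_def Sg_sets by (intro conjI sigma_sets_mono' Union_mono image_mono) simp_all

abbreviation younger :: "nat => (label + label + label) set" where
 "younger n \<equiv> {k. \<exists>u. length u < n \<and> (k = Inl u \<or> k = Inr (Inl u) \<or> k = Inr (Inr u))}"

text \<open>Replacing generation n by n + 1 as stopping level changes only the terms of generation
  n, and the own randomness of its particles is independent of all earlier generations. No
  observation of the own path enters, so the list given to \<open>seen\<close> is empty.\<close>

lemma UU_generation: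
 assumes C: "C \<in> sets (Sg (younger n))" and t: "0 <= t"
 shows "(\<E> w. indicator C w * UU l (Suc n) t w) = (\<E> w. indicator C w * UU l n t w)"
proof -
 have CM[measurable]: "C \<in> sets M" using C subalgebra_Sg unfolding subalgebra_def by blast
 have I: "(\<E> w. indicator C w * gsum n (\<lambda>v. F v w)) = gsum n (\<lambda>v. \<E> w. indicator C w * F v w)"
  if [measurable]: "!!v. F v \<in> bm M" for F
  unfolding gsum_cmult[symmetric] by (rule nn_integral_gsum) measurable
 have B: "Bo l (Suc n) t w = gsum n (\<lambda>v. of_bool (realized A v w) * kids v w * (of_bool (death T v w <= t) * ennreal (Yd l v w)))" for w
  unfolding Bo_def
  by (rule gsum_children) (simp only: Yb_Cons birth.simps death_def[symmetric] of_bool_conj mult.assoc)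
 have v: "(\<E> w. indicator C w * (of_bool (realized A v w \<and> bt v w <= t) * ennreal (Yb l v w)))
  = (\<E> w. indicator C w * (of_bool (realized A v w \<and> bt v w <= t \<and> t < death T v w) * ennreal (Yt l t v w)))
  + (\<E> w. indicator C w * (of_bool (realized A v w) * kids v w * (of_bool (death T v w <= t) * ennreal (Yd l v w))))"
  if len: "length v = n" for v
 proof -
  let ?Z = "\<lambda>w. of_bool (realized A v w) * indicator C w :: ennreal"
  have "subalgebra (SO v) (Sg (younger n))"
   by (rule Sg_mono) (use len in \<open>auto simp: own_def\<close>)
  hence [measurable]: "C \<in> sets (SO v)" using C unfolding subalgebra_def by blast
  have Zm: "?Z \<in> bm (SO v)" using SO_realized[OF not_ancs_self, of v] by measurable
  have q: "seen v [] b y w" for b y w by (simp add: seen_def)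
  have b: "AE w in M. bt v w < death T v w \<and> 0 <= bt v w \<and> w \<in> space M" using alive_after_birth_AE[of v] AE_space
   by eventually_elim (simp add: birth_nonneg)
  have "(\<E> w. indicator C w * (of_bool (realized A v w \<and> bt v w <= t) * ennreal (Yb l v w)))
   = (\<E> w. ?Z w * of_bool (bt v w <= t \<and> seen v [] (bt v w) (bp v w) w \<and> max 0 (bt v w) < death T v w) * ennreal (Yt l (max 0 (bt v w)) v w))"
   by (rule nn_integral_cong_AE) (use b in \<open>eventually_elim, auto simp: q max_def Yt_birth of_bool_def\<close>)
  also have "... = (\<E> w. ?Z w * of_bool (bt v w <= t \<and> seen v [] (bt v w) (bp v w) w \<and> t < death T v w) * ennreal (Yt l t v w))
   + (\<E> w. ?Z w * of_bool (bt v w <= t \<and> seen v [] (bt v w) (bp v w) w \<and> max 0 (bt v w) < death T v w \<and> death T v w <= t)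
     * kids v w * ennreal (Yd l v w))"
   by (rule particle_balance[OF Zm _ order_refl t]) simp
  also have "... = (\<E> w. indicator C w * (of_bool (realized A v w \<and> bt v w <= t \<and> t < death T v w) * ennreal (Yt l t v w)))
   + (\<E> w. indicator C w * (of_bool (realized A v w) * kids v w * (of_bool (death T v w <= t) * ennreal (Yd l v w))))"
   by (intro arg_cong2[of _ _ _ _ "(+)"] nn_integral_cong_AE; use b in \<open>eventually_elim, auto simp: q of_bool_def mult.assoc\<close>)
  finally show ?thesis .
 qed
 have "(\<E> w. indicator C w * Bo l n t w) = (\<E> w. indicator C w * Al l n t w) + (\<E> w. indicator C w * Bo l (Suc n) t w)"
  unfolding B unfolding Al_def Bo_def by (subst I, measurable)+ (simp only: gsum_add[symmetric] v cong: gsum_cong)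
 thus ?thesis unfolding UU_def distrib_left sum_distrib_left by (simp add: nn_integral_add nn_integral_sum ac_simps)
qed

lemma UU_Sg: "UU l n t \<in> bm (Sg (younger n))" (is "_ \<in> bm (Sg ?P)")
proof -
 have al: "(\<lambda>w. of_bool (realized A v w \<and> bt v w <= t \<and> t < death T v w) * ennreal (Yt l t v w)) \<in> bm (Sg ?P)" if "length v < n" for v
 proof -
  have P: "!!u. u \<in> insert v (ancs v) ==> Inl u \<in> ?P \<and> Inr (Inl u) \<in> ?P \<and> Inr (Inr u) \<in> ?P" using that ancs_length by fastforce
  have [measurable]: "birth T v \<in> bm (Sg ?P)" by (rule Sg_birth; use P in blast)
  have [measurable]: "death T v \<in> bm (Sg ?P)" by (rule Sg_T; use P in blast)
  have [measurable]: "realized A v \<in> measurable (Sg ?P) (count_space UNIV)" by (rule Sg_realized; use P in blast)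
  have [measurable]: "Yt l t v \<in> bm (Sg ?P)" by (rule Yt_measurable_Sg; use P in blast)
  show ?thesis by measurable
 qed
 have bo: "(\<lambda>w. of_bool (realized A v w \<and> bt v w <= t) * ennreal (Yb l v w)) \<in> bm (Sg ?P)" if "length v = n" for v
 proof -
  have P: "!!u. u \<in> ancs v ==> Inl u \<in> ?P \<and> Inr (Inl u) \<in> ?P \<and> Inr (Inr u) \<in> ?P" using that ancs_length by fastforce
  have [measurable]: "birth T v \<in> bm (Sg ?P)" "bp v \<in> bm (Sg ?P)" by (rule Sg_birth; use P in blast)+
  have [measurable]: "realized A v \<in> measurable (Sg ?P) (count_space UNIV)" by (rule Sg_realized; use P in blast)
  show ?thesis unfolding Yb_def by measurable
 qed
 show ?thesis unfolding UU_def[abs_def] Al_def Bo_def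
  by (intro borel_measurable_add borel_measurable_sum gsum_measurable al bo) auto
qed

lemma UU_min_generation: "0 <= t ==> (\<E> w. min (UU l (Suc n) t w) C) <= (\<E> w. min (UU l n t w) C)"
proof (rule min_mean_antimono)
 assume t: "0 <= t"
 have [measurable]: "UU l n t \<in> bm (Sg (younger n))" (is "_ \<in> bm ?S") by (rule UU_Sg)
 have "{w \<in> space ?S. UU l n t w < C} \<in> sets ?S" by measurable
 moreover have "space ?S = space M" using subalgebra_Sg by (auto simp: subalgebra_def)
 ultimately have "{w \<in> space M. UU l n t w < C} \<in> sets ?S" by simp
 from UU_generation[OF this t, of l]
 show "(\<E> w. of_bool (UU l n t w < C) * UU l n t w) = (\<E> w. of_bool (UU l n t w < C) * UU l (Suc n) t w)"
  by (auto simp: indicator_def of_bool_def cong: nn_integral_cong)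
qed measurable

lemma UU_min_time: "0 <= s ==> s <= t ==> (\<E> w. min (UU l n t w) C) <= (\<E> w. min (UU l n s w) C)"
proof (rule min_mean_antimono)
 assume st: "0 <= s" "s <= t"
 note [measurable] = UU_Obs[OF st(1), of l n]
 have X: "{w \<in> space (Obs s). UU l n s w < C} \<in> sets (Obs s)" by measurable
 have "(\<E> w. UU l n s w) < \<infinity>" using UU_mean[OF st(1), of l n] by (simp add: order_le_less_trans)
 from Obs_eq[OF UU_measurable UU_measurable UU_event[OF _ st] this X]
 show "(\<E> w. of_bool (UU l n s w < C) * UU l n s w) = (\<E> w. of_bool (UU l n s w < C) * UU l n t w)"
  by (auto simp: indicator_def of_bool_def cong: nn_integral_cong)
qed measurable

lemma UU_WW_tendsto:
 assumes "finite {v. realized A v w \<and> bt v w <= t}"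
 shows "(\<lambda>n. UU l n t w) \<longlonglongrightarrow> WW l t w"
proof -
 obtain N where N: "!!v. realized A v w ==> bt v w <= t ==> length v < N"
  using finite_nat_set_iff_bounded[of "length ` {v. realized A v w \<and> bt v w <= t}"] assms by auto
 have z: "Al l n t w = 0" "Bo l n t w = 0" if "N <= n" for n
  unfolding Al_def Bo_def using N that by (force intro!: gsum_zero)+
 have "WW l t w = (\<Sum>k<n. Al l k t w)" if "N <= n" for n
  unfolding WW_def by (rule suminf_finite) (use that z in auto)
 hence "UU l n t w = WW l t w" if "N <= n" for n
  using that z(2) by (simp add: UU_def)
 hence "\<forall>\<^sub>F n in sequentially. UU l n t w = WW l t w" unfolding eventually_sequentially by metis
 thus ?thesis by (rule tendsto_eventually)
qed

lemma finite_generation: "finite {v. realized A v w \<and> length v = n}"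
proof (induction n)
 case (Suc n)
 have "{v. realized A v w \<and> length v = Suc n} \<subseteq> (\<Union>v\<in>{v. realized A v w \<and> length v = n}. (\<lambda>i. i # v) ` {..A v w})"
  by (auto simp: length_Suc_conv)
 thus ?case by (rule finite_subset) (use Suc in auto)
qed (auto intro: finite_subset[of _ "{[]}"])

text \<open>The first n generations contain finitely many particles, and from some time on all of
  them have died.\<close>

lemma UU_VV_tendsto:
 assumes wt: "w \<in> space M" shows "((\<lambda>t. UU l n t w) \<longlongrightarrow> VV l n w) at_top"
proof -
 let ?F = "\<Union>k\<le>n. {v. realized A v w \<and> length v = k}"
 have F: "finite ((\<lambda>v. death T v w) ` ?F)" using finite_generation by auto
 let ?K = "Max (insert 0 ((\<lambda>v. death T v w) ` ?F))"
 have K: "death T v w <= ?K" if "realized A v w" "length v <= n" for v using F that by (intro Max_ge) auto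
 have "UU l n t w = VV l n w" if t: "?K <= t" for t
 proof -
  have "Al l k t w = 0" if "k < n" for k unfolding Al_def
   by (rule gsum_zero) (use K that t in \<open>force simp: not_less\<close>)
  moreover have "Bo l n t w = VV l n w" unfolding Bo_def VV_def
  proof (rule gsum_cong)
   fix v :: label assume "length v = n"
   hence "realized A v w ==> bt v w <= t" using K[of v] birth_le_death[OF wt, of v] t by linarith
   thus "of_bool (realized A v w \<and> bt v w <= t) * ennreal (Yb l v w) = of_bool (realized A v w) * ennreal (Yb l v w)"
    by (auto simp: of_bool_def)
  qed
  ultimately show ?thesis by (simp add: UU_def)
 qed
 hence "\<forall>\<^sub>F t in at_top. UU l n t w = VV l n w" unfolding eventually_at_top_linorder by blast
 thus ?thesis by (rule tendsto_eventually)
qed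

lemma nn_integral_min_tendsto:
 fixes F :: "nat => 'w => ennreal"
 assumes [measurable]: "!!n. F n \<in> bm M" "G \<in> bm M"
  and lim: "AE w in M. (\<lambda>n. F n w) \<longlonglongrightarrow> G w"
 shows "(\<lambda>n. \<E> w. min (F n w) (ennreal C)) \<longlonglongrightarrow> (\<E> w. min (G w) (ennreal C))"
proof (rule nn_integral_dominated_convergence[where w = "\<lambda>_. ennreal C"])
 show "AE w in M. (\<lambda>n. min (F n w) (ennreal C)) \<longlonglongrightarrow> min (G w) (ennreal C)"
  using lim by eventually_elim (intro tendsto_min tendsto_const)
qed (auto simp: emeasure_space_1)

text \<open>At fixed t the truncated means decrease in n with limit that of \<open>WW l t\<close>;
  then t tends to infinity at fixed n. The truncation supplies the domination for both
  limits.\<close>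

lemma WW_min_le_VV:
 "limsup (\<lambda>j. \<E> w. min (WW l (real j) w) (ennreal C)) <= (\<E> w. min (VV l n w) (ennreal C))"
proof -
 have le: "(\<E> w. min (WW l t w) (ennreal C)) <= (\<E> w. min (UU l n t w) (ennreal C))" if t: "0 <= t" for t
 proof (rule LIMSEQ_le_const2)
  show "(\<lambda>n. \<E> w. min (UU l n t w) (ennreal C)) \<longlonglongrightarrow> (\<E> w. min (WW l t w) (ennreal C))"
   by (rule nn_integral_min_tendsto) (use population_finite in \<open>auto elim!: eventually_mono intro: UU_WW_tendsto\<close>)
  have "antimono (\<lambda>n. \<E> w. min (UU l n t w) (ennreal C))" unfolding decseq_Suc_iff[abs_def] using UU_min_generation[OF t] by blast
  thus "\<exists>N. \<forall>k\<ge>N. (\<E> w. min (UU l k t w) (ennreal C)) <= (\<E> w. min (UU l n t w) (ennreal C))"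
   by (auto dest: antimonoD)
 qed
 have "(\<lambda>j. \<E> w. min (UU l n (real j) w) (ennreal C)) \<longlonglongrightarrow> (\<E> w. min (VV l n w) (ennreal C))"
  by (rule nn_integral_min_tendsto) (auto intro!: AE_I2 filterlim_compose[OF UU_VV_tendsto filterlim_real_sequentially])
 hence "limsup (\<lambda>j. \<E> w. min (UU l n (real j) w) (ennreal C)) = (\<E> w. min (VV l n w) (ennreal C))"
  by (intro lim_imp_Limsup) auto
 thus ?thesis using Limsup_mono[of _ _ sequentially, OF always_eventually, OF allI, OF le, of real] by simp
qed

text \<open>Monotonicity in the other parameter: at fixed n the truncated means decrease in t
  towards that of \<open>VV l n\<close>, which is therefore a lower bound; a bound uniform in n
  survives the limit n to infinity at fixed t.\<close>

lemma WW_min_ge_VV: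
 assumes t: "0 <= t" and c: "!!n. c <= (\<E> w. min (VV l n w) (ennreal C))"
 shows "c <= (\<E> w. min (WW l t w) (ennreal C))"
proof (rule LIMSEQ_le_const)
 show "(\<lambda>n. \<E> w. min (UU l n t w) (ennreal C)) \<longlonglongrightarrow> (\<E> w. min (WW l t w) (ennreal C))"
  by (rule nn_integral_min_tendsto) (use population_finite in \<open>auto elim!: eventually_mono intro: UU_WW_tendsto\<close>)
 have "(\<E> w. min (VV l n w) (ennreal C)) <= (\<E> w. min (UU l n t w) (ennreal C))" for n
 proof (rule LIMSEQ_le_const2)
  show "(\<lambda>j. \<E> w. min (UU l n (real j) w) (ennreal C)) \<longlonglongrightarrow> (\<E> w. min (VV l n w) (ennreal C))"
   by (rule nn_integral_min_tendsto) (auto intro!: AE_I2 filterlim_compose[OF UU_VV_tendsto filterlim_real_sequentially])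
  obtain N where "t <= real N" using real_arch_simple by blast
  thus "\<exists>N. \<forall>j\<ge>N. (\<E> w. min (UU l n (real j) w) (ennreal C)) <= (\<E> w. min (UU l n t w) (ennreal C))"
   using t by (intro exI[of _ N] allI impI UU_min_time) auto
 qed
 thus "\<exists>N. \<forall>n\<ge>N. c <= (\<E> w. min (UU l n t w) (ennreal C))" using order_trans[OF c] by blast
qed

end

section \<open>Convergence of nonnegative martingales\<close>

context prob_space begin

lemma bounded_integrable: "f \<in> bm M ==> (!!w. w \<in> space M ==> 0 <= f w \<and> f w <= (1 :: real)) ==> integrable M f"
 by (rule integrable_const_bound[of _ 1]) auto

context
 fixes F :: "real => 'a measure" and Y :: "real => 'a => real"
 assumes mart: "is_martingale F Y" and pos: "!!t w. 0 <= t ==> 0 <= Y t w"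
begin

lemma mart_sub: "0 <= t ==> subalgebra M (F t)" "0 <= s ==> s <= t ==> subalgebra (F t) (F s)"
 and mart_Y: "0 <= t ==> Y t \<in> bm (F t)" "0 <= t ==> integrable M (Y t)"
 and mart_cond: "0 <= s ==> s <= t ==> AE w in M. real_cond_exp M (F s) (Y t) w = Y s w"
 using mart unfolding is_martingale_def by auto

text \<open>Convexity of exp(- c y) gives a lower bound by the tangent at Y_s, and the martingale
  property removes its linear term. The case c = 1 says that \<open>Ze\<close> is a submartingale, c
  = 2 that its square is one.\<close>

lemma mart_exp_weighted:
 assumes st: "0 <= s" "s <= t" and wt: "wt \<in> bm (F s)" "!!w. w \<in> space M ==> 0 <= wt w \<and> wt w <= 1" and c: "0 < c"
 shows "(\<integral>w. wt w * exp (- c * Y s w) \<partial>M) <= (\<integral>w. wt w * exp (- c * Y t w) \<partial>M)"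
proof -
 have t: "0 <= t" using st by simp
 interpret S: finite_measure_subalgebra M "F s" by standard (rule mart_sub(1)[OF st(1)])
 note Ys = mart_Y[OF st(1)] and Yt = mart_Y[OF t]
 have [measurable]: "Y s \<in> bm M" "Y t \<in> bm M" using Ys Yt by auto
 have [measurable]: "wt \<in> bm M" by (rule measurable_from_subalg[OF mart_sub(1)[OF st(1)] wt(1)])
 define f where "f w = wt w * (c * exp (- c * Y s w))" for w
 have fF: "f \<in> bm (F s)" unfolding f_def[abs_def] using wt(1) Ys(1) by measurable
 have fM[measurable]: "f \<in> bm M" by (rule measurable_from_subalg[OF mart_sub(1)[OF st(1)] fF])
 have fb: "0 <= f w \<and> f w <= c" if "w \<in> space M" for w
 proof -
  have "wt w * (c * exp (- c * Y s w)) <= 1 * (c * 1)" using wt(2)[OF that] c pos[OF st(1), of w] by (intro mult_mono) auto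
  thus ?thesis using wt(2)[OF that] c by (simp add: f_def)
 qed
 have fi: "integrable M (\<lambda>w. f w * Y r w)" if "integrable M (Y r)" "0 <= r" for r
  by (rule Bochner_Integration.integrable_bound[of _ "\<lambda>w. c * Y r w"])
   (use that fb pos c in \<open>auto simp: abs_mult intro!: mult_right_mono\<close>)
 have eq: "(\<integral>w. f w * Y s w \<partial>M) = (\<integral>w. f w * Y t w \<partial>M)"
  unfolding S.real_cond_exp_intg(2)[OF fi[OF Yt(2) t] fF, OF \<open>Y t \<in> bm M\<close>, symmetric]
  by (rule integral_cong_AE) (use mart_cond[OF st] in auto)
 have i: "integrable M (\<lambda>w. wt w * exp (- c * Y r w))" if "0 <= r" "Y r \<in> bm M" for r
 proof (rule bounded_integrable)
  have "wt w * exp (- c * Y r w) <= 1 * 1" if "w \<in> space M" for w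
   using wt(2)[OF that] c pos[OF \<open>0 <= r\<close>, of w] by (intro mult_mono) auto
  thus "0 <= wt w * exp (- c * Y r w) \<and> wt w * exp (- c * Y r w) <= 1" if "w \<in> space M" for w using wt(2)[OF that] that by simp
 qed (use that in measurable)
 have "(\<integral>w. wt w * exp (- c * Y s w) \<partial>M) <= (\<integral>w. wt w * exp (- c * Y t w) + (f w * Y t w - f w * Y s w) \<partial>M)"
 proof (rule integral_mono)
  fix w assume sp: "w \<in> space M"
  have "1 + (- c * Y t w + c * Y s w) <= exp (- c * Y t w + c * Y s w)" by (rule exp_ge_add_one_self)
  hence "exp (- c * Y s w) * (1 + (- c * Y t w + c * Y s w)) <= exp (- c * Y s w) * exp (- c * Y t w + c * Y s w)" by (rule mult_left_mono) simp
  also have "... = exp (- c * Y t w)" by (simp flip: exp_add)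
  finally have "wt w * (exp (- c * Y s w) * (1 + (- c * Y t w + c * Y s w))) <= wt w * exp (- c * Y t w)"
   by (rule mult_left_mono) (use wt(2)[OF sp] in simp)
  thus "wt w * exp (- c * Y s w) <= wt w * exp (- c * Y t w) + (f w * Y t w - f w * Y s w)"
   by (simp add: f_def algebra_simps)
 qed (use i fi st t Ys Yt in auto)
 also have "... = (\<integral>w. wt w * exp (- c * Y t w) \<partial>M)"
  using i[OF t] fi st t Ys Yt eq by simp
 finally show ?thesis .
qed

abbreviation (input) "Ze t w \<equiv> exp (- Y t w)"

lemma Ze_bounds: "0 <= t ==> 0 <= Ze t w \<and> Ze t w <= 1" using pos by simp

lemma Ze_meas: "0 <= s ==> s <= t ==> Ze s \<in> bm (F t)" "0 <= s ==> Ze s \<in> bm M"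
 using measurable_from_subalg[OF mart_sub(2) mart_Y(1), of s t] borel_measurable_integrable[OF mart_Y(2), of s] by auto

text \<open>For the submartingale \<open>Ze\<close> and a stopping time \<open>ta\<close>, \<open>E (Ze ta - Ze s)^2 <= E (Ze ta)^2 - E (Ze s)^2\<close>; here
 \<open>ta\<close> is the first time of the grid \<open>r\<close> at which \<open>Ze\<close> has moved by more than \<open>ep\<close>.\<close>

lemma mart_maximal:
 assumes r: "mono r" "0 <= r 0" and ep: "0 < ep"
 shows "prob {w \<in> space M. \<exists>i\<le>n. ep < \<bar>Ze (r i) w - Ze (r 0) w\<bar>} * ep^2
  <= (\<integral>w. (Ze (r n) w)^2 \<partial>M) - (\<integral>w. (Ze (r (0 :: nat)) w)^2 \<partial>M)"
proof -
 define hit where "hit j w \<longleftrightarrow> (\<exists>i\<le>j. ep < \<bar>Ze (r i) w - Ze (r 0) w\<bar>)" for j w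
 \<comment> \<open>\<open>S\<close> follows \<open>Ze\<close> along the grid and is frozen at the
   first index that leaves the band; whether it moves on to index j + 1 depends on values up to
   index j only.\<close>
 define S where "S = rec_nat (Ze (r 0)) (\<lambda>j v w. if hit j w then v w else Ze (r (Suc j)) w)"
 have S0: "S 0 = Ze (r 0)" and SS: "S (Suc j) = (\<lambda>w. if hit j w then S j w else Ze (r (Suc j)) w)" for j
  by (auto simp: S_def)
 have r0: "0 <= r i" for i using r monoD[OF r(1), of 0 i] by simp
 have rm: "i <= j ==> r i <= r j" for i j using r(1) by (rule monoD)
 have hm: "hit j \<in> measurable (F (r j)) (count_space UNIV)" for j
 proof -
  have "Ze (r i) \<in> bm (F (r j))" if "i <= j" for i using Ze_meas(1)[OF r0 rm[OF that]] .
  hence "{w \<in> space (F (r j)). ep < \<bar>Ze (r i) w - Ze (r 0) w\<bar>} \<in> sets (F (r j))" if "i <= j" for i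
   using that by measurable
  hence "(\<Union>i\<in>{..j}. {w \<in> space (F (r j)). ep < \<bar>Ze (r i) w - Ze (r 0) w\<bar>}) \<in> sets (F (r j))" by (intro sets.finite_UN) auto
  also have "(\<Union>i\<in>{..j}. {w \<in> space (F (r j)). ep < \<bar>Ze (r i) w - Ze (r 0) w\<bar>}) = {w \<in> space (F (r j)). hit j w}"
   by (auto simp: hit_def)
  finally show ?thesis by (simp add: pred_def)
 qed
 have hM[measurable]: "hit j \<in> measurable M (count_space UNIV)" for j by (rule measurable_from_subalg[OF mart_sub(1)[OF r0] hm])
 have Zm[measurable]: "Ze (r j) \<in> bm M" for j by (rule Ze_meas(2)[OF r0])
 have Sm[measurable]: "S j \<in> bm M" for j by (induction j) (simp_all add: S0 SS)
 have Sb: "0 <= S j w \<and> S j w <= 1" for j w by (induction j) (simp_all add: S0 SS pos[OF r0])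
 have nohit: "\<not> hit j w ==> S j w = Ze (r j) w" for j w by (cases j) (auto simp: S0 SS hit_def)
 have dev: "hit j w ==> ep < \<bar>S j w - Ze (r 0) w\<bar>" for j w
 proof (induction j)
  case (Suc j)
  show ?case
  proof (cases "hit j w")
   case False
   hence "ep < \<bar>Ze (r (Suc j)) w - Ze (r 0) w\<bar>" using Suc.prems unfolding hit_def by (metis le_Suc_eq)
   thus ?thesis using False by (simp add: SS)
  qed (use Suc.IH in \<open>simp add: SS\<close>)
 qed (use ep in \<open>simp add: hit_def\<close>)
 have I: "integrable M (\<lambda>w. f w * h w)" if "f \<in> bm M" "h \<in> bm M"
  "!!w. 0 <= f w \<and> f w <= 1" "!!w. 0 <= h w \<and> h w <= 1" for f h :: "'a => real"
  by (rule bounded_integrable) (use that in \<open>auto intro: mult_le_one\<close>)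
 have Iz: "integrable M (\<lambda>w. f w * h w * Ze (r j) w)" if "f \<in> bm M" "h \<in> bm M"
  "!!w. 0 <= f w \<and> f w <= 1" "!!w. 0 <= h w \<and> h w <= 1" for f h :: "'a => real" and j
  by (rule I) (use that Ze_bounds[OF r0] in \<open>auto intro: mult_le_one\<close>)
 \<comment> \<open>Tested against the initial value of \<open>Ze\<close>, the part that has not been
   stopped increases in mean.\<close>
 have a: "(\<integral>w. Ze (r 0) w * Ze (r 0) w \<partial>M) <= (\<integral>w. Ze (r 0) w * S j w \<partial>M)" for j
 proof (induction j)
  case (Suc j)
  let ?wt = "\<lambda>w. Ze (r 0) w * of_bool (\<not> hit j w) :: real"
  have "?wt \<in> bm (F (r j))" using hm Ze_meas(1)[OF r0 rm, of 0 j] by measurable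
  hence wt: "(\<integral>w. ?wt w * exp (- 1 * Y (r j) w) \<partial>M) <= (\<integral>w. ?wt w * exp (- 1 * Y (r (Suc j)) w) \<partial>M)"
   by (rule mart_exp_weighted[OF r0 rm[OF le_SucI[OF order_refl]]]) (use Ze_bounds[OF r0] in \<open>auto intro: mult_le_one\<close>)
  have i: "integrable M (\<lambda>w. Ze (r 0) w * S j w)" "integrable M (\<lambda>w. ?wt w * Ze (r k) w)" for k
   by (intro I Iz; use Sb Ze_bounds[OF r0] in auto)+
  have "(\<integral>w. Ze (r 0) w * S (Suc j) w \<partial>M) = (\<integral>w. Ze (r 0) w * S j w + (?wt w * Ze (r (Suc j)) w - ?wt w * Ze (r j) w) \<partial>M)"
   by (rule Bochner_Integration.integral_cong) (auto simp: SS nohit algebra_simps)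
  also have "... = (\<integral>w. Ze (r 0) w * S j w \<partial>M) + ((\<integral>w. ?wt w * Ze (r (Suc j)) w \<partial>M) - (\<integral>w. ?wt w * Ze (r j) w \<partial>M))"
   using i by simp
  finally show ?case using wt Suc.IH by simp
 qed (simp add: S0)
 \<comment> \<open>On the stopped part \<open>S\<close> stays constant, whereas the square of
   \<open>Ze\<close> keeps increasing in mean.\<close>
 have b: "(\<integral>w. S j w * S j w \<partial>M) <= (\<integral>w. Ze (r j) w * Ze (r j) w \<partial>M)" for j
 proof (induction j)
  case (Suc j)
  let ?wt = "\<lambda>w. of_bool (hit j w) :: real"
  have sq: "exp (- 2 * Y t w) = Ze t w * Ze t w" for t w by (simp flip: exp_add)
  have "?wt \<in> bm (F (r j))" using hm by measurable
  hence wt: "(\<integral>w. ?wt w * exp (- 2 * Y (r j) w) \<partial>M) <= (\<integral>w. ?wt w * exp (- 2 * Y (r (Suc j)) w) \<partial>M)"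
   by (rule mart_exp_weighted[OF r0 rm[OF le_SucI[OF order_refl]]]) auto
  have i: "integrable M (\<lambda>w. S j w * S j w)" "integrable M (\<lambda>w. Ze (r k) w * Ze (r k) w)" "integrable M (\<lambda>w. ?wt w * exp (- 2 * Y (r k) w))" for k
   unfolding sq mult.assoc[symmetric] by (intro I Iz; use Sb Ze_bounds[OF r0] in auto)+
  have "(\<integral>w. S (Suc j) w * S (Suc j) w \<partial>M)
   = (\<integral>w. (Ze (r (Suc j)) w * Ze (r (Suc j)) w - ?wt w * exp (- 2 * Y (r (Suc j)) w)) + (?wt w * exp (- 2 * Y (r j) w) + (S j w * S j w - Ze (r j) w * Ze (r j) w)) \<partial>M)"
   unfolding sq by (rule Bochner_Integration.integral_cong) (auto simp: SS nohit)
  also have "... = ((\<integral>w. Ze (r (Suc j)) w * Ze (r (Suc j)) w \<partial>M) - (\<integral>w. ?wt w * exp (- 2 * Y (r (Suc j)) w) \<partial>M))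
   + ((\<integral>w. ?wt w * exp (- 2 * Y (r j) w) \<partial>M) + ((\<integral>w. S j w * S j w \<partial>M) - (\<integral>w. Ze (r j) w * Ze (r j) w \<partial>M)))"
   using i by simp
  finally show ?case using wt Suc.IH by simp
 qed (simp add: S0)
 have i: "integrable M (\<lambda>w. S n w * S n w)" "integrable M (\<lambda>w. Ze (r 0) w * Ze (r 0) w)" "integrable M (\<lambda>w. Ze (r 0) w * S n w)"
  by (intro I; use Sb Ze_bounds[OF r0] in auto)+
 have "prob {w \<in> space M. hit n w} * ep^2 = (\<integral>w. indicator {w \<in> space M. hit n w} w * ep^2 \<partial>M)" by simp
 also have "... <= (\<integral>w. S n w * S n w + (Ze (r 0) w * Ze (r 0) w - 2 * (Ze (r 0) w * S n w)) \<partial>M)"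
 proof (rule integral_mono)
  show "integrable M (\<lambda>w. indicator {w \<in> space M. hit n w} w * ep^2)"
   by (intro integrable_mult_left integrable_real_indicator) (auto simp: less_top[symmetric])
  show "integrable M (\<lambda>w. S n w * S n w + (Ze (r 0) w * Ze (r 0) w - 2 * (Ze (r 0) w * S n w)))"
   using i by simp
  fix w assume "w \<in> space M"
  have "ep^2 <= (S n w - Ze (r 0) w)^2" if "hit n w"
   using power_mono[of ep "\<bar>S n w - Ze (r 0) w\<bar>" 2] dev[OF that] ep by simp
  hence "indicator {w \<in> space M. hit n w} w * ep^2 <= (S n w - Ze (r 0) w)^2" by (auto simp: indicator_def)
  thus "indicator {w \<in> space M. hit n w} w * ep^2 <= S n w * S n w + (Ze (r 0) w * Ze (r 0) w - 2 * (Ze (r 0) w * S n w))"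
   by (simp add: power2_eq_square algebra_simps)
 qed
 also have "... = (\<integral>w. S n w * S n w \<partial>M) + ((\<integral>w. Ze (r 0) w * Ze (r 0) w \<partial>M) - 2 * (\<integral>w. Ze (r 0) w * S n w \<partial>M))"
  using i by simp
 also have "... <= (\<integral>w. (Ze (r n) w)^2 \<partial>M) - (\<integral>w. (Ze (r 0) w)^2 \<partial>M)"
  using a[of n] b[of n] by (simp add: power2_eq_square)
 finally show ?thesis by (simp only: hit_def)
qed

text \<open>The grids of mesh 2^-n on [s, s + n] are nested, so the exceptional events increase and
  the maximal bound passes to their union. Every later t is approached strictly from the right by
  grid points, which is where right continuity enters.\<close>

lemma mart_tail:
 assumes s: "0 <= s" and ep: "0 < ep" and L: "!!t. s <= t ==> (\<integral>w. (Ze t w)^2 \<partial>M) <= L"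
 shows "\<exists>H\<in>sets M. prob H * ep^2 <= L - (\<integral>w. (Ze s w)^2 \<partial>M) \<and>
  (\<forall>w\<in>space M - H. (\<forall>t\<ge>0. ((\<lambda>u. Y u w) \<longlongrightarrow> Y t w) (at_right t)) --> (\<forall>t\<ge>s. \<bar>Ze t w - Ze s w\<bar> <= ep))"
proof -
 define H where "H n = {w \<in> space M. \<exists>i\<le>n * 2 ^ n. ep < \<bar>Ze (s + real i / 2 ^ n) w - Ze (s + real 0 / 2 ^ n) w\<bar>}" for n
 have Hm: "H n \<in> sets M" for n
 proof -
  have [measurable]: "Ze (s + real i / 2 ^ n) \<in> bm M" for i using s by (intro Ze_meas) auto
  show ?thesis unfolding H_def by measurable
 qed
 have "prob (H n) * ep^2 <= L - (\<integral>w. (Ze s w)^2 \<partial>M)" for n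
  using mart_maximal[of "\<lambda>i. s + real i / 2 ^ n" ep "n * 2 ^ n"] L[of "s + real (n * 2 ^ n) / 2 ^ n"] s ep
  unfolding H_def by (auto simp: mono_def divide_right_mono)
 moreover have inc: "incseq H"
 proof (rule incseq_SucI, rule subsetI)
  fix n w assume "w \<in> H n"
  then obtain i where i: "i <= n * 2 ^ n" "ep < \<bar>Ze (s + real i / 2 ^ n) w - Ze s w\<bar>" "w \<in> space M" by (auto simp: H_def)
  have "2 * i <= Suc n * 2 ^ Suc n" using i(1) by simp
  moreover have "real (2 * i) / 2 ^ Suc n = real i / 2 ^ n" by simp
  ultimately show "w \<in> H (Suc n)" using i unfolding H_def by (auto intro!: exI[of _ "2 * i"])
 qed
 hence "(\<lambda>n. prob (H n) * ep^2) \<longlonglongrightarrow> prob (\<Union>n. H n) * ep^2"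
  using Hm by (intro tendsto_mult_right finite_Lim_measure_incseq) auto
 ultimately have "prob (\<Union>n. H n) * ep^2 <= L - (\<integral>w. (Ze s w)^2 \<partial>M)"
  by (intro LIMSEQ_le_const2[of "\<lambda>n. prob (H n) * ep^2"]) auto
 moreover have "\<bar>Ze t w - Ze s w\<bar> <= ep"
  if wt: "w \<in> space M" "w \<notin> (\<Union>n. H n)" and rc: "!!t. 0 <= t ==> ((\<lambda>u. Y u w) \<longlongrightarrow> Y t w) (at_right t)" and t: "s <= t" for w t
 proof -
  have d: "\<bar>Ze (s + real i / 2 ^ n) w - Ze s w\<bar> <= ep" for i n
  proof -
   have "i * 2 ^ i <= (n + i) * 2 ^ (n + i)" by (intro mult_mono power_increasing) auto
   moreover have "real (i * 2 ^ i) / 2 ^ (n + i) = real i / 2 ^ n" by (simp add: power_add)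
   moreover have "w \<notin> H (n + i)" using wt by blast
   ultimately show ?thesis using wt(1) unfolding H_def by (auto simp: not_less dest!: spec[of _ "i * 2 ^ i"])
  qed
  define u where "u n = s + real (Suc (nat \<lfloor>(t - s) * 2 ^ n\<rfloor>)) / 2 ^ n" for n
  have u: "t < u n" "u n <= t + (1/2) ^ n" for n
  proof -
   have "(t - s) * 2 ^ n < real (Suc (nat \<lfloor>(t - s) * 2 ^ n\<rfloor>))" "real (nat \<lfloor>(t - s) * 2 ^ n\<rfloor>) <= (t - s) * 2 ^ n"
    using t by (linarith, simp)
   hence "t - s < real (Suc (nat \<lfloor>(t - s) * 2 ^ n\<rfloor>)) / 2 ^ n" "real (nat \<lfloor>(t - s) * 2 ^ n\<rfloor>) / 2 ^ n <= t - s"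
    by (simp_all only: pos_less_divide_eq pos_divide_le_eq zero_less_power zero_less_numeral)
   thus "t < u n" "u n <= t + (1/2) ^ n" by (simp_all add: u_def power_one_over add_divide_distrib)
  qed
  have "(\<lambda>n. t + (1/2) ^ n) \<longlonglongrightarrow> t + (0 :: real)" by (intro tendsto_intros LIMSEQ_realpow_zero) auto
  hence "u \<longlonglongrightarrow> t" by (intro tendsto_sandwich[of "\<lambda>_. t" u sequentially "\<lambda>n. t + (1/2) ^ n"]) (use u in \<open>simp_all add: less_imp_le\<close>)
  hence "filterlim u (at_right t) sequentially" using u(1) by (auto simp: filterlim_at less_imp_neq[THEN not_sym])
  from filterlim_compose[OF rc this] have "(\<lambda>n. Y (u n) w) \<longlonglongrightarrow> Y t w" using s t by simp
  hence "(\<lambda>n. \<bar>Ze (u n) w - Ze s w\<bar>) \<longlonglongrightarrow> \<bar>Ze t w - Ze s w\<bar>" by (intro tendsto_intros)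
  thus ?thesis by (rule LIMSEQ_le_const2) (use d in \<open>auto simp: u_def simp del: of_nat_Suc intro!: exI[of _ 0]\<close>)
 qed
 ultimately show ?thesis using Hm by (intro bexI[of _ "\<Union>n. H n"]) auto
qed

text \<open>The second moments of \<open>Ze\<close> increase and are bounded, so their gap to the
  limit tends to 0, and with it the probability of any later oscillation of a given size.\<close>

lemma nonneg_martingale_convergence:
 assumes rc: "AE w in M. \<forall>t\<ge>0. ((\<lambda>u. Y u w) \<longlongrightarrow> Y t w) (at_right t)"
 shows "\<exists>W\<in>borel_measurable M. AE w in M. ((\<lambda>t. Y t w) \<longlongrightarrow> W w) at_top"
proof -
 define a where "a t = (\<integral>w. (Ze t w)^2 \<partial>M)" for t
 have sq: "(Ze t w)^2 = 1 * exp (- 2 * Y t w)" for t w by (simp add: power2_eq_square flip: exp_add)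
 have am: "a s <= a t" if "0 <= s" "s <= t" for s t unfolding a_def sq by (rule mart_exp_weighted) (use that in auto)
 have a1: "a t <= 1" if t: "0 <= t" for t
 proof -
  have "a t <= (\<integral>w. 1 \<partial>M)" unfolding a_def
  proof (rule integral_mono)
   show "integrable M (\<lambda>w. (Ze t w)^2)" by (rule bounded_integrable) (use Ze_meas(2)[OF t] Ze_bounds[OF t] in \<open>auto simp: power_le_one\<close>)
  qed (use Ze_bounds[OF t] in \<open>auto simp: power_le_one\<close>)
  thus ?thesis by (simp add: prob_space)
 qed
 have inc: "incseq (\<lambda>n. a (real n))" by (rule incseq_SucI) (simp add: am)
 obtain L where L: "(\<lambda>n. a (real n)) \<longlonglongrightarrow> L" "!!n. a (real n) <= L"
  by (rule incseq_convergent[OF inc, of 1]) (use a1 in auto)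
 have aL: "a t <= L" if "0 <= t" for t
 proof -
  obtain n where "t <= real n" using real_arch_simple by blast
  thus ?thesis using am[OF that] L(2)[of n] order_trans by blast
 qed
 define osc where "osc w n k \<longleftrightarrow> (\<forall>t\<ge>real n. \<bar>Ze t w - Ze (real n) w\<bar> <= 1 / real (Suc k))" for w n k
 have "AE w in M. \<exists>n. osc w n k" for k
 proof -
  have "\<exists>H\<in>sets M. prob H * (1 / real (Suc k))^2 <= L - a (real n) \<and>
   (\<forall>w\<in>space M - H. (\<forall>t\<ge>0. ((\<lambda>u. Y u w) \<longlongrightarrow> Y t w) (at_right t)) --> osc w n k)" for n
   unfolding osc_def a_def by (rule mart_tail) (use aL in \<open>auto simp: a_def\<close>)
  then obtain H where H: "!!n. H n \<in> sets M" "!!n. prob (H n) * (1 / real (Suc k))^2 <= L - a (real n)"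
   "!!n w. w \<in> space M - H n ==> (\<forall>t\<ge>0. ((\<lambda>u. Y u w) \<longlongrightarrow> Y t w) (at_right t)) ==> osc w n k"
   by metis
  have "prob (\<Inter>n. H n) * (1 / real (Suc k))^2 <= L - a (real n)" for n
   by (rule order_trans[OF mult_right_mono H(2)]) (use H(1) in \<open>auto intro!: finite_measure_mono\<close>)
  moreover have "(\<lambda>n. L - a (real n)) \<longlonglongrightarrow> L - L" by (intro tendsto_intros L)
  ultimately have "prob (\<Inter>n. H n) * (1 / real (Suc k))^2 <= L - L" by (intro LIMSEQ_le_const) auto
  hence "prob (\<Inter>n. H n) = 0" by (auto simp: mult_le_0_iff intro: antisym)
  hence "(\<Inter>n. H n) \<in> null_sets M" using H(1) by (auto simp: null_sets_def emeasure_eq_measure)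
  from AE_not_in[OF this] rc AE_space show ?thesis by eventually_elim (use H(3) in blast)
 qed
 hence osc: "AE w in M. \<forall>k. \<exists>n. osc w n k" by (simp add: AE_all_countable)
 have Ym[measurable]: "Y (real n) \<in> bm M" for n using mart_Y(2)[of "real n"] by simp
 have mean: "(\<E> w. ennreal (Y (real n) w)) = ennreal (\<integral>w. Y 0 w \<partial>M)" for n
 proof -
  interpret S: finite_measure_subalgebra M "F 0" by standard (rule mart_sub(1), simp)
  have "(\<integral>w. Y (real n) w \<partial>M) = (\<integral>w. real_cond_exp M (F 0) (Y (real n)) w \<partial>M)"
   by (rule S.real_cond_exp_int(2)[symmetric]) (simp add: mart_Y)
  also have "... = (\<integral>w. Y 0 w \<partial>M)" by (rule integral_cong_AE) (use mart_cond[of 0 "real n"] mart_Y(2)[of 0] in auto)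
  finally show ?thesis using nn_integral_eq_integral[OF mart_Y(2)[of "real n"]] pos[of "real n"] by simp
 qed
 have "(\<E> w. liminf (\<lambda>n. ennreal (Y (real n) w))) <= liminf (\<lambda>n. \<E> w. ennreal (Y (real n) w))"
  by (rule nn_integral_liminf) measurable
 hence "(\<E> w. liminf (\<lambda>n. ennreal (Y (real n) w))) ~= \<infinity>" unfolding mean by (auto simp: Liminf_const top_unique)
 hence fin: "AE w in M. liminf (\<lambda>n. ennreal (Y (real n) w)) ~= \<infinity>" by (rule nn_integral_PInf_AE[rotated]) measurable
 show ?thesis
 proof (intro bexI[of _ "\<lambda>w. lim (\<lambda>n. Y (real n) w)"])
  show "(\<lambda>w. lim (\<lambda>n. Y (real n) w)) \<in> bm M" by measurable
  show "AE w in M. ((\<lambda>t. Y t w) \<longlongrightarrow> lim (\<lambda>n. Y (real n) w)) at_top"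
   using osc fin
  proof eventually_elim
   case (elim w)
   have osc': "\<exists>n. \<forall>t\<ge>real n. \<forall>u\<ge>real n. \<bar>Ze t w - Ze u w\<bar> < e" if e: "0 < e" for e
   proof -
    obtain k where k: "1 / real (Suc k) < e / 2" using nat_approx_posE[of "e / 2"] e by (metis half_gt_zero)
    obtain n where n: "osc w n k" using elim by blast
    have "\<bar>Ze t w - Ze u w\<bar> < e" if "real n <= t" "real n <= u" for t u
    proof -
     have "\<bar>Ze t w - Ze (real n) w\<bar> <= 1 / real (Suc k)" "\<bar>Ze u w - Ze (real n) w\<bar> <= 1 / real (Suc k)"
      using n that unfolding osc_def by blast+
     thus ?thesis using k by linarith
    qed
    thus ?thesis by blast
   qed
   have "Cauchy (\<lambda>n. Ze (real n) w)"
   proof (rule CauchyI)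
    fix e :: real assume "0 < e"
    from osc'[OF this] show "\<exists>N. \<forall>m\<ge>N. \<forall>n\<ge>N. norm (Ze (real m) w - Ze (real n) w) < e"
     unfolding real_norm_def by (metis of_nat_le_iff)
   qed
   then obtain z where z: "(\<lambda>n. Ze (real n) w) \<longlonglongrightarrow> z" by (auto simp: Cauchy_convergent_iff convergent_def)
   have zt: "((\<lambda>t. Ze t w) \<longlongrightarrow> z) at_top"
   proof (rule tendstoI)
    fix e :: real assume e: "0 < e"
    obtain n where n: "!!t u. real n <= t ==> real n <= u ==> \<bar>Ze t w - Ze u w\<bar> < e / 2" using osc'[of "e / 2"] e by auto
    have "\<bar>Ze t w - z\<bar> <= e / 2" if t: "real n <= t" for t
    proof (rule LIMSEQ_le_const2)
     show "(\<lambda>j. \<bar>Ze t w - Ze (real j) w\<bar>) \<longlonglongrightarrow> \<bar>Ze t w - z\<bar>" by (intro tendsto_intros z)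
     show "\<exists>N. \<forall>j\<ge>N. \<bar>Ze t w - Ze (real j) w\<bar> <= e / 2" by (rule exI[of _ n]) (use n[OF t] in \<open>auto intro: less_imp_le\<close>)
    qed
    thus "\<forall>\<^sub>F t in at_top. dist (Ze t w) z < e"
     using e by (intro eventually_at_top_linorderI[of "real n"]) (fastforce simp: dist_real_def)
   qed
   have "z \<ge> 0" by (rule LIMSEQ_le_const[OF z]) auto
   \<comment> \<open>The limit of \<open>Ze\<close> can vanish only where Y tends to infinity; Fatou
     excludes this because the means of Y are constant.\<close>
   moreover have "z ~= 0"
   proof
    assume z0: "z = 0"
    have "of_nat K <= liminf (\<lambda>n. ennreal (Y (real n) w))" for K
    proof (rule Liminf_bounded)
     have "\<forall>\<^sub>F n in sequentially. Ze (real n) w < exp (- real K)" by (rule order_tendstoD(2)[OF z]) (simp add: z0)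
     thus "\<forall>\<^sub>F n in sequentially. of_nat K <= ennreal (Y (real n) w)"
      by eventually_elim (simp add: ennreal_of_nat_eq_real_of_nat ennreal_leI)
    qed
    thus False using elim(2) ennreal_Ex_less_of_nat[of "liminf (\<lambda>n. ennreal (Y (real n) w))"]
     by (auto simp: top.not_eq_extremum not_less[symmetric])
   qed
   ultimately have "((\<lambda>t. - ln (Ze t w)) \<longlongrightarrow> - ln z) at_top" by (intro tendsto_intros zt) auto
   hence Yt: "((\<lambda>t. Y t w) \<longlongrightarrow> - ln z) at_top" by simp
   hence "lim (\<lambda>n. Y (real n) w) = - ln z" by (intro limI filterlim_compose[OF Yt filterlim_real_sequentially])
   thus ?case using Yt by simp
  qed
 qed
qed

end
end

section \<open>The additive martingale\<close>

context bbm_full begin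

lemma gsum_suminf: "(\<Sum>n. gsum n F) = (\<integral>\<^sup>+v. F v \<partial>count_space UNIV)"
proof -
 have "(\<Sum>n. gsum n F) = (\<Sum>n. \<integral>\<^sup>+v. F v * indicator {v. length v = n} v \<partial>count_space UNIV)"
  by (simp add: gsum_def nn_integral_count_space_indicator)
 also have "... = (\<integral>\<^sup>+v. (\<Sum>n. F v * indicator {v. length v = n} v) \<partial>count_space UNIV)"
  by (rule nn_integral_suminf[symmetric]) simp
 also have "... = (\<integral>\<^sup>+v. F v \<partial>count_space UNIV)"
 proof (rule nn_integral_cong)
  fix v :: label
  show "(\<Sum>n. F v * indicator {v. length v = n} v) = F v"
   by (subst suminf_finite[of "{length v}"]) auto
 qed
 finally show ?thesis .
qed

abbreviation "aw l \<equiv> additive_W x B T A ga \<psi> l"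
abbreviation "nf \<equiv> natural_filtration M x B T A"

lemma aw_sum: "aw l t w = (\<Sum>u\<in>alive T A t w. Yt l t u w)"
 unfolding additive_W_def sum_distrib_left
 by (rule sum.cong) (auto simp: alive_def Yt_position hh_def mult.assoc)

lemma aw_nonneg: "0 <= aw l t w"
 unfolding aw_sum using Yt_pos by (intro sum_nonneg) (auto simp: less_imp_le)

lemma aw_count:
 assumes "finite (alive T A t w)"
 shows "ennreal (aw l t w) = (\<integral>\<^sup>+v. of_bool (v \<in> alive T A t w) * ennreal (Yt l t v w) \<partial>count_space UNIV)"
proof -
 have "(\<integral>\<^sup>+v. of_bool (v \<in> alive T A t w) * ennreal (Yt l t v w) \<partial>count_space UNIV) = (\<Sum>v\<in>alive T A t w. of_bool (v \<in> alive T A t w) * ennreal (Yt l t v w))"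
  by (rule nn_integral_count_space'[OF assms]) auto
 also have "... = (\<Sum>v\<in>alive T A t w. ennreal (Yt l t v w))" by (rule sum.cong) auto
 also have "... = ennreal (aw l t w)" unfolding aw_sum using Yt_pos by (intro sum_ennreal) (auto simp: less_imp_le)
 finally show ?thesis by simp
qed

lemma aw_WW: "AE w in M. \<forall>t. ennreal (aw l t w) = WW l t w"
 using population_finite
proof eventually_elim
 case (elim w)
 show ?case
 proof
  fix t
  have "finite (alive T A t w)" by (rule finite_subset[OF _ elim[rule_format, of t]]) (auto simp: alive_def)
  from aw_count[OF this] show "ennreal (aw l t w) = WW l t w"
   unfolding WW_def Al_def gsum_suminf alive_def by simp
 qed
qed

lemma nf_sets: "sets (nf t) = sigma_sets (space M)
  {{w \<in> space M. v \<in> alive T A s w \<and> position x B T v s w \<in> S} | v s S. 0 <= s \<and> s <= t \<and> S \<in> sets borel}"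
 and nf_space: "space (nf t) = space M"
 unfolding natural_filtration_def by (auto intro!: space_measure_of sets_measure_of)

lemma nf_mono: "s <= t ==> subalgebra (nf t) (nf s)"
 unfolding subalgebra_def nf_space nf_sets by (intro conjI refl sigma_sets_mono') force

lemma nf_Obs: "sets (nf t) \<subseteq> sets (Obs t)"
proof -
 have "{w \<in> space M. v \<in> alive T A s w \<and> position x B T v s w \<in> S} \<in> sets (Obs t)" if "0 <= s" "s <= t" "S \<in> sets borel" for v s S
 proof -
  have "{w \<in> space M. v \<in> alive T A s w \<and> position x B T v s w \<in> S}
   = {w \<in> space M. (realized A v w \<and> bt v w <= s \<and> s < death T v w) \<and> bp v w + B v (max 0 (s - bt v w)) w \<in> S}"
   by (auto simp: alive_def position_def)
  thus ?thesis using Obs_alive[OF that] by simp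
 qed
 thus ?thesis unfolding nf_sets by (intro sets.sigma_sets_subset[of _ "Obs t", unfolded space_Obs]) auto
qed

lemma nf_subalgebra: "subalgebra M (nf t)"
 using nf_Obs[of t] Obs_subalgebra[of t] by (auto simp: subalgebra_def nf_space)

text \<open>A sum over an infinite population is 0 by convention, so the population size
  \<open>N\<close> is used to switch that case off; otherwise \<open>I\<close> is the sum, written
  as an integral over counting measure.\<close>

lemma aw_adapted:
 assumes t: "0 <= t" shows "aw l t \<in> bm (nf t)"
proof -
 have m: "(\<lambda>w. of_bool (v \<in> alive T A t w) * F (position x B T v t w)) \<in> bm (nf t)"
  if F: "F \<in> bm borel" for v and F :: "real => ennreal"
 proof (rule measurable_on_event[OF _ F])
  fix S :: "real set" assume "S \<in> sets borel"
  thus "{w \<in> space (nf t). v \<in> alive T A t w \<and> position x B T v t w \<in> S} \<in> sets (nf t)"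
   unfolding nf_space nf_sets using t by (intro sigma_sets.Basic) auto
 qed simp
 have c: "(\<lambda>w. \<integral>\<^sup>+v. f v w \<partial>count_space UNIV) \<in> bm (nf t)"
  if "!!v. f v \<in> bm (nf t)" for f :: "label => 'w => ennreal"
  unfolding gsum_suminf[symmetric] by (intro borel_measurable_suminf_order gsum_measurable that)
 define N where "N w = (\<integral>\<^sup>+v. of_bool (v \<in> alive T A t w) * 1 \<partial>count_space (UNIV :: label set))" for w
 define I where "I w = (\<integral>\<^sup>+v. of_bool (v \<in> alive T A t w) * ennreal (exp (- ga l * t) * hh l (position x B T v t w)) \<partial>count_space UNIV)" for w
 have [measurable]: "N \<in> bm (nf t)" "I \<in> bm (nf t)"
  unfolding N_def[abs_def] I_def[abs_def] using m[of "\<lambda>_. 1"] m[of "\<lambda>y. ennreal (exp (- ga l * t) * hh l y)"] by (auto intro!: c)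
 have "aw l t w = enn2real (of_bool (N w < \<infinity>) * I w)" for w
 proof (cases "finite (alive T A t w)")
  case True
  have "N w = (\<Sum>v\<in>alive T A t w. of_bool (v \<in> alive T A t w) * 1)" unfolding N_def by (rule nn_integral_count_space'[OF True]) auto
  hence "N w < \<infinity>" using True by (simp add: ennreal_of_nat_eq_real_of_nat)
  moreover have "ennreal (aw l t w) = I w" unfolding aw_count[OF True] I_def
   by (intro nn_integral_cong) (auto simp: alive_def Yt_position of_bool_def)
  ultimately show ?thesis using aw_nonneg[of l t w] by (simp flip: \<open>ennreal (aw l t w) = I w\<close>)
 next
  case False
  have "N w = (\<integral>\<^sup>+v. indicator (alive T A t w) v \<partial>count_space UNIV)" unfolding N_def by (intro nn_integral_cong) (auto simp: indicator_def)
  hence "N w = \<infinity>" using False by (simp add: emeasure_count_space_infinite)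
  thus ?thesis using False by (simp add: aw_sum)
 qed
 hence "aw l t = (\<lambda>w. enn2real (of_bool (N w < \<infinity>) * I w))" by auto
 thus ?thesis by simp
qed

lemma aw_measurable: "0 <= t ==> aw l t \<in> bm M"
 by (rule measurable_from_subalg[OF nf_subalgebra aw_adapted])

lemma aw_mean: assumes t: "0 <= t" shows "(\<E> w. ennreal (aw l t w)) = ennreal (hh l x)"
 unfolding WW_mean[OF t, symmetric] by (rule nn_integral_cong_AE) (use aw_WW[of l] in eventually_elim, simp)

lemma aw_integrable: "0 <= t ==> integrable M (aw l t)"
 by (rule integrableI_nonneg) (auto simp: aw_measurable aw_mean aw_nonneg)

text \<open>The integrals over all events of \<open>Obs s\<close> agree at times s and t, and these
  include the events of the natural filtration.\<close>

lemma aw_martingale: "is_martingale nf (aw l)"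
 unfolding is_martingale_def
proof (intro conjI allI impI nf_subalgebra nf_mono aw_adapted aw_integrable)
 fix s t :: real assume st: "0 <= s" "s <= t"
 interpret S: finite_measure_subalgebra M "nf s" by standard (rule nf_subalgebra)
 show "AE w in M. real_cond_exp M (nf s) (aw l t) w = aw l s w"
 proof (rule S.real_cond_exp_charact)
  fix C assume C: "C \<in> sets (nf s)"
  hence CO: "C \<in> sets (Obs s)" using nf_Obs by auto
  hence CM: "C \<in> sets M" using Obs_subalgebra by (auto simp: subalgebra_def)
  have "(\<integral>w\<in>C. aw l r w \<partial>M) = enn2real (\<E> w. indicator C w * WW l r w)" if r: "0 <= r" for r
  proof -
   have "(\<integral>w\<in>C. aw l r w \<partial>M) = enn2real (\<E> w. ennreal (indicator C w *\<^sub>R aw l r w))"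
    unfolding set_lebesgue_integral_def by (rule integral_eq_nn_integral) (use CM aw_measurable[OF r] aw_nonneg in auto)
   also have "(\<E> w. ennreal (indicator C w *\<^sub>R aw l r w)) = (\<E> w. indicator C w * WW l r w)"
    by (rule nn_integral_cong_AE) (use aw_WW[of l] in \<open>eventually_elim, auto simp: indicator_def\<close>)
   finally show ?thesis .
  qed
  moreover have "(\<E> w. indicator C w * WW l s w) = (\<E> w. indicator C w * WW l t w)"
   by (rule Obs_eq[OF _ _ WW_event[OF _ st] _ CO]) (use WW_mean[OF st(1)] in auto)
  ultimately show "(\<integral>w\<in>C. aw l t w \<partial>M) = (\<integral>w\<in>C. aw l s w \<partial>M)" using st by simp
 qed (use st in \<open>auto intro: aw_integrable aw_adapted\<close>)
qed

text \<open>Only the finitely many particles born by time t + 1 matter immediately after t, so the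
  living set is constant just to the right of t, and each summand is continuous.\<close>

lemma aw_right_continuous: "AE w in M. \<forall>t\<ge>0. ((\<lambda>u. aw l u w) \<longlongrightarrow> aw l t w) (at_right t)"
 using AE_good
proof eventually_elim
 case (elim w)
 show ?case
 proof (intro allI impI)
  fix t :: real assume t: "0 <= t"
  let ?S = "{v. realized A v w \<and> bt v w <= t + 1}"
  have S: "finite ?S" using elim by blast
  have ev: "\<forall>\<^sub>F u in at_right t. (bt v w <= u \<longleftrightarrow> bt v w <= t) \<and> (u < death T v w \<longleftrightarrow> t < death T v w)" for v
  proof -
   have b: "\<forall>\<^sub>F u in at_right t. u < c \<longleftrightarrow> t < c" for c :: real
   proof (cases "t < c")
    case True
    show ?thesis using eventually_at_right_real[OF True] by eventually_elim (use True in auto)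
   next
    case False
    show ?thesis using eventually_at_right_less[of t] by eventually_elim (use False in auto)
   qed
   show ?thesis using b[of "bt v w"] b[of "death T v w"]
    by eventually_elim auto
  qed
  have "\<forall>\<^sub>F u in at_right t. u < t + 1" using eventually_at_right_real[of t "t + 1"] by (auto elim: eventually_mono)
  moreover have "\<forall>\<^sub>F u in at_right t. \<forall>v\<in>?S. (bt v w <= u \<longleftrightarrow> bt v w <= t) \<and> (u < death T v w \<longleftrightarrow> t < death T v w)"
   by (rule eventually_ball_finite[OF S]) (use ev in blast)
  ultimately have al: "\<forall>\<^sub>F u in at_right t. alive T A u w = alive T A t w"
   by eventually_elim (auto simp: alive_def)
  have "((\<lambda>u. \<Sum>v\<in>alive T A t w. Yt l u v w) \<longlongrightarrow> (\<Sum>v\<in>alive T A t w. Yt l t v w)) (at_right t)"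
  proof (rule tendsto_sum)
   fix v
   have "continuous_on UNIV (\<lambda>u. B v (max 0 (u - bt v w)) w)"
    by (rule continuous_on_compose2[of "{0..}" "\<lambda>s. B v s w"]) (use elim BM_continuous[OF motion] in \<open>auto intro!: continuous_intros\<close>)
   hence "continuous_on UNIV (\<lambda>u. hh l (bp v w + B v (max 0 (u - bt v w)) w))"
    by (intro continuous_on_compose2[OF floquet_continuous(1)[OF floquet_hh]] continuous_on_add continuous_on_const) auto
   hence "continuous_on UNIV (\<lambda>u. Yt l u v w)" unfolding Yt_def
    by (intro continuous_on_mult continuous_on_exp continuous_on_id continuous_on_const)
   thus "((\<lambda>u. Yt l u v w) \<longlongrightarrow> Yt l t v w) (at_right t)"
    unfolding continuous_on_def by (auto intro: tendsto_within_subset[of _ _ t UNIV])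
  qed
  thus "((\<lambda>u. aw l u w) \<longlongrightarrow> aw l t w) (at_right t)"
   unfolding aw_sum[of l t] by (rule Lim_transform_eventually) (use al in \<open>eventually_elim, simp add: aw_sum\<close>)
 qed
qed

lemma aw_convergent: obtains W where "W \<in> bm M" "AE w in M. ((\<lambda>t. aw l t w) \<longlongrightarrow> W w) at_top"
 using nonneg_martingale_convergence[OF aw_martingale aw_nonneg aw_right_continuous] by blast

section \<open>Identification of the limit\<close>

context
 fixes l :: real and W :: "'w => real"
 assumes Wm [measurable]: "W \<in> bm M" and lim: "AE w in M. ((\<lambda>t. aw l t w) \<longlongrightarrow> W w) at_top"
begin

lemma WW_tendsto: "AE w in M. (\<lambda>j. WW l (real j) w) \<longlonglongrightarrow> ennreal (W w)"
 using lim aw_WW[of l]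
proof eventually_elim
 case (elim w)
 have "(\<lambda>j. ennreal (aw l (real j) w)) \<longlonglongrightarrow> ennreal (W w)"
  by (intro tendsto_ennrealI filterlim_compose[OF elim(1) filterlim_real_sequentially])
 thus ?case using elim(2) by simp
qed

lemma W_nonneg: "AE w in M. 0 <= W w"
 using lim by eventually_elim (rule tendsto_lowerbound, auto simp: aw_nonneg)

lemma W_min_tendsto: "(\<lambda>j. \<E> w. min (WW l (real j) w) (ennreal C)) \<longlonglongrightarrow> (\<E> w. min (ennreal (W w)) (ennreal C))"
 by (rule nn_integral_min_tendsto[OF _ _ WW_tendsto]) auto

lemma W_zero:
 assumes "!!e. 0 < e ==> (\<E> w. min (ennreal (W w)) 1) <= ennreal e"
 shows "AE w in M. W w = 0"
proof -
 have "(\<E> w. min (ennreal (W w)) 1) <= 0" by (rule ennreal_le_epsilon) (use assms in auto)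
 hence "(\<E> w. min (ennreal (W w)) 1) = 0" by simp
 hence "AE w in M. min (ennreal (W w)) 1 = 0" by (subst (asm) nn_integral_0_iff_AE) auto
 thus ?thesis using W_nonneg by eventually_elim (auto simp: min_def ennreal_eq_0_iff split: if_splits)
qed

lemma W_zero_VV:
 assumes "!!e. 0 < e ==> \<exists>n. (\<E> w. min (VV l n w) (ennreal 1)) <= ennreal e"
 shows "AE w in M. W w = 0"
proof (rule W_zero)
 fix e :: real assume "0 < e"
 then obtain n where n: "(\<E> w. min (VV l n w) (ennreal 1)) <= ennreal e" using assms by blast
 have "limsup (\<lambda>j. \<E> w. min (WW l (real j) w) (ennreal 1)) = (\<E> w. min (ennreal (W w)) (ennreal 1))"
  by (rule lim_imp_Limsup[OF _ W_min_tendsto]) simp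
 thus "(\<E> w. min (ennreal (W w)) 1) <= ennreal e" using order_trans[OF WW_min_le_VV[of l 1 n] n] by simp
qed

lemma W_mean_le: "(\<E> w. ennreal (W w)) <= ennreal (hh l x)"
proof -
 have "(\<E> w. ennreal (W w)) = (\<E> w. liminf (\<lambda>j. WW l (real j) w))"
  by (rule nn_integral_cong_AE) (use WW_tendsto in \<open>eventually_elim, simp add: lim_imp_Liminf\<close>)
 also have "... <= liminf (\<lambda>j. \<E> w. WW l (real j) w)" by (rule nn_integral_liminf) measurable
 finally show ?thesis by (simp add: WW_mean Liminf_const)
qed

lemma W_integrable: "integrable M W"
proof -
 have "(\<E> w. ennreal (norm (W w))) = (\<E> w. ennreal (W w))"
  by (rule nn_integral_cong_AE) (use W_nonneg in \<open>eventually_elim, simp\<close>)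
 thus ?thesis using W_mean_le by (intro integrableI_bounded) (auto simp: order_le_less_trans)
qed

text \<open>Scheffe's lemma: almost sure convergence plus convergence of the means. Fatou always
  bounds the mean of W by that of W_t, so the hypothesis is the missing half.\<close>

lemma W_L1:
 assumes mean: "ennreal (hh l x) <= (\<E> w. ennreal (W w))"
 shows "((\<lambda>t. \<E> w. ennreal \<bar>aw l t w - W w\<bar>) \<longlongrightarrow> 0) at_top"
proof (rule tendsto_at_topI_sequentially)
 fix X :: "nat => real" assume X: "filterlim X at_top sequentially"
 hence ev: "\<forall>\<^sub>F n in sequentially. max 0 (X n) = X n"
  by (auto simp: filterlim_at_top elim: eventually_mono dest!: spec[of _ 0])
 hence X': "filterlim (\<lambda>n. max 0 (X n)) at_top sequentially"
  using filterlim_cong[OF refl refl ev] X by simp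
 have "(\<lambda>n. \<E> w. ennreal (norm (aw l (max 0 (X n)) w - W w))) \<longlonglongrightarrow> 0"
 proof (rule Scheffe_lemma1[OF aw_integrable W_integrable])
  show "AE w in M. (\<lambda>n. aw l (max 0 (X n)) w) \<longlonglongrightarrow> W w"
   using lim by eventually_elim (rule filterlim_compose[OF _ X'])
  have "(\<E> w. ennreal (norm (W w))) = (\<E> w. ennreal (W w))"
   by (rule nn_integral_cong_AE) (use W_nonneg in \<open>eventually_elim, simp\<close>)
  thus "limsup (\<lambda>n. \<E> w. ennreal (norm (aw l (max 0 (X n)) w))) <= (\<E> w. ennreal (norm (W w)))"
   using mean by (simp add: aw_nonneg aw_mean Limsup_const)
 qed simp
 thus "(\<lambda>n. \<E> w. ennreal \<bar>aw l (X n) w - W w\<bar>) \<longlonglongrightarrow> 0"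
  by (rule Lim_transform_eventually) (use ev in \<open>eventually_elim, simp\<close>)
qed

end
end

section \<open>Fractional moments and truncation\<close>

text \<open>If all terms are at most 1, each lies below its th-power; otherwise a single power
  already exceeds 1.\<close>

lemma min_sum_le_powr:
 fixes y :: "'i => real"
 assumes S: "finite S" and y: "!!i. i \<in> S ==> 0 < y i" and th: "0 < th" "th < 1"
 shows "min (\<Sum>i\<in>S. y i) 1 <= (\<Sum>i\<in>S. y i powr th)"
proof (cases "\<forall>i\<in>S. y i <= 1")
 case True
 have "y i <= y i powr th" if "i \<in> S" for i
  using powr_mono'[of th 1 "y i"] y[OF that] True that th by simp
 thus ?thesis using sum_mono[of S y "\<lambda>i. y i powr th"] by (simp add: min_le_iff_disj)
next
 case False
 then obtain i where i: "i \<in> S" "1 < y i" by (auto simp: not_le)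
 have "1 <= y i powr th" using i th by (intro ge_one_powr_ge_zero) auto
 also have "... <= (\<Sum>i\<in>S. y i powr th)" using i S by (intro member_le_sum) auto
 finally show ?thesis by simp
qed

context bbm_full begin

text \<open>The c-th power of the function for l has the same multiplier as the function for c l, so
  their quotient is periodic and hence bounded.\<close>

lemma powr_hh: "\<exists>C>0. \<forall>y. hh l y powr c <= C * hh (c * l) y"
proof -
 let ?q = "\<lambda>y. hh l y powr c / hh (c * l) y"
 have "continuous_on UNIV ?q"
  using floquet_continuous(1)[OF floquet_hh] hh_pos
  by (intro continuous_intros) (auto simp: less_imp_neq[THEN not_sym])
 moreover have "?q (y + 1) = ?q y" for y
 proof -
  have "hh k (y + 1) = exp (- k) * hh k y" for k using floquet_hh[of k] by (auto simp: floquet_def)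
  thus ?thesis using hh_pos[of l y] by (simp add: powr_mult) (simp add: powr_def)
 qed
 ultimately have "\<exists>C>0. \<forall>y. \<bar>?q y\<bar> <= C" by (rule periodic_bounded)
 then obtain C where C: "C > 0" "!!y. \<bar>?q y\<bar> <= C" by blast
 have "hh l y powr c <= C * hh (c * l) y" for y
  using abs_le_D1[OF C(2)[of y]] hh_pos[of "c * l" y] by (simp add: divide_le_eq)
 thus ?thesis using C(1) by blast
qed

lemma Y_powr:
 assumes C: "!!y. hh l y powr c <= C * hh (c * l) y"
 shows "(exp (- ga l * t) * hh l y) powr c <= C * (exp (- (c * ga l) * t) * hh (c * l) y)"
proof -
 have "(exp (- ga l * t) * hh l y) powr c = exp (- (c * ga l) * t) * hh l y powr c"
  using hh_nonneg[of l y] by (simp add: powr_mult) (simp add: powr_def)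
 also have "... <= exp (- (c * ga l) * t) * (C * hh (c * l) y)" by (rule mult_left_mono[OF C]) simp
 finally show ?thesis by (simp add: mult_ac)
qed

text \<open>The fractional moment is taken of W_t directly: min(W_t, 1) is at most a constant times
  exp(- d t) times the martingale with parameter th l, whose mean does not depend on t.\<close>

lemma W_zero_supercritical:
 assumes sup: "\<bar>l\<bar> > lstar" and W: "W \<in> bm M" "AE w in M. ((\<lambda>t. aw l t w) \<longlongrightarrow> W w) at_top"
 shows "AE w in M. W w = 0"
proof -
 obtain th where th: "0 < th" "th < 1" "ga (th * l) < th * ga l" using supercritical[OF sup] by blast
 obtain C where C: "0 < C" "!!y. hh l y powr th <= C * hh (th * l) y" using powr_hh by blast
 let ?d = "th * ga l - ga (th * l)"
 have le: "min (aw l t w) 1 <= C * exp (- ?d * t) * aw (th * l) t w" for t w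
 proof (cases "finite (alive T A t w)")
  case True
  have "min (aw l t w) 1 <= (\<Sum>u\<in>alive T A t w. Yt l t u w powr th)"
   unfolding aw_sum by (rule min_sum_le_powr[OF True Yt_pos th(1,2)])
  also have "... <= (\<Sum>u\<in>alive T A t w. C * exp (- ?d * t) * Yt (th * l) t u w)"
  proof (rule sum_mono)
   fix u
   have "exp (- (th * ga l) * t) = exp (- ?d * t) * exp (- ga (th * l) * t)" by (simp add: algebra_simps flip: exp_add)
   thus "Yt l t u w powr th <= C * exp (- ?d * t) * Yt (th * l) t u w"
    unfolding Yt_def using Y_powr[OF C(2), of t] by (simp only: mult.assoc)
  qed
  finally show ?thesis unfolding aw_sum sum_distrib_left .
 qed (simp add: aw_sum)
 have b: "(\<E> w. min (WW l (real j) w) (ennreal 1)) <= ennreal (C * exp (- ?d * real j) * hh (th * l) x)" for j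
 proof -
  have "(\<E> w. min (WW l (real j) w) (ennreal 1)) <= (\<E> w. ennreal (C * exp (- ?d * real j)) * ennreal (aw (th * l) (real j) w))"
  proof (rule nn_integral_mono_AE)
   show "AE w in M. min (WW l (real j) w) (ennreal 1) <= ennreal (C * exp (- ?d * real j)) * ennreal (aw (th * l) (real j) w)"
    using aw_WW[of l]
   proof eventually_elim
    case (elim w)
    have "min (WW l (real j) w) (ennreal 1) = ennreal (min (aw l (real j) w) 1)"
     using elim[rule_format, of "real j", symmetric] by (simp only: min_ennreal aw_nonneg zero_le_one)
    thus ?case using C(1) aw_nonneg by (simp only: ennreal_mult[symmetric] mult_nonneg_nonneg exp_ge_zero less_imp_le) (rule ennreal_leI[OF le])
   qed
  qed
  also have "... = ennreal (C * exp (- ?d * real j) * hh (th * l) x)"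
   using aw_measurable[of "real j" "th * l", measurable] by (subst nn_integral_cmult) (use C(1) hh_nonneg in \<open>auto simp: aw_mean ennreal_mult\<close>)
  finally show ?thesis .
 qed
 have "(\<lambda>j. C * exp (- ?d) ^ j * hh (th * l) x) \<longlonglongrightarrow> C * 0 * hh (th * l) x"
  using th(3) by (intro tendsto_intros LIMSEQ_realpow_zero) auto
 moreover have "exp (- ?d) ^ j = exp (- ?d * real j)" for j by (simp only: exp_of_nat_mult[symmetric] mult.commute)
 ultimately have "(\<lambda>j. C * exp (- ?d * real j) * hh (th * l) x) \<longlonglongrightarrow> 0" by simp
 hence "(\<lambda>j. ennreal (C * exp (- ?d * real j) * hh (th * l) x)) \<longlonglongrightarrow> ennreal 0" by (rule tendsto_ennrealI)
 hence "(\<E> w. min (ennreal (W w)) (ennreal 1)) <= ennreal 0"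
  by (rule LIMSEQ_le[OF W_min_tendsto[OF W]]) (use b in auto)
 thus ?thesis by (intro W_zero[OF W]) auto
qed

text \<open>An exclusion rule may use the generation, the family size, the death time and the place
  of death; a bad particle loses all its children. The rule is left open so as to serve both the
  deletion of large families and the barrier at criticality.\<close>

definition excm :: "(nat => nat => real => real => bool) => bool" where
 "excm exc \<longleftrightarrow> (\<forall>k a. Measurable.pred (borel \<Otimes>\<^sub>M borel) (\<lambda>(d, y). exc k a d y))"

definition bad :: "(nat => nat => real => real => bool) => label => 'w => bool" where
 "bad exc v w \<longleftrightarrow> exc (length v) (A v w) (death T v w) (dp v w)"

primrec ok :: "(nat => nat => real => real => bool) => label => 'w => bool" where
 "ok exc [] w \<longleftrightarrow> True"
| "ok exc (i # v) w \<longleftrightarrow> ok exc v w \<and> \<not> bad exc v w"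

definition Vg :: "(nat => nat => real => real => bool) => real => (real => real) => nat => 'w => ennreal" where
 "Vg exc dl H n w = gsum n (\<lambda>v. of_bool (realized A v w \<and> ok exc v w) * gw dl H v w)"
text \<open>The weight removed by deleting families of generation n, evaluated at the death of the
  parent, that is at the birth of the deleted children.\<close>

definition lossg :: "(nat => nat => real => real => bool) => real => (real => real) => nat => 'w => ennreal" where
 "lossg exc dl H n w = gsum n (\<lambda>v. of_bool (realized A v w \<and> ok exc v w \<and> bad exc v w) * kids v w * ennreal (exp (- dl * death T v w) * H (dp v w)))"

abbreviation "Vt exc l \<equiv> Vg exc (ga l) (hh l)"
abbreviation "loss exc l \<equiv> lossg exc (ga l) (hh l)"

lemma Vt_def: "Vt exc l n w = gsum n (\<lambda>v. of_bool (realized A v w \<and> ok exc v w) * ennreal (Yb l v w))"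
 and loss_def: "loss exc l n w = gsum n (\<lambda>v. of_bool (realized A v w \<and> ok exc v w \<and> bad exc v w) * kids v w * ennreal (Yd l v w))"
 by (simp_all add: Vg_def lossg_def gw_def Yb_def Yd_def)

text \<open>For the potential gamma - m g and the discount gamma the upper and the lower one-step
  bound coincide, so the balance is exact; a mark f on the family size contributes only its
  mean.\<close>

lemma one_step_Y:
 assumes Z: "Z \<in> bm (SO v)"
 shows "ennreal (1 + m) * (\<E> w. Z w * f (A v w) * ennreal (Yd l v w)) = (\<integral>\<^sup>+k. f k \<partial>measure_pmf p) * (\<E> w. Z w * ennreal (Yb l v w))"
proof -
 obtain g0 where g0: "g0 > 0" "!!y. g0 <= g y" using g_bounds by metis
 show ?thesis unfolding Yd_def Yb_def
 proof (rule antisym)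
  show "ennreal (1 + m) * (\<E> w. Z w * f (A v w) * ennreal (exp (- ga l * death T v w) * hh l (dp v w)))
   <= (\<integral>\<^sup>+k. f k \<partial>measure_pmf p) * (\<E> w. Z w * ennreal (exp (- ga l * bt v w) * hh l (bp v w)))"
   by (rule one_step_le[OF Z floquet_hh pot_per_lip]) (use m_pos in \<open>auto simp: algebra_simps\<close>)
  show "(\<integral>\<^sup>+k. f k \<partial>measure_pmf p) * (\<E> w. Z w * ennreal (exp (- ga l * bt v w) * hh l (bp v w)))
   <= ennreal (1 + m) * (\<E> w. Z w * f (A v w) * ennreal (exp (- ga l * death T v w) * hh l (dp v w)))"
  proof (rule one_step_ge[OF Z floquet_hh pot_per_lip _ g0(1)])
   show "g0 <= g y + ga l - (ga l - m * g y)" for y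
    using add_mono[OF g0(2)[of y] mult_nonneg_nonneg[OF less_imp_le[OF m_pos] less_imp_le[OF gpos[of y]]]] by simp
  qed (use m_pos in \<open>auto simp: algebra_simps\<close>)
 qed
qed

lemma one_step_child:
 assumes Z: "Z \<in> bm (SO v)"
 shows "(\<E> w. Z w * kids v w * ennreal (Yd l v w)) = (\<E> w. Z w * ennreal (Yb l v w))"
proof -
 have "ennreal (1 + m) * (\<E> w. Z w * kids v w * ennreal (Yd l v w)) = ennreal (1 + m) * (\<E> w. Z w * ennreal (Yb l v w))"
  using one_step_Y[OF Z, of "\<lambda>k. ennreal (1 + real k)" l] by (simp only: offspring_mean)
 thus ?thesis using m_pos by (subst (asm) ennreal_mult_cancel_left) auto
qed

context
 fixes exc :: "nat => nat => real => real => bool"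
 assumes exc: "excm exc"
begin

lemma bad_Sg:
 assumes "!!u. u \<in> insert wt (ancs wt) ==> Inl u \<in> P \<and> Inr (Inl u) \<in> P \<and> Inr (Inr u) \<in> P"
 shows "Measurable.pred (Sg P) (bad exc wt)"
proof -
 have [measurable]: "dp wt \<in> bm (Sg P)" "death T wt \<in> bm (Sg P)" by (rule Sg_T; use assms in blast)+
 have Aw: "A wt \<in> measurable (Sg P) (count_space UNIV)" by (rule Sg_A) (use assms in blast)
 have "Measurable.pred (Sg P) (\<lambda>w. exc (length wt) a (death T wt w) (dp wt w))" for a
  using measurable_compose[OF _ exc[unfolded excm_def, rule_format], of "\<lambda>w. (death T wt w, dp wt w)" "Sg P" "length wt" a] by simp
 thus ?thesis unfolding bad_def[abs_def] by (rule measurable_compose_countable) (rule Aw)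
qed

lemma ok_Sg:
 assumes "!!u. u \<in> ancs wt ==> Inl u \<in> P \<and> Inr (Inl u) \<in> P \<and> Inr (Inr u) \<in> P"
 shows "Measurable.pred (Sg P) (ok exc wt)"
 using assms
proof (induction wt)
 case Nil
 have "ok exc [] = (\<lambda>_. True)" by auto
 thus ?case by simp
next
 case (Cons i v)
 have [measurable]: "Measurable.pred (Sg P) (ok exc v)" by (rule Cons.IH) (use Cons.prems in auto)
 have [measurable]: "Measurable.pred (Sg P) (bad exc v)" by (rule bad_Sg) (use Cons.prems in auto)
 have "ok exc (i # v) = (\<lambda>w. ok exc v w \<and> \<not> bad exc v w)" by auto
 thus ?case by simp
qed

lemma bad_measurable [measurable]: "Measurable.pred M (bad exc v)"
 by (rule measurable_from_subalg[OF subalgebra_Sg bad_Sg[of v UNIV]]) auto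
lemma ok_measurable [measurable]: "Measurable.pred M (ok exc v)"
 by (rule measurable_from_subalg[OF subalgebra_Sg ok_Sg[of v UNIV]]) auto

lemma ok_SO: "v \<notin> ancs wt ==> Measurable.pred (SO v) (\<lambda>w. realized A wt w \<and> ok exc wt w)"
 by (intro pred_intros_logic SO_realized ok_Sg) (auto simp: own_def)

lemma
 assumes [measurable]: "H \<in> bm borel"
 shows Vg_measurable [measurable]: "Vg exc dl H n \<in> bm M"
  and lossg_measurable [measurable]: "lossg exc dl H n \<in> bm M"
 unfolding Vg_def[abs_def] lossg_def[abs_def] gw_def by (rule gsum_measurable; measurable)+

lemma ok_indicator_SO: "(\<lambda>w. of_bool (realized A v w \<and> ok exc v w) :: ennreal) \<in> bm (SO v)"
 using ok_SO[OF not_ancs_self, of v] by measurable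

lemma Vg_Suc: "Vg exc dl H (Suc n) w = gsum n (\<lambda>v. of_bool (realized A v w) * kids v w
  * (of_bool (ok exc v w \<and> \<not> bad exc v w) * ennreal (exp (- dl * death T v w) * H (dp v w))))"
 unfolding Vg_def by (rule gsum_children) (simp only: ok.simps of_bool_conj gw_def birth.simps birth_place.simps death_def[symmetric] dp_def[symmetric] mult.assoc)

lemma Vg_mean:
 assumes [measurable]: "H \<in> bm borel"
 shows "(\<E> w. Vg exc dl H n w) = gsum n (\<lambda>v. \<E> w. of_bool (realized A v w \<and> ok exc v w) * gw dl H v w)"
 unfolding Vg_def gw_def by (rule nn_integral_gsum) measurable

lemma Vg_mean_Suc:
 assumes [measurable]: "H \<in> bm borel"
 shows "(\<E> w. Vg exc dl H (Suc n) w) + (\<E> w. lossg exc dl H n w)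
  = gsum n (\<lambda>v. \<E> w. of_bool (realized A v w \<and> ok exc v w) * kids v w * ennreal (exp (- dl * death T v w) * H (dp v w)))"
proof -
 have "(\<E> w. Vg exc dl H (Suc n) w) + (\<E> w. lossg exc dl H n w) = (\<E> w. Vg exc dl H (Suc n) w + lossg exc dl H n w)"
  by (rule nn_integral_add[symmetric]) measurable
 also have "... = (\<E> w. gsum n (\<lambda>v. of_bool (realized A v w \<and> ok exc v w) * kids v w * ennreal (exp (- dl * death T v w) * H (dp v w))))"
  unfolding Vg_Suc lossg_def gsum_add[symmetric] by (intro nn_integral_cong gsum_cong) (auto simp: of_bool_def)
 finally show ?thesis by (subst (asm) nn_integral_gsum) measurable
qed

lemma Vt_mean_step: "(\<E> w. Vt exc l (Suc n) w) + (\<E> w. loss exc l n w) = (\<E> w. Vt exc l n w)"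
 unfolding Vg_mean_Suc[OF hh_borel] Vg_mean[OF hh_borel, where n = n] gw_def Yb_def[symmetric] Yd_def[symmetric]
 by (intro gsum_cong one_step_child ok_indicator_SO)

lemma Vt_marked:
 "ennreal (1 + m) * (\<E> w. gsum n (\<lambda>v. of_bool (realized A v w \<and> ok exc v w) * f (A v w) * ennreal (Yd l v w)))
  = (\<integral>\<^sup>+k. f k \<partial>measure_pmf p) * (\<E> w. Vt exc l n w)"
proof -
 have [measurable]: "(\<lambda>w. f (A v w)) \<in> bm M" for v by (rule measurable_compose[OF A_measurable]) simp
 show ?thesis
  unfolding Vg_mean[OF hh_borel] gw_def Yb_def[symmetric] gsum_cmult[symmetric]
  by (subst nn_integral_gsum, measurable, unfold gsum_cmult[symmetric]) (intro gsum_cong one_step_Y ok_indicator_SO)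
qed

lemma Vt_mean_sum: "(\<E> w. Vt exc l n w) + (\<Sum>k<n. \<E> w. loss exc l k w) = ennreal (hh l x)"
proof (induction n)
 case 0
 show ?case by (simp add: Vt_def gsum_0 Yb_def emeasure_space_1)
next
 case (Suc n)
 show ?case using Suc.IH unfolding Vt_mean_step[of l n, symmetric] by (simp add: ac_simps)
qed

lemma not_ok_bad: "realized A v w ==> \<not> ok exc v w ==> \<exists>wt. length wt < length v \<and> realized A wt w \<and> ok exc wt w \<and> bad exc wt w"
proof (induction v)
 case (Cons i v)
 thus ?case by (cases "ok exc v w") (auto intro: less_SucI)
qed simp

text \<open>Where nothing was deleted, V_n equals its reduced version. Otherwise some bad family
  with good ancestry adds at least C to the loss; the expected total loss is at most h(x), so this
  case costs at most h(x) / C.\<close>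

lemma VV_truncated:
 assumes C: "0 < C" and bad: "!!v w. bad exc v w ==> C <= (1 + real (A v w)) * Yd l v w"
 shows "(\<E> w. min (VV l n w) (ennreal 1)) <= (\<E> w. Vt exc l n w) + ennreal (hh l x / C)"
proof -
 have pt: "min (VV l n w) (ennreal 1) <= Vt exc l n w + (\<Sum>k<n. ennreal (1 / C) * loss exc l k w)" for w
 proof (cases "\<exists>v. length v = n \<and> realized A v w \<and> \<not> ok exc v w")
  case True
  then obtain wt where wt: "length wt < n" "realized A wt w" "ok exc wt w" "bad exc wt w" using not_ok_bad by blast
  let ?F = "\<lambda>v. of_bool (realized A v w \<and> ok exc v w \<and> bad exc v w) * kids v w * ennreal (Yd l v w)"
  have "ennreal 1 <= ennreal (1 / C * ((1 + real (A wt w)) * Yd l wt w))"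
   using bad[OF wt(4)] C by (intro ennreal_leI) (simp add: field_simps)
  also have "... = ennreal (1 / C) * ?F wt" using wt C Yd_pos[of l wt w]
   by (simp add: ennreal_mult[symmetric] mult.assoc[symmetric] less_imp_le del: ennreal_plus times_divide_eq_left)
  also have "?F wt <= gsum (length wt) ?F"
  proof -
   have "?F wt = (\<integral>\<^sup>+v. ?F wt * indicator {wt} v \<partial>count_space {v. length v = length wt})"
    by (subst nn_integral_cmult_indicator) (auto simp: emeasure_count_space)
   also have "... <= gsum (length wt) ?F" unfolding gsum_def by (rule nn_integral_mono) (auto simp: indicator_def)
   finally show ?thesis .
  qed
  also have "ennreal (1 / C) * gsum (length wt) ?F = ennreal (1 / C) * loss exc l (length wt) w" by (simp add: loss_def)
  also have "... <= (\<Sum>k<n. ennreal (1 / C) * loss exc l k w)" using wt(1) by (intro member_le_sum) auto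
  finally show ?thesis by (simp add: min.coboundedI2 add_increasing mult_left_mono)
 next
  case False
  hence "VV l n w = Vt exc l n w" unfolding VV_def Vt_def by (intro gsum_cong) (auto simp: of_bool_def)
  thus ?thesis by (simp add: min.coboundedI1 add_increasing2)
 qed
 have "(\<E> w. min (VV l n w) (ennreal 1)) <= (\<E> w. Vt exc l n w + (\<Sum>k<n. ennreal (1 / C) * loss exc l k w))"
  by (rule nn_integral_mono) (rule pt)
 also have "... = (\<E> w. Vt exc l n w) + ennreal (1 / C) * (\<Sum>k<n. \<E> w. loss exc l k w)"
  by (simp add: nn_integral_add nn_integral_sum nn_integral_cmult sum_distrib_left)
 also have "ennreal (1 / C) * (\<Sum>k<n. \<E> w. loss exc l k w) <= ennreal (1 / C) * ennreal (hh l x)"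
  unfolding Vt_mean_sum[of l n, symmetric] by (intro mult_left_mono) auto
 also have "... = ennreal (hh l x / C)" using C hh_nonneg by (simp add: ennreal_mult[symmetric])
 finally show ?thesis by (simp add: add_left_mono)
qed

end

lemmas exc_measurable = ok_measurable bad_measurable Vg_measurable lossg_measurable

lemma W_zero_truncated:
 assumes W: "W \<in> bm M" "AE w in M. ((\<lambda>t. aw l t w) \<longlongrightarrow> W w) at_top"
  and ex: "!!C. 0 < C ==> \<exists>exc. excm exc \<and>
   (\<forall>v w. bad exc v w --> C <= (1 + real (A v w)) * Yd l v w) \<and> (\<lambda>n. \<E> w. Vt exc l n w) \<longlonglongrightarrow> 0"
 shows "AE w in M. W w = 0"
proof (rule W_zero_VV[OF W])
 fix e :: real assume e: "0 < e"
 let ?C = "2 * hh l x / e"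
 have C: "0 < ?C" using e hh_pos[of l x] by simp
 obtain exc where exc: "excm exc"
   "!!v w. bad exc v w ==> ?C <= (1 + real (A v w)) * Yd l v w" "(\<lambda>n. \<E> w. Vt exc l n w) \<longlonglongrightarrow> 0"
  using ex[OF C] by blast
 have "\<forall>\<^sub>F n in sequentially. (\<E> w. Vt exc l n w) < ennreal (e / 2)" using order_tendstoD(2)[OF exc(3), of "ennreal (e / 2)"] e by simp
 then obtain n where n: "(\<E> w. Vt exc l n w) < ennreal (e / 2)" by (auto simp: eventually_sequentially)
 have "(\<E> w. min (VV l n w) (ennreal 1)) <= (\<E> w. Vt exc l n w) + ennreal (hh l x / ?C)"
  by (rule VV_truncated[OF exc(1) C exc(2)])
 also have "... <= ennreal (e / 2) + ennreal (e / 2)"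
  using n hh_pos[of l x] e by (intro add_mono) (auto intro!: ennreal_leI)
 also have "... = ennreal e" using e by (simp flip: ennreal_plus)
 finally show "\<exists>n. (\<E> w. min (VV l n w) (ennreal 1)) <= ennreal e" by blast
qed

end

section \<open>The L log L dichotomy\<close>

text \<open>The number of n with C exp(n ka) < 1 + k is about log(1 + k) / ka, so counting each such
  n with weight 1 + k reproduces k log k up to multiples of 1 + k.\<close>

lemma LlogL_lower:
 assumes ka: "0 < ka" and C: "0 < C"
 shows "ennreal (real k * log_plus (real k))
  <= ennreal ka * (\<Sum>n. ennreal (1 + real k) * of_bool (C * exp (real n * ka) < 1 + real k)) + ennreal \<bar>ln C\<bar> * ennreal (1 + real k)"
proof -
 define t where "t = ln (1 + real k) - ln C"
 define N where "N = nat \<lceil>t / ka\<rceil>"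
 have "C * exp (real n * ka) < 1 + real k" if "n < N" for n
 proof -
  have "real n < t / ka" using that unfolding N_def by linarith
  hence "real n * ka < t" using ka by (simp add: less_divide_eq)
  hence "exp (ln C + real n * ka) < exp (ln (1 + real k))" by (simp only: exp_less_cancel_iff) (simp add: t_def)
  thus ?thesis using C by (simp add: exp_add)
 qed
 hence "(\<Sum>n<N. ennreal (1 + real k) * of_bool (C * exp (real n * ka) < 1 + real k)) = (\<Sum>n<N. ennreal (1 + real k))"
  by (intro sum.cong) auto
 hence S: "ennreal (real N * (1 + real k)) <= (\<Sum>n. ennreal (1 + real k) * of_bool (C * exp (real n * ka) < 1 + real k))"
  using sum_le_suminf[of "\<lambda>n. ennreal (1 + real k) * of_bool (C * exp (real n * ka) < 1 + real k)" "{..<N}"]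
  by (simp add: ennreal_mult ennreal_of_nat_eq_real_of_nat del: ennreal_plus)
 have "ln (1 + real k) <= ka * real N + \<bar>ln C\<bar>"
 proof -
  have "t / ka <= real N" unfolding N_def by linarith
  hence "t <= ka * real N" using ka by (simp add: divide_le_eq mult.commute)
  thus ?thesis by (simp add: t_def)
 qed
 hence "real k * log_plus (real k) <= (1 + real k) * (ka * real N + \<bar>ln C\<bar>)"
 proof (intro mult_mono)
  assume le: "ln (1 + real k) <= ka * real N + \<bar>ln C\<bar>"
  have "log_plus (real k) <= ln (1 + real k)" by (auto simp: log_plus_def)
  thus "log_plus (real k) <= ka * real N + \<bar>ln C\<bar>" using le by simp
 qed (auto simp: log_plus_def)
 hence "ennreal (real k * log_plus (real k)) <= ennreal (ka * (real N * (1 + real k)) + \<bar>ln C\<bar> * (1 + real k))"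
  by (intro ennreal_leI) (simp add: algebra_simps)
 also have "... = ennreal ka * ennreal (real N * (1 + real k)) + ennreal \<bar>ln C\<bar> * ennreal (1 + real k)"
  using ka by (subst ennreal_plus) (auto simp: ennreal_mult simp del: ennreal_plus)
 also have "... <= ennreal ka * (\<Sum>n. ennreal (1 + real k) * of_bool (C * exp (real n * ka) < 1 + real k)) + ennreal \<bar>ln C\<bar> * ennreal (1 + real k)"
  by (intro add_mono mult_left_mono S) auto
 finally show ?thesis .
qed

lemma LlogL_upper:
 assumes s: "1 < s"
 shows "(\<Sum>n. ennreal (1 + real k) * of_bool (s ^ n < 1 + real k))
  <= ennreal (2 / ln s) * ennreal (real k * log_plus (real k)) + ennreal (1 + ln 2 / ln s) * ennreal (1 + real k)"
proof -
 have ls: "0 < ln s" using s by simp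
 define N where "N = Suc (nat \<lfloor>ln (1 + real k) / ln s\<rfloor>)"
 have z: "\<not> s ^ n < 1 + real k" if "N <= n" for n
 proof -
  have "ln (1 + real k) / ln s < real n" using that unfolding N_def by linarith
  hence "ln (1 + real k) < ln (s ^ n)" using ls s by (simp add: divide_less_eq ln_realpow)
  thus ?thesis using s by (simp add: ln_less_cancel_iff)
 qed
 have "(\<Sum>n. ennreal (1 + real k) * of_bool (s ^ n < 1 + real k)) = (\<Sum>n<N. ennreal (1 + real k) * of_bool (s ^ n < 1 + real k))"
  by (rule suminf_finite) (use z in auto)
 also have "... <= (\<Sum>n<N. ennreal (1 + real k))" by (rule sum_mono) (auto simp: of_bool_def)
 also have "... = ennreal (real N * (1 + real k))" by (simp add: ennreal_mult ennreal_of_nat_eq_real_of_nat del: ennreal_plus)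
 also have "... <= ennreal (2 / ln s * (real k * log_plus (real k)) + (1 + ln 2 / ln s) * (1 + real k))"
 proof (rule ennreal_leI)
  have "real N <= 1 + ln (1 + real k) / ln s" unfolding N_def using ls by simp
  hence "real N * (1 + real k) <= (1 + ln (1 + real k) / ln s) * (1 + real k)" by (rule mult_right_mono) simp
  also have "... = (1 + real k) + ((1 + real k) * ln (1 + real k)) / ln s" by (simp add: algebra_simps)
  also have "(1 + real k) * ln (1 + real k) <= 2 * (real k * log_plus (real k)) + ln 2 * (1 + real k)"
  proof (cases "k = 0")
   case False
   have "ln (1 + real k) <= ln (2 * real k)" using False by (subst ln_le_cancel_iff) auto
   also have "... = ln 2 + log_plus (real k)" using False by (auto simp: ln_mult log_plus_def)
   finally have "(1 + real k) * ln (1 + real k) <= (1 + real k) * (ln 2 + log_plus (real k))" by (rule mult_left_mono) simp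
   moreover have "(1 + real k) * log_plus (real k) <= (2 * real k) * log_plus (real k)" using False by (intro mult_right_mono) (auto simp: log_plus_def)
   ultimately show ?thesis by (simp add: algebra_simps)
  qed simp
  finally show "real N * (1 + real k) <= 2 / ln s * (real k * log_plus (real k)) + (1 + ln 2 / ln s) * (1 + real k)"
   using ls by (simp add: divide_right_mono field_simps)
 qed
 also have "... = ennreal (2 / ln s) * ennreal (real k * log_plus (real k)) + ennreal (1 + ln 2 / ln s) * ennreal (1 + real k)"
 proof -
  have "0 <= real k * log_plus (real k)" by (simp add: log_plus_def)
  thus ?thesis using ls by (simp add: ennreal_mult ennreal_plus del: times_divide_eq_left)
 qed
 finally show ?thesis .
qed

context bbm_full begin

text \<open>The gain from an event that forces a large family is compared with the loss; families that are
 large only relative to a small weight contribute a geometrically small error.\<close>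

lemma loss_lower:
 assumes C: "0 < C" and "exc = (\<lambda>k a d y. C < (1 + real a) * (exp (- ga l * d) * hh l y))"
 obtains ka K where "0 < ka" "0 <= K"
  "!!n. (\<integral>\<^sup>+k. ennreal (1 + real k) * of_bool (C * exp (real n * ka) < 1 + real k) \<partial>measure_pmf p) * (\<E> w. Vt exc l n w)
   <= ennreal (1 + m) * (\<E> w. loss exc l n w) + ennreal (K * (1/2) ^ n)"
proof -
 have exc: "excm exc" unfolding excm_def assms(2) by (intro allI) measurable
 note [measurable] = exc_measurable[OF exc]
 obtain g0 g1 where g0: "0 < g0" "g0 <= g1" "!!y. g0 <= g y" "!!y. g y <= g1" by (rule g_bounds) (rule that; assumption)
 \<comment> \<open>Chosen so that the sums with exponent 1 - th grow by at most a factor 2 per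
   generation: convexity of gamma between l and 0 costs th gamma(0), which is made at most (1 + m) /
   2 times \<open>g0\<close>.\<close>
 define th where "th = min (1/2) ((1 + m) * g0 / (2 * ga 0))"
 have th: "0 < th" "th < 1" "th * ga 0 <= (1 + m) / 2 * g0"
 proof -
  show "0 < th" "th < 1" using g0 m_pos ga_0_pos by (auto simp: th_def)
  have "th * ga 0 <= ((1 + m) * g0 / (2 * ga 0)) * ga 0" using ga_0_pos by (intro mult_right_mono) (auto simp: th_def)
  thus "th * ga 0 <= (1 + m) / 2 * g0" using ga_0_pos by simp
 qed
 let ?c = "1 - th"
 obtain K where K: "0 < K" "!!y. hh l y powr ?c <= K * hh (?c * l) y" using powr_hh by blast
 define G where "G n = (\<E> w. gsum n (\<lambda>v. of_bool (realized A v w) * gw (?c * ga l) (hh (?c * l)) v w))" for n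
 have G: "G n <= ennreal (2 ^ n * hh (?c * l) x)" for n
 proof -
  have "G n <= ennreal (((1 + m) / ((1 + m) / 2)) ^ n * hh (?c * l) x)" unfolding G_def
  proof (rule generation_le[OF floquet_hh pot_per_lip])
   fix y
   have "ga (?c * l) <= ?c * ga l + th * ga 0" using ga_convex[of ?c th l 0] th by simp
   moreover have "th * ga 0 <= (1 + m) / 2 * g y" by (rule order_trans[OF th(3)]) (use g0 m_pos in \<open>auto intro!: mult_left_mono\<close>)
   ultimately show "(1 + m) / 2 * g y <= g y + ?c * ga l - (ga (?c * l) - m * g y)" by (simp add: field_simps)
  qed (use m_pos in simp)
  moreover have "(1 + m) / ((1 + m) / 2) = 2" using m_pos by (simp add: divide_simps)
  ultimately show ?thesis by simp
 qed
 \<comment> \<open>A weight of at most exp(- n ka) has a th-power of at most 4^-n, which beats the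
   growth 2^n.\<close>
 define ka where "ka = ln 4 / th"
 have ka: "0 < ka" "exp (- real n * ka * th) = (1/4) ^ n" for n
  using th by (auto simp: ka_def exp_of_nat_mult exp_minus power_one_over inverse_eq_divide)
 define f where "f n k = ennreal (1 + real k) * of_bool (C * exp (real n * ka) < 1 + real k)" for n k
 \<comment> \<open>A family that exceeds C exp(n ka) without being bad must carry a weight of at
   most exp(- n ka), and it is charged to the sum with exponent 1 - th.\<close>
 have pt: "of_bool (realized A v w \<and> ok exc v w) * f n (A v w) * ennreal (Yd l v w)
  <= of_bool (realized A v w \<and> ok exc v w \<and> bad exc v w) * kids v w * ennreal (Yd l v w)
   + ennreal (K * (1/4) ^ n) * (of_bool (realized A v w) * kids v w * ennreal (exp (- (?c * ga l) * death T v w) * hh (?c * l) (dp v w)))"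
  for v w n
 proof (cases "realized A v w \<and> ok exc v w \<and> \<not> bad exc v w \<and> C * exp (real n * ka) < 1 + real (A v w)")
  case True
  hence "(1 + real (A v w)) * Yd l v w <= C" by (simp add: bad_def assms(2) Yd_def not_less)
  moreover have "C * exp (real n * ka) * Yd l v w <= (1 + real (A v w)) * Yd l v w" using True Yd_pos[of l v w] by (intro mult_right_mono) auto
  ultimately have "C * (exp (real n * ka) * Yd l v w) <= C * 1" by simp
  hence "exp (real n * ka) * Yd l v w <= 1" using C by (simp only: mult_le_cancel_left_pos)
  hence "Yd l v w <= exp (- real n * ka)" by (simp add: exp_minus field_simps)
  hence "Yd l v w powr th <= exp (- real n * ka) powr th" using Yd_pos[of l v w] th by (intro powr_mono2) auto
  hence "Yd l v w powr th <= (1/4) ^ n" using ka(2)[of n] by (simp add: powr_def mult_ac)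
  moreover have "Yd l v w powr ?c <= K * (exp (- (?c * ga l) * death T v w) * hh (?c * l) (dp v w))"
   unfolding Yd_def by (rule Y_powr[OF K(2)])
  ultimately have "Yd l v w powr th * Yd l v w powr ?c <= (1/4) ^ n * (K * (exp (- (?c * ga l) * death T v w) * hh (?c * l) (dp v w)))"
   by (intro mult_mono) auto
  moreover have "Yd l v w powr th * Yd l v w powr ?c = Yd l v w" using Yd_pos[of l v w] by (simp flip: powr_add)
  ultimately have y: "Yd l v w <= K * (1/4) ^ n * (exp (- (?c * ga l) * death T v w) * hh (?c * l) (dp v w))" by (simp add: mult_ac)
  have "ennreal (Yd l v w) <= ennreal (K * (1/4) ^ n) * ennreal (exp (- (?c * ga l) * death T v w) * hh (?c * l) (dp v w))"
   using ennreal_leI[OF y] K(1) hh_nonneg by (subst ennreal_mult[symmetric]) auto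
  from mult_left_mono[OF this, of "kids v w"] show ?thesis using True by (simp add: f_def ac_simps del: ennreal_plus)
 qed (auto simp: f_def of_bool_def)
 show ?thesis
 proof (rule that[OF ka(1), of "(1 + m) * (K * (2 * hh (?c * l) x))"])
  show "0 <= (1 + m) * (K * (2 * hh (?c * l) x))" using m_pos K(1) hh_nonneg by simp
  fix n
  have "(\<E> w. gsum n (\<lambda>v. of_bool (realized A v w \<and> ok exc v w) * f n (A v w) * ennreal (Yd l v w)))
   <= (\<E> w. loss exc l n w + ennreal (K * (1/4) ^ n) * gsum (Suc n) (\<lambda>v. of_bool (realized A v w) * gw (?c * ga l) (hh (?c * l)) v w))"
   unfolding gsum_realized_Suc loss_def gsum_cmult[symmetric] gsum_add[symmetric] by (intro nn_integral_mono gsum_mono pt)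
  also have "... = (\<E> w. loss exc l n w) + ennreal (K * (1/4) ^ n) * G (Suc n)"
  proof -
   have [measurable]: "(\<lambda>w. gsum (Suc n) (\<lambda>v. of_bool (realized A v w) * gw (?c * ga l) (hh (?c * l)) v w)) \<in> bm M"
    unfolding gw_def by (rule gsum_measurable) measurable
   show ?thesis unfolding G_def by (subst nn_integral_add; simp add: nn_integral_cmult)
  qed
  also have "... <= (\<E> w. loss exc l n w) + ennreal (K * (1/4) ^ n) * ennreal (2 ^ Suc n * hh (?c * l) x)"
   by (intro add_left_mono mult_left_mono G) simp
  also have "... = (\<E> w. loss exc l n w) + ennreal (K * (2 * hh (?c * l) x) * (1/2) ^ n)"
  proof -
   have "(1/4 :: real) ^ n * 2 ^ n = (1/2) ^ n" by (simp flip: power_mult_distrib)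
   hence "K * (1/4) ^ n * (2 ^ Suc n * hh (?c * l) x) = K * (2 * hh (?c * l) x) * (1/2) ^ n" by (simp add: ac_simps)
   thus ?thesis using K(1) hh_nonneg by (subst ennreal_mult[symmetric]) auto
  qed
  finally have "ennreal (1 + m) * (\<E> w. gsum n (\<lambda>v. of_bool (realized A v w \<and> ok exc v w) * f n (A v w) * ennreal (Yd l v w)))
   <= ennreal (1 + m) * ..." by (rule mult_left_mono) simp
  also have "... = ennreal (1 + m) * (\<E> w. loss exc l n w) + ennreal ((1 + m) * (K * (2 * hh (?c * l) x)) * (1/2) ^ n)"
   unfolding distrib_left mult.assoc[of "1 + m"] using m_pos K(1) hh_nonneg by (subst ennreal_mult[symmetric]) auto
  finally show "(\<integral>\<^sup>+k. ennreal (1 + real k) * of_bool (C * exp (real n * ka) < 1 + real k) \<partial>measure_pmf p) * (\<E> w. Vt exc l n w)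
   <= ennreal (1 + m) * (\<E> w. loss exc l n w) + ennreal ((1 + m) * (K * (2 * hh (?c * l) x)) * (1/2) ^ n)"
   unfolding Vt_marked[OF exc] unfolding f_def .
 qed
qed

lemma W_zero_LlogL:
 assumes inf: "E_LlogL p = \<infinity>" and W: "W \<in> bm M" "AE w in M. ((\<lambda>t. aw l t w) \<longlongrightarrow> W w) at_top"
 shows "AE w in M. W w = 0"
proof (rule W_zero_truncated[OF W])
 fix C :: real assume C: "0 < C"
 define exc :: "nat => nat => real => real => bool" where "exc = (\<lambda>k a d y. C < (1 + real a) * (exp (- ga l * d) * hh l y))"
 have exc: "excm exc" unfolding excm_def exc_def by (intro allI) measurable
 obtain ka K where ka: "0 < ka" "0 <= K" and
  b: "!!n. (\<integral>\<^sup>+k. ennreal (1 + real k) * of_bool (C * exp (real n * ka) < 1 + real k) \<partial>measure_pmf p) * (\<E> w. Vt exc l n w)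
   <= ennreal (1 + m) * (\<E> w. loss exc l n w) + ennreal (K * (1/2) ^ n)"
  by (rule loss_lower[OF C exc_def]) (rule that; assumption)
 define F where "F n = (\<integral>\<^sup>+k. ennreal (1 + real k) * of_bool (C * exp (real n * ka) < 1 + real k) \<partial>measure_pmf p)" for n
 define X where "X n = (\<E> w. Vt exc l n w)" for n
 have "E_LlogL p <= (\<integral>\<^sup>+k. ennreal ka * (\<Sum>n. ennreal (1 + real k) * of_bool (C * exp (real n * ka) < 1 + real k)) + ennreal \<bar>ln C\<bar> * ennreal (1 + real k) \<partial>measure_pmf p)"
  unfolding E_LlogL_def by (intro nn_integral_mono LlogL_lower ka C)
 also have "... = ennreal ka * (\<Sum>n. F n) + ennreal \<bar>ln C\<bar> * ennreal (1 + m)"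
  unfolding F_def by (subst nn_integral_add, simp, simp) (simp add: nn_integral_cmult nn_integral_suminf[symmetric] offspring_mean del: ennreal_plus)
 finally have F: "(\<Sum>n. F n) = \<infinity>" using inf ka by (auto simp: top_unique ennreal_mult_eq_top_iff ennreal_mult[symmetric] simp del: ennreal_plus)
 have "X (Suc n) <= X n" for n unfolding X_def Vt_mean_step[OF exc, of l n, symmetric] by simp
 hence dec: "decseq X" by (rule decseq_SucI)
 have "(\<Sum>n. F n * X n) <= (\<Sum>n. ennreal (1 + m) * (\<E> w. loss exc l n w) + ennreal (K * (1/2) ^ n))"
  unfolding F_def X_def by (intro suminf_le b) auto
 also have "... = ennreal (1 + m) * (\<Sum>n. \<E> w. loss exc l n w) + (\<Sum>n. ennreal (K * (1/2) ^ n))"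
  by (subst suminf_add[symmetric]) auto
 also have "... < \<infinity>"
 proof -
  have "(\<Sum>k<n. \<E> w. loss exc l k w) <= ennreal (hh l x)" for n
   unfolding Vt_mean_sum[OF exc, of l n, symmetric] by (simp add: add_increasing)
  hence "(\<Sum>n. \<E> w. loss exc l n w) <= ennreal (hh l x)" by (intro suminf_le_const) auto
  hence "(\<Sum>n. \<E> w. loss exc l n w) < \<infinity>" by (simp add: order_le_less_trans)
  hence "ennreal (1 + m) * (\<Sum>n. \<E> w. loss exc l n w) < \<infinity>" by (simp add: ennreal_mult_less_top del: ennreal_plus)
  moreover have "(\<Sum>n. ennreal (K * (1/2) ^ n)) < \<infinity>"
   using ka(2) by (subst suminf_ennreal2) (auto intro!: summable_mult)
  ultimately show ?thesis by simp
 qed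
 finally have fin: "(\<Sum>n. F n * X n) < \<infinity>" .
 \<comment> \<open>The series of \<open>F n\<close> diverges and \<open>X\<close> decreases, so the
   finite series of products forces the limit of \<open>X\<close> to be 0.\<close>
 have "(INF n. X n) = 0"
 proof (rule ccontr)
  assume nz: "(INF n. X n) ~= 0"
  have "(\<Sum>n. F n) * (INF n. X n) = (\<Sum>n. F n * (INF n. X n))" by simp
  also have "... <= (\<Sum>n. F n * X n)" by (intro suminf_le mult_left_mono INF_lower) auto
  finally show False using fin nz F by (simp add: ennreal_top_mult top_unique)
 qed
 hence "X \<longlonglongrightarrow> 0" using LIMSEQ_INF[OF dec] by simp
 thus "\<exists>exc. excm exc \<and>
   (\<forall>v w. bad exc v w --> C <= (1 + real (A v w)) * Yd l v w) \<and> (\<lambda>n. \<E> w. Vt exc l n w) \<longlonglongrightarrow> 0"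
  using exc unfolding X_def by (intro exI[of _ exc]) (auto simp: bad_def Yd_def exc_def)
qed

end

section \<open>Second moments below criticality\<close>

lemma ennreal_le_min_square:
 fixes y :: ennreal
 assumes C: "0 < C" shows "y <= min y (ennreal C) + ennreal (1 / C) * (y * y)"
proof (cases "y <= ennreal C")
 case False
 hence "ennreal C <= y" by simp
 hence "ennreal (1 / C) * (ennreal C * y) <= ennreal (1 / C) * (y * y)" by (intro mult_left_mono mult_right_mono) auto
 moreover have "ennreal (1 / C) * (ennreal C * y) = y" using C by (simp add: mult.assoc[symmetric] ennreal_mult[symmetric])
 ultimately show ?thesis by (simp add: add_increasing)
qed (simp add: min_def add_increasing2)

context bbm_full begin

lemma gsum_single: "length v = n ==> gsum n (\<lambda>wt. of_bool (v = wt) * c) = c"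
proof -
 assume "length v = n"
 hence "gsum n (\<lambda>wt. c * indicator {v} wt) = c"
  unfolding gsum_def by (subst nn_integral_cmult_indicator) (auto simp: emeasure_count_space)
 moreover have "(\<lambda>wt. of_bool (v = wt) * c) = (\<lambda>wt. c * indicator {v} wt)" by (auto simp: indicator_def)
 ultimately show ?thesis by simp
qed

lemma Yd_SO: "v \<notin> ancs wt ==> v ~= wt ==> Yd l wt \<in> bm (SO v)"
 and Yb_SO: "v \<notin> ancs wt ==> Yb l wt \<in> bm (SO v)"
proof -
 assume "v \<notin> ancs wt"
 note [measurable] = SO_birth[OF this]
 show "Yb l wt \<in> bm (SO v)" unfolding Yb_def[abs_def] by measurable
next
 assume "v \<notin> ancs wt" "v ~= wt"
 note [measurable] = SO_T[OF this]
 show "Yd l wt \<in> bm (SO v)" unfolding Yd_def[abs_def] by measurable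
qed

text \<open>Distinct labels of one generation are not ancestors of each other, so the two families
  can be replaced by their means one after the other, and deletion only lowers the product. Thus
  only diagonal terms add to the second moment, and the deletion rule bounds them by
  \<open>D n\<close> times the mean.\<close>

lemma Vt_second_moment:
 assumes exc: "excm exc"
  and D: "!!v w. \<not> bad exc v w ==> (1 + real (A v w)) * Yd l v w <= D (length v)" "!!n. 0 <= D n"
 shows "(\<E> w. Vt exc l n w * Vt exc l n w) <= ennreal (hh l x * hh l x + (\<Sum>k<n. D k) * hh l x)"
proof (induction n)
 case 0
 show ?case using hh_nonneg by (simp add: Vt_def gsum_0 Yb_def emeasure_space_1 ennreal_mult)
next
 case (Suc n)
 note [measurable] = exc_measurable[OF exc]
 define b where "b v w = (of_bool (realized A v w \<and> ok exc v w) :: ennreal)" for v w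
 define a where "a v w = kids v w" for v w
 define c where "c v w = b v w * of_bool (\<not> bad exc v w) * a v w * ennreal (Yd l v w)" for v w
 have bS: "b wt \<in> bm (SO v)" if "v \<notin> ancs wt" for v wt
  unfolding b_def[abs_def] using ok_SO[OF exc that] by measurable
 have [measurable]: "a v \<in> bm M" "b v \<in> bm M" "c v \<in> bm M" for v
  unfolding a_def[abs_def] b_def[abs_def] c_def[abs_def] by measurable
 have V: "Vt exc l n w = gsum n (\<lambda>v. b v w * ennreal (Yb l v w))" for w unfolding Vt_def b_def ..
 have V': "Vt exc l (Suc n) w = gsum n (\<lambda>v. c v w)" for w
  unfolding Vg_Suc[OF exc] by (rule gsum_cong) (auto simp: c_def b_def a_def Yd_def of_bool_def)
 have one: "(\<E> w. Z w * a v w * ennreal (Yd l v w)) = (\<E> w. Z w * ennreal (Yb l v w))" if "Z \<in> bm (SO v)" for Z v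
  unfolding a_def by (rule one_step_child[OF that])
 have sq: "gsum n F * gsum n F = gsum n (\<lambda>v. gsum n (\<lambda>wt. F v * F wt))" for F
 proof -
  have "gsum n F * gsum n F = gsum n (\<lambda>v. gsum n F * F v)" by (rule gsum_cmult[symmetric])
  also have "... = gsum n (\<lambda>v. F v * gsum n F)" by (simp only: mult.commute)
  finally show ?thesis unfolding gsum_cmult .
 qed
 have I: "(\<E> w. gsum n (\<lambda>v. F v w) * gsum n (\<lambda>v. F v w)) = gsum n (\<lambda>v. gsum n (\<lambda>wt. \<E> w. F v w * F wt w))"
  if [measurable]: "!!v. F v \<in> bm M" for F
  unfolding sq by (subst nn_integral_gsum, rule gsum_measurable, measurable, subst nn_integral_gsum, measurable)
 have pair: "(\<E> w. c v w * c wt w) <= (\<E> w. (b v w * ennreal (Yb l v w)) * (b wt w * ennreal (Yb l wt w)))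
   + of_bool (v = wt) * (ennreal (D n) * (\<E> w. b v w * ennreal (Yb l v w)))"
  if len: "length v = n" "length wt = n" for v wt
 proof (cases "v = wt")
  case True
  have "(\<E> w. c v w * c v w) <= (\<E> w. ennreal (D n) * (b v w * a v w * ennreal (Yd l v w)))"
  proof (rule nn_integral_mono)
   fix w
   have "c v w <= ennreal (D n)"
   proof (cases "bad exc v w")
    case False
    from ennreal_leI[OF D(1)[OF False]] show ?thesis
     unfolding c_def b_def a_def len using Yd_pos[of l v w]
     by (auto simp: of_bool_def ennreal_mult[symmetric] less_imp_le simp del: ennreal_plus)
   qed (simp add: c_def)
   moreover have "c v w <= b v w * a v w * ennreal (Yd l v w)" by (auto simp: c_def of_bool_def)
   ultimately show "c v w * c v w <= ennreal (D n) * (b v w * a v w * ennreal (Yd l v w))" by (intro mult_mono) auto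
  qed
  also have "... = ennreal (D n) * (\<E> w. b v w * ennreal (Yb l v w))"
   by (subst nn_integral_cmult, measurable) (simp only: one[OF bS[OF not_ancs_self]])
  finally show ?thesis using True by (simp add: add_increasing)
 next
  case False
  have an: "v \<notin> ancs wt" "wt \<notin> ancs v" using ancs_length len by fastforce+
  have aw: "a wt \<in> bm (SO v)" unfolding a_def[abs_def] by (rule measurable_compose[OF SO_T(4)[OF an(1) False]]) simp
  have "(\<E> w. c v w * c wt w) <= (\<E> w. (b v w * (b wt w * a wt w * ennreal (Yd l wt w))) * a v w * ennreal (Yd l v w))"
   by (rule nn_integral_mono) (auto simp: c_def of_bool_def ac_simps)
  also have "... = (\<E> w. (b v w * (b wt w * a wt w * ennreal (Yd l wt w))) * ennreal (Yb l v w))"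
   by (rule one) (use bS[OF not_ancs_self, of v] bS[OF an(1)] aw Yd_SO[OF an(1) False, of l] in measurable)
  also have "... = (\<E> w. (b v w * b wt w * ennreal (Yb l v w)) * a wt w * ennreal (Yd l wt w))"
   by (simp only: ac_simps)
  also have "... = (\<E> w. (b v w * b wt w * ennreal (Yb l v w)) * ennreal (Yb l wt w))"
   by (rule one) (use bS[OF not_ancs_self, of wt] bS[OF an(2)] Yb_SO[OF an(2), of l] in measurable)
  also have "... = (\<E> w. (b v w * ennreal (Yb l v w)) * (b wt w * ennreal (Yb l wt w)))"
   by (simp only: ac_simps)
  finally show ?thesis using False by simp
 qed
 have "(\<E> w. Vt exc l (Suc n) w * Vt exc l (Suc n) w) = gsum n (\<lambda>v. gsum n (\<lambda>wt. \<E> w. c v w * c wt w))"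
  unfolding V' by (rule I) measurable
 also have "... <= gsum n (\<lambda>v. gsum n (\<lambda>wt. (\<E> w. (b v w * ennreal (Yb l v w)) * (b wt w * ennreal (Yb l wt w)))
   + of_bool (v = wt) * (ennreal (D n) * (\<E> w. b v w * ennreal (Yb l v w)))))"
  by (intro gsum_mono pair)
 also have "... = gsum n (\<lambda>v. gsum n (\<lambda>wt. \<E> w. (b v w * ennreal (Yb l v w)) * (b wt w * ennreal (Yb l wt w))))
   + gsum n (\<lambda>v. ennreal (D n) * (\<E> w. b v w * ennreal (Yb l v w)))"
  unfolding gsum_add by (rule arg_cong2[of _ _ _ _ "(+)"]) (auto intro!: gsum_cong gsum_single)
 also have "... = (\<E> w. Vt exc l n w * Vt exc l n w) + ennreal (D n) * (\<E> w. Vt exc l n w)"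
  unfolding V by (subst I, measurable, subst nn_integral_gsum, measurable) (simp only: gsum_cmult)
 also have "... <= ennreal (hh l x * hh l x + (\<Sum>k<n. D k) * hh l x) + ennreal (D n) * ennreal (hh l x)"
 proof (intro add_mono mult_left_mono Suc.IH)
  show "(\<E> w. Vt exc l n w) <= ennreal (hh l x)" unfolding Vt_mean_sum[OF exc, of l n, symmetric] by simp
 qed simp
 also have "... = ennreal (hh l x * hh l x + (\<Sum>k<Suc n. D k) * hh l x)"
  using D(2) hh_nonneg by (simp add: ennreal_mult[symmetric] ennreal_plus[symmetric] sum_nonneg algebra_simps del: ennreal_plus)
 finally show ?case .
qed

lemma W_mean_ge:
 assumes sub: "\<bar>l\<bar> < lstar" and LL: "E_LlogL p < \<infinity>"
  and W: "W \<in> bm M" "AE w in M. ((\<lambda>t. aw l t w) \<longlongrightarrow> W w) at_top"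
 shows "ennreal (hh l x) <= (\<E> w. ennreal (W w))"
proof -
 obtain et where et: "0 < et" "ga ((1 + et) * l) < (1 + et) * ga l" using subcritical[OF sub] by blast
 let ?c = "1 + et"
 obtain K1 where K1: "0 < K1" "!!y. hh l y powr ?c <= K1 * hh (?c * l) y" using powr_hh by blast
 obtain rh where rh: "0 < rh" "rh < 1"
  "!!n. (\<E> w. gsum n (\<lambda>v. of_bool (realized A v w) * gw (?c * ga l) (hh (?c * l)) v w)) <= ennreal (rh ^ n * hh (?c * l) x)"
  by (rule generation_decay[OF floquet_hh et(2)]) (rule that; assumption)
 \<comment> \<open>The decay rate \<open>rh\<close> of the moments of order 1 + et is shared: one
   factor r lets the weight threshold shrink with the generation, the other remains for summing the
   losses. Then \<open>s\<close> > 1 is chosen so that family size times weight still decays, at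
   rate \<open>s * r powr (1 / et) = q\<close> < 1.\<close>
 define r where "r = sqrt rh"
 have r: "0 < r" "r < 1" "r * r = rh" using rh by (auto simp: r_def)
 define s where "s = r powr (- (1 / (2 * et)))"
 define q where "q = r powr (1 / (2 * et))"
 have "1 / (2 * et) * ln r < 0" using r et by (intro mult_pos_neg) auto
 hence s: "1 < s" and q: "0 < q" "q < 1" using r by (auto simp: s_def q_def powr_def)
 have sq: "s * r powr (1 / et) = q" unfolding s_def q_def using r et by (simp flip: powr_add)
 \<comment> \<open>The power of r is \<open>Suc k\<close> because the weight at the death of a
   particle of generation k is a birth weight of generation k + 1.\<close>
 define exc where "exc K = (\<lambda>k a d y. K * s ^ k < 1 + real (a :: nat) \<or> K * r ^ Suc k < (exp (- ga l * d) * hh l y) powr et)" for K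
 have exc: "excm (exc K)" for K unfolding excm_def exc_def by (intro allI) measurable
 define F where "F K n k = ennreal (1 + real k) * of_bool (K * s ^ n < 1 + real k)" for K n k
 have loss: "(\<E> w. loss (exc K) l n w) <= ennreal (hh l x) * (\<integral>\<^sup>+k. F K n k \<partial>measure_pmf p) + ennreal (K1 * hh (?c * l) x / K * r ^ n)"
  if K: "0 < K" for K n
 proof -
  note [measurable] = exc_measurable[OF exc[of K]]
  have FA[measurable]: "(\<lambda>w. F K n (A v w)) \<in> bm M" for v by (rule measurable_compose[OF A_measurable]) simp
  let ?b = "\<lambda>v w. of_bool (realized A v w \<and> ok (exc K) v w) :: ennreal"
  let ?G = "\<lambda>w. gsum (Suc n) (\<lambda>v. of_bool (realized A v w) * gw (?c * ga l) (hh (?c * l)) v w)"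
  have Gm[measurable]: "?G \<in> bm M" unfolding gw_def by (rule gsum_measurable) measurable
  have pt: "of_bool (realized A v w \<and> ok (exc K) v w \<and> bad (exc K) v w) * kids v w * ennreal (Yd l v w)
   <= ?b v w * F K n (A v w) * ennreal (Yd l v w)
    + ennreal (K1 / (K * r ^ Suc n)) * (of_bool (realized A v w) * kids v w * ennreal (exp (- (?c * ga l) * death T v w) * hh (?c * l) (dp v w)))"
   if len: "length v = n" for v w
  proof (cases "realized A v w \<and> ok (exc K) v w \<and> bad (exc K) v w \<and> \<not> K * s ^ n < 1 + real (A v w)")
   case True
   hence "K * r ^ Suc n <= Yd l v w powr et" by (auto simp: bad_def exc_def Yd_def len)
   hence "Yd l v w * (K * r ^ Suc n) <= Yd l v w * Yd l v w powr et" using Yd_pos[of l v w] by (intro mult_left_mono) auto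
   also have "... = Yd l v w powr ?c" using Yd_pos[of l v w] by (simp add: powr_add)
   also have "... <= K1 * (exp (- (?c * ga l) * death T v w) * hh (?c * l) (dp v w))" unfolding Yd_def by (rule Y_powr[OF K1(2)])
   finally have y: "Yd l v w <= K1 / (K * r ^ Suc n) * (exp (- (?c * ga l) * death T v w) * hh (?c * l) (dp v w))"
    using K r by (simp add: pos_le_divide_eq)
   have "ennreal (Yd l v w) <= ennreal (K1 / (K * r ^ Suc n)) * ennreal (exp (- (?c * ga l) * death T v w) * hh (?c * l) (dp v w))"
    using ennreal_leI[OF y] K K1(1) r hh_nonneg by (subst ennreal_mult[symmetric]) auto
   from mult_left_mono[OF this, of "kids v w"] show ?thesis using True by (simp add: F_def ac_simps del: ennreal_plus power_Suc)
  qed (auto simp: F_def of_bool_def)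
  have "(\<E> w. loss (exc K) l n w)
   <= (\<E> w. gsum n (\<lambda>v. ?b v w * F K n (A v w) * ennreal (Yd l v w)) + ennreal (K1 / (K * r ^ Suc n)) * ?G w)"
   unfolding gsum_realized_Suc loss_def gsum_cmult[symmetric] gsum_add[symmetric] by (intro nn_integral_mono gsum_mono pt)
  also have "... = (\<E> w. gsum n (\<lambda>v. ?b v w * F K n (A v w) * ennreal (Yd l v w))) + ennreal (K1 / (K * r ^ Suc n)) * (\<E> w. ?G w)"
   by (subst nn_integral_add, rule gsum_measurable, measurable, subst nn_integral_cmult, measurable)
  also have "... <= ennreal (hh l x) * (\<integral>\<^sup>+k. F K n k \<partial>measure_pmf p) + ennreal (K1 / (K * r ^ Suc n)) * ennreal (rh ^ Suc n * hh (?c * l) x)"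
  proof (rule add_mono[OF _ mult_left_mono[OF rh(3)]])
   let ?J = "\<E> w. gsum n (\<lambda>v. ?b v w * F K n (A v w) * ennreal (Yd l v w))"
   have "1 * ?J <= ennreal (1 + m) * ?J" using m_pos by (intro mult_right_mono) auto
   also have "... <= (\<integral>\<^sup>+k. F K n k \<partial>measure_pmf p) * ennreal (hh l x)"
    unfolding Vt_marked[OF exc] Vt_mean_sum[OF exc[of K], of l n, symmetric] by (intro mult_left_mono) auto
   finally show "?J <= ennreal (hh l x) * (\<integral>\<^sup>+k. F K n k \<partial>measure_pmf p)" by (simp add: mult.commute)
  qed simp
  also have "ennreal (K1 / (K * r ^ Suc n)) * ennreal (rh ^ Suc n * hh (?c * l) x) = ennreal (K1 * hh (?c * l) x / K * r ^ Suc n)"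
   using K K1(1) r rh hh_nonneg by (subst ennreal_mult[symmetric]) (auto simp: r(3)[symmetric] power_mult_distrib field_simps)
  also have "... <= ennreal (K1 * hh (?c * l) x / K * r ^ n)"
   using K K1(1) r hh_nonneg by (intro ennreal_leI mult_left_mono) (auto simp: mult_le_cancel_right1)
  finally show ?thesis by (simp add: add_left_mono)
 qed
 \<comment> \<open>Summed over n, the part of the loss due to large families is dominated by k log k
   and multiples of 1 + k; raising the threshold K makes it vanish by dominated convergence.\<close>
 define U where "U j k = (\<Sum>n. F (real (Suc j)) n k)" for j k
 have U: "(\<lambda>j. \<integral>\<^sup>+k. U j k \<partial>measure_pmf p) \<longlonglongrightarrow> (\<integral>\<^sup>+k. 0 \<partial>measure_pmf p)"
 proof (rule nn_integral_dominated_convergence[where w = "U 0"])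
  have "(\<integral>\<^sup>+k. U 0 k \<partial>measure_pmf p) <= (\<integral>\<^sup>+k. ennreal (2 / ln s) * ennreal (real k * log_plus (real k)) + ennreal (1 + ln 2 / ln s) * ennreal (1 + real k) \<partial>measure_pmf p)"
   unfolding U_def F_def using LlogL_upper[OF s] by (intro nn_integral_mono) simp
  also have "... = ennreal (2 / ln s) * E_LlogL p + ennreal (1 + ln 2 / ln s) * ennreal (1 + m)"
   unfolding E_LlogL_def by (subst nn_integral_add, simp, simp) (simp add: nn_integral_cmult offspring_mean del: ennreal_plus)
  also have "... < \<infinity>" using LL by (simp add: ennreal_mult_less_top del: ennreal_plus)
  finally show "(\<integral>\<^sup>+k. U 0 k \<partial>measure_pmf p) < \<infinity>" .
  have "1 * s ^ n <= real (Suc j) * s ^ n" for j n using s by (intro mult_right_mono) auto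
  thus "AE k in measure_pmf p. U j k <= U 0 k" for j
   unfolding U_def F_def by (intro AE_I2 suminf_le mult_left_mono) (auto simp: of_bool_def intro: order_le_less_trans)
  show "AE k in measure_pmf p. (\<lambda>j. U j k) \<longlonglongrightarrow> 0"
  proof (rule AE_I2)
   fix k
   have "U j k = 0" if j: "k <= j" for j
   proof -
    have "\<not> real (Suc j) * s ^ n < 1 + real k" for n
     using mult_mono[of "1 + real k" "real (Suc j)" 1 "s ^ n"] s j by (simp add: one_le_power not_less)
    thus ?thesis unfolding U_def F_def by (simp del: of_nat_Suc)
   qed
   hence "\<forall>\<^sub>F j in sequentially. U j k = 0" unfolding eventually_sequentially by blast
   thus "(\<lambda>j. U j k) \<longlonglongrightarrow> 0" by (rule tendsto_eventually)
  qed
 qed (auto simp: U_def)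
 have small: "\<exists>j. (\<Sum>n. \<E> w. loss (exc (real (Suc j))) l n w) < ennreal e" if e: "0 < e" for e
 proof -
  let ?b = "\<lambda>j. ennreal (hh l x) * (\<integral>\<^sup>+k. U j k \<partial>measure_pmf p) + ennreal (K1 * hh (?c * l) x / real (Suc j) * (1 / (1 - r)))"
  have b: "(\<Sum>n. \<E> w. loss (exc (real (Suc j))) l n w) <= ?b j" for j
  proof -
   have "(\<Sum>n. \<E> w. loss (exc (real (Suc j))) l n w)
    <= (\<Sum>n. ennreal (hh l x) * (\<integral>\<^sup>+k. F (real (Suc j)) n k \<partial>measure_pmf p) + ennreal (K1 * hh (?c * l) x / real (Suc j) * r ^ n))"
    by (intro suminf_le loss) auto
   also have "... = ennreal (hh l x) * (\<Sum>n. \<integral>\<^sup>+k. F (real (Suc j)) n k \<partial>measure_pmf p) + (\<Sum>n. ennreal (K1 * hh (?c * l) x / real (Suc j) * r ^ n))"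
    by (subst suminf_add[symmetric]) auto
   also have "(\<Sum>n. ennreal (K1 * hh (?c * l) x / real (Suc j) * r ^ n)) = ennreal (K1 * hh (?c * l) x / real (Suc j) * (1 / (1 - r)))"
   proof (rule suminf_ennreal_eq)
    show "(\<lambda>n. K1 * hh (?c * l) x / real (Suc j) * r ^ n) sums (K1 * hh (?c * l) x / real (Suc j) * (1 / (1 - r)))"
     by (intro sums_mult geometric_sums) (use r in auto)
   qed (use r K1(1) hh_nonneg in auto)
   also have "(\<Sum>n. \<integral>\<^sup>+k. F (real (Suc j)) n k \<partial>measure_pmf p) = (\<integral>\<^sup>+k. U j k \<partial>measure_pmf p)"
    unfolding U_def by (rule nn_integral_suminf[symmetric]) simp
   finally show ?thesis .
  qed
  have "?b \<longlonglongrightarrow> ennreal (hh l x) * (\<integral>\<^sup>+k. 0 \<partial>measure_pmf p) + ennreal (K1 * hh (?c * l) x * 0 * (1 / (1 - r)))"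
   unfolding divide_inverse[of _ "real (Suc _)"]
   by (intro tendsto_add ennreal_tendsto_cmult U tendsto_ennrealI tendsto_mult tendsto_const LIMSEQ_inverse_real_of_nat) auto
  hence "?b \<longlonglongrightarrow> 0" by simp
  hence "\<forall>\<^sub>F j in sequentially. ?b j < ennreal e" using order_tendstoD(2)[of ?b 0 sequentially "ennreal e"] e by simp
  then obtain j where "?b j < ennreal e" unfolding eventually_sequentially by blast
  thus ?thesis using order_le_less_trans[OF b] by blast
 qed
 show ?thesis
 proof (rule ennreal_le_epsilon)
  fix e :: real assume e: "0 < e"
  obtain j where j: "(\<Sum>n. \<E> w. loss (exc (real (Suc j))) l n w) < ennreal (e / 2)" using small[of "e / 2"] e by auto
  define K where "K = real (Suc j)"
  have K: "0 < K" by (simp add: K_def)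
  note [measurable] = exc_measurable[OF exc[of K]]
  define D where "D n = K * (K * r) powr (1 / et) * q ^ n" for n
  have D0: "0 <= D n" for n using K q by (simp add: D_def)
  have Db: "(1 + real (A v w)) * Yd l v w <= D (length v)" if nb: "\<not> bad (exc K) v w" for v w
  proof -
   let ?n = "length v"
   have a: "1 + real (A v w) <= K * s ^ ?n" and "Yd l v w powr et <= K * r ^ Suc ?n"
    using nb by (auto simp: bad_def exc_def Yd_def not_less)
   hence "(Yd l v w powr et) powr (1 / et) <= (K * r ^ Suc ?n) powr (1 / et)" using et by (intro powr_mono2) auto
   hence y: "Yd l v w <= (K * r ^ Suc ?n) powr (1 / et)" using et Yd_pos[of l v w] by (simp add: powr_powr)
   have "(r ^ ?n) powr (1 / et) = (r powr (1 / et)) ^ ?n" using r by (simp add: powr_realpow[symmetric] powr_powr mult.commute)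
   hence p: "(K * r ^ Suc ?n) powr (1 / et) = (K * r) powr (1 / et) * (r powr (1 / et)) ^ ?n"
    using K r by (simp add: powr_mult)
   have "(1 + real (A v w)) * Yd l v w <= (K * s ^ ?n) * ((K * r) powr (1 / et) * (r powr (1 / et)) ^ ?n)"
    unfolding p[symmetric] using a y Yd_pos[of l v w] K s by (intro mult_mono) auto
   also have "... = D ?n" unfolding D_def sq[symmetric] by (simp add: power_mult_distrib)
   finally show ?thesis .
  qed
  define S where "S = hh l x * hh l x + K * (K * r) powr (1 / et) * (1 / (1 - q)) * hh l x"
  have S: "(\<E> w. Vt (exc K) l n w * Vt (exc K) l n w) <= ennreal S" for n
  proof (rule order_trans[OF Vt_second_moment[OF exc Db D0]])
   have "(\<Sum>k<n. q ^ k) <= 1 / (1 - q)" using sum_le_suminf[of "\<lambda>k. q ^ k" "{..<n}"] q by (simp add: suminf_geometric)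
   hence "(\<Sum>k<n. D k) <= K * (K * r) powr (1 / et) * (1 / (1 - q))"
    unfolding D_def sum_distrib_left[symmetric] using K by (intro mult_left_mono) auto
   thus "ennreal (hh l x * hh l x + (\<Sum>k<n. D k) * hh l x) <= ennreal S"
    unfolding S_def using hh_nonneg by (intro ennreal_leI add_left_mono mult_right_mono) auto
  qed
  have S0: "0 <= S" unfolding S_def using hh_nonneg K q by auto
  \<comment> \<open>With this level the second-moment term S / C is at most e / 2; the other half of
    e pays for the deleted mass.\<close>
  define C where "C = 2 * (S + 1) / e"
  have C: "0 < C" "S / C <= e / 2" using S0 e by (auto simp: C_def field_simps)
  have VV: "ennreal (hh l x) <= (\<E> w. min (VV l n w) (ennreal C)) + ennreal e" for n
  proof -
   have "ennreal (hh l x) = (\<E> w. Vt (exc K) l n w) + (\<Sum>k<n. \<E> w. loss (exc K) l k w)"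
    by (rule Vt_mean_sum[OF exc, symmetric])
   also have "... <= (\<E> w. min (VV l n w) (ennreal C) + ennreal (1 / C) * (Vt (exc K) l n w * Vt (exc K) l n w)) + ennreal (e / 2)"
   proof (rule add_mono)
    have "Vt (exc K) l n w <= VV l n w" for w unfolding Vt_def VV_def by (rule gsum_mono) (auto simp: of_bool_def)
    thus "(\<E> w. Vt (exc K) l n w) <= (\<E> w. min (VV l n w) (ennreal C) + ennreal (1 / C) * (Vt (exc K) l n w * Vt (exc K) l n w))"
     by (intro nn_integral_mono order_trans[OF ennreal_le_min_square[OF C(1)] add_right_mono[OF min.mono[OF _ order_refl]]])
    have "(\<Sum>k<n. \<E> w. loss (exc K) l k w) <= (\<Sum>k. \<E> w. loss (exc K) l k w)" by (rule sum_le_suminf) auto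
    thus "(\<Sum>k<n. \<E> w. loss (exc K) l k w) <= ennreal (e / 2)" using j unfolding K_def by simp
   qed
   also have "... = (\<E> w. min (VV l n w) (ennreal C)) + ennreal (1 / C) * (\<E> w. Vt (exc K) l n w * Vt (exc K) l n w) + ennreal (e / 2)"
    by (subst nn_integral_add) (auto simp: nn_integral_cmult)
   also have "... <= (\<E> w. min (VV l n w) (ennreal C)) + ennreal (1 / C) * ennreal S + ennreal (e / 2)"
    by (intro add_mono order_refl mult_left_mono S) simp
   also have "ennreal (1 / C) * ennreal S = ennreal (S / C)" using C S0 by (subst ennreal_mult[symmetric]) auto
   also have "(\<E> w. min (VV l n w) (ennreal C)) + ennreal (S / C) + ennreal (e / 2) <= (\<E> w. min (VV l n w) (ennreal C)) + ennreal (e / 2) + ennreal (e / 2)"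
    by (intro add_mono order_refl ennreal_leI C)
   also have "... = (\<E> w. min (VV l n w) (ennreal C)) + ennreal e" using e by (simp add: add.assoc flip: ennreal_plus)
   finally show ?thesis .
  qed
  hence "ennreal (hh l x) - ennreal e <= (\<E> w. min (VV l n w) (ennreal C))" for n
   by (simp add: ennreal_minus_le_iff add.commute)
  hence "ennreal (hh l x) - ennreal e <= (\<E> w. min (WW l (real i) w) (ennreal C))" for i by (intro WW_min_ge_VV) auto
  hence "ennreal (hh l x) - ennreal e <= (\<E> w. min (ennreal (W w)) (ennreal C))"
   by (intro LIMSEQ_le_const[OF W_min_tendsto[OF W]]) auto
  also have "... <= (\<E> w. ennreal (W w))" by (rule nn_integral_mono) simp
  finally show "ennreal (hh l x) <= (\<E> w. ennreal (W w)) + ennreal e" by (simp add: ennreal_minus_le_iff add.commute)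
 qed
qed

end

section \<open>The critical case\<close>

text \<open>X, P and Q stand for the untilted mass and for its small and large tilt, and x, p, q for
  their losses. The combination F = X + Q - P is nonnegative and drops by at least a / 2 times P in
  each step, so P is summable and tends to 0; then X <= F + P gives the bound. It is useful when P
  starts close to X and Q starts small.\<close>

lemma critical_sequences:
 fixes X P Q x p q :: "nat => real"
 assumes X: "!!n. X (Suc n) + x n = X n" and P: "!!n. (1 + a) * P n <= P (Suc n) + p n"
  and Q: "!!n. Q (Suc n) + q n <= (1 + b) * Q n" and pq: "!!n. p n <= x n + q n" and PQ: "!!n. P n <= X n + Q n"
  and drop: "!!n. b * Q n <= a / 2 * P n" and a: "0 < a" and P0: "!!n. 0 <= P n" and Q0: "!!n. 0 <= Q n" and e: "0 < (e :: real)"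
 shows "\<exists>N. \<forall>n\<ge>N. X n <= X 0 + Q 0 - P 0 + e"
proof -
 define F where "F n = X n + Q n - P n" for n
 have F: "F (Suc n) + a / 2 * P n <= F n" for n
  using X[of n] P[of n] Q[of n] pq[of n] drop[of n] unfolding F_def by (simp add: algebra_simps)
 have S: "F n + (\<Sum>k<n. a / 2 * P k) <= F 0" for n
 proof (induction n)
  case (Suc n)
  thus ?case using F[of n] by simp
 qed simp
 have "summable (\<lambda>k. a / 2 * P k)"
 proof (rule summableI_nonneg_bounded)
  show "(\<Sum>k<n. a / 2 * P k) <= F 0" for n using S[of n] PQ[of n] by (simp add: F_def)
 qed (use a P0 in simp)
 hence "(\<lambda>k. a / 2 * P k) \<longlonglongrightarrow> 0" by (rule summable_LIMSEQ_zero)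
 hence "\<forall>\<^sub>F k in sequentially. a / 2 * P k < a / 2 * e" using order_tendstoD(2) a e by fastforce
 then obtain N where N: "!!n. N <= n ==> P n < e" using a by (auto simp: eventually_sequentially)
 have "X n <= X 0 + Q 0 - P 0 + e" if "N <= n" for n
 proof -
  have "F n <= F 0" using S[of n] sum_nonneg[of "{..<n}" "\<lambda>k. a / 2 * P k"] a P0 by (simp add: add_increasing2)
  moreover have "X n <= F n + P n" using Q0[of n] by (simp add: F_def)
  ultimately show ?thesis using N[OF that] by (simp add: F_def)
 qed
 thus ?thesis by blast
qed

text \<open>All sequences inherit finiteness from X 0 and Q 0, which reduces the claim to real
  sequences; \<open>P 0\<close> stands on the left of the conclusion to avoid a subtraction.\<close>

lemma critical_sequences_ennreal:
 fixes X P Q x p q :: "nat => ennreal"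
 assumes X: "!!n. X (Suc n) + x n = X n" and P: "!!n. ennreal (1 + a) * P n <= P (Suc n) + p n"
  and Q: "!!n. Q (Suc n) + q n <= ennreal (1 + b) * Q n" and pq: "!!n. p n <= x n + q n" and PQ: "!!n. P n <= X n + Q n"
  and drop: "!!n. ennreal b * Q n <= ennreal (a / 2) * P n" and ab: "0 < a" "0 < b" and e: "0 < (e :: real)"
  and fin: "X 0 < \<infinity>" "Q 0 < \<infinity>"
 shows "\<exists>N. \<forall>n\<ge>N. X n + P 0 <= X 0 + Q 0 + ennreal e"
proof -
 have fX: "X n < \<infinity>" for n
 proof (induction n)
  case (Suc n) thus ?case unfolding X[of n, symmetric] by simp
 qed (rule fin)
 have fQ: "Q n < \<infinity>" for n
 proof (induction n)
  case (Suc n)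
  hence "ennreal (1 + b) * Q n < \<infinity>" by (simp add: ennreal_mult_less_top del: ennreal_plus)
  hence "Q (Suc n) + q n < \<infinity>" by (rule le_less_trans[OF Q])
  thus ?case by simp
 qed (rule fin)
 have fx: "x n < \<infinity>" for n using fX[of n] unfolding X[of n, symmetric] by simp
 have "ennreal (1 + b) * Q n < \<infinity>" for n using fQ[of n] by (simp add: ennreal_mult_less_top del: ennreal_plus)
 hence "Q (Suc n) + q n < \<infinity>" for n by (rule le_less_trans[OF Q])
 hence fq: "q n < \<infinity>" for n by simp
 have fP: "P n < \<infinity>" for n using le_less_trans[OF PQ[of n]] fX[of n] fQ[of n] by simp
 have fp: "p n < \<infinity>" for n using le_less_trans[OF pq[of n]] fx[of n] fq[of n] by simp
 have "\<exists>f. (\<forall>n. 0 <= f n) \<and> F = (\<lambda>n. ennreal (f n))" if "!!n. F n < \<infinity>" for F :: "nat => ennreal"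
  by (rule exI[of _ "\<lambda>n. enn2real (F n)"]) (use that in \<open>auto simp: less_top\<close>)
 note r = this
 obtain X' P' Q' x' p' q' where nn: "!!n. 0 <= X' n" "!!n. 0 <= P' n" "!!n. 0 <= Q' n" "!!n. 0 <= x' n" "!!n. 0 <= p' n" "!!n. 0 <= q' n"
  and eq: "X = (\<lambda>n. ennreal (X' n))" "P = (\<lambda>n. ennreal (P' n))" "Q = (\<lambda>n. ennreal (Q' n))"
   "x = (\<lambda>n. ennreal (x' n))" "p = (\<lambda>n. ennreal (p' n))" "q = (\<lambda>n. ennreal (q' n))"
  using r[of X, OF fX] r[of P, OF fP] r[of Q, OF fQ] r[of x, OF fx] r[of p, OF fp] r[of q, OF fq] by metis
 note s = ennreal_plus[symmetric] ennreal_mult[symmetric]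
 have "\<exists>N. \<forall>n\<ge>N. X' n <= X' 0 + Q' 0 - P' 0 + e"
  by (rule critical_sequences[of X' x' a P' p' Q' q' b])
    (use X P Q pq PQ drop ab nn e in \<open>simp_all add: eq s del: ennreal_plus\<close>)
 thus ?thesis using nn e by (simp add: eq s algebra_simps del: ennreal_plus)
qed

lemma ennreal_weighted_le:
 fixes z :: ennreal
 assumes "a * u <= y + b * v" shows "a * (z * u) <= z * y + b * (z * v)"
 using mult_left_mono[OF assms, of z] by (simp add: distrib_left mult.left_commute)

context bbm_full begin

section \<open>Growth of tilted sums at criticality\<close>

lemma tilted_step:
 assumes exc: "excm exc" and H: "H \<in> bm borel"
  and lo: "!!Z v. Z \<in> bm (SO v) ==> ennreal lo * (\<E> w. Z w * gw dl H v w)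
   <= (\<E> w. Z w * kids v w * ennreal (exp (- dl * death T v w) * H (dp v w)))"
  and hi: "!!Z v. Z \<in> bm (SO v) ==> (\<E> w. Z w * kids v w * ennreal (exp (- dl * death T v w) * H (dp v w)))
   <= ennreal hi * (\<E> w. Z w * gw dl H v w)"
 shows "ennreal lo * (\<E> w. Vg exc dl H n w) <= (\<E> w. Vg exc dl H (Suc n) w) + (\<E> w. lossg exc dl H n w)"
  and "(\<E> w. Vg exc dl H (Suc n) w) + (\<E> w. lossg exc dl H n w) <= ennreal hi * (\<E> w. Vg exc dl H n w)"
 unfolding Vg_mean_Suc[OF exc H] Vg_mean[OF exc H, where n = n] gsum_cmult[symmetric] by (intro gsum_mono lo hi ok_indicator_SO[OF exc])+

text \<open>The tilt adds th^2 w^2 / 2 to the potential, so mass disappears more slowly than (1 + m)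
  g by this amount. Enclosing the amount between z and y times (1 + m) g gives a growth factor
  between 1 + z and 1 / (1 - y) <= 1 + 2 y; the bound on th keeps y <= 1/2.\<close>

lemma tilted_one_step:
 assumes fl: "floquet k (\<lambda>y. c y + th^2 * (wt y)^2 / 2) H H'" and r: "per_lip (\<lambda>y. c y + th^2 * (wt y)^2 / 2)"
  and c: "!!y. g y + dl - c y = (1 + m) * g y" and g0: "0 < g0" "!!y. g0 <= g y" "!!y. g y <= g1"
  and wt: "0 < w1" "!!y. w1 <= (wt y)^2" "!!y. (wt y)^2 <= w2" and th: "th^2 * w2 <= (1 + m) * g0"
  and Z: "Z \<in> bm (SO v)"
 shows "ennreal (1 + w1 / (2 * g1 * (1 + m)) * th^2) * (\<E> w. Z w * gw dl H v w)
   <= (\<E> w. Z w * kids v w * ennreal (exp (- dl * death T v w) * H (dp v w)))" (is "_ * ?I <= ?J")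
  and "(\<E> w. Z w * kids v w * ennreal (exp (- dl * death T v w) * H (dp v w)))
   <= ennreal (1 + w2 / (g0 * (1 + m)) * th^2) * (\<E> w. Z w * gw dl H v w)"
proof -
 define z where "z = w1 / (2 * g1 * (1 + m)) * th^2"
 define y where "y = w2 / (2 * g0 * (1 + m)) * th^2"
 have g1: "g0 <= g1" using order_trans[OF g0(2)[of 0] g0(3)] .
 have w12: "w1 <= w2" using order_trans[OF wt(2)[of 0] wt(3)] .
 have y: "y <= 1 / 2"
  using th g0 m_pos by (simp add: y_def divide_simps) (simp add: algebra_simps)
 have zy: "z <= y" unfolding z_def y_def using g0 g1 wt w12 m_pos by (intro mult_right_mono frac_le mult_mono) auto
 have z0: "0 <= z" unfolding z_def using g0 g1 wt m_pos by simp
 have y0: "0 <= y" using z0 zy by simp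
 have cancel: "n * (wt' / (2 * g' * n) * th^2) * g' = th^2 * wt' / 2" if "n ~= 0" "g' ~= 0" for n g' wt' :: real
  using that by (simp add: field_simps)
 have cancel2: "(1 + z) / n * (n * (1 - z)) = 1 - z * z" if "n ~= 0" for n :: real using that by (simp add: field_simps)
 have zg: "(1 + m) * z * g u <= th^2 * (wt u)^2 / 2" for u
 proof -
  have "(1 + m) * z * g u <= (1 + m) * z * g1" using g0 z0 m_pos by (intro mult_left_mono) auto
  also have "... = th^2 * w1 / 2" unfolding z_def by (rule cancel) (use g0(1) g1 m_pos in auto)
  also have "... <= th^2 * (wt u)^2 / 2" using wt by (intro divide_right_mono mult_left_mono) auto
  finally show ?thesis .
 qed
 have yg: "th^2 * (wt u)^2 / 2 <= (1 + m) * y * g u" for u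
 proof -
  have "th^2 * (wt u)^2 / 2 <= th^2 * w2 / 2" using wt by (intro divide_right_mono mult_left_mono) auto
  also have "... = (1 + m) * y * g0" unfolding y_def by (rule cancel[symmetric]) (use g0(1) m_pos in auto)
  also have "... <= (1 + m) * y * g u" using g0 y0 m_pos by (intro mult_left_mono) auto
  finally show ?thesis .
 qed
 have d: "g u + dl - (c u + th^2 * (wt u)^2 / 2) = (1 + m) * g u - th^2 * (wt u)^2 / 2" for u using c[of u] by simp
 have "ennreal (1 + m) * ?I <= ennreal ((1 + m) * (1 - z)) * ?J"
  unfolding offspring_mean[symmetric] gw_def
 proof (rule one_step_ge[OF Z fl r _ _ , of _ "(1 + m) / 2 * g0"])
  show "0 < (1 + m) * (1 - z)" using m_pos zy y by simp
  show "0 < (1 + m) / 2 * g0" using m_pos g0 by simp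
  show "g u + dl - (c u + th^2 * (wt u)^2 / 2) <= (1 + m) * (1 - z) * g u" for u unfolding d using zg[of u] by (simp add: algebra_simps)
  show "(1 + m) / 2 * g0 <= g u + dl - (c u + th^2 * (wt u)^2 / 2)" for u
  proof -
   have "(1 + m) * y * g u <= (1 + m) * (1/2) * g u" using y m_pos g0(1) g0(2)[of u] by (intro mult_right_mono mult_left_mono) auto
   moreover have "(1 + m) / 2 * g0 <= (1 + m) / 2 * g u" using m_pos g0 by (intro mult_left_mono) auto
   ultimately show ?thesis unfolding d using yg[of u] by simp
  qed
 qed
 from mult_left_mono[OF this, of "ennreal ((1 + z) / (1 + m))"]
 have "ennreal ((1 + z) / (1 + m)) * ennreal (1 + m) * ?I <= ennreal ((1 + z) / (1 + m)) * ennreal ((1 + m) * (1 - z)) * ?J"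
  by (simp add: mult.assoc)
 also have "ennreal ((1 + z) / (1 + m)) * ennreal (1 + m) = ennreal (1 + z)" using z0 m_pos by (subst ennreal_mult[symmetric]) auto
 also have "ennreal ((1 + z) / (1 + m)) * ennreal ((1 + m) * (1 - z)) = ennreal (1 - z * z)"
  using z0 zy y m_pos cancel2[of "1 + m"] by (subst ennreal_mult[symmetric]) (auto intro!: mult_nonneg_nonneg)
 finally have "ennreal (1 + z) * ?I <= ennreal (1 - z * z) * ?J" .
 also have "... <= 1 * ?J" by (intro mult_right_mono) (auto simp: ennreal_le_1)
 finally show "ennreal (1 + w1 / (2 * g1 * (1 + m)) * th^2) * ?I <= ?J" by (simp add: z_def)
 have "ennreal ((1 + m) * (1 - y)) * ?J <= ennreal (1 + m) * ?I"
  unfolding offspring_mean[symmetric] gw_def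
 proof (rule one_step_le[OF Z fl r])
  show "0 < (1 + m) * (1 - y)" using m_pos y by simp
  show "(1 + m) * (1 - y) * g u <= g u + dl - (c u + th^2 * (wt u)^2 / 2)" for u unfolding d using yg[of u] by (simp add: algebra_simps)
 qed
 from mult_left_mono[OF this, of "ennreal (1 / ((1 + m) * (1 - y)))"]
 have "ennreal (1 / ((1 + m) * (1 - y))) * ennreal ((1 + m) * (1 - y)) * ?J <= ennreal (1 / ((1 + m) * (1 - y))) * ennreal (1 + m) * ?I"
  by (simp add: mult.assoc)
 also have "ennreal (1 / ((1 + m) * (1 - y))) * ennreal ((1 + m) * (1 - y)) = 1" using y m_pos by (subst ennreal_mult[symmetric]) auto
 also have "ennreal (1 / ((1 + m) * (1 - y))) * ennreal (1 + m) = ennreal (1 / (1 - y))" using y m_pos by (subst ennreal_mult[symmetric]) auto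
 finally have "?J <= ennreal (1 / (1 - y)) * ?I" by simp
 also have "... <= ennreal (1 + 2 * y) * ?I"
 proof (intro mult_right_mono ennreal_leI)
  have "0 <= y * (1 - 2 * y)" using y y0 by simp
  hence "1 <= (1 + 2 * y) * (1 - y)" by (simp add: algebra_simps)
  thus "1 / (1 - y) <= 1 + 2 * y" using y by (simp add: divide_le_eq)
 qed simp
 also have "1 + 2 * y = 1 + w2 / (g0 * (1 + m)) * th^2" by (simp add: y_def)
 finally show "?J <= ennreal (1 + w2 / (g0 * (1 + m)) * th^2) * ?I" .
qed

lemma W_zero_critical:
 assumes crit: "\<bar>l\<bar> = lstar" and W: "W \<in> bm M" "AE w in M. ((\<lambda>t. aw l t w) \<longlongrightarrow> W w) at_top"
 shows "AE w in M. W w = 0"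
proof (rule W_zero_truncated[OF W])
 fix C :: real assume C: "0 < C"
 obtain D wt wt' where D: "!!y. (D has_real_derivative wt y) (at y)" "!!y. (wt has_real_derivative wt' y) (at y)"
  "continuous_on UNIV wt'" "!!y. wt (y + 1) = wt y" "!!y. wt y ~= 0" "!!y. D (y + 1) = D y - l"
  "!!th. floquet ((1 + th) * l) (\<lambda>y. ga l - m * g y + th * ga l + th^2 * (wt y)^2 / 2)
    (\<lambda>y. hh l y * exp (th * D y)) (\<lambda>y. hh l y * exp (th * D y) * (hh' l y / hh l y + th * wt y))"
  by (rule critical_corrector[OF crit]) (rule that; assumption)
 define H where "H th y = hh l y * exp (th * D y)" for th y
 have Dc: "continuous_on UNIV D" using D(1) by (auto intro: continuous_at_imp_continuous_on DERIV_isCont)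
 have wc: "continuous_on UNIV wt" using D(2) by (auto intro: continuous_at_imp_continuous_on DERIV_isCont)
 have [measurable]: "D \<in> bm borel" by (rule borel_measurable_continuous_onI[OF Dc])
 have Hm[measurable]: "H th \<in> bm borel" for th unfolding H_def[abs_def] by measurable
 have "per_lip wt" by (rule per_lip_C1[OF D(2,3,4)])
 hence pl: "per_lip (\<lambda>y. ga l - m * g y + th * ga l + th^2 * (wt y)^2 / 2)" for th
  using per_lip_add[OF per_lip_add[OF pot_per_lip[of "ga l"] per_lip_const[of "th * ga l"]] per_lip_mult[OF per_lip_const[of "th^2 / 2"] per_lip_mult[of wt wt]]]
  by (simp add: power2_eq_square)
 obtain g0 g1 where g0: "0 < g0" "g0 <= g1" "!!y. g0 <= g y" "!!y. g y <= g1" by (rule g_bounds) (rule that; assumption)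
 have "\<exists>c>0. \<forall>y. c <= (wt y)^2" by (rule periodic_lower_bound) (use D wc in \<open>auto intro!: continuous_intros\<close>)
 then obtain w1 where w1: "0 < w1" "!!y. w1 <= (wt y)^2" by blast
 have "\<exists>c>0. \<forall>y. \<bar>(wt y)^2\<bar> <= c" by (rule periodic_bounded) (use D wc in \<open>auto intro!: continuous_intros\<close>)
 then obtain w2 where w2: "0 < w2" "!!y. (wt y)^2 <= w2" by auto
 define a where "a = w1 / (2 * g1 * (1 + m))"
 define b where "b = w2 / (g0 * (1 + m))"
 have ab: "0 < a" "0 < b" using w1 w2 g0 m_pos by (auto simp: a_def b_def)
 define th1 where "th1 = sqrt ((1 + m) * g0 / w2)"
 have th1: "0 < th1" "th1^2 * w2 = (1 + m) * g0" using m_pos g0 w2 by (auto simp: th1_def)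
 \<comment> \<open>The drop of D by l over a period compensates the multiplier of h, so the product
   is periodic. Hence the weight of a particle is at least c0 times exp(D(X_t) - gamma t).\<close>
 have "\<exists>c>0. \<forall>y. c <= hh l y * exp (- D y)"
  by (rule periodic_lower_bound) (use hh_pos floquet_continuous(1)[OF floquet_hh] Dc D(6) floquet_hh[of l] in \<open>auto simp: floquet_def mult_ac exp_add[symmetric] intro!: continuous_intros\<close>)
 then obtain c0 where c0: "0 < c0" "!!y. c0 <= hh l y * exp (- D y)" by blast
 \<comment> \<open>The first entry gives every particle beyond the barrier a weight of at least C;
   the second keeps the initial particle below the barrier.\<close>
 define K0 where "K0 = max (ln (C / c0)) (D x)"
 define exc :: "nat => nat => real => real => bool" where "exc = (\<lambda>k a d y. K0 < D y - ga l * d)"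
 have exc: "excm exc" unfolding excm_def exc_def by (intro allI) measurable
 note [measurable] = exc_measurable[OF exc]
 have large: "C <= (1 + real (A v w)) * Yd l v w" if "bad exc v w" for v w
 proof -
  let ?R = "D (dp v w) - ga l * death T v w"
  have "ln (C / c0) <= ?R" using that by (auto simp: bad_def exc_def K0_def)
  hence "exp (ln (C / c0)) <= exp ?R" by simp
  hence "C / c0 <= exp ?R" using C c0 by (subst (asm) exp_ln) auto
  hence "C <= c0 * exp ?R" using c0 by (simp add: divide_le_eq mult.commute)
  also have "... <= hh l (dp v w) * exp (- D (dp v w)) * exp ?R" by (intro mult_right_mono c0) simp
  also have "... = Yd l v w" unfolding Yd_def mult.assoc by (simp add: exp_add[symmetric] mult.commute)
  also have "... <= (1 + real (A v w)) * Yd l v w" using Yd_pos[of l v w] by (simp add: mult_le_cancel_right1)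
  finally show ?thesis .
 qed
 have okR: "D (bp v w) - ga l * bt v w <= K0" if "ok exc v w" for v w
  using that by (cases v) (auto simp: K0_def bad_def exc_def death_def dp_def)
 have tilt: "exp (- (th * K)) * (exp (- ((1 + th) * ga l) * t) * H th y) = exp (- ga l * t) * hh l y * exp (th * (D y - ga l * t - K))" for th K t y
 proof -
  have "exp (- (th * K)) * exp (- ((1 + th) * ga l) * t) * exp (th * D y) = exp (- ga l * t) * exp (th * (D y - ga l * t - K))"
   by (simp add: exp_add[symmetric] algebra_simps)
  thus ?thesis by (simp add: H_def mult_ac)
 qed
 define V where "V th n = (\<E> w. Vg exc ((1 + th) * ga l) (H th) n w)" for th n
 define L where "L th n = (\<E> w. lossg exc ((1 + th) * ga l) (H th) n w)" for th n
 have step: "ennreal (1 + a * th^2) * V th n <= V th (Suc n) + L th n" "V th (Suc n) + L th n <= ennreal (1 + b * th^2) * V th n"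
  if th: "0 < th" "th <= th1" for th n
 proof -
  have "th^2 * w2 <= th1^2 * w2" using th w2 by (intro mult_right_mono power_mono) auto
  hence t: "th^2 * w2 <= (1 + m) * g0" using th1 by simp
  note os = tilted_one_step[OF D(7)[of th] pl _ g0(1,3,4) w1 w2(2) t, of "(1 + th) * ga l", folded H_def a_def b_def]
  show "ennreal (1 + a * th^2) * V th n <= V th (Suc n) + L th n" "V th (Suc n) + L th n <= ennreal (1 + b * th^2) * V th n"
   unfolding V_def L_def by (rule tilted_step[OF exc Hm os]; simp add: algebra_simps)+
 qed
 \<comment> \<open>The values are tuned so that, with th = c q^j and at least j units below the
   normalization level, the growth b th1^2 of the large tilt is absorbed by half of the growth a
   th^2 of the small one.\<close>
 define c where "c = th1 * sqrt (2 * b / a)"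
 define q where "q = exp (- th1 / 4)"
 have c: "0 < c" "c^2 = 2 * b * th1^2 / a" and q: "0 < q" "q < 1" using ab th1 by (auto simp: c_def q_def power_mult_distrib)
 define d0 where "d0 = D x - K0"
 have V0: "V th 0 = ennreal (H th x)" for th by (simp add: V_def Vg_def gsum_0 gw_def emeasure_space_1)
 have main: "\<exists>N. \<forall>n\<ge>N. (\<E> w. Vt exc l n w) <= ennreal (hh l x * (1 + exp (th1 * (d0 - real j)) - exp (c * q ^ j * (d0 - real j))) + e)"
  if j: "c * q ^ j <= th1 / 2" and e: "0 < e" for j e
 proof -
  define th where "th = c * q ^ j"
  \<comment> \<open>Both tilts are normalized to 1 at the level K, so the surviving particles, which
    lie below K0, are at least j units below it.\<close>
  define K where "K = K0 + real j"
  have th: "0 < th" "th <= th1" "th <= th1 / 2" using c q j th1 by (auto simp: th_def)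
  let ?e = "\<lambda>th. ennreal (exp (- (th * K)))"
  \<comment> \<open>A particle killed at the barrier may overshoot it by any amount: below the level
    the small tilt is at most 1, above it the large tilt takes over.\<close>
  have u: "exp (th * u) <= 1 + exp (th1 * u)" for u
  proof (cases "u <= 0")
   case True
   hence "exp (th * u) <= 1" using th by (simp add: mult_nonneg_nonpos)
   thus ?thesis by (simp add: add_increasing2)
  next
   case False
   hence "exp (th * u) <= exp (th1 * u)" using th by simp
   thus ?thesis by (simp add: add_increasing)
  qed
  \<comment> \<open>At j units below the level, th <= th1 / 2 makes
    \<open>exp ((th1 - th) * u)\<close> at most q^(2 j), and the value of c^2 supplies the
    constants.\<close>
  have u': "b * th1^2 * exp (th1 * u) <= a * th^2 / 2 * exp (th * u)" if "u <= - real j" for u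
  proof -
   have "(th1 - th) * u <= (th1 / 2) * u" using th that by (intro mult_right_mono_neg) auto
   also have "... <= (th1 / 2) * (- real j)" using th1 that by (intro mult_left_mono) auto
   finally have "exp ((th1 - th) * u) <= exp ((th1 / 2) * (- real j))" by simp
   also have "... = (q ^ j)^2" unfolding q_def by (simp add: exp_of_nat_mult[symmetric] power2_eq_square exp_add[symmetric] algebra_simps)
   finally have "b * th1^2 * exp ((th1 - th) * u) <= b * th1^2 * (q ^ j)^2" using ab by (intro mult_left_mono) auto
   also have "... = a * th^2 / 2" unfolding th_def power_mult_distrib c(2) using ab by simp
   finally have "b * th1^2 * exp ((th1 - th) * u) * exp (th * u) <= a * th^2 / 2 * exp (th * u)" by (rule mult_right_mono) simp
   moreover have "exp ((th1 - th) * u) * exp (th * u) = exp (th1 * u)" by (simp add: exp_add[symmetric] algebra_simps)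
   ultimately show ?thesis by (simp add: mult.assoc)
  qed
  let ?Y = "\<lambda>t y. exp (- ga l * t) * hh l y"
  have t: "?e th' * ennreal (exp (- ((1 + th') * ga l) * t) * H th' y) = ennreal (?Y t y * exp (th' * (D y - ga l * t - K)))" for th' t y
   unfolding tilt[symmetric] by (rule ennreal_mult'[symmetric]) simp
  have Y0: "0 <= ?Y t y" for t y using hh_nonneg by simp
  have cmp: "?e th * (\<E> w. gsum n (\<lambda>v. z v w * ennreal (exp (- ((1 + th) * ga l) * ta v w) * H th (y v w))))
    <= (\<E> w. gsum n (\<lambda>v. z v w * ennreal (?Y (ta v w) (y v w))))
     + ?e th1 * (\<E> w. gsum n (\<lambda>v. z v w * ennreal (exp (- ((1 + th1) * ga l) * ta v w) * H th1 (y v w))))"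
   if [measurable]: "!!v. z v \<in> bm M" "!!v. ta v \<in> bm M" "!!v. y v \<in> bm M" for z ta y n
  proof -
   have m: "(\<lambda>w. gsum n (\<lambda>v. z v w * ennreal (exp (- dl * ta v w) * f (y v w)))) \<in> bm M" if [measurable]: "f \<in> bm borel" for dl f
    by (rule gsum_measurable) measurable
   note [measurable] = m[OF hh_borel] m[OF Hm]
   have le: "?e th * ennreal (exp (- ((1 + th) * ga l) * s) * H th y) <= ennreal (?Y s y) + ?e th1 * ennreal (exp (- ((1 + th1) * ga l) * s) * H th1 y)" for s y
    unfolding t using ennreal_leI[OF mult_left_mono[OF u Y0]] Y0 by (subst ennreal_plus[symmetric]) (simp_all add: distrib_left del: ennreal_plus)
   have "?e th * (\<E> w. gsum n (\<lambda>v. z v w * ennreal (exp (- ((1 + th) * ga l) * ta v w) * H th (y v w))))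
    <= (\<E> w. gsum n (\<lambda>v. z v w * ennreal (?Y (ta v w) (y v w)))
     + ?e th1 * gsum n (\<lambda>v. z v w * ennreal (exp (- ((1 + th1) * ga l) * ta v w) * H th1 (y v w))))"
    unfolding gsum_cmult[symmetric] gsum_add[symmetric]
    by (subst nn_integral_cmult[OF m[OF Hm], symmetric], unfold gsum_cmult[symmetric]) (intro nn_integral_mono gsum_mono ennreal_weighted_le le)
   also have "... = (\<E> w. gsum n (\<lambda>v. z v w * ennreal (?Y (ta v w) (y v w))))
     + ?e th1 * (\<E> w. gsum n (\<lambda>v. z v w * ennreal (exp (- ((1 + th1) * ga l) * ta v w) * H th1 (y v w))))"
    by (subst nn_integral_add, measurable) (simp only: nn_integral_cmult[OF m[OF Hm]])
   finally show ?thesis .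
  qed
  have N: "\<exists>N. \<forall>n\<ge>N. (\<E> w. Vt exc l n w) + ?e th * V th 0 <= (\<E> w. Vt exc l 0 w) + ?e th1 * V th1 0 + ennreal e"
  proof (rule critical_sequences_ennreal)
   fix n
   show "(\<E> w. Vt exc l (Suc n) w) + (\<E> w. loss exc l n w) = (\<E> w. Vt exc l n w)" by (rule Vt_mean_step[OF exc])
   show "ennreal (1 + a * th^2) * (?e th * V th n) <= ?e th * V th (Suc n) + ?e th * L th n"
    using mult_left_mono[OF step(1)[OF th(1,2)], of "?e th" n] by (simp only: distrib_left mult.left_commute) simp
   show "?e th1 * V th1 (Suc n) + ?e th1 * L th1 n <= ennreal (1 + b * th1^2) * (?e th1 * V th1 n)"
    using mult_left_mono[OF step(2)[OF th1(1) order_refl], of "?e th1" n] by (simp only: distrib_left mult.left_commute) simp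
   show "?e th * L th n <= (\<E> w. loss exc l n w) + ?e th1 * L th1 n"
    unfolding L_def lossg_def by (rule cmp) measurable
   show "?e th * V th n <= (\<E> w. Vt exc l n w) + ?e th1 * V th1 n"
    unfolding V_def Vg_def gw_def by (rule cmp) measurable
   let ?c1 = "b * th1^2" and ?c = "a * th^2 / 2"
   have le: "ennreal k * ?e th' * gw ((1 + th') * ga l) (H th') v w = ennreal (Yb l v w * (k * exp (th' * (D (bp v w) - ga l * bt v w - K))))" if "0 <= k" for k th' v w
    using that Yb_pos[of l v w] unfolding gw_def mult.assoc t Yb_def[symmetric] by (simp add: ennreal_mult[symmetric] mult.left_commute)
   have "ennreal ?c1 * ?e th1 * V th1 n <= ennreal ?c * ?e th * V th n"
    unfolding V_def
   proof (subst (1 2) nn_integral_cmult[symmetric], measurable, intro nn_integral_mono, unfold Vg_def gsum_cmult[symmetric], intro gsum_mono)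
    fix w v
    have "ennreal (Yb l v w * (?c1 * exp (th1 * (D (bp v w) - ga l * bt v w - K)))) <= ennreal (Yb l v w * (?c * exp (th * (D (bp v w) - ga l * bt v w - K))))" if "ok exc v w"
     by (intro ennreal_leI mult_left_mono u') (use okR[OF that] Yb_pos[of l v w] in \<open>auto simp: K_def\<close>)
    thus "ennreal ?c1 * ?e th1 * (of_bool (realized A v w \<and> ok exc v w) * gw ((1 + th1) * ga l) (H th1) v w)
     <= ennreal ?c * ?e th * (of_bool (realized A v w \<and> ok exc v w) * gw ((1 + th) * ga l) (H th) v w)"
     using le[of ?c1 th1 v w] le[of ?c th v w] ab by (cases "realized A v w \<and> ok exc v w") auto
   qed
   thus "ennreal ?c1 * (?e th1 * V th1 n) <= ennreal ?c * (?e th * V th n)" by (simp only: mult.assoc)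
  qed (use ab th th1 e in \<open>simp_all add: V0 Vt_def gsum_0 Yb_def emeasure_space_1 ennreal_mult_less_top\<close>)
  have 1: "?e th' * V th' 0 = ennreal (hh l x * exp (th' * (d0 - real j)))" for th'
   using t[of th' 0 x] by (simp add: V0 K_def d0_def algebra_simps)
  have 2: "(\<E> w. Vt exc l 0 w) = ennreal (hh l x)" by (simp add: Vt_def gsum_0 Yb_def emeasure_space_1)
  have "z <= ennreal (h * (1 + s1 - s) + e)" if "z + ennreal (h * s) <= ennreal h + ennreal (h * s1) + ennreal e" "0 <= h" "0 <= s" "0 <= s1" for z h s s1
   using that e by (cases z) (auto simp: ennreal_plus[symmetric] algebra_simps top_unique simp del: ennreal_plus)
  from this[OF _ hh_nonneg exp_ge_zero exp_ge_zero] N show ?thesis unfolding 1 2 th_def by blast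
 qed
 have "(\<lambda>n. \<E> w. Vt exc l n w) \<longlonglongrightarrow> 0"
 proof (rule tendsto_zero_ennreal)
  fix e :: real assume e: "0 < e"
  \<comment> \<open>The small tilt parameter c q^j vanishes faster than 1 / j, so the small tilt of
    the initial particle tends to 1 although the level recedes, while its large tilt tends to 0; the
    bound therefore vanishes.\<close>
  have qj: "(\<lambda>j. q ^ j) \<longlonglongrightarrow> 0" and jq: "(\<lambda>j. real j * q ^ j) \<longlonglongrightarrow> 0"
   using q LIMSEQ_realpow_zero[of q] powser_times_n_limit_0[of q] by auto
  have ej: "(\<lambda>j. exp (th1 * (d0 - real j))) \<longlonglongrightarrow> 0"
  proof -
   have "(\<lambda>j. exp (th1 * d0) * exp (- th1) ^ j) \<longlonglongrightarrow> exp (th1 * d0) * 0" using th1 by (intro tendsto_intros LIMSEQ_realpow_zero) auto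
   moreover have "exp (th1 * d0) * exp (- th1) ^ j = exp (th1 * (d0 - real j))" for j
    by (simp add: exp_of_nat_mult[symmetric] exp_add[symmetric] algebra_simps)
   ultimately show ?thesis by simp
  qed
  have "(\<lambda>j. c * d0 * q ^ j - c * (real j * q ^ j)) \<longlonglongrightarrow> c * d0 * 0 - c * 0" by (intro tendsto_intros qj jq)
  hence tj: "(\<lambda>j. c * q ^ j * (d0 - real j)) \<longlonglongrightarrow> 0" by (simp add: algebra_simps)
  have "(\<lambda>j. hh l x * (1 + exp (th1 * (d0 - real j)) - exp (c * q ^ j * (d0 - real j)))) \<longlonglongrightarrow> hh l x * (1 + 0 - exp 0)"
   by (intro tendsto_intros ej tj)
  hence "\<forall>\<^sub>F j in sequentially. hh l x * (1 + exp (th1 * (d0 - real j)) - exp (c * q ^ j * (d0 - real j))) < e / 2"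
   by (rule order_tendstoD(2)) (use e in simp)
  moreover have "(\<lambda>j. c * q ^ j) \<longlonglongrightarrow> c * 0" by (intro tendsto_intros qj)
  hence "\<forall>\<^sub>F j in sequentially. c * q ^ j < th1 / 2" by (rule order_tendstoD(2)) (use th1 in simp)
  ultimately have "\<forall>\<^sub>F j in sequentially. hh l x * (1 + exp (th1 * (d0 - real j)) - exp (c * q ^ j * (d0 - real j))) < e / 2 \<and> c * q ^ j < th1 / 2"
   by eventually_elim simp
  then obtain j where j: "hh l x * (1 + exp (th1 * (d0 - real j)) - exp (c * q ^ j * (d0 - real j))) < e / 2" "c * q ^ j < th1 / 2"
   by (auto simp: eventually_sequentially)
  obtain N where N: "!!n. N <= n ==> (\<E> w. Vt exc l n w) <= ennreal (hh l x * (1 + exp (th1 * (d0 - real j)) - exp (c * q ^ j * (d0 - real j))) + e / 4)"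
   using main[of j "e / 4"] j e by auto
  have "ennreal (hh l x * (1 + exp (th1 * (d0 - real j)) - exp (c * q ^ j * (d0 - real j))) + e / 4) < ennreal e"
   using j(1) e by (intro ennreal_lessI) auto
  thus "\<forall>\<^sub>F n in sequentially. (\<E> w. Vt exc l n w) < ennreal e"
   using N by (auto simp: eventually_sequentially intro: le_less_trans)
 qed
 thus "\<exists>exc. excm exc \<and> (\<forall>v w. bad exc v w --> C <= (1 + real (A v w)) * Yd l v w) \<and> (\<lambda>n. \<E> w. Vt exc l n w) \<longlonglongrightarrow> 0"
  using exc large by blast
qed

end

theorem theorem1p1:
  fixes g :: "real \<Rightarrow> real" and p :: "nat pmf" and m :: real
    and \<gamma> :: "real \<Rightarrow> real" and \<psi> :: "real \<Rightarrow> real \<Rightarrow> real" and lstar :: real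
    and M :: "'w measure" and x :: real
    and B :: "nat list \<Rightarrow> real \<Rightarrow> 'w \<Rightarrow> real" and T :: "nat list \<Rightarrow> 'w \<Rightarrow> real"
    and A :: "nat list \<Rightarrow> 'w \<Rightarrow> nat"
    and l :: real
  assumes g_C1: "g C1_differentiable_on UNIV"
    and g_pos: "\<And>y. 0 < g y"
    and g_periodic: "\<And>y. g (y + 1) = g y"
    and L_integrable: "integrable (measure_pmf p) real"
    and m_def: "m = measure_pmf.expectation p real"
    and m_pos: "0 < m"
    and eigen: "\<And>k. principal_eigenpair g m k (\<gamma> k) (\<lambda>y. \<psi> y k)"
    and lstar: "is_arg_min (\<lambda>k. \<gamma> k / k) (\<lambda>k. 0 < k) lstar"
    and bbm: "bbmpe M g p x B T A"
  shows "prob_space.is_martingale M (natural_filtration M x B T A) (additive_W x B T A \<gamma> \<psi> l) \<and>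
    (\<exists>W \<in> borel_measurable M.
       (AE \<omega> in M. ((\<lambda>t. additive_W x B T A \<gamma> \<psi> l t \<omega>) \<longlongrightarrow> W \<omega>) at_top) \<and>
       (\<bar>l\<bar> > lstar \<longrightarrow> (AE \<omega> in M. W \<omega> = 0)) \<and>
       (\<bar>l\<bar> = lstar \<longrightarrow> (AE \<omega> in M. W \<omega> = 0)) \<and>
       (\<bar>l\<bar> < lstar \<longrightarrow>
          (E_LlogL p = \<infinity> \<longrightarrow> (AE \<omega> in M. W \<omega> = 0)) \<and>
          (E_LlogL p < \<infinity> \<longrightarrow>
             integrable M W \<and>
             ((\<lambda>t. \<integral>\<^sup>+\<omega>. ennreal \<bar>additive_W x B T A \<gamma> \<psi> l t \<omega> - W \<omega>\<bar> \<partial>M) \<longlongrightarrow> 0) at_top)))"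
proof -
 obtain g' where "!!y. (g has_real_derivative g' y) (at y)" "continuous_on UNIV g'"
  using g_C1 by (auto simp: C1_differentiable_on_def has_real_derivative_iff_has_vector_derivative)
 hence g: "per_lip g" using g_periodic by (rule per_lip_C1)
 interpret bbmpe M g p x B T A by (rule bbm)
 interpret bbm_full M g p x B T A m \<gamma> \<psi> lstar
  by unfold_locales (fact g g_pos g_C1 g_periodic m_pos eigen lstar L_integrable m_def)+
 obtain W where W: "W \<in> bm M" "AE w in M. ((\<lambda>t. additive_W x B T A \<gamma> \<psi> l t w) \<longlongrightarrow> W w) at_top"
  by (rule aw_convergent) (rule that; assumption)
 show ?thesis
  by (intro conjI impI bexI[OF _ W(1)] aw_martingale W(2) W_zero_supercritical[OF _ W] W_zero_critical[OF _ W] W_zero_LlogL[OF _ W]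
    W_integrable[OF W] W_L1[OF W W_mean_ge[OF _ _ W]])
qed

end
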